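(* Set $r=4$. There exists $a_0>0$ such that for each $a\ge a_0$ the following holds: for every dynamically isospectral $C^1$ family $\{\Omega_\tau\}_{|\tau|\le 1}$ in $\mathcal M^r$ with $\Omega_0=\Omega_*$, the deformation function $\mathbf n$ of the family at $\Omega_*$ vanishes identically. (Both $\Omega_*$ and $\mathcal M^r$ depend on $a$.)
   Context: For $a>0$, $\Omega_*\subset\mathbb R^2$ is the circular Bunimovich stadium: the convex domain bounded by the two flat edges $E_{\mathrm{top}}=[-a/2,a/2]\times\{1\}$, $E_{\mathrm{bot}}=[-a/2,a/2]\times\{-1\}$ and by the left and right unit semicircles centred at $(-a/2,0)$ and $(a/2,0)$. Class $\mathcal M^r$: a planar domain $\Omega$ belongs to $\mathcal M^r$ if (M1) $\partial\Omega=E_{\mathrm{top}}\cup E_{\mathrm{bot}}\cup\Gamma_1\cup\Gamma_2$, where $\Gamma_1,\Gamma_2$ are simple $C^r$ arcs of positive curvature joining respectively $(-a/2,1)$ to $(-a/2,-1)$ on the left and $(a/2,1)$ to $(a/2,-1)$ on the right, and $\Omega$ is convex; (M2) at each of the four junction points $(\pm a/2,\pm1)$ the arc meets the adjacent flat edge with $C^1$ tangency; (M3) $\Omega$ is symmetric under reflection across the horizontal axis $\{y=0\}$. $C^1$ family: for $\{\Omega_\tau\}_{|\tau|\le1}\subset\mathcal M^r$ and $i\in\{1,2\}$, put $S_i=[-\pi/2,\pi/2]$ and let $\gamma_{i,\tau}:S_i\to\partial\Omega_\tau$ be the constant-speed parametrization of the $i$-th arc ($i=1$ left, $i=2$ right)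 of $\Omega_\tau$, with $\gamma_{i,\tau}(-\pi/2)$ and $\gamma_{i,\tau}(\pi/2)$ the junction points on $E_{\mathrm{bot}}$ and $E_{\mathrm{top}}$ respectively. The family is $C^1$ if $\tau\mapsto\gamma_{i,\tau}$ is $C^1$ with values in $C^r(S_i,\mathbb R^2)$ for $i=1,2$. Deformation function at $\Omega_*=\Omega_0$: the function $\mathbf n$ on the disjoint union $S=S_1\sqcup S_2$ given on $S_i$ by $\mathbf n_i(s_i)=\langle\partial_\tau\gamma_{i,\tau}(s_i)|_{\tau=0},N_{i,0}(s_i)\rangle$, where $N_{i,0}$ is the inward unit normal along $\gamma_{i,0}$ (the flat edges do not move, so the deformation function is zero there). Length spectrum: a closed billiard trajectory in a convex planar domain $\Omega$ with $C^1$ boundary is a closed polygon with finitely many ($\ge2$) vertices on $\partial\Omega$, with open sides inside $\Omega$, obeying the law of reflection (equal angles with the tangent line) at each vertex; its length is its perimeter, traversed once. $\mathcal L(\Omega)$ is the set of lengths of all closed billiard trajectories in $\Omega$. The family is dynamically isospectral if $\mathcal L(\Omega_\tau)=\mathcal L(\Omega_0)$ for every $\tau\in[-1,1]$. *)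

theory Defs
  imports "HOL-Analysis.Analysis"
begin

type_synonym point = "real \<times> real"

datatype side = Left_Side | Right_Side

fun side_sign :: "side \<Rightarrow> real" where
  "side_sign Left_Side = -1"
| "side_sign Right_Side = 1"

definition flat_edges :: "real \<Rightarrow> point set" where
  "flat_edges a = {-a/2..a/2} \<times> {1} \<union> {-a/2..a/2} \<times> {-1}"

definition unit_semicircle :: "real \<Rightarrow> side \<Rightarrow> point set" where
  "unit_semicircle a i =
     sphere (side_sign i * a/2, 0) 1 \<inter> {p. a/2 \<le> side_sign i * fst p}"

definition stadium :: "real \<Rightarrow> point set" where
  "stadium a = inside (flat_edges a \<union> (\<Union>i. unit_semicircle a i))"

definition arc_dom :: "real set" where
  "arc_dom = {-pi/2..pi/2}"

text \<open>Derivatives are taken within the closed interval, hence one-sided at its ends.\<close>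

fun arc_deriv :: "nat \<Rightarrow> (real \<Rightarrow> point) \<Rightarrow> real \<Rightarrow> point" where
  "arc_deriv 0 f = f"
| "arc_deriv (Suc k) f = (\<lambda>s. vector_derivative (arc_deriv k f) (at s within arc_dom))"

definition Cr_on_arc :: "nat \<Rightarrow> (real \<Rightarrow> point) \<Rightarrow> bool" where
  "Cr_on_arc r f \<longleftrightarrow>
     (\<forall>k<r. \<forall>s\<in>arc_dom. arc_deriv k f differentiable (at s within arc_dom)) \<and>
     continuous_on arc_dom (arc_deriv r f)"

definition Cr_norm :: "nat \<Rightarrow> (real \<Rightarrow> point) \<Rightarrow> real" where
  "Cr_norm r f = (\<Sum>k\<le>r. SUP s\<in>arc_dom. norm (arc_deriv k f s))"

text \<open>Continuous differentiability on \<open>[-1,1]\<close> of a curve in the Banach space \<open>C\<^sup>r\<close>,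
  with one-sided derivatives at \<open>-1\<close> and \<open>1\<close>; \<open>D\<close> is the derivative.\<close>

definition C1_into_Cr :: "nat \<Rightarrow> (real \<Rightarrow> real \<Rightarrow> point) \<Rightarrow> bool" where
  "C1_into_Cr r g \<longleftrightarrow>
     (\<forall>\<tau>\<in>{-1..1}. Cr_on_arc r (g \<tau>)) \<and>
     (\<exists>D. (\<forall>\<tau>\<in>{-1..1}. Cr_on_arc r (D \<tau>)) \<and>
          (\<forall>\<tau>\<in>{-1..1}.
             ((\<lambda>t. Cr_norm r (\<lambda>s. (g t s - g \<tau> s) /\<^sub>R (t - \<tau>) - D \<tau> s)) \<longlongrightarrow> 0)
               (at \<tau> within {-1..1})) \<and>
          (\<forall>\<tau>\<in>{-1..1}.
             ((\<lambda>t. Cr_norm r (\<lambda>s. D t s - D \<tau> s)) \<longlongrightarrow> 0) (at \<tau> within {-1..1})))"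

definition cross :: "point \<Rightarrow> point \<Rightarrow> real" where
  "cross u v = fst u * snd v - snd u * fst v"

text \<open>Unsigned curvature, independent of the parametrization and its orientation.\<close>

definition arc_curvature :: "(real \<Rightarrow> point) \<Rightarrow> real \<Rightarrow> real" where
  "arc_curvature \<gamma> s = \<bar>cross (arc_deriv 1 \<gamma> s) (arc_deriv 2 \<gamma> s)\<bar> / norm (arc_deriv 1 \<gamma> s) ^ 3"

text \<open>A regular \<open>C\<^sup>r\<close> parametrization, running from the bottom to the top junction point, of a
  simple arc of positive curvature on side \<open>i\<close>. In the last two conditions \<open>sgn\<close> normalises
  vectors: the arc continues the bottom edge in the outward
  horizontal direction and arrives at the top edge in the opposite direction.\<close>

definition stadium_arc_param :: "nat \<Rightarrow> real \<Rightarrow> side \<Rightarrow> (real \<Rightarrow> point) \<Rightarrow> bool" where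
  "stadium_arc_param r a i \<gamma> \<longleftrightarrow>
     Cr_on_arc r \<gamma> \<and> inj_on \<gamma> arc_dom \<and> (\<forall>s\<in>arc_dom. arc_deriv 1 \<gamma> s \<noteq> 0) \<and>
     \<gamma> (-pi/2) = (side_sign i * a/2, -1) \<and> \<gamma> (pi/2) = (side_sign i * a/2, 1) \<and>
     (\<forall>s\<in>arc_dom. a/2 \<le> side_sign i * fst (\<gamma> s)) \<and>
     (\<forall>s\<in>arc_dom. 0 < arc_curvature \<gamma> s) \<and>
     sgn (arc_deriv 1 \<gamma> (-pi/2)) = (side_sign i, 0) \<and>
     sgn (arc_deriv 1 \<gamma> (pi/2)) = (- side_sign i, 0)"

definition generalised_stadium ::
    "nat \<Rightarrow> real \<Rightarrow> point set \<Rightarrow> (side \<Rightarrow> real \<Rightarrow> point) \<Rightarrow> bool" where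
  "generalised_stadium r a \<Omega> \<gamma> \<longleftrightarrow>
     open \<Omega> \<and> convex \<Omega> \<and>
     frontier \<Omega> = flat_edges a \<union> (\<Union>i. \<gamma> i ` arc_dom) \<and>
     (\<forall>i. stadium_arc_param r a i (\<gamma> i)) \<and>
     (\<forall>x y. (x, y) \<in> \<Omega> \<longleftrightarrow> (x, -y) \<in> \<Omega>)"

definition class_M :: "nat \<Rightarrow> real \<Rightarrow> point set set" where
  "class_M r a = {\<Omega>. \<exists>\<gamma>. generalised_stadium r a \<Omega> \<gamma>}"

definition constant_speed :: "(real \<Rightarrow> point) \<Rightarrow> bool" where
  "constant_speed \<gamma> \<longleftrightarrow> (\<exists>c. \<forall>s\<in>arc_dom. norm (arc_deriv 1 \<gamma> s) = c)"

text \<open>Every domain in the class has constant-speed parametrizations of its two arcs, they are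
  unique on \<open>arc_dom\<close>, and they are again of class \<open>C\<^sup>r\<close>; so in the next definition
  \<open>\<lambda>i. \<gamma> i \<tau>\<close> is determined on \<open>arc_dom\<close> by \<open>\<Omega> \<tau>\<close>.\<close>

definition C1_family ::
    "nat \<Rightarrow> real \<Rightarrow> (real \<Rightarrow> point set) \<Rightarrow> (side \<Rightarrow> real \<Rightarrow> real \<Rightarrow> point) \<Rightarrow> bool" where
  "C1_family r a \<Omega> \<gamma> \<longleftrightarrow>
     (\<forall>\<tau>\<in>{-1..1}. \<Omega> \<tau> \<in> class_M r a \<and>
        generalised_stadium r a (\<Omega> \<tau>) (\<lambda>i. \<gamma> i \<tau>) \<and> (\<forall>i. constant_speed (\<gamma> i \<tau>))) \<and>
     (\<forall>i. C1_into_Cr r (\<gamma> i))"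

definition inward_unit_normal :: "point set \<Rightarrow> (real \<Rightarrow> point) \<Rightarrow> real \<Rightarrow> point" where
  "inward_unit_normal \<Omega> \<gamma> s =
     (THE N. norm N = 1 \<and> N \<bullet> arc_deriv 1 \<gamma> s = 0 \<and>
             (\<exists>\<epsilon>>0. \<forall>t\<in>{0<..<\<epsilon>}. \<gamma> s + t *\<^sub>R N \<in> \<Omega>))"

definition deformation_function ::
    "(real \<Rightarrow> point set) \<Rightarrow> (side \<Rightarrow> real \<Rightarrow> real \<Rightarrow> point) \<Rightarrow> side \<Rightarrow> real \<Rightarrow> real" where
  "deformation_function \<Omega> \<gamma> i s =
     vector_derivative (\<lambda>\<tau>. \<gamma> i \<tau> s) (at 0) \<bullet> inward_unit_normal (\<Omega> 0) (\<gamma> i 0) s"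

definition boundary_tangent :: "point set \<Rightarrow> point \<Rightarrow> point \<Rightarrow> bool" where
  "boundary_tangent \<Omega> p T \<longleftrightarrow>
     (\<exists>c \<epsilon>. \<epsilon> > 0 \<and> (\<forall>t\<in>{-\<epsilon><..<\<epsilon>}. c t \<in> frontier \<Omega>) \<and> c 0 = p \<and>
            (c has_vector_derivative T) (at (0::real)))"

text \<open>Reflection at \<open>q\<close> of a ray coming from \<open>p\<close> and leaving towards \<open>p'\<close>: the incoming and
  the outgoing unit direction make the same angle with a tangent vector. The directions point
  out of and into \<open>\<Omega>\<close> respectively, so this is the law of reflection.\<close>

definition reflects :: "point set \<Rightarrow> point \<Rightarrow> point \<Rightarrow> point \<Rightarrow> bool" where
  "reflects \<Omega> p q p' \<longleftrightarrow>
     (\<exists>T. T \<noteq> 0 \<and> boundary_tangent \<Omega> q T \<and> sgn (q - p) \<bullet> T = sgn (p' - q) \<bullet> T)"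

text \<open>Vertices are listed cyclically. Consecutive vertices must differ, since the open segment
  of a degenerate side is empty. The last condition says that the polygon is traversed once,
  that is, its list of vertices is not a repetition of a shorter one.\<close>

definition closed_billiard_trajectory :: "point set \<Rightarrow> point list \<Rightarrow> bool" where
  "closed_billiard_trajectory \<Omega> ps \<longleftrightarrow>
     (let n = length ps; P = (\<lambda>k. ps ! (k mod n)) in
        2 \<le> n \<and>
        (\<forall>k<n. P k \<in> frontier \<Omega> \<and> P k \<noteq> P (k + 1) \<and>
               open_segment (P k) (P (k + 1)) \<subseteq> \<Omega> \<and>
               reflects \<Omega> (P k) (P (k + 1)) (P (k + 2))) \<and>
        (\<forall>d. 0 < d \<and> d < n \<longrightarrow> rotate d ps \<noteq> ps))"

definition perimeter :: "point list \<Rightarrow> real" where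
  "perimeter ps = (\<Sum>k<length ps. dist (ps ! k) (ps ! ((k + 1) mod length ps)))"

definition length_spectrum :: "point set \<Rightarrow> real set" where
  "length_spectrum \<Omega> = {perimeter ps | ps. closed_billiard_trajectory \<Omega> ps}"

definition dynamically_isospectral :: "(real \<Rightarrow> point set) \<Rightarrow> bool" where
  "dynamically_isospectral \<Omega> \<longleftrightarrow>
     (\<forall>\<tau>\<in>{-1..1}. length_spectrum (\<Omega> \<tau>) = length_spectrum (\<Omega> 0))"

end

theory Submission
  imports Defs
begin

text \<open>
  A closed billiard orbit of the stadium whose length is a strict local maximum over polygons
  with the same number of vertices on the same caps persists under small deformations, and the
  critical value of the length is continuous in the parameter. Since the length spectrum of the
  stadium is countable and the family is isospectral, this value is constant, so that the first
  variation of the length at the orbit vanishes: the sum over the vertices of the sine of the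
  angle of reflection times the normal velocity is zero. Countability holds because a trajectory
  meeting both caps is determined by its combinatorial type, the divergence along the long flights
  between the caps outweighing the focusing, while every other trajectory is vertical.

  For \<open>p, q \<ge> 1\<close> there is such an orbit with \<open>q\<close> equally spaced reflections on the left cap and
  \<open>p\<close> equally spaced reflections on the right cap. The normal velocity vanishes at the ends of
  the caps and is even there by the reflection symmetry, hence it is a cosine series with
  coefficients \<open>b m\<close> such that \<open>m\<^sup>2 * \<bar>b m\<bar>\<close> is summable. The orbits with \<open>q = p\<close> sample the sum of
  the two normal velocities on exactly equidistant grids, which forces this sum to vanish. The
  orbits with \<open>q = 4 * p\<close> then compare the averages of one normal velocity on two grids which are
  equidistant up to a relative error \<open>O(1 / (a * p\<^sup>2))\<close>, and for large \<open>a\<close> the resulting linear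
  system for the coefficients is diagonally dominant.
\<close>

section \<open>Cosine series of even functions\<close>

text \<open>All estimates use the norm \<open>B\<close>, the sum of
  \<open>real m ^ 2 * \<bar>b m\<bar>\<close>, and the equation for \<open>p\<close> gets the weight
  \<open>real p ^ 2\<close>. An exact grid of \<open>p\<close> points kills every frequency except
  the multiples of \<open>p\<close>, so the \<open>p\<close>-grid shows \<open>b p\<close> in full,
  while the \<open>4 * p\<close>-grid starts at \<open>b (4 * p)\<close>. The obstacle is the grid
  error: a Lipschitz bound gives order \<open>m * \<kappa>\<close> in every weighted equation, which
  diverges when summed over \<open>p\<close>. For \<open>p\<close> large against \<open>m\<close>
  the leading error is \<open>(1 - 1/\<mu>) * (-1)^m\<close>; summed against \<open>b\<close> it is
  a multiple of the value of the series at the end of the cap, which is zero. Only its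
  \<open>b 0\<close> part stays. It is removed beforehand: its coefficient, a difference of two
  values of \<open>sin x / x\<close>, has order \<open>1 / p^2\<close>, so each weighted equation
  would add a fixed multiple of \<open>\<bar>b 0\<bar>\<close> to a bounded sum. Countability rests
  on an identity for two trajectories with the same code: over a period the spreading
  \<open>S\<close> during flights and the focusing \<open>T\<close> at caps have equal sums, but a
  flight between the caps uses up at most half of its share of \<open>T\<close>.\<close>

lemma sin_mult_sum_cos_odd:
  "sin \<theta> * (\<Sum>j<p. cos ((2 * real j - (real p - 1)) * \<theta>)) = sin (real p * \<theta>)"
proof -
  define g where "g j = sin ((2 * real j - real p) * \<theta>)" for j :: nat
  have "2 * (sin \<theta> * cos ((2 * real j - (real p - 1)) * \<theta>)) = g (Suc j) - g j" for j
  proof -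
    have "g (Suc j) = sin ((2 * real j - (real p - 1)) * \<theta> + \<theta>)"
      and "g j = sin ((2 * real j - (real p - 1)) * \<theta> - \<theta>)"
      by (simp_all add: g_def algebra_simps)
    then show ?thesis
      by (simp add: sin_add sin_diff)
  qed
  then have "2 * (sin \<theta> * (\<Sum>j<p. cos ((2 * real j - (real p - 1)) * \<theta>))) = (\<Sum>j<p. g (Suc j) - g j)"
    by (simp add: sum_distrib_left)
  also have "\<dots> = g p - g 0"
    by (rule sum_lessThan_telescope)
  also have "\<dots> = 2 * sin (real p * \<theta>)"
    by (simp add: g_def)
  finally show ?thesis
    by simp
qed

lemma has_integral_cos_even_multiple:
  "((\<lambda>x. cos (2 * real j * x)) has_integral (if j = 0 then pi else 0)) {-pi/2..pi/2}"
proof (cases "j = 0")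
  case True
  then show ?thesis
    using has_integral_const_real[of "1::real" "-pi/2" "pi/2"] by simp
next
  case False
  have "((\<lambda>x. cos (2 * real j * x)) has_integral
          (sin (2 * real j * (pi/2)) / (2 * real j) - sin (2 * real j * (-pi/2)) / (2 * real j))) {-pi/2..pi/2}"
    using False
    by (intro fundamental_theorem_of_calculus)
       (auto intro!: derivative_eq_intros simp: has_real_derivative_iff_has_vector_derivative[symmetric])
  then show ?thesis
    using False by simp
qed

lemma has_integral_cos_mult_cos:
  "((\<lambda>x. cos (2 * real m * x) * cos (2 * real k * x)) has_integral
     (if m = k then if m = 0 then pi else pi/2 else 0)) {-pi/2..pi/2}"
proof -
  define d where "d = (if m \<le> k then k - m else m - k)"
  have *: "cos (2 * real m * x) * cos (2 * real k * x)
      = (cos (2 * real d * x) + cos (2 * real (m + k) * x)) / 2" for x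
  proof -
    have "cos (2 * real d * x) = cos (2 * real m * x - 2 * real k * x)"
    proof (cases "m \<le> k")
      case True
      then have "2 * real d * x = - (2 * real m * x - 2 * real k * x)"
        by (simp add: d_def of_nat_diff algebra_simps)
      then show ?thesis
        by (simp only: cos_minus)
    next
      case False
      then show ?thesis
        by (simp add: d_def of_nat_diff algebra_simps)
    qed
    then show ?thesis
      by (simp add: cos_add cos_diff algebra_simps)
  qed
  have "((\<lambda>x. (cos (2 * real d * x) + cos (2 * real (m + k) * x)) / 2) has_integral
     ((if d = 0 then pi else 0) + (if m + k = 0 then pi else 0)) / 2) {-pi/2..pi/2}"
    by (intro has_integral_divide has_integral_add has_integral_cos_even_multiple)
  moreover have "((if d = 0 then pi else 0) + (if m + k = 0 then pi else 0)) / 2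
      = (if m = k then if m = 0 then pi else pi/2 else 0)"
    by (auto simp: d_def)
  ultimately show ?thesis
    unfolding * by simp
qed

text \<open>Completeness of the even cosines: an even function on this interval is a function
  \<open>G\<close> of \<open>u = (cos x)\<^sup>2\<close>, so it is approximated by polynomials in
  \<open>u\<close>. The vanishing coefficients make \<open>g\<close> orthogonal to these
  polynomials, hence to itself up to any error.\<close>

lemma even_cosine_coefficients_zero:
  fixes g :: "real \<Rightarrow> real"
  assumes cont: "continuous_on {-pi/2..pi/2} g"
    and even: "\<And>x. x \<in> {-pi/2..pi/2} \<Longrightarrow> g (-x) = g x"
    and coeff: "\<And>m::nat. integral {-pi/2..pi/2} (\<lambda>x. g x * cos (2 * real m * x)) = 0"
    and x: "x \<in> {-pi/2..pi/2}"
  shows "g x = 0"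
proof -
  let ?I = "{-pi/2..pi/2::real}"
  \<comment> \<open>The cosine factor with arbitrary \<open>m\<close> makes the induction work:
    multiplication by \<open>(cos x)\<^sup>2\<close> sends frequency \<open>m\<close> to
    \<open>m\<close> and its two neighbours.\<close>
  have hi: "((\<lambda>x. g x * cos (2 * real m * x) * ((cos x)\<^sup>2) ^ k) has_integral 0) ?I" for m k
  proof (induction k arbitrary: m)
    case 0
    have "(\<lambda>x. g x * cos (2 * real m * x)) integrable_on ?I"
      by (intro integrable_continuous_real continuous_intros cont)
    then show ?case
      using coeff[of m] by (simp add: has_integral_integral)
  next
    case (Suc k)
    \<comment> \<open>\<open>l\<close> is the absolute value of \<open>m - 1\<close>: the cosine is
      even, so frequency -1 is frequency 1.\<close>
    define l where "l = (if m = 0 then 1 else m - 1)"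
    have cs: "cos (2 * real m * x) * (cos x)\<^sup>2
        = cos (2 * real m * x) / 2 + cos (2 * real (Suc m) * x) / 4 + cos (2 * real l * x) / 4" for x
    proof -
      have l: "cos (2 * real l * x) = cos (2 * real m * x - 2 * x)"
      proof (cases m)
        case 0
        then have "2 * real l * x = - (2 * real m * x - 2 * x)"
          by (simp add: l_def)
        then show ?thesis
          by (simp only: cos_minus)
      qed (simp add: l_def algebra_simps)
      have m: "cos (2 * real (Suc m) * x) = cos (2 * real m * x + 2 * x)"
        by (simp add: algebra_simps)
      have "cos (2 * real (Suc m) * x) / 4 + cos (2 * real l * x) / 4 = cos (2 * real m * x) * cos (2 * x) / 2"
        unfolding l m cos_add cos_diff by (simp add: add_divide_distrib diff_divide_distrib)
      also have "\<dots> = cos (2 * real m * x) * (cos x)\<^sup>2 - cos (2 * real m * x) / 2"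
        unfolding cos_double_cos[of x] by (simp add: field_simps)
      finally show ?thesis
        by simp
    qed
    have "((\<lambda>x. (g x * cos (2 * real m * x) * ((cos x)\<^sup>2) ^ k) / 2
             + (g x * cos (2 * real (Suc m) * x) * ((cos x)\<^sup>2) ^ k) / 4
             + (g x * cos (2 * real l * x) * ((cos x)\<^sup>2) ^ k) / 4) has_integral (0/2 + 0/4 + 0/4)) ?I"
      by (rule has_integral_add[OF has_integral_add[OF has_integral_divide[OF Suc.IH[of m]]
            has_integral_divide[OF Suc.IH[of "Suc m"]]] has_integral_divide[OF Suc.IH[of l]]])
    moreover have "(g x * cos (2 * real m * x) * ((cos x)\<^sup>2) ^ k) / 2
             + (g x * cos (2 * real (Suc m) * x) * ((cos x)\<^sup>2) ^ k) / 4
             + (g x * cos (2 * real l * x) * ((cos x)\<^sup>2) ^ k) / 4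
          = g x * cos (2 * real m * x) * ((cos x)\<^sup>2) ^ Suc k" for x
    proof -
      have "g x * cos (2 * real m * x) * ((cos x)\<^sup>2) ^ Suc k
          = g x * ((cos x)\<^sup>2) ^ k * (cos (2 * real m * x) * (cos x)\<^sup>2)"
        by simp
      then show ?thesis
        unfolding cs by (simp add: field_simps)
    qed
    ultimately show ?case
      by simp
  qed
  define G where "G u = g (arccos (sqrt u))" for u
  have cosI: "0 \<le> cos y" if "y \<in> ?I" for y
    using that by (intro cos_ge_zero) auto
  have Gg: "G ((cos y)\<^sup>2) = g y" if "y \<in> ?I" for y
  proof -
    have "arccos (cos y) = \<bar>y\<bar>"
      using that by (cases "0 \<le> y") (auto simp: arccos_cos arccos_cos2)
    then show ?thesis
      using cosI[OF that] even[OF that] by (auto simp: G_def abs_if)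
  qed
  have Gcont: "continuous_on {0..1} G"
    unfolding G_def
  proof (rule continuous_on_compose2[OF cont])
    have s: "0 \<le> sqrt u \<and> sqrt u \<le> 1 \<and> -1 \<le> sqrt u" if "u \<in> {0..1}" for u
      using that real_sqrt_ge_zero[of u] by (auto simp del: real_sqrt_ge_0_iff)
    then show "continuous_on {0..1} (\<lambda>u. arccos (sqrt u))"
      by (intro continuous_intros) blast+
    have "0 \<le> arccos (sqrt u)" "arccos (sqrt u) \<le> pi/2" if "u \<in> {0..1}" for u
      using s[OF that] arccos_lbound[of "sqrt u"] arccos_le_pi2[of "sqrt u"] by auto
    then show "(\<lambda>u. arccos (sqrt u)) ` {0..1} \<subseteq> ?I"
      using pi_gt_zero by (fastforce simp: image_subset_iff)
  qed
  obtain M where "\<forall>z\<in>g ` ?I. norm z \<le> M"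
    using compact_imp_bounded[OF compact_continuous_image[OF cont compact_Icc]]
    unfolding bounded_iff by blast
  then have M: "\<And>y. y \<in> ?I \<Longrightarrow> \<bar>g y\<bar> \<le> M"
    by (metis image_eqI real_norm_def)
  have M0: "0 \<le> M"
    using order_trans[OF abs_ge_zero M[of 0]] by simp
  \<comment> \<open>As \<open>g\<close> is orthogonal to the polynomial \<open>P\<close> in
    \<open>(cos y)\<^sup>2\<close>, the integral of \<open>g * g\<close> equals that of
    \<open>g * (g - P)\<close>, whose second factor is smaller than \<open>e\<close>.\<close>
  have gg: "integral ?I (\<lambda>y. g y * g y) \<le> e * (M * pi)" if e: "e > 0" for e
  proof -
    obtain P where P: "real_polynomial_function P" "\<And>u. u \<in> {0..1} \<Longrightarrow> \<bar>G u - P u\<bar> < e"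
      using Stone_Weierstrass_real_polynomial_function[OF compact_Icc Gcont e] by metis
    obtain a n where a: "P = (\<lambda>x. \<Sum>i\<le>n. a i * x ^ i)"
      using P(1) real_polynomial_function_iff_sum by auto
    have "((\<lambda>y. \<Sum>i\<le>n. a i * (g y * cos (2 * real 0 * y) * ((cos y)\<^sup>2) ^ i)) has_integral (\<Sum>i\<le>n. a i * 0)) ?I"
      by (intro has_integral_sum has_integral_mult_right hi) auto
    then have "((\<lambda>y. g y * P ((cos y)\<^sup>2)) has_integral 0) ?I"
      by (simp add: a sum_distrib_left mult_ac)
    moreover have "((\<lambda>y. g y * g y) has_integral integral ?I (\<lambda>y. g y * g y)) ?I"
      by (intro integrable_integral integrable_continuous_real continuous_intros cont)
    ultimately have d: "((\<lambda>y. g y * g y - g y * P ((cos y)\<^sup>2)) has_integral integral ?I (\<lambda>y. g y * g y) - 0) ?I"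
      by (intro has_integral_diff)
    have "((\<lambda>y. e * M) has_integral (e * M) * (pi/2 - (-pi/2))) ?I"
      using has_integral_const_real[of "e * M" "-pi/2" "pi/2"] by (simp add: mult_ac)
    from has_integral_le[OF d this]
    have "integral ?I (\<lambda>y. g y * g y) - 0 \<le> (e * M) * (pi/2 - (-pi/2))"
    proof -
      have "g y * g y - g y * P ((cos y)\<^sup>2) \<le> e * M" if y: "y \<in> ?I" for y
      proof -
        have "(cos y)\<^sup>2 \<in> {0..1}"
          using abs_cos_le_one[of y] by (auto simp: abs_square_le_1)
        then have "\<bar>g y - P ((cos y)\<^sup>2)\<bar> \<le> e"
          using P(2)[of "(cos y)\<^sup>2"] Gg[OF y] by simp
        then have "\<bar>g y\<bar> * \<bar>g y - P ((cos y)\<^sup>2)\<bar> \<le> M * e"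
          using M[OF y] M0 by (intro mult_mono) auto
        moreover have "g y * g y - g y * P ((cos y)\<^sup>2) \<le> \<bar>g y * (g y - P ((cos y)\<^sup>2))\<bar>"
          by (simp add: algebra_simps)
        ultimately show ?thesis
          by (simp add: abs_mult mult.commute)
      qed
      then show ?thesis
        using \<open>\<lbrakk>\<And>x. x \<in> ?I \<Longrightarrow> g x * g x - g x * P ((cos x)\<^sup>2) \<le> e * M\<rbrakk> \<Longrightarrow> _\<close> by blast
    qed
    then show ?thesis
      by (simp add: field_simps)
  qed
  have "integral ?I (\<lambda>y. g y * g y) \<le> 0"
  proof (rule field_le_epsilon)
    fix e :: real assume e: "e > 0"
    have "integral ?I (\<lambda>y. g y * g y) \<le> (e / (M * pi + 1)) * (M * pi)"
      using e M0 by (intro gg divide_pos_pos add_nonneg_pos) auto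
    also have "\<dots> \<le> e"
    proof -
      have "M * pi \<ge> 0"
        using M0 by simp
      then show ?thesis
        using e by (simp add: pos_divide_le_eq algebra_simps)
    qed
    finally show "integral ?I (\<lambda>y. g y * g y) \<le> 0 + e"
      by simp
  qed
  moreover have "0 \<le> integral ?I (\<lambda>y. g y * g y)"
    by (intro integral_nonneg integrable_continuous_real continuous_intros cont) auto
  ultimately have "integral ?I (\<lambda>y. g y * g y) = 0"
    by simp
  moreover have "continuous_on ?I (\<lambda>y. g y * g y)"
    by (intro continuous_intros cont)
  ultimately have "\<forall>y\<in>?I. g y * g y = 0"
    by (subst (asm) integral_eq_0_iff) simp_all
  then have "g x * g x = 0"
    using x by blast
  then show ?thesis
    by simp
qed

text \<open>Four integrations by parts, collected in the antiderivative \<open>H\<close>. The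
  boundary terms with \<open>f\<close> and \<open>f2\<close> carry \<open>sin (k * x)\<close>, zero
  at the ends because \<open>k\<close> is twice an integer; the term with \<open>f1\<close> vanishes
  by assumption; those with \<open>f3\<close> already have the factor
  \<open>1 / k^4\<close>.\<close>

lemma cosine_coefficient_bound:
  fixes f f1 f2 f3 f4 :: "real \<Rightarrow> real"
  assumes d: "\<And>x. x \<in> {-pi/2..pi/2} \<Longrightarrow> (f has_real_derivative f1 x) (at x within {-pi/2..pi/2})"
      "\<And>x. x \<in> {-pi/2..pi/2} \<Longrightarrow> (f1 has_real_derivative f2 x) (at x within {-pi/2..pi/2})"
      "\<And>x. x \<in> {-pi/2..pi/2} \<Longrightarrow> (f2 has_real_derivative f3 x) (at x within {-pi/2..pi/2})"
      "\<And>x. x \<in> {-pi/2..pi/2} \<Longrightarrow> (f3 has_real_derivative f4 x) (at x within {-pi/2..pi/2})"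
    and c4: "continuous_on {-pi/2..pi/2} f4"
    and ends: "f1 (-pi/2) = 0" "f1 (pi/2) = 0"
  obtains C where "\<And>m. m \<ge> 1 \<Longrightarrow> \<bar>integral {-pi/2..pi/2} (\<lambda>x. f x * cos (2 * real m * x))\<bar> \<le> C / real m ^ 4"
proof -
  let ?I = "{-pi/2..pi/2::real}"
  obtain M where "\<forall>z\<in>f4 ` ?I. norm z \<le> M"
    using compact_imp_bounded[OF compact_continuous_image[OF c4 compact_Icc]]
    unfolding bounded_iff by blast
  then have M: "\<And>y. y \<in> ?I \<Longrightarrow> \<bar>f4 y\<bar> \<le> M"
    by (metis image_eqI real_norm_def)
  have M0: "0 \<le> M"
    using order_trans[OF abs_ge_zero M[of 0]] by simp
  have cf: "continuous_on ?I f"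
    using d(1) by (meson DERIV_continuous continuous_on_eq_continuous_within)
  define C where "C = (\<bar>f3 (pi/2)\<bar> + \<bar>f3 (-pi/2)\<bar> + M * pi) / 16"
  have "\<bar>integral ?I (\<lambda>x. f x * cos (2 * real m * x))\<bar> \<le> C / real m ^ 4" if m: "m \<ge> 1" for m
  proof -
    define k where "k = 2 * real m"
    have k: "k > 0"
      using m by (simp add: k_def)
    define H where "H x = f x * sin (k * x) / k + f1 x * cos (k * x) / k^2
        - f2 x * sin (k * x) / k^3 - f3 x * cos (k * x) / k^4" for x
    have "((\<lambda>x. f x * cos (k * x) - f4 x * cos (k * x) / k^4) has_integral (H (pi/2) - H (-pi/2))) ?I"
    proof (rule fundamental_theorem_of_calculus)
      fix x assume x: "x \<in> ?I"
      define S where "S = ?I"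
      note d' = d[OF x, folded S_def]
      have "(H has_real_derivative (f x * cos (k * x) - f4 x * cos (k * x) / k^4)) (at x within S)"
        unfolding H_def using k
        by (auto intro!: derivative_eq_intros d' simp: field_simps eval_nat_numeral)
      then show "(H has_vector_derivative (f x * cos (k * x) - f4 x * cos (k * x) / k^4)) (at x within ?I)"
        by (simp add: has_real_derivative_iff_has_vector_derivative S_def)
    qed simp
    moreover have ig: "((\<lambda>x. f4 x * cos (k * x) / k^4) has_integral integral ?I (\<lambda>x. f4 x * cos (k * x) / k^4)) ?I"
      using k by (intro integrable_integral integrable_continuous_real continuous_intros c4) auto
    ultimately have "((\<lambda>x. (f x * cos (k * x) - f4 x * cos (k * x) / k^4) + f4 x * cos (k * x) / k^4) has_integral
        (H (pi/2) - H (-pi/2)) + integral ?I (\<lambda>x. f4 x * cos (k * x) / k^4)) ?I"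
      by (intro has_integral_add)
    then have eq: "integral ?I (\<lambda>x. f x * cos (k * x)) =
        (H (pi/2) - H (-pi/2)) + integral ?I (\<lambda>x. f4 x * cos (k * x) / k^4)"
      by (simp add: integral_unique)
    have sk: "sin (k * (pi/2)) = 0" "sin (k * (-pi/2)) = 0"
      by (simp_all add: k_def)
    have b1: "\<bar>H (pi/2)\<bar> \<le> \<bar>f3 (pi/2)\<bar> / k^4" "\<bar>H (-pi/2)\<bar> \<le> \<bar>f3 (-pi/2)\<bar> / k^4"
      unfolding H_def sk ends using k
      by (auto simp: abs_mult intro!: divide_right_mono mult_left_le abs_cos_le_one)
    have "norm (integral ?I (\<lambda>x. f4 x * cos (k * x) / k^4)) \<le> integral ?I (\<lambda>x. M / k^4)"
    proof (rule integral_norm_bound_integral)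
      show "(\<lambda>x. f4 x * cos (k * x) / k ^ 4) integrable_on ?I"
        using ig by blast
      show "(\<lambda>x. M / k ^ 4) integrable_on ?I"
        by (intro integrable_continuous_real continuous_intros)
      fix x assume x: "x \<in> ?I"
      have "\<bar>f4 x\<bar> * \<bar>cos (k * x)\<bar> \<le> M * 1"
        using M[OF x] M0 by (intro mult_mono) auto
      then show "norm (f4 x * cos (k * x) / k ^ 4) \<le> M / k ^ 4"
        using k by (simp add: abs_mult divide_right_mono)
    qed
    then have b2: "\<bar>integral ?I (\<lambda>x. f4 x * cos (k * x) / k^4)\<bar> \<le> M * pi / k^4"
      by (simp add: field_simps)
    have "\<bar>integral ?I (\<lambda>x. f x * cos (k * x))\<bar>
        \<le> \<bar>f3 (pi/2)\<bar> / k^4 + \<bar>f3 (-pi/2)\<bar> / k^4 + M * pi / k^4"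
      unfolding eq using b1 b2 by linarith
    also have "\<dots> = C / real m ^ 4"
      by (simp add: C_def k_def power_mult_distrib add_divide_distrib)
    finally show ?thesis
      by (simp add: k_def)
  qed
  then show ?thesis
    using that by blast
qed

text \<open>The series formed with the Fourier coefficients converges uniformly to a function
  \<open>F\<close> with the same coefficients as \<open>f\<close>, and completeness gives
  \<open>F = f\<close>. The fourth-order decay is what leaves
  \<open>real m ^ 2 * \<bar>b m\<bar>\<close> summable, like \<open>1 / m^2\<close>.\<close>

theorem even_cosine_series:
  fixes f f1 f2 f3 f4 :: "real \<Rightarrow> real"
  assumes d: "\<And>x. x \<in> {-pi/2..pi/2} \<Longrightarrow> (f has_real_derivative f1 x) (at x within {-pi/2..pi/2})"
      "\<And>x. x \<in> {-pi/2..pi/2} \<Longrightarrow> (f1 has_real_derivative f2 x) (at x within {-pi/2..pi/2})"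
      "\<And>x. x \<in> {-pi/2..pi/2} \<Longrightarrow> (f2 has_real_derivative f3 x) (at x within {-pi/2..pi/2})"
      "\<And>x. x \<in> {-pi/2..pi/2} \<Longrightarrow> (f3 has_real_derivative f4 x) (at x within {-pi/2..pi/2})"
    and c4: "continuous_on {-pi/2..pi/2} f4"
    and ends: "f1 (-pi/2) = 0" "f1 (pi/2) = 0"
    and even: "\<And>x. x \<in> {-pi/2..pi/2} \<Longrightarrow> f (-x) = f x"
  obtains b :: "nat \<Rightarrow> real" where "summable (\<lambda>m. real m ^ 2 * \<bar>b m\<bar>)" "summable (\<lambda>m. \<bar>b m\<bar>)"
    "\<And>x. x \<in> {-pi/2..pi/2} \<Longrightarrow> (\<lambda>m. b m * cos (2 * real m * x)) sums f x"
proof -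
  let ?I = "{-pi/2..pi/2::real}"
  obtain C where C: "\<And>m. m \<ge> 1 \<Longrightarrow> \<bar>integral ?I (\<lambda>x. f x * cos (2 * real m * x))\<bar> \<le> C / real m ^ 4"
    using cosine_coefficient_bound[OF d c4 ends] by metis
  have cf: "continuous_on ?I f"
    using d(1) by (meson DERIV_continuous continuous_on_eq_continuous_within)
  define b where "b m = integral ?I (\<lambda>x. f x * cos (2 * real m * x)) / (if m = 0 then pi else pi/2)" for m :: nat
  have C0: "C \<ge> 0"
    using order_trans[OF abs_ge_zero C[of 1]] by simp
  have bb: "\<bar>b m\<bar> \<le> C / real m ^ 4" if "m \<ge> 1" for m
  proof -
    have "\<bar>b m\<bar> = \<bar>integral ?I (\<lambda>x. f x * cos (2 * real m * x))\<bar> / (pi/2)"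
      using that by (simp add: b_def abs_mult)
    also have "\<dots> \<le> \<bar>integral ?I (\<lambda>x. f x * cos (2 * real m * x))\<bar> / 1"
      using pi_gt3 by (intro divide_left_mono) auto
    finally show ?thesis
      using C[OF that] by simp
  qed
  have s2: "summable (\<lambda>m. real m ^ 2 * \<bar>b m\<bar>)"
  proof (rule summable_comparison_test'[of "\<lambda>m. C * inverse (real m ^ 2)" 1])
    show "summable (\<lambda>m. C * inverse (real m ^ 2))"
      by (intro summable_mult inverse_power_summable) simp
    fix m :: nat assume m: "m \<ge> 1"
    have "real m ^ 2 * \<bar>b m\<bar> \<le> real m ^ 2 * (C / real m ^ 4)"
      using bb[OF m] by (intro mult_left_mono) auto
    also have "\<dots> = C * inverse (real m ^ 2)"
      using m by (simp add: field_simps eval_nat_numeral)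
    finally show "norm (real m ^ 2 * \<bar>b m\<bar>) \<le> C * inverse (real m ^ 2)"
      by simp
  qed
  have s0: "summable (\<lambda>m. \<bar>b m\<bar>)"
  proof (rule summable_comparison_test'[OF s2, of 1])
    fix m :: nat assume m: "m \<ge> 1"
    have "1 * \<bar>b m\<bar> \<le> real m ^ 2 * \<bar>b m\<bar>"
      using m by (intro mult_right_mono) auto
    then show "norm \<bar>b m\<bar> \<le> real m ^ 2 * \<bar>b m\<bar>"
      by simp
  qed
  define F where "F x = (\<Sum>m. b m * cos (2 * real m * x))" for x
  have le: "norm (b m * cos (2 * real m * x)) \<le> \<bar>b m\<bar>" for m x
    by (simp add: abs_mult mult_left_le)
  have ul: "uniform_limit ?I (\<lambda>n x. \<Sum>m<n. b m * cos (2 * real m * x)) F sequentially"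
    unfolding F_def by (rule Weierstrass_m_test[OF le s0])
  have cF: "continuous_on ?I F"
    by (rule uniform_limit_theorem[OF _ ul]) (auto intro!: always_eventually continuous_intros)
  have Fc: "integral ?I (\<lambda>x. F x * cos (2 * real k * x)) = b k * (if k = 0 then pi else pi/2)" for k
  proof -
    have "uniform_limit ?I (\<lambda>n x. (\<Sum>m<n. b m * cos (2 * real m * x)) * cos (2 * real k * x))
       (\<lambda>x. F x * cos (2 * real k * x)) sequentially"
    proof (rule uniform_lim_mult[OF ul uniform_limit_const])
      show "bounded (F ` ?I)"
        by (intro compact_imp_bounded compact_continuous_image cF compact_Icc)
      show "bounded ((\<lambda>x. cos (2 * real k * x)) ` ?I)"
        by (intro compact_imp_bounded compact_continuous_image continuous_intros compact_Icc)
    qed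
    then obtain I J where IJ: "\<And>n. ((\<lambda>x. (\<Sum>m<n. b m * cos (2 * real m * x)) * cos (2 * real k * x)) has_integral I n) ?I"
      "((\<lambda>x. F x * cos (2 * real k * x)) has_integral J) ?I" "I \<longlonglongrightarrow> J"
      by (rule uniform_limit_integral) (auto intro!: continuous_intros)
    \<comment> \<open>As soon as the partial sum contains frequency \<open>k\<close>, orthogonality
      freezes the value of \<open>I n\<close>.\<close>
    have "I n = b k * (if k = 0 then pi else pi/2)" if n: "n > k" for n
    proof -
      have "((\<lambda>x. \<Sum>m<n. b m * (cos (2 * real m * x) * cos (2 * real k * x))) has_integral
         (\<Sum>m<n. b m * (if m = k then if m = 0 then pi else pi/2 else 0))) ?I"
        by (intro has_integral_sum has_integral_mult_right has_integral_cos_mult_cos) auto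
      moreover have "(\<Sum>m<n. b m * (if m = k then if m = 0 then pi else pi/2 else 0))
          = (\<Sum>m<n. if m = k then b k * (if k = 0 then pi else pi/2) else 0)"
        by (intro sum.cong) auto
      ultimately have "((\<lambda>x. \<Sum>m<n. b m * (cos (2 * real m * x) * cos (2 * real k * x))) has_integral
         b k * (if k = 0 then pi else pi/2)) ?I"
        using n by (simp add: sum.delta)
      then show ?thesis
        using IJ(1)[of n] by (simp add: sum_distrib_right mult.assoc has_integral_unique)
    qed
    then have "I \<longlonglongrightarrow> b k * (if k = 0 then pi else pi/2)"
      by (intro tendsto_eventually) (auto simp: eventually_sequentially intro!: exI[of _ "Suc k"])
    then have "J = b k * (if k = 0 then pi else pi/2)"
      using IJ(3) LIMSEQ_unique by blast
    then show ?thesis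
      using IJ(2) by blast
  qed
  have "f x - F x = 0" if x: "x \<in> ?I" for x
  proof (rule even_cosine_coefficients_zero[where g = "\<lambda>x. f x - F x"])
    show "continuous_on ?I (\<lambda>x. f x - F x)"
      by (intro continuous_intros cf cF)
    show "f (- x) - F (- x) = f x - F x" if "x \<in> ?I" for x
      using even[OF that] by (simp add: F_def)
    show "integral ?I (\<lambda>x. (f x - F x) * cos (2 * real m * x)) = 0" for m
    proof -
      have "integral ?I (\<lambda>x. f x * cos (2 * real m * x) - F x * cos (2 * real m * x)) =
         integral ?I (\<lambda>x. f x * cos (2 * real m * x)) - integral ?I (\<lambda>x. F x * cos (2 * real m * x))"
        by (intro integral_diff integrable_continuous_real continuous_intros cf cF)
      also have "\<dots> = 0"
        unfolding Fc by (simp add: b_def)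
      finally show ?thesis
        by (simp add: left_diff_distrib)
    qed
  qed (use x in auto)
  moreover have "(\<lambda>m. b m * cos (2 * real m * x)) sums F x" for x
    unfolding F_def by (intro summable_sums summable_comparison_test'[OF s0, of 0] le)
  ultimately show ?thesis
    using that[of b] s2 s0 by auto
qed

section \<open>Cosine series determined by sums over almost equidistant grids\<close>

text \<open>Comparison with a telescoping sum, since
  \<open>(k + 3/2) * (k + 5/2) < (k + 2)^2\<close>. The second sum lacks the first term of the first
  one; that it stays below 1 is what makes the linear systems for the coefficients diagonally
  dominant.\<close>

lemma sum_inverse_squares_le:
  "(\<Sum>k<n. 1 / (real k + 1)\<^sup>2) \<le> 5/3" "(\<Sum>k<n. 1 / (real k + 2)\<^sup>2) \<le> 2/3"
proof -
  have step: "1 / (real k + 2)\<^sup>2 \<le> 1 / (real k + 3/2) - 1 / (real (Suc k) + 3/2)" for k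
    by (simp add: divide_simps power2_eq_square) (simp add: algebra_simps)
  have "(\<Sum>k<n. 1 / (real k + 2)\<^sup>2) \<le> (\<Sum>k<n. 1 / (real k + 3/2) - 1 / (real (Suc k) + 3/2))" for n
    by (intro sum_mono step)
  also have "\<dots> n = 1 / (real 0 + 3/2) - 1 / (real n + 3/2)" for n
    by (rule sum_lessThan_telescope')
  finally have *: "(\<Sum>k<n. 1 / (real k + 2)\<^sup>2) \<le> 2/3 - 1 / (real n + 3/2)" for n
    by simp
  have le: "(\<Sum>k<n. 1 / (real k + 2)\<^sup>2) \<le> 2/3" for n
    by (rule order_trans[OF *]) simp
  then show "(\<Sum>k<n. 1 / (real k + 2)\<^sup>2) \<le> 2/3" .
  show "(\<Sum>k<n. 1 / (real k + 1)\<^sup>2) \<le> 5/3"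
  proof (cases n)
    case (Suc n')
    have "(\<Sum>k<n. 1 / (real k + 1)\<^sup>2) = 1 + (\<Sum>k<n'. 1 / (real k + 2)\<^sup>2)"
      unfolding Suc sum.lessThan_Suc_shift by (simp add: add.commute)
    then show ?thesis
      using le[of n'] by simp
  qed simp
qed

text \<open>After an exchange of summations, for fixed \<open>k\<close> the indices are distinct
  multiples of \<open>l = (k + j) * c\<close>, so the sum with weights \<open>real p ^ 2\<close> is
  at most \<open>1 / l^2\<close> times the full norm of \<open>b\<close>. The factor
  \<open>1 / c^2\<close> is the gain of a grid that is \<open>c\<close> times finer.\<close>

lemma weighted_multiples_sum_le:
  fixes b :: "nat \<Rightarrow> real"
  assumes s2: "summable (\<lambda>m. real m ^ 2 * \<bar>b m\<bar>)" and s0: "summable (\<lambda>m. \<bar>b m\<bar>)"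
    and c: "c \<ge> 1" and j: "j \<ge> 1"
    and Z: "\<And>n. (\<Sum>k<n. 1 / (real k + real j)\<^sup>2) \<le> Z"
  shows "(\<Sum>p=1..N. real p ^ 2 * (\<Sum>k. \<bar>b ((k + j) * (c * p))\<bar>)) \<le> (\<Sum>m. real m ^ 2 * \<bar>b m\<bar>) / real c ^ 2 * Z"
proof -
  define B where "B = (\<Sum>m. real m ^ 2 * \<bar>b m\<bar>)"
  have B0: "B \<ge> 0"
    unfolding B_def by (intro suminf_nonneg s2) auto
  have inj1: "inj (\<lambda>k. (k + j) * (c * p))" if "p \<ge> 1" for p
    using c that by (auto simp: inj_on_def)
  have sk: "summable (\<lambda>k. \<bar>b ((k + j) * (c * p))\<bar>)" if "p \<ge> 1" for p
    using summable_reindex[OF s0 inj1[OF that]] by (simp add: o_def)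
  have sm: "summable (\<lambda>k. real p ^ 2 * \<bar>b ((k + j) * (c * p))\<bar>)" if "p \<in> {1..N}" for p
    using that by (intro summable_mult sk) auto
  have "(\<Sum>p=1..N. real p ^ 2 * (\<Sum>k. \<bar>b ((k + j) * (c * p))\<bar>))
      = (\<Sum>p=1..N. \<Sum>k. real p ^ 2 * \<bar>b ((k + j) * (c * p))\<bar>)"
    by (intro sum.cong refl suminf_mult[symmetric] sk) auto
  also have "\<dots> = (\<Sum>k. \<Sum>p=1..N. real p ^ 2 * \<bar>b ((k + j) * (c * p))\<bar>)"
    by (intro suminf_sum[symmetric] sm)
  also have "\<dots> \<le> B / real c ^ 2 * Z"
  proof (rule suminf_le_const)
    show "summable (\<lambda>k. \<Sum>p=1..N. real p ^ 2 * \<bar>b ((k + j) * (c * p))\<bar>)"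
      by (intro summable_sum sm)
    have inner: "(\<Sum>p=1..N. real p ^ 2 * \<bar>b ((k + j) * (c * p))\<bar>) \<le> B / real c ^ 2 * (1 / (real k + real j)\<^sup>2)" for k
    proof -
      define l where "l = (k + j) * c"
      have l: "l \<ge> 1"
        using c j by (simp add: l_def)
      have "(\<Sum>p=1..N. real (l * p) ^ 2 * \<bar>b (l * p)\<bar>) = (\<Sum>m\<in>(\<lambda>p. l * p) ` {1..N}. real m ^ 2 * \<bar>b m\<bar>)"
        using l by (subst sum.reindex) (auto simp: inj_on_def)
      also have "\<dots> \<le> B"
        unfolding B_def by (intro sum_le_suminf s2) auto
      finally have "real l ^ 2 * (\<Sum>p=1..N. real p ^ 2 * \<bar>b (l * p)\<bar>) \<le> B"
        by (simp add: sum_distrib_left power_mult_distrib mult_ac)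
      then have "(\<Sum>p=1..N. real p ^ 2 * \<bar>b (l * p)\<bar>) \<le> B / real l ^ 2"
        using l by (simp add: field_simps)
      also have "\<dots> = B / real c ^ 2 * (1 / (real k + real j)\<^sup>2)"
        unfolding l_def of_nat_mult of_nat_add power_mult_distrib by simp
      finally show ?thesis
        by (simp add: l_def mult_ac)
    qed
    fix n
    have "(\<Sum>k<n. \<Sum>p=1..N. real p ^ 2 * \<bar>b ((k + j) * (c * p))\<bar>)
        \<le> (\<Sum>k<n. B / real c ^ 2 * (1 / (real k + real j)\<^sup>2))"
      by (intro sum_mono inner)
    also have "\<dots> = B / real c ^ 2 * (\<Sum>k<n. 1 / (real k + real j)\<^sup>2)"
      by (simp add: sum_distrib_left)
    also have "\<dots> \<le> B / real c ^ 2 * Z"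
      using B0 by (intro mult_left_mono Z) auto
    finally show "(\<Sum>k<n. \<Sum>p=1..N. real p ^ 2 * \<bar>b ((k + j) * (c * p))\<bar>) \<le> B / real c ^ 2 * Z" .
  qed
  finally show ?thesis
    unfolding B_def .
qed

text \<open>Symmetric about 0 with spacing \<open>2 * \<alpha>\<close>. For
  \<open>\<alpha> = pi / (2 * p)\<close> these are the midpoints of \<open>p\<close> equal parts of
  \<open>arc_dom\<close>.\<close>

definition grid :: "nat \<Rightarrow> real \<Rightarrow> nat \<Rightarrow> real" where
  "grid p \<alpha> j = (2 * real j - (real p - 1)) * \<alpha>"

definition grid_kernel :: "nat \<Rightarrow> real \<Rightarrow> nat \<Rightarrow> real" where
  "grid_kernel p \<alpha> m = (\<Sum>j<p. cos (2 * real m * grid p \<alpha> j)) / real p"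

lemma grid_kernel_0 [simp]: "p \<ge> 1 \<Longrightarrow> grid_kernel p \<alpha> 0 = 1"
  by (simp add: grid_kernel_def)

text \<open>\<open>grid_kernel\<close> is a Dirichlet kernel. The product form of its closed
  expression stays valid at the zeros of the sine.\<close>

lemma sin_mult_grid_kernel:
  "sin (2 * real m * \<alpha>) * (real p * grid_kernel p \<alpha> m) = sin (real p * (2 * real m * \<alpha>))"
proof (cases "p = 0")
  case False
  have "sin (2 * real m * \<alpha>) * (real p * grid_kernel p \<alpha> m)
      = sin (2 * real m * \<alpha>) * (\<Sum>j<p. cos ((2 * real j - (real p - 1)) * (2 * real m * \<alpha>)))"
    using False by (simp add: grid_kernel_def grid_def mult_ac)
  then show ?thesis
    by (simp only: sin_mult_sum_cos_odd)
qed simp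

text \<open>The numerator \<open>sin (m * pi)\<close> of the Dirichlet kernel is zero, and its
  denominator vanishes only if \<open>p\<close> divides \<open>m\<close>.\<close>

lemma grid_kernel_not_dvd:
  assumes p: "p \<ge> 1" and m: "\<not> p dvd m"
  shows "grid_kernel p (pi / (2 * real p)) m = 0"
proof -
  have "sin (2 * real m * (pi / (2 * real p))) \<noteq> 0"
  proof
    assume "sin (2 * real m * (pi / (2 * real p))) = 0"
    then obtain i where "2 * real m * (pi / (2 * real p)) = of_int i * pi"
      unfolding sin_zero_iff_int2 by blast
    then have "real m = of_int i * real p"
      using p by (simp add: field_simps)
    then have "int m = i * int p"
      by (metis of_int_eq_iff of_int_mult of_int_of_nat_eq)
    then have "int p dvd int m"
      by simp
    then show False
      using m by simp
  qed
  moreover have "real p * (2 * real m * (pi / (2 * real p))) = real m * pi"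
    using p by simp
  ultimately show ?thesis
    using sin_mult_grid_kernel[of m "pi / (2 * real p)" p] p by simp
qed

text \<open>A frequency divisible by \<open>p\<close> takes the same value 1 or -1 at all points of
  the exact grid: this is aliasing.\<close>

lemma grid_kernel_dvd:
  assumes p: "p \<ge> 1"
  shows "\<bar>grid_kernel p (pi / (2 * real p)) (k * p)\<bar> = 1"
proof -
  have "cos (2 * real (k * p) * grid p (pi / (2 * real p)) j) = (-1) ^ (k * (p - 1))" for j
  proof -
    have "2 * real (k * p) * grid p (pi / (2 * real p)) j = 2 * real (k * j) * pi - real (k * (p - 1)) * pi"
      using p by (simp add: grid_def of_nat_diff field_simps)
    moreover have "cos (2 * real (k * j) * pi) = 1" "sin (2 * real (k * j) * pi) = 0"
      using cos_integer_2pi[of "real (k * j)"] sin_integer_2pi[of "real (k * j)"]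
      by (simp_all add: mult_ac)
    ultimately show ?thesis
      by (simp add: cos_diff del: of_nat_mult)
  qed
  then show ?thesis
    using p by (simp add: grid_kernel_def)
qed

lemma abs_sin_diff_le_cube: "\<bar>sin x - x\<bar> \<le> \<bar>x\<bar> ^ 3 / 6" for x :: real
  using Maclaurin_sin_bound[of x 3] by (simp add: sin_coeff_def eval_nat_numeral)

lemma abs_sin_diff_le_square: "\<bar>sin x - x\<bar> \<le> x\<^sup>2" for x :: real
proof (cases "\<bar>x\<bar> \<le> 6")
  case True
  then have "\<bar>x\<bar> ^ 3 / 6 \<le> \<bar>x\<bar> ^ 2"
    using mult_right_mono[of "\<bar>x\<bar>" 6 "x * x"] by (simp add: eval_nat_numeral mult_ac)
  then show ?thesis
    using abs_sin_diff_le_cube[of x] by simp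
next
  case False
  have "\<bar>sin x\<bar> \<le> 1"
    by simp
  then have "\<bar>sin x - x\<bar> \<le> 2 * \<bar>x\<bar>"
    using False by linarith
  also have "\<dots> \<le> \<bar>x\<bar> * \<bar>x\<bar>"
    using False by (intro mult_right_mono) auto
  finally show ?thesis
    by (simp add: power2_eq_square)
qed

lemma abs_cos_diff_le: "\<bar>cos x - cos y\<bar> \<le> \<bar>x - y\<bar>" for x y :: real
proof -
  have "cos x - cos y = 2 * sin ((x + y) / 2) * sin ((y - x) / 2)"
    by (rule cos_diff_cos)
  then have "\<bar>cos x - cos y\<bar> = 2 * \<bar>sin ((x + y) / 2)\<bar> * \<bar>sin ((y - x) / 2)\<bar>"
    by (simp add: abs_mult)
  also have "\<dots> \<le> 2 * 1 * \<bar>(y - x) / 2\<bar>"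
    by (intro mult_mono abs_sin_x_le_abs_x) auto
  finally show ?thesis
    by simp
qed

text \<open>The stretched grid fills the interval of half-length \<open>\<mu> * pi / 2\<close>, over
  which \<open>cos (2 * m * x)\<close> has the mean
  \<open>sin (m * \<mu> * pi) / (m * \<mu> * pi)\<close>; to first order in \<open>\<mu> - 1\<close>
  this is \<open>(1 - 1/\<mu>) * (-1)^m\<close>. For \<open>p \<ge> 4 * m\<close> the grid mean is
  close to this mean. For smaller \<open>p\<close> a Lipschitz estimate suffices, since there are
  fewer than \<open>4 * m\<close> of them.\<close>

lemma grid_kernel_perturbation:
  assumes p: "p \<ge> 1" and m: "m \<ge> 1" and \<mu>: "\<bar>\<mu> - 1\<bar> \<le> \<eta>" and \<eta>: "\<eta> \<le> 1/2"
  shows "\<bar>grid_kernel p (\<mu> * (pi / (2 * real p))) m - grid_kernel p (pi / (2 * real p)) m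
           - (1 - 1/\<mu>) * (-1)^m\<bar>
         \<le> (if p < 4 * m then 6 * real m * \<eta> else (5 * (real m)\<^sup>2 / (real p)\<^sup>2 + 8 * real m * \<eta>) * \<eta>)"
proof -
  have \<mu>b: "\<mu> \<ge> 1/2" "\<mu> \<le> 3/2" and \<eta>0: "\<eta> \<ge> 0"
    using \<mu> \<eta> by linarith+
  define \<alpha> where "\<alpha> = pi / (2 * real p)"
  show ?thesis
  proof (cases "p < 4 * m")
    case True
    have "\<bar>cos (2 * real m * grid p (\<mu> * \<alpha>) j) - cos (2 * real m * grid p \<alpha> j)\<bar> \<le> 4 * real m * \<eta>"
      if j: "j < p" for j
    proof -
      have "\<bar>2 * real j - (real p - 1)\<bar> \<le> real p"
        using j by linarith
      then have "\<bar>2 * real j - (real p - 1)\<bar> * \<alpha> \<le> real p * \<alpha>"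
        by (intro mult_right_mono) (auto simp: \<alpha>_def)
      also have "\<dots> \<le> 2"
        using p pi_less_4 by (simp add: \<alpha>_def)
      finally have g: "\<bar>grid p \<alpha> j\<bar> \<le> 2"
        using p by (simp add: grid_def abs_mult \<alpha>_def)
      have "\<bar>cos (2 * real m * grid p (\<mu> * \<alpha>) j) - cos (2 * real m * grid p \<alpha> j)\<bar>
          \<le> \<bar>2 * real m * grid p (\<mu> * \<alpha>) j - 2 * real m * grid p \<alpha> j\<bar>"
        by (rule abs_cos_diff_le)
      also have "\<dots> = 2 * real m * (\<bar>\<mu> - 1\<bar> * \<bar>grid p \<alpha> j\<bar>)"
      proof -
        have "2 * real m * grid p (\<mu> * \<alpha>) j - 2 * real m * grid p \<alpha> j = 2 * real m * ((\<mu> - 1) * grid p \<alpha> j)"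
          by (simp add: grid_def algebra_simps)
        then show ?thesis
          by (simp add: abs_mult)
      qed
      also have "\<dots> \<le> 2 * real m * (\<eta> * 2)"
        using g \<mu> \<eta>0 by (intro mult_left_mono mult_mono) auto
      finally show ?thesis
        by simp
    qed
    then have "\<bar>\<Sum>j<p. cos (2 * real m * grid p (\<mu> * \<alpha>) j) - cos (2 * real m * grid p \<alpha> j)\<bar>
        \<le> (\<Sum>j<p. 4 * real m * \<eta>)"
      by (intro order_trans[OF sum_abs] sum_mono) auto
    then have "\<bar>grid_kernel p (\<mu> * \<alpha>) m - grid_kernel p \<alpha> m\<bar> \<le> 4 * real m * \<eta>"
      using p by (simp add: grid_kernel_def diff_divide_distrib[symmetric] sum_subtractf[symmetric] field_simps)
    moreover have "\<bar>(1 - 1/\<mu>) * (-1)^m\<bar> \<le> 2 * \<eta>"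
    proof -
      have "\<bar>1 - 1/\<mu>\<bar> = \<bar>\<mu> - 1\<bar> / \<mu>"
        using \<mu>b by (simp add: field_simps abs_divide[symmetric])
      also have "\<dots> \<le> \<eta> / (1/2)"
        using \<mu> \<mu>b \<eta>0 by (intro frac_le) auto
      finally show ?thesis
        by (simp add: abs_mult power_abs)
    qed
    moreover have "2 * \<eta> \<le> 2 * real m * \<eta>"
      using m \<eta>0 by (simp add: mult_right_mono)
    ultimately show ?thesis
      using True unfolding \<alpha>_def by simp
  next
    case False
    then have pm: "4 * real m \<le> real p"
      by simp
    \<comment> \<open>The kernel is \<open>sin (p * \<theta>) / (p * sin \<theta>)\<close>, and
      \<open>y\<close> is the distance of \<open>p * \<theta>\<close> from
      \<open>m * pi\<close>.\<close>
    define \<theta> where "\<theta> = real m * \<mu> * pi / real p"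
    define y where "y = real m * pi * (\<mu> - 1)"
    have \<theta>0: "\<theta> > 0"
      using m p \<mu>b by (simp add: \<theta>_def)
    have "\<theta> = (real m / real p) * (\<mu> * pi)"
      by (simp add: \<theta>_def)
    also have "\<dots> \<le> 1/4 * (3/2 * 3.2)"
      using pm p \<mu>b pi_less_4 pi_approx by (intro mult_mono) (auto simp: field_simps)
    finally have \<theta>1: "\<theta> \<le> 1.2"
      by simp
    have "\<theta> ^ 3 / 6 \<le> \<theta> / 2"
    proof -
      have "\<theta> * \<theta> \<le> 1.2 * 1.2"
        using \<theta>0 \<theta>1 by (intro mult_mono) auto
      then have "\<theta> * (\<theta> * \<theta>) \<le> \<theta> * 3"
        using \<theta>0 by (intro mult_left_mono) auto
      then show ?thesis
        by (simp add: eval_nat_numeral)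
    qed
    moreover have "\<bar>sin \<theta> - \<theta>\<bar> \<le> \<theta> ^ 3 / 6"
      using abs_sin_diff_le_cube[of \<theta>] \<theta>0 by simp
    ultimately have sin\<theta>: "sin \<theta> \<ge> \<theta> / 2"
      by linarith
    have nd: "\<not> p dvd m"
      using False m by (auto dest: dvd_imp_le)
    have K1: "grid_kernel p \<alpha> m = 0"
      unfolding \<alpha>_def by (rule grid_kernel_not_dvd[OF p nd])
    have yb: "\<bar>y\<bar> \<le> real m * pi * \<eta>"
      using \<mu> m by (simp add: y_def abs_mult mult_left_mono)
    have p\<theta>: "real p * \<theta> = real m * pi * \<mu>"
      using p by (simp add: \<theta>_def)
    have "sin (real p * \<theta>) = sin (real m * pi + y)"
      unfolding p\<theta> by (simp add: y_def algebra_simps)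
    also have "\<dots> = (-1)^m * sin y"
      by (simp add: sin_add)
    finally have "sin \<theta> * (real p * grid_kernel p (\<mu> * \<alpha>) m) = (-1)^m * sin y"
      using sin_mult_grid_kernel[of m "\<mu> * \<alpha>" p] p by (simp add: \<theta>_def \<alpha>_def mult_ac)
    then have K: "grid_kernel p (\<mu> * \<alpha>) m = (-1)^m * (sin y / (real p * sin \<theta>))"
      using sin\<theta> \<theta>0 p by (simp add: field_simps)
    have c: "1 - 1/\<mu> = y / (real p * \<theta>)"
      unfolding p\<theta> y_def using m \<mu>b by (simp add: field_simps)
    \<comment> \<open>Two replacements: \<open>sin \<theta>\<close> by \<open>\<theta>\<close> in
      the denominator costs the first term, \<open>sin y\<close> by \<open>y\<close> in the
      numerator costs the second.\<close>
    have "grid_kernel p (\<mu> * \<alpha>) m - grid_kernel p \<alpha> m - (1 - 1/\<mu>) * (-1)^m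
        = (-1)^m * (sin y * ((\<theta> - sin \<theta>) / (real p * \<theta> * sin \<theta>)) + (sin y - y) / (real p * \<theta>))"
      unfolding K K1 c using sin\<theta> \<theta>0 p by (simp add: field_simps)
    then have "\<bar>grid_kernel p (\<mu> * \<alpha>) m - grid_kernel p \<alpha> m - (1 - 1/\<mu>) * (-1)^m\<bar>
        = \<bar>sin y * ((\<theta> - sin \<theta>) / (real p * \<theta> * sin \<theta>)) + (sin y - y) / (real p * \<theta>)\<bar>"
      by (simp add: abs_mult power_abs)
    also have "\<dots> \<le> \<bar>sin y * ((\<theta> - sin \<theta>) / (real p * \<theta> * sin \<theta>))\<bar> + \<bar>(sin y - y) / (real p * \<theta>)\<bar>"
      by (rule abs_triangle_ineq)
    also have "\<dots> \<le> 5 * (real m)\<^sup>2 / (real p)\<^sup>2 * \<eta> + 8 * real m * \<eta> * \<eta>"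
    proof (rule add_mono)
      have "\<bar>(\<theta> - sin \<theta>) / (real p * \<theta> * sin \<theta>)\<bar> = \<bar>sin \<theta> - \<theta>\<bar> / (real p * \<theta> * sin \<theta>)"
        using sin\<theta> \<theta>0 by (simp add: abs_mult abs_minus_commute)
      also have "\<dots> \<le> (\<theta>^3 / 6) / (real p * \<theta> * (\<theta> / 2))"
        using abs_sin_diff_le_cube[of \<theta>] sin\<theta> \<theta>0 p by (intro frac_le mult_left_mono) auto
      also have "\<dots> = \<theta> / (3 * real p)"
        using \<theta>0 p by (simp add: field_simps eval_nat_numeral)
      finally have 1: "\<bar>(\<theta> - sin \<theta>) / (real p * \<theta> * sin \<theta>)\<bar> \<le> \<theta> / (3 * real p)" .
      have "\<bar>sin y\<bar> \<le> real m * pi * \<eta>"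
        using abs_sin_x_le_abs_x[of y] yb by linarith
      then have "\<bar>sin y * ((\<theta> - sin \<theta>) / (real p * \<theta> * sin \<theta>))\<bar> \<le> (real m * pi * \<eta>) * (\<theta> / (3 * real p))"
        unfolding abs_mult using 1 by (intro mult_mono) auto
      also have "\<dots> = (real m)\<^sup>2 / (real p)\<^sup>2 * \<eta> * (pi\<^sup>2 * \<mu> / 3)"
        by (simp add: \<theta>_def power2_eq_square mult_ac)
      also have "\<dots> \<le> (real m)\<^sup>2 / (real p)\<^sup>2 * \<eta> * 5"
      proof (rule mult_left_mono)
        have "pi * pi \<le> 3.15 * 3.15"
          using pi_approx by (intro mult_mono) auto
        then have "pi\<^sup>2 * \<mu> \<le> 10 * (3/2)"
          using \<mu>b by (intro mult_mono) (auto simp: power2_eq_square)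
        then show "pi\<^sup>2 * \<mu> / 3 \<le> 5"
          by simp
      qed (use \<eta>0 in auto)
      finally show "\<bar>sin y * ((\<theta> - sin \<theta>) / (real p * \<theta> * sin \<theta>))\<bar> \<le> 5 * (real m)\<^sup>2 / (real p)\<^sup>2 * \<eta>"
        by (simp add: mult_ac)
      have "\<bar>(sin y - y) / (real p * \<theta>)\<bar> = \<bar>sin y - y\<bar> / (real m * pi * \<mu>)"
        unfolding p\<theta> using \<mu>b by (simp add: abs_mult)
      also have "\<dots> \<le> (real m * pi * \<eta>)\<^sup>2 / (real m * pi * (1/2))"
      proof (rule frac_le)
        have "\<bar>y\<bar>\<^sup>2 \<le> (real m * pi * \<eta>)\<^sup>2"
          using yb by (intro power_mono) auto
        then show "\<bar>sin y - y\<bar> \<le> (real m * pi * \<eta>)\<^sup>2"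
          using abs_sin_diff_le_square[of y] by simp
        show "real m * pi * (1 / 2) \<le> real m * pi * \<mu>"
          using \<mu>b by (intro mult_left_mono) auto
      qed (use m in auto)
      also have "\<dots> = 2 * pi * (real m * \<eta> * \<eta>)"
        using m by (simp add: power2_eq_square field_simps)
      also have "\<dots> \<le> 8 * (real m * \<eta> * \<eta>)"
        using pi_less_4 \<eta>0 by (intro mult_right_mono) auto
      finally show "\<bar>(sin y - y) / (real p * \<theta>)\<bar> \<le> 8 * real m * \<eta> * \<eta>"
        by simp
    qed
    finally show ?thesis
      using False unfolding \<alpha>_def by (simp add: distrib_right)
  qed
qed

text \<open>The change of the kernel after removal of its leading term. At \<open>m = 0\<close> the
  kernel does not change at all and the leading term is accounted for separately, hence the value
  0.\<close>

definition grid_defect :: "nat \<Rightarrow> real \<Rightarrow> nat \<Rightarrow> real" where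
  "grid_defect p \<mu> m = (if m = 0 then 0 else
     \<bar>grid_kernel p (\<mu> * (pi / (2 * real p))) m - grid_kernel p (pi / (2 * real p)) m - (1 - 1/\<mu>) * (-1)^m\<bar>)"

lemma grid_defect_nonneg: "grid_defect p \<mu> m \<ge> 0"
  by (simp add: grid_defect_def)

lemma abs_grid_kernel_le_1: "\<bar>grid_kernel p \<alpha> m\<bar> \<le> 1"
proof (cases "p = 0")
  case False
  have "\<bar>\<Sum>j<p. cos (2 * real m * grid p \<alpha> j)\<bar> \<le> (\<Sum>j<p. 1)"
    by (intro order_trans[OF sum_abs] sum_mono) auto
  then show ?thesis
    using False by (simp add: grid_kernel_def)
qed (simp add: grid_kernel_def)

lemma grid_defect_le: "grid_defect p \<mu> m \<le> 2 + \<bar>1 - 1/\<mu>\<bar>"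
proof -
  have "\<bar>(1 - 1/\<mu>) * (-1)^m\<bar> = \<bar>1 - 1/\<mu>\<bar>"
    by (simp add: abs_mult power_abs)
  then show ?thesis
    using abs_grid_kernel_le_1[of p "\<mu> * (pi / (2 * real p))" m]
      abs_grid_kernel_le_1[of p "pi / (2 * real p)" m]
    unfolding grid_defect_def by (auto split: if_splits)
qed

text \<open>With \<open>\<eta> = \<kappa> / p^2\<close> the weight cancels: each of the fewer than
  \<open>4 * m\<close> small \<open>p\<close> contributes \<open>6 * m * \<kappa>\<close>, and the
  others are dominated by a series in \<open>1 / p^2\<close>. Together this is
  \<open>24 + 9 * 5/3 = 39\<close>, rounded up to 40. The growth in \<open>m\<close> is just that of
  the weights in the norm of \<open>b\<close>.\<close>

lemma sum_grid_defect_le: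
  assumes \<kappa>: "0 \<le> \<kappa>" "\<kappa> \<le> 1/2" and \<mu>: "\<And>p. p \<ge> 1 \<Longrightarrow> \<bar>\<mu> p - 1\<bar> \<le> \<kappa> / real p ^ 2"
  shows "(\<Sum>p=1..N. real p ^ 2 * grid_defect p (\<mu> p) m) \<le> 40 * \<kappa> * real m ^ 2"
proof (cases "m = 0")
  case False
  then have m: "m \<ge> 1"
    by simp
  define D where "D = 5 * real m ^ 2 * \<kappa> + 4 * real m * \<kappa>"
  have D0: "D \<ge> 0"
    using \<kappa> by (simp add: D_def)
  have summand: "real p ^ 2 * grid_defect p (\<mu> p) m \<le> (if p < 4 * m then 6 * real m * \<kappa> else 0) + D * (1 / real p ^ 2)"
    if p: "p \<ge> 1" for p
  proof -
    have p2: "real p ^ 2 \<ge> 1"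
      using p by simp
    define \<eta> where "\<eta> = \<kappa> / real p ^ 2"
    have "\<eta> \<le> \<kappa> / 1"
      unfolding \<eta>_def using \<kappa> p2 p by (intro divide_left_mono) auto
    then have \<eta>: "\<eta> \<le> 1/2"
      using \<kappa> by simp
    have p\<eta>: "real p ^ 2 * \<eta> = \<kappa>"
      using p by (simp add: \<eta>_def)
    have bd: "grid_defect p (\<mu> p) m \<le> (if p < 4 * m then 6 * real m * \<eta> else (5 * (real m)\<^sup>2 / (real p)\<^sup>2 + 8 * real m * \<eta>) * \<eta>)"
      using grid_kernel_perturbation[OF p m \<mu>[OF p, folded \<eta>_def] \<eta>] m by (simp add: grid_defect_def)
    show ?thesis
    proof (cases "p < 4 * m")
      case True
      have "real p ^ 2 * grid_defect p (\<mu> p) m \<le> real p ^ 2 * (6 * real m * \<eta>)"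
        using bd True by (intro mult_left_mono) auto
      also have "\<dots> = 6 * real m * (real p ^ 2 * \<eta>)"
        by simp
      finally show ?thesis
        using True D0 p2 unfolding p\<eta> by (simp add: add_increasing2)
    next
      case False
      have "real p ^ 2 * grid_defect p (\<mu> p) m \<le> real p ^ 2 * ((5 * (real m)\<^sup>2 / (real p)\<^sup>2 + 8 * real m * \<eta>) * \<eta>)"
        using bd False by (intro mult_left_mono) auto
      also have "\<dots> = (5 * (real m)\<^sup>2 / (real p)\<^sup>2 + 8 * real m * \<eta>) * (real p ^ 2 * \<eta>)"
        by simp
      also have "\<dots> = (5 * (real m)\<^sup>2 * \<kappa> + 8 * real m * \<kappa> * \<kappa>) * (1 / real p ^ 2)"
        unfolding p\<eta> by (simp add: \<eta>_def algebra_simps add_divide_distrib)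
      also have "\<dots> \<le> D * (1 / real p ^ 2)"
        using mult_left_mono[of "2 * \<kappa>" 1 "4 * real m * \<kappa>"] \<kappa> unfolding D_def
        by (intro mult_right_mono) (auto simp: mult_ac)
      finally show ?thesis
        using False by simp
    qed
  qed
  have "(\<Sum>p=1..N. real p ^ 2 * grid_defect p (\<mu> p) m)
      \<le> (\<Sum>p=1..N. (if p < 4 * m then 6 * real m * \<kappa> else 0) + D * (1 / real p ^ 2))"
    by (intro sum_mono summand) auto
  also have "\<dots> = (\<Sum>p=1..N. (if p < 4 * m then 6 * real m * \<kappa> else 0)) + D * (\<Sum>p=1..N. 1 / real p ^ 2)"
    by (simp add: sum.distrib sum_distrib_left)
  also have "\<dots> \<le> 24 * real m ^ 2 * \<kappa> + D * (5/3)"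
  proof (rule add_mono)
    have "(\<Sum>p=1..N. (if p < 4 * m then 6 * real m * \<kappa> else 0)) = (\<Sum>p\<in>{1..N} \<inter> {p. p < 4 * m}. 6 * real m * \<kappa>)"
      by (simp add: sum.If_cases)
    also have "\<dots> = real (card ({1..N} \<inter> {p. p < 4 * m})) * (6 * real m * \<kappa>)"
      by simp
    also have "\<dots> \<le> real (4 * m) * (6 * real m * \<kappa>)"
    proof (intro mult_right_mono)
      have "card ({1..N} \<inter> {p. p < 4 * m}) \<le> card {..<4 * m}"
        by (intro card_mono) auto
      then show "real (card ({1..N} \<inter> {p. p < 4 * m})) \<le> real (4 * m)"
        by simp
    qed (use \<kappa> in auto)
    finally show "(\<Sum>p=1..N. (if p < 4 * m then 6 * real m * \<kappa> else 0)) \<le> 24 * real m ^ 2 * \<kappa>"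
      by (simp add: power2_eq_square)
    have "(\<Sum>p=1..N. 1 / real p ^ 2) \<le> 5/3"
      using sum_inverse_squares_le(1)[of N] by (simp add: sum.atLeast1_atMost_eq add.commute)
    then show "D * (\<Sum>p=1..N. 1 / real p ^ 2) \<le> D * (5/3)"
      using D0 by (rule mult_left_mono)
  qed
  also have "D \<le> 9 * real m ^ 2 * \<kappa>"
  proof -
    have "real m * \<kappa> \<le> (real m * real m) * \<kappa>"
      using m \<kappa> by (intro mult_right_mono) auto
    then show ?thesis
      by (simp add: D_def power2_eq_square algebra_simps)
  qed
  finally have "(\<Sum>p=1..N. real p ^ 2 * grid_defect p (\<mu> p) m) \<le> 39 * (\<kappa> * real m ^ 2)"
    by (simp add: algebra_simps)
  moreover have "0 \<le> \<kappa> * real m ^ 2"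
    using \<kappa> by simp
  ultimately show ?thesis
    by linarith
qed (simp add: grid_defect_def)

lemma grid_sum_cosine_series:
  fixes b :: "nat \<Rightarrow> real"
  assumes s0: "summable (\<lambda>m. \<bar>b m\<bar>)"
  shows "summable (\<lambda>m. b m * grid_kernel p \<alpha> m)"
    and "p \<ge> 1 \<Longrightarrow> (\<Sum>j<p. \<Sum>m. b m * cos (2 * real m * grid p \<alpha> j)) = real p * (\<Sum>m. b m * grid_kernel p \<alpha> m)"
proof -
  show s: "summable (\<lambda>m. b m * grid_kernel p \<alpha> m)"
    using abs_grid_kernel_le_1
    by (intro summable_comparison_test'[OF s0, of 0]) (simp add: abs_mult mult_left_le)
  have sc: "summable (\<lambda>m. b m * cos (2 * real m * x))" for x
    by (intro summable_comparison_test'[OF s0, of 0]) (simp add: abs_mult mult_left_le)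
  assume p: "p \<ge> 1"
  have "(\<Sum>j<p. \<Sum>m. b m * cos (2 * real m * grid p \<alpha> j)) = (\<Sum>m. \<Sum>j<p. b m * cos (2 * real m * grid p \<alpha> j))"
    by (intro suminf_sum[symmetric] sc)
  also have "\<dots> = (\<Sum>m. real p * (b m * grid_kernel p \<alpha> m))"
    using p by (simp add: grid_kernel_def sum_distrib_left[symmetric])
  also have "\<dots> = real p * (\<Sum>m. b m * grid_kernel p \<alpha> m)"
    by (intro suminf_mult s)
  finally show "(\<Sum>j<p. \<Sum>m. b m * cos (2 * real m * grid p \<alpha> j)) = real p * (\<Sum>m. b m * grid_kernel p \<alpha> m)" .
qed

text \<open>On the exact grid, \<open>G\<close> is a sum of \<open>b\<close> over the positive
  multiples of \<open>p\<close> with signs. Bounding all of it gives the first estimate; isolating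
  the multiple \<open>p\<close> itself gives the second.\<close>

lemma aliasing_bounds:
  fixes b :: "nat \<Rightarrow> real"
  assumes s0: "summable (\<lambda>m. \<bar>b m\<bar>)" and p: "p \<ge> 1"
  defines "G \<equiv> (\<Sum>m. b m * grid_kernel p (pi / (2 * real p)) m) - b 0"
  shows "\<bar>G\<bar> \<le> (\<Sum>k. \<bar>b ((k + 1) * p)\<bar>)" "\<bar>b p\<bar> \<le> \<bar>G\<bar> + (\<Sum>k. \<bar>b ((k + 2) * p)\<bar>)"
proof -
  let ?K = "grid_kernel p (pi / (2 * real p))"
  have sj: "summable (\<lambda>k. \<bar>b ((k + j) * p)\<bar>)" for j
  proof -
    have "inj (\<lambda>k. (k + j) * p)"
      using p by (auto simp: inj_on_def)
    then show ?thesis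
      using summable_reindex[OF s0, of "\<lambda>k. (k + j) * p"] by (simp add: o_def)
  qed
  have ab: "\<bar>b ((k + j) * p) * ?K ((k + j) * p)\<bar> = \<bar>b ((k + j) * p)\<bar>" for k j
    unfolding abs_mult grid_kernel_dvd[OF p] by simp
  have "(\<lambda>m. b m * ?K m) sums (G + b 0)"
    unfolding G_def using grid_sum_cosine_series(1)[OF s0] by (simp add: summable_sums)
  moreover have "strict_mono (\<lambda>k. k * p)"
    using p by (auto simp: strict_mono_def)
  moreover have "b m * ?K m = 0" if "m \<notin> range (\<lambda>k. k * p)" for m
  proof -
    have "\<not> p dvd m"
      using that by (auto simp: dvd_def mult.commute)
    then show ?thesis
      using grid_kernel_not_dvd[OF p] by simp
  qed
  ultimately have "(\<lambda>k. b (k * p) * ?K (k * p)) sums (G + b 0)"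
    by (subst sums_mono_reindex[of "\<lambda>k. k * p" "\<lambda>m. b m * ?K m"]) auto
  then have 1: "(\<lambda>k. b ((k + 1) * p) * ?K ((k + 1) * p)) sums G"
    using sums_Suc_iff[of "\<lambda>k. b (k * p) * ?K (k * p)" G] p by simp
  have 2: "(\<lambda>k. b ((k + 2) * p) * ?K ((k + 2) * p)) sums (G - b p * ?K p)"
  proof -
    have "(\<lambda>k. b ((k + 1) * p) * ?K ((k + 1) * p)) sums ((G - b p * ?K p) + b ((0 + 1) * p) * ?K ((0 + 1) * p))"
      using 1 by simp
    then have "(\<lambda>k. b ((Suc k + 1) * p) * ?K ((Suc k + 1) * p)) sums (G - b p * ?K p)"
      by (subst sums_Suc_iff)
    then show ?thesis
      by (simp add: numeral_2_eq_2)
  qed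
  have le: "\<bar>S\<bar> \<le> (\<Sum>k. \<bar>b ((k + j) * p)\<bar>)"
    if "(\<lambda>k. b ((k + j) * p) * ?K ((k + j) * p)) sums S" for S j
  proof -
    have "norm (\<Sum>k. b ((k + j) * p) * ?K ((k + j) * p)) \<le> (\<Sum>k. \<bar>b ((k + j) * p)\<bar>)"
      by (rule norm_suminf_le[OF _ sj]) (simp only: real_norm_def ab order_refl)
    then show ?thesis
      using sums_unique[OF that] by simp
  qed
  show "\<bar>G\<bar> \<le> (\<Sum>k. \<bar>b ((k + 1) * p)\<bar>)"
    by (rule le[OF 1])
  have "\<bar>b p * ?K p\<bar> = \<bar>b p\<bar>"
    using ab[of 0 1] by simp
  moreover have "\<bar>G - b p * ?K p\<bar> \<le> (\<Sum>k. \<bar>b ((k + 2) * p)\<bar>)"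
    by (rule le[OF 2])
  ultimately show "\<bar>b p\<bar> \<le> \<bar>G\<bar> + (\<Sum>k. \<bar>b ((k + 2) * p)\<bar>)"
    by linarith
qed

text \<open>\<open>alt\<close> expresses that the cosine series vanishes at \<open>pi/2\<close>. It
  allows the leading term to be subtracted for all \<open>m\<close> at once; as
  \<open>grid_defect\<close> leaves out \<open>m = 0\<close>, the share of \<open>b 0\<close>
  appears on the left.\<close>

lemma grid_defect_suminf_bound:
  fixes b :: "nat \<Rightarrow> real"
  assumes s0: "summable (\<lambda>m. \<bar>b m\<bar>)" and p: "p \<ge> 1" and alt: "(\<lambda>m. b m * (-1)^m) sums 0"
  shows "summable (\<lambda>m. \<bar>b m\<bar> * grid_defect p \<mu> m)"
    and "\<bar>(\<Sum>m. b m * grid_kernel p (\<mu> * (pi / (2 * real p))) m) - (\<Sum>m. b m * grid_kernel p (pi / (2 * real p)) m)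
            + (1 - 1/\<mu>) * b 0\<bar> \<le> (\<Sum>m. \<bar>b m\<bar> * grid_defect p \<mu> m)"
proof -
  let ?K = "grid_kernel p (pi / (2 * real p))" and ?L = "grid_kernel p (\<mu> * (pi / (2 * real p)))"
  define c where "c = 1 - 1/\<mu>"
  show sd: "summable (\<lambda>m. \<bar>b m\<bar> * grid_defect p \<mu> m)"
  proof (rule summable_comparison_test'[of "\<lambda>m. \<bar>b m\<bar> * (2 + \<bar>1 - 1/\<mu>\<bar>)" 0])
    show "summable (\<lambda>m. \<bar>b m\<bar> * (2 + \<bar>1 - 1/\<mu>\<bar>))"
      by (intro summable_mult2 s0)
    show "norm (\<bar>b m\<bar> * grid_defect p \<mu> m) \<le> \<bar>b m\<bar> * (2 + \<bar>1 - 1/\<mu>\<bar>)" for m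
      using grid_defect_le[of p \<mu> m] grid_defect_nonneg[of p \<mu> m] by (simp add: abs_mult mult_left_mono)
  qed
  have "(\<lambda>m. b m * ?L m - b m * ?K m - c * (b m * (-1)^m)) sums
      ((\<Sum>m. b m * ?L m) - (\<Sum>m. b m * ?K m) - c * 0)"
    by (intro sums_diff sums_mult alt summable_sums grid_sum_cosine_series(1) s0)
  then have "(\<lambda>m. b m * (?L m - ?K m - c * (-1)^m)) sums ((\<Sum>m. b m * ?L m) - (\<Sum>m. b m * ?K m))"
    by (simp add: algebra_simps)
  from sums_diff[OF this sums_single[of 0 "\<lambda>m. b m * (?L m - ?K m - c * (-1)^m)"]]
  have "(\<lambda>m. b m * (?L m - ?K m - c * (-1)^m) - (if m = 0 then b m * (?L m - ?K m - c * (-1)^m) else 0)) sums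
      ((\<Sum>m. b m * ?L m) - (\<Sum>m. b m * ?K m) + c * b 0)"
    using p by (simp add: mult.commute)
  moreover have "(\<lambda>m. b m * (?L m - ?K m - c * (-1)^m) - (if m = 0 then b m * (?L m - ?K m - c * (-1)^m) else 0))
      = (\<lambda>m. if m = 0 then 0 else b m * (?L m - ?K m - c * (-1)^m))"
    by auto
  ultimately have *: "(\<lambda>m. if m = 0 then 0 else b m * (?L m - ?K m - c * (-1)^m)) sums
      ((\<Sum>m. b m * ?L m) - (\<Sum>m. b m * ?K m) + c * b 0)"
    by (simp only:)
  have "norm (\<Sum>m. if m = 0 then 0 else b m * (?L m - ?K m - c * (-1)^m)) \<le> (\<Sum>m. \<bar>b m\<bar> * grid_defect p \<mu> m)"
    by (rule norm_suminf_le[OF _ sd]) (simp add: grid_defect_def abs_mult c_def)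
  then show "\<bar>(\<Sum>m. b m * ?L m) - (\<Sum>m. b m * ?K m) + (1 - 1/\<mu>) * b 0\<bar> \<le> (\<Sum>m. \<bar>b m\<bar> * grid_defect p \<mu> m)"
    using sums_unique[OF *] by (simp add: c_def)
qed

lemma sum_grid_defect_suminf_le:
  fixes b :: "nat \<Rightarrow> real"
  assumes s2: "summable (\<lambda>m. real m ^ 2 * \<bar>b m\<bar>)" and s0: "summable (\<lambda>m. \<bar>b m\<bar>)"
    and alt: "(\<lambda>m. b m * (-1)^m) sums 0"
    and \<kappa>: "0 \<le> \<kappa>" "\<kappa> \<le> 1/2" and \<mu>: "\<And>p. p \<ge> 1 \<Longrightarrow> \<bar>\<mu> p - 1\<bar> \<le> \<kappa> / real p ^ 2"
  shows "(\<Sum>p=1..N. real p ^ 2 * (\<Sum>m. \<bar>b m\<bar> * grid_defect p (\<mu> p) m)) \<le> 40 * \<kappa> * (\<Sum>m. real m ^ 2 * \<bar>b m\<bar>)"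
proof -
  have sd: "summable (\<lambda>m. \<bar>b m\<bar> * grid_defect p (\<mu> p) m)" if "p \<in> {1..N}" for p
    using that by (intro grid_defect_suminf_bound(1) s0 alt) auto
  have sd': "summable (\<lambda>m. real p ^ 2 * (\<bar>b m\<bar> * grid_defect p (\<mu> p) m))" if "p \<in> {1..N}" for p
    by (intro summable_mult sd that)
  have "(\<Sum>p=1..N. real p ^ 2 * (\<Sum>m. \<bar>b m\<bar> * grid_defect p (\<mu> p) m))
      = (\<Sum>p=1..N. \<Sum>m. real p ^ 2 * (\<bar>b m\<bar> * grid_defect p (\<mu> p) m))"
    by (intro sum.cong refl suminf_mult[symmetric] sd)
  also have "\<dots> = (\<Sum>m. \<Sum>p=1..N. real p ^ 2 * (\<bar>b m\<bar> * grid_defect p (\<mu> p) m))"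
    by (intro suminf_sum[symmetric] sd')
  also have "\<dots> \<le> (\<Sum>m. 40 * \<kappa> * (real m ^ 2 * \<bar>b m\<bar>))"
  proof (rule suminf_le)
    show "summable (\<lambda>m. \<Sum>p=1..N. real p ^ 2 * (\<bar>b m\<bar> * grid_defect p (\<mu> p) m))"
      by (intro summable_sum sd')
    show "summable (\<lambda>m. 40 * \<kappa> * (real m ^ 2 * \<bar>b m\<bar>))"
      by (intro summable_mult s2)
    fix m
    have "(\<Sum>p=1..N. real p ^ 2 * (\<bar>b m\<bar> * grid_defect p (\<mu> p) m)) = \<bar>b m\<bar> * (\<Sum>p=1..N. real p ^ 2 * grid_defect p (\<mu> p) m)"
      by (simp add: sum_distrib_left mult_ac)
    also have "\<dots> \<le> \<bar>b m\<bar> * (40 * \<kappa> * real m ^ 2)"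
      by (intro mult_left_mono sum_grid_defect_le \<kappa> \<mu>) auto
    finally show "(\<Sum>p=1..N. real p ^ 2 * (\<bar>b m\<bar> * grid_defect p (\<mu> p) m)) \<le> 40 * \<kappa> * (real m ^ 2 * \<bar>b m\<bar>)"
      by (simp add: mult_ac)
  qed
  also have "\<dots> = 40 * \<kappa> * (\<Sum>m. real m ^ 2 * \<bar>b m\<bar>)"
    by (intro suminf_mult s2)
  finally show ?thesis .
qed

text \<open>\<open>\<beta>\<close> is about a quarter of \<open>\<alpha>\<close>, so
  \<open>sin x / x\<close> drops between them by the order of \<open>\<alpha>^2\<close>, that is
  \<open>1 / p^2\<close>; this keeps the coefficient of \<open>b 0\<close> away from zero. The
  remaining bounds show that the weights of the two grid means have a quotient below 2.\<close>

lemma sinc_gap: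
  assumes \<mu>: "\<bar>\<mu> - 1\<bar> \<le> 1/1000" "\<bar>\<nu> - 1\<bar> \<le> 1/1000" and p: "p \<ge> (1::nat)"
  defines "\<alpha> \<equiv> \<mu> * (pi / (2 * real p))" and "\<beta> \<equiv> \<nu> * (pi / (2 * real (4 * p)))"
  shows "1 / (5 * real p ^ 2) \<le> sin \<beta> / \<beta> - sin \<alpha> / \<alpha>"
    and "0.92 \<le> real p * sin \<alpha>" and "real p * sin \<alpha> \<le> 1.573" and "real (4 * p) * sin \<beta> \<le> 1.573" "0 \<le> sin \<beta>"
proof -
  have p1: "real p \<ge> 1"
    using p by simp
  have pib: "3.1415 \<le> pi" "pi \<le> 3.1416"
    using pi_approx by auto
  have pa: "real p * \<alpha> = \<mu> * pi / 2" and qb: "real (4 * p) * \<beta> = \<nu> * pi / 2"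
    using p by (simp_all add: \<alpha>_def \<beta>_def)
  have m: "0.999 \<le> \<mu>" "\<mu> \<le> 1.001" "0.999 \<le> \<nu>" "\<nu> \<le> 1.001"
    using \<mu> by (simp_all, linarith+)
  have ub: "\<mu> * pi \<le> 1.001 * 3.1416" "\<nu> * pi \<le> 1.001 * 3.1416"
    by (rule mult_mono[OF m(2) pib(2)] mult_mono[OF m(4) pib(2)]; simp)+
  have lb: "0.999 * 3.1415 \<le> \<mu> * pi"
    by (rule mult_mono[OF m(1) pib(1)]) (use m in simp_all)
  have pab: "1.569 \<le> real p * \<alpha>" "real p * \<alpha> \<le> 1.573" "real (4 * p) * \<beta> \<le> 1.573"
    unfolding pa qb using ub lb by (simp_all add: mult.commute)
  have \<alpha>0: "\<alpha> > 0" and \<beta>0: "\<beta> > 0"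
    using m p by (auto simp: \<alpha>_def \<beta>_def)
  have \<alpha>1: "\<alpha> \<le> 1.573"
    using pab(2) mult_right_mono[OF p1, of \<alpha>] \<alpha>0 by linarith
  have \<alpha>sq: "\<alpha> * \<alpha> \<le> 1.573 * 1.573"
    using \<alpha>0 \<alpha>1 by (intro mult_mono) auto
  have \<beta>\<alpha>: "\<beta> \<le> \<alpha> / 3"
  proof -
    have "\<nu> / 4 * (pi / (2 * real p)) \<le> \<mu> / 3 * (pi / (2 * real p))"
      using m by (intro mult_right_mono) auto
    then show ?thesis
      by (simp add: \<alpha>_def \<beta>_def)
  qed
  have "\<bar>sin \<beta> - \<beta>\<bar> \<le> \<beta> ^ 3 / 6"
    using abs_sin_diff_le_cube[of \<beta>] \<beta>0 by simp
  then have "\<beta> - \<beta> ^ 3 / 6 \<le> sin \<beta>"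
    by linarith
  then have "(\<beta> - \<beta> ^ 3 / 6) / \<beta> \<le> sin \<beta> / \<beta>"
    using \<beta>0 by (intro divide_right_mono) auto
  then have sb: "1 - \<beta> * \<beta> / 6 \<le> sin \<beta> / \<beta>"
    using \<beta>0 by (simp add: diff_divide_distrib eval_nat_numeral)
  have "\<bar>sin \<alpha> - (\<alpha> - \<alpha> ^ 3 / 6)\<bar> \<le> \<alpha> ^ 5 / 120"
  proof -
    have "(\<Sum>m<5. sin_coeff m * \<alpha> ^ m) = \<alpha> - \<alpha> ^ 3 / 6"
      by (simp add: lessThan_nat_numeral sin_coeff_def fact_numeral)
    then show ?thesis
      using Maclaurin_sin_bound[of \<alpha> 5] \<alpha>0 by (simp add: fact_numeral)
  qed
  then have "sin \<alpha> \<le> \<alpha> - \<alpha> ^ 3 / 6 + \<alpha> ^ 5 / 120"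
    by linarith
  then have "sin \<alpha> / \<alpha> \<le> (\<alpha> - \<alpha> ^ 3 / 6 + \<alpha> ^ 5 / 120) / \<alpha>"
    using \<alpha>0 by (intro divide_right_mono) auto
  then have sa: "sin \<alpha> / \<alpha> \<le> 1 - \<alpha> * \<alpha> / 6 + (\<alpha> * \<alpha>) * (\<alpha> * \<alpha>) / 120"
    using \<alpha>0 by (simp add: diff_divide_distrib add_divide_distrib eval_nat_numeral)
  have "\<beta> * \<beta> \<le> (\<alpha> * \<alpha>) / 9"
    using mult_mono[OF \<beta>\<alpha> \<beta>\<alpha>] \<beta>0 \<alpha>0 by simp
  moreover have "(\<alpha> * \<alpha>) * (\<alpha> * \<alpha>) \<le> 5/2 * (\<alpha> * \<alpha>)"
    using \<alpha>sq by (intro mult_right_mono) auto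
  ultimately have "\<alpha> * \<alpha> / 10 \<le> sin \<beta> / \<beta> - sin \<alpha> / \<alpha>"
    using sa sb mult_pos_pos[OF \<alpha>0 \<alpha>0]
    by (simp only: diff_conv_add_uminus)
  moreover have "1 / (5 * real p ^ 2) \<le> \<alpha> * \<alpha> / 10"
  proof -
    have "1.569 * 1.569 \<le> (real p * \<alpha>) * (real p * \<alpha>)"
      using pab by (intro mult_mono) auto
    then have "2 \<le> real p ^ 2 * (\<alpha> * \<alpha>)"
      by (simp add: power2_eq_square mult_ac)
    then show ?thesis
      using p by (simp add: field_simps)
  qed
  ultimately show "1 / (5 * real p ^ 2) \<le> sin \<beta> / \<beta> - sin \<alpha> / \<alpha>"
    by linarith
  have "\<bar>sin \<alpha> - \<alpha>\<bar> \<le> \<alpha> ^ 3 / 6"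
    using abs_sin_diff_le_cube[of \<alpha>] \<alpha>0 by simp
  then have "\<bar>sin \<alpha> - \<alpha>\<bar> \<le> \<alpha> * (\<alpha> * \<alpha>) / 6"
    by (simp add: power3_eq_cube mult.assoc)
  then have "\<alpha> - \<alpha> * (\<alpha> * \<alpha>) / 6 \<le> sin \<alpha>"
    by linarith
  moreover have "\<alpha> * (\<alpha> * \<alpha>) \<le> \<alpha> * (99/40)"
    using \<alpha>sq \<alpha>0 by (intro mult_left_mono) auto
  ultimately have "\<alpha> * (587/1000) \<le> sin \<alpha>"
    using \<alpha>0 by linarith
  then have "real p * (\<alpha> * (587/1000)) \<le> real p * sin \<alpha>"
    by (intro mult_left_mono) auto
  then show "0.92 \<le> real p * sin \<alpha>"
    using pab(1) by simp
  have "real p * sin \<alpha> \<le> real p * \<alpha>"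
    using \<alpha>0 sin_x_le_x[of \<alpha>] by (intro mult_left_mono) auto
  then show "real p * sin \<alpha> \<le> 1.573"
    using pab by linarith
  have "real (4 * p) * sin \<beta> \<le> real (4 * p) * \<beta>"
    using \<beta>0 sin_x_le_x[of \<beta>] by (intro mult_left_mono) auto
  then show "real (4 * p) * sin \<beta> \<le> 1.573"
    using pab by linarith
  show "0 \<le> sin \<beta>"
    using \<beta>0 \<beta>\<alpha> \<alpha>1 pi_gt3 by (intro sin_ge_zero) auto
qed

text \<open>Once \<open>b 0 = 0\<close>, the weighted sum of the bounds for
  \<open>\<bar>b p\<bar>\<close> yields \<open>B \<le> (2/3 + 2 * 5/48 + 40 * \<kappa> + 2 * 640 *
  \<kappa>) * B\<close>, where the factor is below 0.95. With 3 in place of 4 the first two terms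
  would already be \<open>2/3 + 10/27 > 1\<close>.\<close>

theorem cosine_series_rigidity:
  fixes b :: "nat \<Rightarrow> real"
  assumes s2: "summable (\<lambda>m. real m ^ 2 * \<bar>b m\<bar>)" and s0: "summable (\<lambda>m. \<bar>b m\<bar>)"
    and alt: "(\<lambda>m. b m * (-1)^m) sums 0"
    and \<kappa>: "0 \<le> \<kappa>" "\<kappa> \<le> 1/20000"
    and \<mu>: "\<And>p. p \<ge> 1 \<Longrightarrow> \<bar>\<mu> p - 1\<bar> \<le> \<kappa> / real p ^ 2"
    and \<nu>: "\<And>p. p \<ge> 1 \<Longrightarrow> \<bar>\<nu> p - 1\<bar> \<le> \<kappa> / real p ^ 2"
    and eq: "\<And>p. p \<ge> 1 \<Longrightarrow>
      sin (\<mu> p * (pi / (2 * real p))) * (\<Sum>j<p. \<Sum>m. b m * cos (2 * real m * grid p (\<mu> p * (pi / (2 * real p))) j))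
      = sin (\<nu> p * (pi / (2 * real (4 * p))))
        * (\<Sum>j<4 * p. \<Sum>m. b m * cos (2 * real m * grid (4 * p) (\<nu> p * (pi / (2 * real (4 * p)))) j))"
  shows "b m = 0"
proof -
  define B where "B = (\<Sum>m. real m ^ 2 * \<bar>b m\<bar>)"
  have B0: "B \<ge> 0"
    unfolding B_def by (intro suminf_nonneg s2) auto
  define G where "G p = (\<Sum>m. b m * grid_kernel p (pi / (2 * real p)) m) - b 0" for p
  define E where "E p = (\<Sum>m. \<bar>b m\<bar> * grid_defect p (\<mu> p) m)" for p
  define E' where "E' p = (\<Sum>m. \<bar>b m\<bar> * grid_defect (4 * p) (\<nu> p) m)" for p
  define x where "x p = real p * sin (\<mu> p * (pi / (2 * real p)))" for p
  define y where "y p = real (4 * p) * sin (\<nu> p * (pi / (2 * real (4 * p))))" for p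
  have small: "\<bar>\<mu> p - 1\<bar> \<le> 1/1000" "\<bar>\<nu> p - 1\<bar> \<le> 1/1000" if p: "p \<ge> 1" for p
  proof -
    have "\<kappa> / real p ^ 2 \<le> \<kappa> / 1"
      using p \<kappa> by (intro divide_left_mono) auto
    then show "\<bar>\<mu> p - 1\<bar> \<le> 1/1000" "\<bar>\<nu> p - 1\<bar> \<le> 1/1000"
      using \<mu>[OF p] \<nu>[OF p] \<kappa> by linarith+
  qed
  \<comment> \<open>A grid mean is \<open>G p + b 0 / \<mu> p\<close> up to \<open>e\<close>: the
    contribution \<open>b 0\<close> of frequency zero and the leftover
    \<open>-(1 - 1/\<mu> p) * b 0\<close> of the leading error combine.\<close>
  have main: "\<exists>e e'. \<bar>e\<bar> \<le> E p \<and> \<bar>e'\<bar> \<le> E' p \<and>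
      x p * (G p + e) + x p / \<mu> p * b 0 = y p * (G (4 * p) + e') + y p / \<nu> p * b 0" if p: "p \<ge> 1" for p
  proof -
    define M where "M = (\<Sum>m. b m * grid_kernel p (\<mu> p * (pi / (2 * real p))) m)"
    define N where "N = (\<Sum>m. b m * grid_kernel (4 * p) (\<nu> p * (pi / (2 * real (4 * p)))) m)"
    have q: "4 * p \<ge> 1"
      using p by simp
    have "x p * M = y p * N"
      using eq[OF p] unfolding grid_sum_cosine_series(2)[OF s0 p] grid_sum_cosine_series(2)[OF s0 q]
      by (simp add: x_def y_def M_def N_def mult_ac)
    moreover have "\<bar>M - G p - b 0 / \<mu> p\<bar> \<le> E p"
      using grid_defect_suminf_bound(2)[OF s0 p alt, of "\<mu> p"] unfolding M_def G_def E_def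
      by (simp add: algebra_simps)
    moreover have "\<bar>N - G (4 * p) - b 0 / \<nu> p\<bar> \<le> E' p"
      using grid_defect_suminf_bound(2)[OF s0 q alt, of "\<nu> p"] unfolding N_def G_def E'_def
      by (simp add: algebra_simps)
    ultimately show ?thesis
      by (intro exI[of _ "M - G p - b 0 / \<mu> p"] exI[of _ "N - G (4 * p) - b 0 / \<nu> p"])
         (simp add: algebra_simps)
  qed
  have xy: "0.92 \<le> x p" "x p \<le> 1.573" "0 \<le> y p" "y p \<le> 1.573" if p: "p \<ge> 1" for p
    using sinc_gap(2-5)[OF small[OF p] p] unfolding x_def y_def by auto
  have sG: "(\<Sum>p=1..N. real p ^ 2 * \<bar>G p\<bar>) \<le> 5/3 * B" for N
  proof -
    have "(\<Sum>p=1..N. real p ^ 2 * \<bar>G p\<bar>) \<le> (\<Sum>p=1..N. real p ^ 2 * (\<Sum>k. \<bar>b ((k + 1) * (1 * p))\<bar>))"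
      using aliasing_bounds(1)[OF s0] by (intro sum_mono mult_left_mono) (auto simp: G_def)
    also have "\<dots> \<le> B / real 1 ^ 2 * (5/3)"
      unfolding B_def by (rule weighted_multiples_sum_le[OF s2 s0]) (use sum_inverse_squares_le(1) in auto)
    finally show ?thesis
      by simp
  qed
  have sG4: "(\<Sum>p=1..N. real p ^ 2 * \<bar>G (4 * p)\<bar>) \<le> 5/48 * B" for N
  proof -
    have "(\<Sum>p=1..N. real p ^ 2 * \<bar>G (4 * p)\<bar>) \<le> (\<Sum>p=1..N. real p ^ 2 * (\<Sum>k. \<bar>b ((k + 1) * (4 * p))\<bar>))"
      using aliasing_bounds(1)[OF s0, of "4 * _"] by (intro sum_mono mult_left_mono) (auto simp: G_def)
    also have "\<dots> \<le> B / real 4 ^ 2 * (5/3)"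
      unfolding B_def by (rule weighted_multiples_sum_le[OF s2 s0]) (use sum_inverse_squares_le(1) in auto)
    finally show ?thesis
      by simp
  qed
  have sT: "(\<Sum>p=1..N. real p ^ 2 * (\<Sum>k. \<bar>b ((k + 2) * p)\<bar>)) \<le> 2/3 * B" for N
  proof -
    have "(\<Sum>p=1..N. real p ^ 2 * (\<Sum>k. \<bar>b ((k + 2) * (1 * p))\<bar>)) \<le> B / real 1 ^ 2 * (2/3)"
      unfolding B_def by (rule weighted_multiples_sum_le[OF s2 s0]) (use sum_inverse_squares_le(2) in auto)
    then show ?thesis
      by simp
  qed
  have sE: "(\<Sum>p=1..N. real p ^ 2 * E p) \<le> 40 * \<kappa> * B" for N
    unfolding E_def B_def using \<kappa> by (intro sum_grid_defect_suminf_le s2 s0 alt \<mu>) auto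
  have sE': "(\<Sum>p=1..N. real p ^ 2 * E' p) \<le> 640 * \<kappa> * B" for N
  proof -
    \<comment> \<open>The grids of \<open>4 * p\<close> points are completed by exact grids to a
      family with one grid for each \<open>q\<close>. At \<open>q = 4 * p\<close> the tolerance
      \<open>\<kappa> / p^2\<close> reads \<open>16 * \<kappa> / q^2\<close>, hence
      \<open>640 = 40 * 16\<close>.\<close>
    define \<rho> where "\<rho> q = (if 4 dvd q then \<nu> (q div 4) else 1)" for q
    have \<rho>: "\<bar>\<rho> q - 1\<bar> \<le> (16 * \<kappa>) / real q ^ 2" if "q \<ge> 1" for q
    proof (cases "4 dvd q")
      case True
      then obtain k where k: "q = 4 * k"
        by auto
      show ?thesis
        using \<nu>[of k] that by (simp add: \<rho>_def k power_mult_distrib)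
    qed (use \<kappa> in \<open>simp add: \<rho>_def\<close>)
    have nn: "(\<Sum>m. \<bar>b m\<bar> * grid_defect q (\<rho> q) m) \<ge> 0" if "q \<ge> 1" for q
      using that by (intro suminf_nonneg grid_defect_suminf_bound(1)[OF s0 _ alt] mult_nonneg_nonneg grid_defect_nonneg) auto
    have E'nn: "E' p \<ge> 0" if "p \<ge> 1" for p
      using nn[of "4 * p"] that by (simp add: E'_def \<rho>_def)
    have "(\<Sum>p=1..N. real p ^ 2 * E' p) \<le> (\<Sum>p=1..N. real (4 * p) ^ 2 * E' p)"
      using E'nn by (intro sum_mono mult_right_mono power_mono) auto
    also have "\<dots> = (\<Sum>q\<in>(\<lambda>p. 4 * p) ` {1..N}. real q ^ 2 * (\<Sum>m. \<bar>b m\<bar> * grid_defect q (\<rho> q) m))"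
      by (subst sum.reindex) (auto simp: inj_on_def \<rho>_def E'_def)
    also have "\<dots> \<le> (\<Sum>q=1..4 * N. real q ^ 2 * (\<Sum>m. \<bar>b m\<bar> * grid_defect q (\<rho> q) m))"
      using nn by (intro sum_mono2 mult_nonneg_nonneg) auto
    also have "\<dots> \<le> 40 * (16 * \<kappa>) * B"
      unfolding B_def using \<kappa> by (intro sum_grid_defect_suminf_le s2 s0 alt \<rho>) auto
    finally show ?thesis
      by simp
  qed
  have \<kappa>B: "\<kappa> * B \<le> B / 20000"
    using mult_right_mono[OF \<kappa>(2) B0] by simp
  have b0: "b 0 = 0"
  proof -
    \<comment> \<open>The coefficient \<open>g\<close> of \<open>b 0\<close> has order
      \<open>1 / p^2\<close>, which the weight compensates; so the constant
      \<open>\<bar>b 0\<bar>\<close> is bounded by terms whose sums over \<open>p\<close> stay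
      bounded.\<close>
    have bd: "\<bar>b 0\<bar> \<le> 10 * (real p ^ 2 * \<bar>G p\<bar> + real p ^ 2 * E p + real p ^ 2 * \<bar>G (4 * p)\<bar> + real p ^ 2 * E' p)" if p: "p \<ge> 1" for p
    proof -
      obtain e e' where e: "\<bar>e\<bar> \<le> E p" "\<bar>e'\<bar> \<le> E' p"
        "x p * (G p + e) + x p / \<mu> p * b 0 = y p * (G (4 * p) + e') + y p / \<nu> p * b 0"
        using main[OF p] by blast
      have \<mu>0: "\<mu> p > 0" "\<nu> p > 0"
        using small[OF p] by linarith+
      define g where "g = y p / \<nu> p - x p / \<mu> p"
      have "g = pi/2 * (sin (\<nu> p * (pi / (2 * real (4 * p)))) / (\<nu> p * (pi / (2 * real (4 * p))))
                 - sin (\<mu> p * (pi / (2 * real p))) / (\<mu> p * (pi / (2 * real p))))"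
        using p \<mu>0 by (simp add: g_def x_def y_def field_simps)
      then have "g \<ge> pi/2 * (1 / (5 * real p ^ 2))"
        using mult_left_mono[OF sinc_gap(1)[OF small[OF p] p], of "pi/2"] by simp
      moreover have "pi/2 * (1 / (5 * real p ^ 2)) \<ge> 3/2 * (1 / (5 * real p ^ 2))"
        using pi_gt3 by (intro mult_right_mono) auto
      ultimately have g: "g \<ge> 3 / (10 * real p ^ 2)"
        by simp
      then have "3 / (10 * real p ^ 2) * \<bar>b 0\<bar> \<le> \<bar>g * b 0\<bar>"
        unfolding abs_mult by (intro mult_right_mono) auto
      also have "g * b 0 = x p * (G p + e) - y p * (G (4 * p) + e')"
        using e(3) by (simp add: g_def algebra_simps)
      also have "\<bar>\<dots>\<bar> \<le> \<bar>x p * (G p + e)\<bar> + \<bar>y p * (G (4 * p) + e')\<bar>"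
        by (rule abs_triangle_ineq4)
      also have "\<dots> \<le> 2 * (\<bar>G p\<bar> + E p) + 2 * (\<bar>G (4 * p)\<bar> + E' p)"
        unfolding abs_mult using xy[OF p] e(1,2) by (intro add_mono mult_mono) auto
      finally show ?thesis
        using p by (simp add: field_simps)
    qed
    have N: "real N * \<bar>b 0\<bar> \<le> 20 * B + 10 * B" for N
    proof -
      have "real N * \<bar>b 0\<bar> = (\<Sum>p=1..N. \<bar>b 0\<bar>)"
        by simp
      also have "\<dots> \<le> (\<Sum>p=1..N. 10 * (real p ^ 2 * \<bar>G p\<bar> + real p ^ 2 * E p + real p ^ 2 * \<bar>G (4 * p)\<bar> + real p ^ 2 * E' p))"
        by (intro sum_mono bd) auto
      also have "\<dots> = 10 * ((\<Sum>p=1..N. real p ^ 2 * \<bar>G p\<bar>) + (\<Sum>p=1..N. real p ^ 2 * E p)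
          + (\<Sum>p=1..N. real p ^ 2 * \<bar>G (4 * p)\<bar>) + (\<Sum>p=1..N. real p ^ 2 * E' p))"
        by (simp add: sum.distrib sum_distrib_left)
      also have "\<dots> \<le> 20 * B + 10 * B"
        using sG[of N] sG4[of N] sE[of N] sE'[of N] \<kappa>B B0 by (simp add: mult.assoc)
      finally show ?thesis .
    qed
    show ?thesis
    proof (rule ccontr)
      assume "b 0 \<noteq> 0"
      then obtain n :: nat where "30 * B < real n * \<bar>b 0\<bar>"
        using reals_Archimedean3[of "\<bar>b 0\<bar>"] by auto
      then show False
        using N[of n] by simp
    qed
  qed
  have bp: "\<bar>b p\<bar> \<le> (\<Sum>k. \<bar>b ((k + 2) * p)\<bar>) + E p + 2 * \<bar>G (4 * p)\<bar> + 2 * E' p" if p: "p \<ge> 1" for p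
  proof -
    obtain e e' where e: "\<bar>e\<bar> \<le> E p" "\<bar>e'\<bar> \<le> E' p"
      "x p * (G p + e) = y p * (G (4 * p) + e')"
      using main[OF p] b0 by auto
    have "0.92 * \<bar>G p + e\<bar> \<le> \<bar>x p * (G p + e)\<bar>"
      unfolding abs_mult using xy[OF p] by (intro mult_right_mono) auto
    also have "\<dots> = \<bar>y p * (G (4 * p) + e')\<bar>"
      by (simp only: e(3))
    \<comment> \<open>1.84 is \<open>2 * 0.92\<close>, chosen to divide out evenly; it exceeds the
      bound 1.573 for \<open>y p\<close>.\<close>
    also have "\<dots> \<le> 1.84 * (\<bar>G (4 * p)\<bar> + E' p)"
      unfolding abs_mult using xy[OF p] e(2) by (intro mult_mono) auto
    finally have "\<bar>G p + e\<bar> \<le> 2 * (\<bar>G (4 * p)\<bar> + E' p)"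
      by simp
    then have "\<bar>G p\<bar> \<le> E p + 2 * (\<bar>G (4 * p)\<bar> + E' p)"
      using e(1) by linarith
    then show ?thesis
      using aliasing_bounds(2)[OF s0 p, folded G_def] by (simp add: distrib_left)
  qed
  have le: "(\<Sum>p=1..N. real p ^ 2 * \<bar>b p\<bar>) \<le> 0.95 * B" for N
  proof -
    have "(\<Sum>p=1..N. real p ^ 2 * \<bar>b p\<bar>)
        \<le> (\<Sum>p=1..N. real p ^ 2 * ((\<Sum>k. \<bar>b ((k + 2) * p)\<bar>) + E p + 2 * \<bar>G (4 * p)\<bar> + 2 * E' p))"
      by (intro sum_mono mult_left_mono bp) auto
    also have "\<dots> = (\<Sum>p=1..N. real p ^ 2 * (\<Sum>k. \<bar>b ((k + 2) * p)\<bar>)) + (\<Sum>p=1..N. real p ^ 2 * E p)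
        + 2 * (\<Sum>p=1..N. real p ^ 2 * \<bar>G (4 * p)\<bar>) + 2 * (\<Sum>p=1..N. real p ^ 2 * E' p)"
      by (simp add: sum.distrib sum_distrib_left distrib_left mult_ac)
    also have "\<dots> \<le> 0.95 * B"
      using sT[of N] sG4[of N] sE[of N] sE'[of N] \<kappa>B B0 by (simp add: mult.assoc)
    finally show ?thesis .
  qed
  have "B \<le> 0.95 * B"
    unfolding B_def
  proof (rule suminf_le_const[OF s2])
    fix n
    have "(\<Sum>m<n. real m ^ 2 * \<bar>b m\<bar>) \<le> (\<Sum>m<Suc n. real m ^ 2 * \<bar>b m\<bar>)"
      by simp
    also have "\<dots> = (\<Sum>p=1..n. real p ^ 2 * \<bar>b p\<bar>)"
      by (simp add: sum.lessThan_Suc_shift sum.atLeast1_atMost_eq del: sum.lessThan_Suc)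
    also have "\<dots> \<le> 0.95 * (\<Sum>m. real m ^ 2 * \<bar>b m\<bar>)"
      using le[of n] unfolding B_def .
    finally show "(\<Sum>m<n. real m ^ 2 * \<bar>b m\<bar>) \<le> 0.95 * (\<Sum>m. real m ^ 2 * \<bar>b m\<bar>)" .
  qed
  then have "(\<Sum>m. real m ^ 2 * \<bar>b m\<bar>) = 0"
    using B0 unfolding B_def by simp
  then have "real m ^ 2 * \<bar>b m\<bar> = 0"
    using suminf_eq_zero_iff[OF s2] by simp
  then show ?thesis
    using b0 by (cases "m = 0") auto
qed

section \<open>Geometry of the stadium\<close>

text \<open>Nearest point of the core interval. The stadium consists of the points at distance less
  than 1 from the core segment on the axis; thus \<open>offset\<close> below is a squared distance
  and \<open>inward_normal\<close> points to the nearest core point, with one formula for caps and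
  edges.\<close>

definition clip :: "real \<Rightarrow> real \<Rightarrow> real" where
  "clip a x = max (-a/2) (min (a/2) x)"

definition inward_normal :: "real \<Rightarrow> point \<Rightarrow> point" where
  "inward_normal a p = (clip a (fst p) - fst p, - snd p)"

definition offset :: "real \<Rightarrow> point \<Rightarrow> real" where
  "offset a p = (fst p - clip a (fst p))\<^sup>2 + (snd p)\<^sup>2"

definition open_stadium :: "real \<Rightarrow> point set" where
  "open_stadium a = (\<Union>c\<in>{-a/2..a/2}. ball (c, 0) 1)"

lemma clip_in: "a > 0 \<Longrightarrow> clip a x \<in> {-a/2..a/2}"
  by (auto simp: clip_def)

lemma clip_nearest: "a > 0 \<Longrightarrow> c \<in> {-a/2..a/2} \<Longrightarrow> \<bar>x - clip a x\<bar> \<le> \<bar>x - c\<bar>"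
  by (auto simp: clip_def)

lemma norm_Pair_less_1_iff: "norm (u, v) < 1 \<longleftrightarrow> u\<^sup>2 + v\<^sup>2 < 1" for u v :: real
  by (simp add: norm_Pair)

lemma norm_Pair_le_1_iff: "norm (u, v) \<le> 1 \<longleftrightarrow> u\<^sup>2 + v\<^sup>2 \<le> 1" for u v :: real
  by (simp add: norm_Pair)

lemma in_ball_axis: "p \<in> ball (c, 0) 1 \<longleftrightarrow> (fst p - c)\<^sup>2 + (snd p)\<^sup>2 < 1" for p :: point
proof -
  have "dist (c, 0) p = norm (fst p - c, snd p)"
    by (cases p) (simp add: dist_norm norm_Pair power2_commute)
  then show ?thesis
    by (simp add: norm_Pair_less_1_iff)
qed

lemma in_cball_axis: "p \<in> cball (c, 0) 1 \<longleftrightarrow> (fst p - c)\<^sup>2 + (snd p)\<^sup>2 \<le> 1" for p :: point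
proof -
  have "dist (c, 0) p = norm (fst p - c, snd p)"
    by (cases p) (simp add: dist_norm norm_Pair power2_commute)
  then show ?thesis
    by (simp add: norm_Pair_le_1_iff)
qed

lemma in_open_stadium_iff:
  assumes a: "a > 0"
  shows "p \<in> open_stadium a \<longleftrightarrow> offset a p < 1"
proof
  assume "p \<in> open_stadium a"
  then obtain c where c: "c \<in> {-a/2..a/2}" "(fst p - c)\<^sup>2 + (snd p)\<^sup>2 < 1"
    unfolding open_stadium_def UN_iff in_ball_axis by blast
  have "(fst p - clip a (fst p))\<^sup>2 \<le> (fst p - c)\<^sup>2"
    using clip_nearest[OF a c(1)] by (simp add: abs_le_square_iff)
  then show "offset a p < 1"
    using c(2) by (simp add: offset_def)
next
  assume "offset a p < 1"
  then show "p \<in> open_stadium a"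
    unfolding open_stadium_def UN_iff in_ball_axis offset_def using clip_in[OF a] by blast
qed

lemma open_open_stadium: "open (open_stadium a)"
  unfolding open_stadium_def by (intro open_UN) auto

lemma convex_open_stadium: "convex (open_stadium a)"
proof -
  have "open_stadium a = (\<Union>x\<in>{-a/2..a/2} \<times> {0::real}. \<Union>y\<in>ball 0 1. {x + y})"
  proof (intro equalityI subsetI)
    fix p assume "p \<in> open_stadium a"
    then obtain c where c: "c \<in> {-a/2..a/2}" "dist (c, 0) p < 1"
      unfolding open_stadium_def by auto
    then have "p - (c, 0) \<in> ball 0 1" "p = (c, 0) + (p - (c, 0))"
      by (simp_all add: dist_norm norm_minus_commute)
    then show "p \<in> (\<Union>x\<in>{-a/2..a/2} \<times> {0::real}. \<Union>y\<in>ball 0 1. {x + y})"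
      using c(1) by blast
  next
    fix p assume "p \<in> (\<Union>x\<in>{-a/2..a/2} \<times> {0::real}. \<Union>y\<in>ball 0 1. {x + y})"
    then obtain c y where "c \<in> {-a/2..a/2}" "y \<in> ball 0 1" "p = (c, 0) + y"
      by blast
    then show "p \<in> open_stadium a"
      unfolding open_stadium_def by (intro UN_I[of c]) (auto simp: dist_norm)
  qed
  then show ?thesis
    by (auto intro!: convex_sums convex_Times)
qed

lemma bounded_open_stadium:
  assumes a: "a > 0"
  shows "bounded (open_stadium a)"
proof (rule boundedI)
  fix p assume p: "p \<in> open_stadium a"
  then obtain c where c: "c \<in> {-a/2..a/2}" "dist (c, 0) p < 1"
    unfolding open_stadium_def by auto
  have "norm p \<le> norm (c, 0 :: real) + dist (c, 0) p"
    by (metis dist_norm norm_minus_commute norm_triangle_sub)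
  then show "norm p \<le> a / 2 + 1"
    using c by (auto simp: norm_Pair)
qed

lemma continuous_on_clip [continuous_intros]:
  "continuous_on S f \<Longrightarrow> continuous_on S (\<lambda>p. clip a (f p))"
  unfolding clip_def by (intro continuous_intros)

lemma closure_open_stadium:
  assumes a: "a > 0"
  shows "closure (open_stadium a) = {p. offset a p \<le> 1}"
proof
  have "closed {p. offset a p \<le> 1}"
    unfolding offset_def by (intro closed_Collect_le continuous_intros)
  then show "closure (open_stadium a) \<subseteq> {p. offset a p \<le> 1}"
    using in_open_stadium_iff[OF a] by (intro closure_minimal) (auto intro: less_imp_le)
  show "{p. offset a p \<le> 1} \<subseteq> closure (open_stadium a)"
  proof
    fix p assume "p \<in> {p. offset a p \<le> 1}"
    then have "p \<in> cball (clip a (fst p), 0) 1"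
      unfolding in_cball_axis by (simp add: offset_def)
    then have "p \<in> closure (ball (clip a (fst p), 0) 1)"
      by simp
    also have "\<dots> \<subseteq> closure (open_stadium a)"
      unfolding open_stadium_def using clip_in[OF a] by (intro closure_mono) blast
    finally show "p \<in> closure (open_stadium a)" .
  qed
qed

lemma frontier_open_stadium:
  assumes a: "a > 0"
  shows "frontier (open_stadium a) = {p. offset a p = 1}"
  unfolding frontier_def closure_open_stadium[OF a] interior_open[OF open_open_stadium]
  using in_open_stadium_iff[OF a] by force

lemma stadium_curve_eq:
  assumes a: "a > 0"
  shows "flat_edges a \<union> (\<Union>i. unit_semicircle a i) = {p. offset a p = 1}"
proof -
  have U: "(\<Union>i. unit_semicircle a i) = unit_semicircle a Left_Side \<union> unit_semicircle a Right_Side"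
    (is "?l = ?r")
  proof
    show "?l \<subseteq> ?r"
    proof
      fix p assume "p \<in> ?l"
      then obtain i where "p \<in> unit_semicircle a i"
        by blast
      then show "p \<in> ?r"
        by (cases i) auto
    qed
  qed blast
  have sphere: "dist (c, 0) (x, y) = 1 \<longleftrightarrow> (x - c)\<^sup>2 + y\<^sup>2 = 1" for x y c :: real
    using in_ball_axis[of "(x, y)" c] in_cball_axis[of "(x, y)" c] by (auto simp: le_less)
  have "p \<in> flat_edges a \<union> (unit_semicircle a Left_Side \<union> unit_semicircle a Right_Side) \<longleftrightarrow> offset a p = 1" for p
  proof -
    obtain x y where p: "p = (x, y)"
      by (cases p)
    have y: "y\<^sup>2 = 1 \<longleftrightarrow> y = 1 \<or> y = -1"
      by (simp add: power2_eq_1_iff)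
    consider "x < -a/2" | "x = -a/2" | "-a/2 < x" "x < a/2" | "x = a/2" | "a/2 < x"
      by linarith
    then show ?thesis
    proof cases
      case 1
      then have clip: "clip a x = -a/2"
        using a by (simp add: clip_def)
      show ?thesis
        using 1 a by (auto simp: p clip flat_edges_def unit_semicircle_def sphere offset_def)
    next
      case 2
      then have clip: "clip a x = -a/2"
        using a by (simp add: clip_def)
      show ?thesis
        using 2 a y by (auto simp: p clip_def flat_edges_def unit_semicircle_def sphere offset_def)
    next
      case 3
      then have clip: "clip a x = x"
        by (simp add: clip_def)
      show ?thesis
        using 3 a y by (auto simp: p clip flat_edges_def unit_semicircle_def sphere offset_def)
    next
      case 4
      then have clip: "clip a x = a/2"
        using a by (simp add: clip_def)
      show ?thesis
        using 4 a y by (auto simp: p clip_def flat_edges_def unit_semicircle_def sphere offset_def)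
    next
      case 5
      then have clip: "clip a x = a/2"
        using a by (simp add: clip_def)
      show ?thesis
        using 5 a by (auto simp: p clip flat_edges_def unit_semicircle_def sphere offset_def)
    qed
  qed
  then show ?thesis
    unfolding U by blast
qed

text \<open>The defining curve is the frontier of a bounded convex open set, and for such a set
  \<open>inside\<close> of the frontier is the interior.\<close>

lemma stadium_eq:
  assumes a: "a > 0"
  shows "stadium a = open_stadium a"
  unfolding stadium_def stadium_curve_eq[OF a] frontier_open_stadium[OF a, symmetric]
  using inside_frontier_eq_interior[OF bounded_open_stadium[OF a] convex_open_stadium]
    interior_open[OF open_open_stadium] by simp

text \<open>The supporting line at \<open>q\<close> is strict. \<open>z - q\<close> splits into the
  vector from the core point of \<open>z\<close> to \<open>z\<close>, which is shorter than 1, the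
  vector between the two core points, which is harmless by the obtuse-angle property of nearest
  points, and the vector from \<open>q\<close> to its core point, which contributes exactly
  1.\<close>

lemma inner_inward_normal_pos:
  assumes a: "a > 0" and q: "offset a q = 1" and z: "offset a z < 1"
  shows "(z - q) \<bullet> inward_normal a q > 0"
proof -
  define c where "c = clip a (fst q)"
  define c' where "c' = clip a (fst z)"
  have N: "inward_normal a q = (c - fst q, - snd q)"
    by (simp add: inward_normal_def c_def)
  have n1: "norm (c - fst q, - snd q) \<le> 1"
    using q by (simp only: norm_Pair_le_1_iff) (simp add: offset_def c_def power2_commute)
  have n2: "norm (fst z - c', snd z) < 1"
    using z by (simp only: norm_Pair_less_1_iff) (simp add: offset_def c'_def)
  have "\<bar>(fst z - c', snd z) \<bullet> (c - fst q, - snd q)\<bar> \<le> norm (fst z - c', snd z) * norm (c - fst q, - snd q)"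
    by (rule Cauchy_Schwarz_ineq2)
  also have "\<dots> \<le> norm (fst z - c', snd z) * 1"
    using n1 by (intro mult_left_mono) auto
  finally have "\<bar>(fst z - c', snd z) \<bullet> (c - fst q, - snd q)\<bar> < 1"
    using n2 by linarith
  then have 1: "(fst z - c', snd z) \<bullet> (c - fst q, - snd q) > -1"
    by linarith
  have 2: "(c' - c) * (c - fst q) \<ge> 0"
    using clip_in[OF a, of "fst z"] a unfolding c_def c'_def
    by (auto simp: clip_def max_def min_def mult_nonneg_nonneg mult_nonpos_nonpos)
  have "(z - q) \<bullet> inward_normal a q
      = (fst z - c', snd z) \<bullet> (c - fst q, - snd q) + (c' - c) * (c - fst q) + ((c - fst q)\<^sup>2 + (snd q)\<^sup>2)"
    unfolding N by (cases z, cases q) (simp add: inner_prod_def algebra_simps power2_eq_square)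
  also have "(c - fst q)\<^sup>2 + (snd q)\<^sup>2 = 1"
    using q by (simp add: offset_def c_def power2_commute)
  finally show ?thesis
    using 1 2 by linarith
qed

lemma norm_inward_normal:
  assumes q: "offset a q = 1"
  shows "norm (inward_normal a q) = 1"
  using q by (simp add: inward_normal_def norm_Pair offset_def power2_commute)

text \<open>A boundary curve through \<open>q\<close> stays in the closed supporting half-plane, so
  its height above the supporting line has a minimum at time 0. This pins down the directions that
  \<open>boundary_tangent\<close> admits.\<close>

lemma boundary_tangent_inner_zero:
  assumes supp: "\<And>z. z \<in> S \<Longrightarrow> (z - q) \<bullet> N \<ge> 0" and T: "boundary_tangent S q T"
  shows "T \<bullet> N = 0"
proof -
  obtain c \<epsilon> where c: "\<epsilon> > 0" "\<And>t. t \<in> {-\<epsilon><..<\<epsilon>} \<Longrightarrow> c t \<in> frontier S" "c 0 = q"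
      "(c has_vector_derivative T) (at (0::real))"
    using T unfolding boundary_tangent_def by blast
  have "closed {z. (z - q) \<bullet> N \<ge> 0}"
    by (intro closed_Collect_le continuous_intros)
  then have "closure S \<subseteq> {z. (z - q) \<bullet> N \<ge> 0}"
    using supp by (intro closure_minimal) auto
  then have fr: "(z - q) \<bullet> N \<ge> 0" if "z \<in> frontier S" for z
    using that by (auto simp: frontier_def)
  have d: "((\<lambda>t. (c t - q) \<bullet> N) has_real_derivative T \<bullet> N) (at 0)"
    using c(4) unfolding has_real_derivative_iff_has_vector_derivative
    by (auto intro!: derivative_eq_intros simp: has_vector_derivative_def inner_left_distrib)
  show ?thesis
  proof (rule DERIV_local_min[OF d c(1)])
    show "\<forall>y. \<bar>0 - y\<bar> < \<epsilon> \<longrightarrow> (c 0 - q) \<bullet> N \<le> (c y - q) \<bullet> N"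
    proof (intro allI impI)
      fix y :: real assume "\<bar>0 - y\<bar> < \<epsilon>"
      then have "c y \<in> frontier S"
        by (intro c(2)) auto
      then show "(c 0 - q) \<bullet> N \<le> (c y - q) \<bullet> N"
        using fr c(3) by simp
    qed
  qed
qed

text \<open>Law of reflection in vector form. The change of direction is orthogonal to a tangent
  vector, hence a multiple of the unit normal, and equality of the norms determines the
  multiple.\<close>

lemma reflects_in_stadium:
  assumes a: "a > 0" and q: "q \<in> frontier (stadium a)" and pq: "p \<noteq> q" and qr: "q \<noteq> r"
    and s1: "open_segment p q \<subseteq> stadium a" and s2: "open_segment q r \<subseteq> stadium a"
    and refl: "reflects (stadium a) p q r"
  shows "sgn (r - q) \<bullet> inward_normal a q > 0"
    and "sgn (q - p) \<bullet> inward_normal a q = - (sgn (r - q) \<bullet> inward_normal a q)"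
    and "sgn (r - q) - sgn (q - p) = (2 * (sgn (r - q) \<bullet> inward_normal a q)) *\<^sub>R inward_normal a q"
proof -
  define N where "N = inward_normal a q"
  define U where "U = sgn (r - q)"
  define V where "V = sgn (q - p)"
  have q1: "offset a q = 1"
    using q by (simp add: stadium_eq[OF a] frontier_open_stadium[OF a])
  have N1: "norm N = 1"
    unfolding N_def by (rule norm_inward_normal[OF q1])
  have pos: "(z - q) \<bullet> N > 0" if "z \<in> stadium a" for z
    using inner_inward_normal_pos[OF a q1] that by (simp add: N_def stadium_eq[OF a] in_open_stadium_iff[OF a])
  \<comment> \<open>One interior point of the side, its midpoint, lies strictly on the inner side of
    the tangent line; so the whole direction points inwards.\<close>
  have dir: "sgn (z - q) \<bullet> N > 0" if z: "z \<noteq> q" "open_segment q z \<subseteq> stadium a" for z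
  proof -
    have "midpoint q z \<in> stadium a"
      using z by (auto simp: midpoint_in_open_segment)
    then have "(midpoint q z - q) \<bullet> N > 0"
      by (rule pos)
    moreover have "midpoint q z - q = (1/2) *\<^sub>R (z - q)"
      by (simp add: midpoint_def prod_eq_iff field_simps)
    ultimately have "(z - q) \<bullet> N > 0"
      by simp
    then show ?thesis
      using z(1) by (simp add: sgn_div_norm)
  qed
  have U0: "U \<bullet> N > 0"
    unfolding U_def using qr s2 by (intro dir) auto
  have "sgn (p - q) \<bullet> N > 0"
    using pq s1 by (intro dir) (auto simp: open_segment_commute)
  moreover have "sgn (p - q) = - V"
    unfolding V_def by (metis minus_diff_eq sgn_minus)
  ultimately have V0: "V \<bullet> N < 0"
    by simp
  obtain T where T: "T \<noteq> 0" "boundary_tangent (stadium a) q T" "V \<bullet> T = U \<bullet> T"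
    using refl unfolding reflects_def U_def V_def by blast
  have TN: "T \<bullet> N = 0"
    using pos by (intro boundary_tangent_inner_zero[OF _ T(2)] less_imp_le) auto
  have nU: "norm U = 1" and nV: "norm V = 1"
    using pq qr by (auto simp: U_def V_def norm_sgn)
  define t where "t = (U - V) \<bullet> N"
  have UV: "U - V = t *\<^sub>R N"
  proof -
    obtain t1 t2 where t: "T = (t1, t2)" by (cases T)
    obtain n1 n2 where n: "N = (n1, n2)" by (cases N)
    obtain w1 w2 where w: "U - V = (w1, w2)" by (cases "U - V")
    have 1: "n1 * n1 + n2 * n2 = 1"
      using N1 by (simp add: n norm_Pair power2_eq_square)
    have 2: "t1 * n1 + t2 * n2 = 0"
      using TN by (simp add: t n inner_prod_def)
    have "(U - V) \<bullet> T = 0"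
      using T(3) by (simp add: inner_diff_left)
    then have 3: "w1 * t1 + w2 * t2 = 0"
      by (simp add: w t inner_prod_def)
    have 4: "t1 \<noteq> 0 \<or> t2 \<noteq> 0"
      using T(1) by (auto simp: t prod_eq_iff)
    define s where "s = t1 * n2 - t2 * n1"
    have t1: "t1 = s * n2" and t2: "t2 = - s * n1"
      using 1 2 unfolding s_def by algebra+
    have "s \<noteq> 0"
      using 4 t1 t2 by auto
    moreover have "s * (w1 * n2 - w2 * n1) = 0"
      using 3 unfolding t1 t2 by (simp add: algebra_simps)
    ultimately have 5: "w1 * n2 - w2 * n1 = 0"
      by simp
    have "w1 = (w1 * n1 + w2 * n2) * n1" "w2 = (w1 * n1 + w2 * n2) * n2"
      using 1 5 by algebra+
    then show ?thesis
      unfolding t_def w n by (simp add: inner_prod_def)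
  qed
  have "U = V + t *\<^sub>R N"
    using UV by (simp add: algebra_simps)
  then have "U \<bullet> U = V \<bullet> V + 2 * t * (V \<bullet> N) + t * t * (N \<bullet> N)"
    by (simp add: inner_add_left inner_add_right inner_commute algebra_simps)
  then have "t * (2 * (V \<bullet> N) + t) = 0"
    using nU nV N1 by (simp add: dot_square_norm algebra_simps)
  moreover have "t > 0"
    using U0 V0 by (simp add: t_def inner_diff_left)
  ultimately have VN: "V \<bullet> N = - t / 2"
    by simp
  then have UN: "U \<bullet> N = t / 2"
    by (simp add: t_def inner_diff_left)
  show "sgn (r - q) \<bullet> inward_normal a q > 0"
    using U0 by (simp add: U_def N_def)
  show "sgn (q - p) \<bullet> inward_normal a q = - (sgn (r - q) \<bullet> inward_normal a q)"
    using VN UN by (simp add: U_def N_def V_def)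
  show "sgn (r - q) - sgn (q - p) = (2 * (sgn (r - q) \<bullet> inward_normal a q)) *\<^sub>R inward_normal a q"
    using UV UN by (simp add: U_def N_def V_def)
qed

section \<open>The length spectrum of the stadium is countable\<close>

lemma unit_vector_polar:
  fixes U :: point
  assumes "norm U = 1"
  obtains \<mu> where "U = (cos \<mu>, sin \<mu>)"
proof -
  have "(fst U)\<^sup>2 + (snd U)\<^sup>2 = 1"
    using assms by (cases U) (simp add: norm_Pair)
  then obtain \<mu> where "fst U = cos \<mu>" "snd U = sin \<mu>"
    using sincos_total_2pi_le by metis
  then show ?thesis
    using that by (metis prod.collapse)
qed

lemma unit_vector_relative_polar:
  fixes U N :: point
  assumes U: "U = (cos \<mu>, sin \<mu>)" and N: "norm N = 1" and pos: "U \<bullet> N > 0"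
  obtains \<phi> where "-pi/2 < \<phi>" "\<phi> < pi/2" "N = (cos (\<mu> + \<phi>), sin (\<mu> + \<phi>))"
    "U \<bullet> N = cos \<phi>" "cross N U = - sin \<phi>"
proof -
  obtain n1 n2 where n: "N = (n1, n2)" by (cases N)
  define c where "c = cos \<mu> * n1 + sin \<mu> * n2"
  define s where "s = cos \<mu> * n2 - sin \<mu> * n1"
  have nn: "n1\<^sup>2 + n2\<^sup>2 = 1"
    using N by (simp add: n norm_Pair)
  have c0: "c > 0"
    using pos by (simp add: U n c_def inner_prod_def)
  have "c\<^sup>2 + s\<^sup>2 = ((cos \<mu>)\<^sup>2 + (sin \<mu>)\<^sup>2) * (n1\<^sup>2 + n2\<^sup>2)"
    unfolding c_def s_def by algebra
  then have cs: "c\<^sup>2 + s\<^sup>2 = 1"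
    using nn by simp
  have "s\<^sup>2 < 1"
    using cs c0 zero_less_power[of c 2] by linarith
  then have s1: "-1 < s" "s < 1"
    by (auto simp: abs_square_less_1 abs_less_iff)
  define \<phi> where "\<phi> = arcsin s"
  have "sin \<phi> = s"
    using s1 by (simp add: \<phi>_def)
  have "cos \<phi> = sqrt (1 - s\<^sup>2)"
    using s1 by (simp add: \<phi>_def cos_arcsin)
  also have "1 - s\<^sup>2 = c\<^sup>2"
    using cs by simp
  finally have "cos \<phi> = c"
    using c0 by simp
  have n1: "n1 = cos \<mu> * c - sin \<mu> * s" and n2: "n2 = sin \<mu> * c + cos \<mu> * s"
    using sin_cos_squared_add[of \<mu>] unfolding c_def s_def by algebra+
  show ?thesis
  proof
    show "-pi/2 < \<phi>" "\<phi> < pi/2"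
      using arcsin_lt_bounded[OF s1] by (auto simp: \<phi>_def)
    show "N = (cos (\<mu> + \<phi>), sin (\<mu> + \<phi>))"
      unfolding n cos_add sin_add \<open>sin \<phi> = s\<close> \<open>cos \<phi> = c\<close> using n1 n2 by simp
    show "U \<bullet> N = cos \<phi>"
      by (simp add: \<open>cos \<phi> = c\<close> U n c_def inner_prod_def)
    show "cross N U = - sin \<phi>"
      by (simp add: \<open>sin \<phi> = s\<close> U n s_def cross_def)
  qed
qed

text \<open>With \<open>\<omega>\<close> and \<open>\<sigma>\<close> the angles from \<open>U\<close> to \<open>U'\<close> and from \<open>N\<close> to \<open>N'\<close>, and \<open>m \<plusminus> k\<close> the angles
  of incidence, the left-hand side is \<open>16 cos\<^sup>2 m sin\<^sup>2 (\<omega>/2) sin\<^sup>2 (\<sigma>/2)\<close> and the right-hand side is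
  \<open>32 cos m cos k sin\<^sup>2 (\<omega>/2) sin\<^sup>2 (\<sigma>/2)\<close>; incidence on the same side of the normal gives
  \<open>\<bar>k\<bar> \<le> \<pi>/4\<close>.\<close>

lemma incidence_inequality:
  fixes U U' N N' :: point
  assumes U: "norm U = 1" and U': "norm U' = 1" and N: "norm N = 1" and N': "norm N' = 1"
    and c: "U \<bullet> N > 0" and c': "U' \<bullet> N' > 0" and s: "cross N U * cross N' U' \<ge> 0"
  shows "((U - U') \<bullet> (N - N'))\<^sup>2 \<le> 2 * (1 - U \<bullet> U') * (2 * (U \<bullet> N + U' \<bullet> N') * (1 - N \<bullet> N'))"
proof -
  obtain \<mu> where \<mu>: "U = (cos \<mu>, sin \<mu>)"
    using unit_vector_polar[OF U] .
  obtain \<mu>' where \<mu>': "U' = (cos \<mu>', sin \<mu>')"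
    using unit_vector_polar[OF U'] .
  obtain \<phi> where \<phi>: "-pi/2 < \<phi>" "\<phi> < pi/2" "N = (cos (\<mu> + \<phi>), sin (\<mu> + \<phi>))"
    "U \<bullet> N = cos \<phi>" "cross N U = - sin \<phi>"
    using unit_vector_relative_polar[OF \<mu> N c] .
  obtain \<phi>' where \<phi>': "-pi/2 < \<phi>'" "\<phi>' < pi/2" "N' = (cos (\<mu>' + \<phi>'), sin (\<mu>' + \<phi>'))"
    "U' \<bullet> N' = cos \<phi>'" "cross N' U' = - sin \<phi>'"
    using unit_vector_relative_polar[OF \<mu>' N' c'] .
  define m where "m = (\<phi> + \<phi>') / 2"
  define k where "k = (\<phi>' - \<phi>) / 2"
  define \<omega> where "\<omega> = \<mu>' - \<mu>"
  define x where "x = sin (\<omega> / 2)"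
  define y where "y = sin (\<omega> / 2 + k)"
  have inner: "(cos p, sin p) \<bullet> (cos q, sin q) = cos (q - p)" for p q :: real
    by (simp add: inner_prod_def cos_diff)
  have cc: "cos \<phi> + cos \<phi>' = 2 * cos m * cos k"
    using cos_plus_cos[of "\<phi>'" "\<phi>"] by (simp add: m_def k_def add.commute)
  have "(U - U') \<bullet> (N - N') = cos \<phi> + cos \<phi>' - (cos (\<omega> + \<phi>') + cos (\<omega> - \<phi>))"
  proof -
    have 1: "\<mu>' + \<phi>' - \<mu> = \<omega> + \<phi>'" and 2: "\<mu> + \<phi> - \<mu>' = - (\<omega> - \<phi>)"
      by (simp_all add: \<omega>_def)
    have "U \<bullet> N' = cos (\<omega> + \<phi>')"
      unfolding \<mu> \<phi>'(3) inner 1 ..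
    moreover have "U' \<bullet> N = cos (\<omega> - \<phi>)"
      unfolding \<mu>' \<phi>(3) inner 2 cos_minus ..
    ultimately show ?thesis
      using \<phi>(4) \<phi>'(4) by (simp add: inner_diff_left inner_diff_right)
  qed
  also have "cos (\<omega> + \<phi>') + cos (\<omega> - \<phi>) = 2 * cos m * cos (\<omega> + k)"
  proof -
    have "(\<omega> + \<phi>' + (\<omega> - \<phi>)) / 2 = \<omega> + k" "(\<omega> + \<phi>' - (\<omega> - \<phi>)) / 2 = m"
      by (simp_all add: m_def k_def field_simps)
    then show ?thesis
      by (simp only: cos_plus_cos) simp
  qed
  also have "cos \<phi> + cos \<phi>' - 2 * cos m * cos (\<omega> + k) = 2 * cos m * (cos k - cos (\<omega> + k))"
    unfolding cc by (simp only: right_diff_distrib)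
  also have "cos k - cos (\<omega> + k) = 2 * y * x"
  proof -
    have "(k + (\<omega> + k)) / 2 = \<omega> / 2 + k" "(\<omega> + k - k) / 2 = \<omega> / 2"
      by (simp_all add: field_simps)
    then show ?thesis
      unfolding x_def y_def by (simp only: cos_diff_cos)
  qed
  finally have lhs: "((U - U') \<bullet> (N - N'))\<^sup>2 = 16 * x\<^sup>2 * y\<^sup>2 * cos m * cos m"
    by (simp add: power2_eq_square)
  have uu: "1 - U \<bullet> U' = 2 * x\<^sup>2"
  proof -
    have "\<mu>' - \<mu> = 2 * (\<omega> / 2)"
      by (simp add: \<omega>_def)
    then show ?thesis
      unfolding \<mu> \<mu>' inner x_def by (simp only: cos_double_sin)
  qed
  have nn: "1 - N \<bullet> N' = 2 * y\<^sup>2"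
  proof -
    have "\<mu>' + \<phi>' - (\<mu> + \<phi>) = 2 * (\<omega> / 2 + k)"
      by (simp add: \<omega>_def k_def field_simps)
    then show ?thesis
      unfolding \<phi>(3) \<phi>'(3) inner y_def by (simp only: cos_double_sin)
  qed
  have rhs: "2 * (1 - U \<bullet> U') * (2 * (U \<bullet> N + U' \<bullet> N') * (1 - N \<bullet> N')) = 16 * x\<^sup>2 * y\<^sup>2 * cos m * (2 * cos k)"
    unfolding uu nn \<phi>(4) \<phi>'(4) cc by simp
  have m0: "cos m \<ge> 0"
    using \<phi>(1,2) \<phi>'(1,2) by (intro cos_ge_zero) (auto simp: m_def)
  have "\<bar>k\<bar> \<le> pi/4"
  proof -
    have "sin \<phi> * sin \<phi>' \<ge> 0"
      using s \<phi>(5) \<phi>'(5) by simp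
    moreover have "sin t > 0" if "t > 0" "t < pi/2" for t
      using that by (intro sin_gt_zero) auto
    moreover have "sin t < 0" if "t < 0" "t > -pi/2" for t
      using that sin_gt_zero[of "-t"] by auto
    ultimately have "\<not> (\<phi> > 0 \<and> \<phi>' < 0)" "\<not> (\<phi> < 0 \<and> \<phi>' > 0)"
      using \<phi>(1,2) \<phi>'(1,2) by (metis mult_pos_neg mult_neg_pos not_le)+
    then have sgn: "\<phi> \<le> 0 \<and> \<phi>' \<le> 0 \<or> 0 \<le> \<phi> \<and> 0 \<le> \<phi>'"
      by linarith
    have b: "- pi < 2 * \<phi>" "2 * \<phi> < pi" "- pi < 2 * \<phi>'" "2 * \<phi>' < pi" "2 * k = \<phi>' - \<phi>"
      using \<phi>(1,2) \<phi>'(1,2) by (simp_all add: k_def)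
    from sgn have "- pi \<le> 4 * k" "4 * k \<le> pi"
      using b by (elim disjE conjE; linarith)+
    then show ?thesis
      by (simp add: abs_le_iff)
  qed
  then have "cos (pi/4) \<le> cos \<bar>k\<bar>"
    by (intro cos_monotone_0_pi_le) auto
  moreover have "cos (pi/4) \<ge> 1/2"
  proof -
    have "sqrt 2 \<ge> 1"
      by simp
    then show ?thesis
      by (simp add: cos_45)
  qed
  ultimately have "cos m \<le> 2 * cos k"
    using cos_le_one[of m] cos_abs_real[of k] by linarith
  then have "16 * x\<^sup>2 * y\<^sup>2 * cos m * cos m \<le> 16 * x\<^sup>2 * y\<^sup>2 * cos m * (2 * cos k)"
    using m0 by (intro mult_left_mono) auto
  then show ?thesis
    using lhs rhs by simp
qed

text \<open>In the frame of \<open>U\<close>, passing from \<open>N\<close> to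
  \<open>N - (2 * (U \<bullet> N)) *\<^sub>R U\<close> reverses the component along
  \<open>U\<close>. The mixed terms of the two inner products cancel, and
  \<open>2 * (c * c' + s * s') * (U \<bullet> U')\<close> remains. For a chord of a cap these
  vectors are the normals at its two ends.\<close>

lemma chord_inequality:
  fixes U U' N N' :: point
  assumes U: "norm U = 1" and U': "norm U' = 1" and N: "norm N = 1" and N': "norm N' = 1"
    and u: "U \<bullet> U' \<ge> 0"
  shows "N \<bullet> N' + (N - (2 * (U \<bullet> N)) *\<^sub>R U) \<bullet> (N' - (2 * (U' \<bullet> N')) *\<^sub>R U') \<le> 2 * (U \<bullet> U')"
proof -
  obtain u1 u2 where u: "U = (u1, u2)" by (cases U)
  obtain v1 v2 where v: "U' = (v1, v2)" by (cases U')
  obtain n1 n2 where n: "N = (n1, n2)" by (cases N)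
  obtain l1 l2 where l: "N' = (l1, l2)" by (cases N')
  have 1: "u1 * u1 + u2 * u2 = 1" "v1 * v1 + v2 * v2 = 1" "n1 * n1 + n2 * n2 = 1" "l1 * l1 + l2 * l2 = 1"
    using U U' N N' by (simp_all add: u v n l norm_Pair power2_eq_square)
  define c where "c = u1 * n1 + u2 * n2"
  define s where "s = u1 * n2 - u2 * n1"
  define c' where "c' = v1 * l1 + v2 * l2"
  define s' where "s' = v1 * l2 - v2 * l1"
  have n12: "n1 = c * u1 - s * u2" "n2 = c * u2 + s * u1"
    unfolding c_def s_def using 1(1) by algebra+
  have l12: "l1 = c' * v1 - s' * v2" "l2 = c' * v2 + s' * v1"
    unfolding c'_def s'_def using 1(2) by algebra+
  have cs: "c * c + s * s = 1"
    using 1(1,3) unfolding c_def s_def by algebra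
  have cs': "c' * c' + s' * s' = 1"
    using 1(2,4) unfolding c'_def s'_def by algebra
  have "(c - c')\<^sup>2 + (s - s')\<^sup>2 \<ge> 0"
    by simp
  then have le: "c * c' + s * s' \<le> 1"
    using cs cs' by (simp add: power2_eq_square algebra_simps)
  have UN: "U \<bullet> N = c" "U' \<bullet> N' = c'"
    by (simp_all add: u n v l c_def c'_def inner_prod_def)
  have "N \<bullet> N' + (N - (2 * (U \<bullet> N)) *\<^sub>R U) \<bullet> (N' - (2 * (U' \<bullet> N')) *\<^sub>R U')
      = 2 * ((c * c' + s * s') * (U \<bullet> U'))"
    unfolding UN unfolding u v n l n12 l12 by (simp add: inner_prod_def algebra_simps)
  also have "\<dots> \<le> 2 * (1 * (U \<bullet> U'))"
    using le assms(5) by (intro mult_left_mono mult_right_mono) auto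
  finally show ?thesis
    by simp
qed

lemma periodic_mono_const:
  fixes f :: "nat \<Rightarrow> real"
  assumes mono: "\<And>k. f k \<le> f (Suc k)" and per: "\<And>k. f (k + n) = f k" and n: "n \<ge> 1"
  shows "f k = f 0"
proof -
  have "f (j * n) = f 0" for j
    by (induction j) (use per[of "_ * n"] in \<open>simp_all add: add.commute\<close>)
  then have "f k \<le> f 0"
    using lift_Suc_mono_le[of f k "k * n", OF mono] n by simp
  moreover have "f 0 \<le> f k"
    by (rule lift_Suc_mono_le[of f, OF mono]) simp
  ultimately show ?thesis
    by simp
qed

section \<open>A single periodic billiard trajectory in the stadium\<close>

locale stadium_trajectory =
  fixes a :: real and n :: nat and P :: "nat \<Rightarrow> point"
  assumes a: "a > 0" and n: "n \<ge> 1" and periodic: "\<And>k. P (k + n) = P k"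
    and frontier: "\<And>k. P k \<in> frontier (stadium a)" and distinct: "\<And>k. P k \<noteq> P (Suc k)"
    and segment: "\<And>k. open_segment (P k) (P (Suc k)) \<subseteq> stadium a"
    and refl: "\<And>k. reflects (stadium a) (P k) (P (Suc k)) (P (Suc (Suc k)))"
begin

definition U :: "nat \<Rightarrow> point" where "U k = sgn (P (Suc k) - P k)"
definition N :: "nat \<Rightarrow> point" where "N k = inward_normal a (P k)"
definition len :: "nat \<Rightarrow> real" where "len k = dist (P k) (P (Suc k))"
definition c :: "nat \<Rightarrow> real" where "c k = U k \<bullet> N k"

lemma U_periodic: "U (k + n) = U k" and N_periodic: "N (k + n) = N k" and c_periodic: "c (k + n) = c k"
  using periodic[of k] periodic[of "Suc k"] by (simp_all add: U_def N_def c_def)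

lemma offset_1: "offset a (P k) = 1"
  using frontier[of k] by (simp add: stadium_eq[OF a] frontier_open_stadium[OF a])

lemma norm_U: "norm (U k) = 1"
  using distinct[of k] by (auto simp: U_def norm_sgn)

lemma norm_N: "norm (N k) = 1"
  unfolding N_def by (rule norm_inward_normal[OF offset_1])

lemma len_pos: "len k > 0"
  using distinct by (simp add: len_def)

lemma step: "P (Suc k) = P k + len k *\<^sub>R U k"
proof -
  have "len k = norm (P (Suc k) - P k)"
    by (simp add: len_def dist_norm norm_minus_commute)
  then show ?thesis
    using len_pos[of k] by (simp add: U_def sgn_div_norm)
qed

text \<open>Reflection laws speak about the index \<open>Suc k\<close>; periodicity transfers them
  to every index, including 0.\<close>

lemma index_shift: obtains j where "k + n = Suc j"
  using that[of "k + n - 1"] n by simp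

lemma c_pos: "c k > 0"
proof -
  obtain j where "k + n = Suc j"
    by (rule index_shift)
  moreover have "c (Suc j) > 0"
    unfolding c_def U_def N_def
    by (rule reflects_in_stadium(1)[OF a frontier distinct distinct segment segment refl])
  ultimately show ?thesis
    using c_periodic[of k] by simp
qed

lemma incoming: "U k \<bullet> N (Suc k) = - c (Suc k)"
  unfolding c_def U_def N_def
  by (rule reflects_in_stadium(2)[OF a frontier distinct distinct segment segment refl])

lemma turn: "U (Suc k) - U k = (2 * c (Suc k)) *\<^sub>R N (Suc k)"
  unfolding c_def U_def N_def
  by (rule reflects_in_stadium(3)[OF a frontier distinct distinct segment segment refl])

abbreviation "X k \<equiv> fst (P k)"
abbreviation "left k \<equiv> X k \<le> -a/2"
abbreviation "right k \<equiv> a/2 \<le> X k"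
abbreviation "flat k \<equiv> \<not> left k \<and> \<not> right k"

lemma N_flat: "flat k \<Longrightarrow> N k = (0, - snd (P k)) \<and> (snd (P k) = 1 \<or> snd (P k) = -1)"
  using offset_1[of k] by (auto simp: N_def inward_normal_def offset_def clip_def power2_eq_1_iff)

lemma N_left: "left k \<Longrightarrow> N k = (-a/2, 0) - P k"
  using a by (cases "P k") (auto simp: N_def inward_normal_def clip_def)

lemma N_right: "right k \<Longrightarrow> N k = (a/2, 0) - P k"
  using a by (cases "P k") (auto simp: N_def inward_normal_def clip_def)

lemma flat_turn:
  assumes "flat (Suc k)"
  shows "fst (U (Suc k)) = fst (U k)" "snd (U (Suc k)) = - snd (U k)"
proof -
  define y where "y = snd (P (Suc k))"
  have y: "N (Suc k) = (0, -y)" "y * y = 1"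
    using N_flat[OF assms] by (auto simp: y_def)
  have c: "c (Suc k) = snd (U k) * y"
    using incoming[of k] by (simp add: y inner_prod_def)
  have "U (Suc k) = U k + (2 * c (Suc k)) *\<^sub>R N (Suc k)"
    using turn[of k] by (simp add: algebra_simps)
  then show "fst (U (Suc k)) = fst (U k)" "snd (U (Suc k)) = - snd (U k)"
    using y(2) by (simp_all add: y(1) c algebra_simps)
qed

lemma X_step: "X (Suc k) = X k + len k * fst (U k)"
  by (simp add: step)

text \<open>When all normals lean to the same side, the horizontal component of the direction is
  monotone in time, hence constant by periodicity. So no normal has a horizontal component, and the
  return to the initial abscissa after a period makes all flights vertical.\<close>

lemma one_sided_vertical:
  assumes \<sigma>: "\<sigma> * \<sigma> = (1::real)" and sided: "\<And>k. \<sigma> * fst (N k) \<ge> 0"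
  shows "len k = 2"
proof -
  have "\<sigma> * fst (U k) \<le> \<sigma> * fst (U (Suc k))" for k
  proof -
    have "fst (U (Suc k)) = fst (U k) + 2 * c (Suc k) * fst (N (Suc k))"
      using turn[of k] by (simp add: prod_eq_iff algebra_simps)
    then have "\<sigma> * fst (U (Suc k)) = \<sigma> * fst (U k) + 2 * c (Suc k) * (\<sigma> * fst (N (Suc k)))"
      by (simp add: algebra_simps)
    then show ?thesis
      using c_pos[of "Suc k"] sided[of "Suc k"] by simp
  qed
  then have "\<sigma> * fst (U k) = \<sigma> * fst (U 0)" for k
    by (rule periodic_mono_const[of "\<lambda>k. \<sigma> * fst (U k)", OF _ _ n]) (simp add: U_periodic)
  then have const: "fst (U k) = fst (U 0)" for k
    using \<sigma> by (metis mult_cancel_left mult_zero_left zero_neq_one)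
  have N0: "fst (N k) = 0" for k
  proof -
    obtain j where j: "k + n = Suc j"
      by (rule index_shift)
    have "fst (U (Suc j)) = fst (U j) + 2 * c (Suc j) * fst (N (Suc j))"
      using turn[of j] by (simp add: prod_eq_iff algebra_simps)
    then have "fst (N (Suc j)) = 0"
      using const[of j] const[of "Suc j"] c_pos[of "Suc j"] by simp
    then show ?thesis
      using N_periodic[of k] j by simp
  qed
  have Xk: "X k = X 0 + fst (U 0) * (\<Sum>j<k. len j)" for k
  proof (induction k)
    case (Suc k)
    then show ?case
      using X_step[of k] const[of k] by (simp add: algebra_simps)
  qed simp
  have "(\<Sum>j<n. len j) > 0"
    using n len_pos by (intro sum_pos) (auto simp: lessThan_empty_iff bot_nat_def)
  then have "fst (U 0) = 0"
    using Xk[of n] periodic[of 0] by simp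
  then have XX: "X (Suc k) = X k"
    using X_step[of k] const[of k] by simp
  have y: "snd (P k) = 1 \<or> snd (P k) = -1" for k
    using norm_N[of k] N0[of k] by (auto simp: N_def inward_normal_def norm_Pair power2_eq_1_iff)
  have "snd (P k) \<noteq> snd (P (Suc k))"
    using XX distinct[of k] by (auto simp: prod_eq_iff)
  then show ?thesis
    using y[of k] y[of "Suc k"] XX
    unfolding len_def by (cases "P k", cases "P (Suc k)") (auto simp: dist_Pair_Pair dist_real_def)
qed

lemma no_right_vertical: "(\<And>k. \<not> right k) \<Longrightarrow> len k = 2"
proof (rule one_sided_vertical[of 1])
  fix k assume "\<And>k. \<not> right k"
  then have "left k \<or> flat k" by blast
  then show "0 \<le> 1 * fst (N k)"
    using N_left[of k] N_flat[of k] by auto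
qed simp

lemma no_left_vertical: "(\<And>k. \<not> left k) \<Longrightarrow> len k = 2"
proof (rule one_sided_vertical[of "-1"])
  fix k assume "\<And>k. \<not> left k"
  then have "right k \<or> flat k" by blast
  then show "0 \<le> -1 * fst (N k)"
    using N_right[of k] N_flat[of k] by auto
qed simp

lemma flat_run_fst_U:
  assumes "\<forall>j. i < j \<longrightarrow> j < k \<longrightarrow> flat j" "i \<le> j" "j < k"
  shows "fst (U j) = fst (U i)"
  using assms(2,3)
proof (induction j rule: dec_induct)
  case (step j)
  then show ?case
    using flat_turn(1)[of j] assms(1) by simp
qed simp

lemma flat_run_X:
  assumes "\<forall>j. i < j \<longrightarrow> j < k \<longrightarrow> flat j" "i \<le> j" "j \<le> k"
  shows "X j = X i + fst (U i) * (\<Sum>l=i..<j. len l)"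
  using assms(2,3)
proof (induction j rule: dec_induct)
  case (step j)
  then show ?case
    using flat_run_fst_U[OF assms(1), of j] by (simp add: X_step algebra_simps)
qed simp

text \<open>Reflections at the edges keep the horizontal component of the direction, so the abscissa
  moves monotonically; having left a cap towards an edge, the trajectory cannot return to that cap
  without meeting the other one.\<close>

lemma same_side_adjacent:
  assumes fl: "\<forall>j. i < j \<longrightarrow> j < k \<longrightarrow> flat j" and ik: "i < k"
    and side: "left i \<and> left k \<or> right i \<and> right k"
  shows "k = Suc i"
proof (rule ccontr)
  assume "k \<noteq> Suc i"
  then have k: "Suc i < k"
    using ik by simp
  have x1: "X (Suc i) = X i + fst (U i) * len i"
    by (simp add: X_step)
  have xk: "X k = X i + fst (U i) * (\<Sum>l=i..<k. len l)"
    using flat_run_X[OF fl, of k] ik by simp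
  have "(\<Sum>l=i..<k. len l) = len i + (\<Sum>l=Suc i..<k. len l)"
    using ik by (simp add: sum.atLeast_Suc_lessThan)
  then have xk': "X k = X (Suc i) + fst (U i) * (\<Sum>l=Suc i..<k. len l)"
    using xk x1 by (simp add: algebra_simps)
  have s: "(\<Sum>l=Suc i..<k. len l) \<ge> 0"
    using len_pos by (intro sum_nonneg less_imp_le) auto
  have f: "flat (Suc i)"
    using fl k by simp
  from side show False
  proof
    assume lr: "left i \<and> left k"
    then have "fst (U i) * len i > 0"
      using x1 f by linarith
    then have "fst (U i) > 0"
      using len_pos[of i] by (simp add: zero_less_mult_iff)
    then have "X k \<ge> X (Suc i)"
      using xk' s by simp
    then show False
      using lr f by linarith
  next
    assume lr: "right i \<and> right k"
    then have "fst (U i) * len i < 0"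
      using x1 f by linarith
    then have "fst (U i) < 0"
      using len_pos[of i] by (simp add: mult_less_0_iff)
    then have "X k \<le> X (Suc i)"
      using xk' s by (simp add: mult_nonpos_nonneg)
    then show False
      using lr f by linarith
  qed
qed

lemma crossing_length:
  assumes fl: "\<forall>j. i < j \<longrightarrow> j < k \<longrightarrow> flat j" and ik: "i < k"
    and side: "left i \<and> right k \<or> right i \<and> left k"
  shows "a \<le> (\<Sum>l=i..<k. len l)"
proof -
  have "X k - X i = fst (U i) * (\<Sum>l=i..<k. len l)"
    using flat_run_X[OF fl, of k] ik by simp
  then have "\<bar>X k - X i\<bar> = \<bar>fst (U i)\<bar> * (\<Sum>l=i..<k. len l)"
    using len_pos by (simp add: abs_mult sum_nonneg less_imp_le abs_of_nonneg)
  also have "\<dots> \<le> 1 * (\<Sum>l=i..<k. len l)"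
  proof (intro mult_right_mono sum_nonneg less_imp_le[OF len_pos])
    show "\<bar>fst (U i)\<bar> \<le> 1"
      using norm_fst_le[of "fst (U i)" "snd (U i)"] norm_U[of i] by simp
  qed
  finally show ?thesis
    using side by auto
qed

lemma not_in_stadium: "P k \<notin> stadium a"
  using frontier[of k] open_open_stadium[of a]
  by (simp add: frontier_def stadium_eq[OF a] interior_open)

end

section \<open>Comparison of two trajectories of the same combinatorial type\<close>

locale stadium_trajectory_pair =
  A: stadium_trajectory a n P + B: stadium_trajectory a n P' for a n P P' +
  assumes a8: "a \<ge> 8"
    and same_left: "\<And>k. fst (P k) \<le> -a/2 \<longleftrightarrow> fst (P' k) \<le> -a/2"
    and same_right: "\<And>k. a/2 \<le> fst (P k) \<longleftrightarrow> a/2 \<le> fst (P' k)"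
    and same_top: "\<And>k. snd (P k) > 0 \<longleftrightarrow> snd (P' k) > 0"
    and same_incidence: "\<And>k. cross (A.N k) (A.U k) \<ge> 0 \<longleftrightarrow> cross (B.N k) (B.U k) \<ge> 0"
    and same_fst_U: "\<And>k. fst (A.U k) \<ge> 0 \<longleftrightarrow> fst (B.U k) \<ge> 0"
    and same_snd_U: "\<And>k. snd (A.U k) \<ge> 0 \<longleftrightarrow> snd (B.U k) \<ge> 0"
begin

definition u :: "nat \<Rightarrow> real" where "u k = A.U k \<bullet> B.U k"
text \<open>Consider the pairing of the difference of directions with the displacement.
  \<open>S k\<close> is its growth during flight \<open>k\<close>, from \<open>out k\<close> to
  \<open>inc k\<close>, and \<open>T k\<close> is its drop at reflection \<open>k\<close>. The
  pairing is periodic, so \<open>S\<close> and \<open>T\<close> have the same sum over a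
  period.\<close>

definition T :: "nat \<Rightarrow> real" where "T k = 2 * (A.c k + B.c k) * (1 - A.N k \<bullet> B.N k)"
definition S :: "nat \<Rightarrow> real" where
  "S k = (A.U k - B.U k) \<bullet> ((P (Suc k) - P' (Suc k)) - (P k - P' k))"
definition out :: "nat \<Rightarrow> real" where "out k = (A.U k - B.U k) \<bullet> (P k - P' k)"
definition inc :: "nat \<Rightarrow> real" where "inc k = (A.U k - B.U k) \<bullet> (P (Suc k) - P' (Suc k))"

lemma inner_le_1: "norm x = 1 \<Longrightarrow> norm y = 1 \<Longrightarrow> x \<bullet> y \<le> 1" for x y :: point
  using norm_cauchy_schwarz[of x y] by simp

lemma T_nonneg: "T k \<ge> 0"
  unfolding T_def using A.c_pos[of k] B.c_pos[of k] inner_le_1[OF A.norm_N B.norm_N, of k k]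
  by (intro mult_nonneg_nonneg) auto

lemma u_le_1: "u k \<le> 1"
  unfolding u_def by (rule inner_le_1[OF A.norm_U B.norm_U])

lemma same_sign_mult: "(x \<ge> 0 \<longleftrightarrow> y \<ge> 0) \<Longrightarrow> x * y \<ge> 0" for x y :: real
  by (cases "x \<ge> 0") (auto simp: mult_nonpos_nonpos not_le less_imp_le)

lemma u_nonneg: "u k \<ge> 0"
  using same_sign_mult[OF same_fst_U[of k]] same_sign_mult[OF same_snd_U[of k]]
  by (simp add: u_def inner_prod_def)

lemma S_eq: "S k = (A.len k + B.len k) * (1 - u k)"
proof -
  have d: "(P (Suc k) - P' (Suc k)) - (P k - P' k) = A.len k *\<^sub>R A.U k - B.len k *\<^sub>R B.U k"
    using A.step[of k] B.step[of k] by simp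
  show ?thesis
    unfolding S_def u_def d
    by (simp add: inner_diff_left inner_diff_right A.norm_U B.norm_U dot_square_norm inner_commute algebra_simps)
qed

lemma S_eq_diff: "S k = inc k - out k"
  by (simp add: S_def inc_def out_def inner_diff_right)

lemma out_periodic: "out (k + n) = out k" and T_periodic: "T (k + n) = T k" and S_periodic: "S (k + n) = S k"
  using A.periodic[of k] B.periodic[of k] A.periodic[of "Suc k"] B.periodic[of "Suc k"]
    A.U_periodic[of k] B.U_periodic[of k] A.N_periodic[of k] B.N_periodic[of k]
    A.c_periodic[of k] B.c_periodic[of k]
  by (simp_all add: out_def T_def S_def)

lemma same_N_flat: "A.flat k \<Longrightarrow> A.N k = B.N k \<and> fst (A.N k) = 0 \<and> snd (P k) = snd (P' k)"
  using A.N_flat[of k] B.N_flat[of k] same_left[of k] same_right[of k] same_top[of k] by auto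

lemma displacement_arc: "\<not> A.flat k \<Longrightarrow> P k - P' k = - (A.N k - B.N k)"
  using A.N_left[of k] B.N_left[of k] A.N_right[of k] B.N_right[of k] same_left[of k] same_right[of k]
  by (auto simp: algebra_simps)

text \<open>On a cap both points are the centre minus the normal, so the displacement is minus the
  difference of the normals and the jump of the directions gives \<open>T\<close>. On an edge the
  normals agree and the displacement is horizontal, so there is no drop.\<close>

lemma inc_out: "inc k - out (Suc k) = T (Suc k)"
proof -
  define j where "j = Suc k"
  have "inc k - out j = - (((A.U j - A.U k) - (B.U j - B.U k)) \<bullet> (P j - P' j))"
    by (simp add: inc_def out_def j_def inner_diff_left algebra_simps)
  also have "(A.U j - A.U k) - (B.U j - B.U k) = (2 * A.c j) *\<^sub>R A.N j - (2 * B.c j) *\<^sub>R B.N j"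
    unfolding j_def A.turn B.turn ..
  also have "- (((2 * A.c j) *\<^sub>R A.N j - (2 * B.c j) *\<^sub>R B.N j) \<bullet> (P j - P' j)) = T j"
  proof (cases "A.flat j")
    case True
    then have "A.N j = B.N j" "fst (B.N j) = 0" "snd (P j) = snd (P' j)"
      using same_N_flat[OF True] by auto
    moreover have "B.N j \<bullet> B.N j = 1"
      by (simp add: dot_square_norm B.norm_N)
    ultimately show ?thesis
      by (simp add: T_def inner_prod_def)
  next
    case False
    show ?thesis
      unfolding displacement_arc[OF False] T_def
      by (simp add: inner_diff_left inner_diff_right A.norm_N B.norm_N dot_square_norm inner_commute algebra_simps)
  qed
  finally show ?thesis
    by (simp add: j_def)
qed

lemma T_flat: "A.flat k \<Longrightarrow> T k = 0"
  using same_N_flat[of k] by (simp add: T_def dot_square_norm B.norm_N)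

lemma out_square_le: "\<not> A.flat k \<Longrightarrow> (out k)\<^sup>2 \<le> 2 * (1 - u k) * T k"
proof -
  assume k: "\<not> A.flat k"
  have "(out k)\<^sup>2 = ((A.U k - B.U k) \<bullet> (A.N k - B.N k))\<^sup>2"
    unfolding out_def displacement_arc[OF k] inner_minus_right power2_minus ..
  also have "\<dots> \<le> 2 * (1 - A.U k \<bullet> B.U k) * (2 * (A.U k \<bullet> A.N k + B.U k \<bullet> B.N k) * (1 - A.N k \<bullet> B.N k))"
    using A.c_pos[of k] B.c_pos[of k] unfolding A.c_def B.c_def
    by (intro incidence_inequality A.norm_U B.norm_U A.norm_N B.norm_N same_sign_mult same_incidence)
  finally show ?thesis
    by (simp add: u_def T_def A.c_def B.c_def)
qed

text \<open>Time reversal of \<open>out_square_le\<close>: the reversed incoming direction is the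
  mirror image of the outgoing one, so \<open>cross\<close> changes its sign for both trajectories
  and they still come in on the same side of the normal.\<close>

lemma inc_square_le: "\<not> A.flat (Suc k) \<Longrightarrow> (inc k)\<^sup>2 \<le> 2 * (1 - u k) * T (Suc k)"
proof -
  assume k: "\<not> A.flat (Suc k)"
  have cr: "cross N (- V) = - cross N W" if "W - V = t *\<^sub>R N" for N V W :: point and t
  proof -
    have "W = V + t *\<^sub>R N"
      using that by (simp add: algebra_simps)
    then show ?thesis
      by (simp add: cross_def algebra_simps)
  qed
  have m: "- A.U k - (- B.U k) = - (A.U k - B.U k)"
    by simp
  have "(inc k)\<^sup>2 = ((- A.U k - (- B.U k)) \<bullet> (A.N (Suc k) - B.N (Suc k)))\<^sup>2"
    unfolding m inc_def displacement_arc[OF k] inner_minus_right inner_minus_left power2_minus ..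
  also have "\<dots> \<le> 2 * (1 - (- A.U k) \<bullet> (- B.U k))
      * (2 * ((- A.U k) \<bullet> A.N (Suc k) + (- B.U k) \<bullet> B.N (Suc k)) * (1 - A.N (Suc k) \<bullet> B.N (Suc k)))"
  proof (rule incidence_inequality)
    show "cross (A.N (Suc k)) (- A.U k) * cross (B.N (Suc k)) (- B.U k) \<ge> 0"
      unfolding cr[OF A.turn] cr[OF B.turn]
      using same_sign_mult[OF same_incidence[of "Suc k"]] by simp
  qed (use A.c_pos[of "Suc k"] B.c_pos[of "Suc k"] A.incoming[of k] B.incoming[of k]
        in \<open>simp_all add: A.norm_U B.norm_U A.norm_N B.norm_N\<close>)
  finally show ?thesis
    using A.incoming[of k] B.incoming[of k] by (simp add: u_def T_def)
qed

text \<open>Each flight is credited with half of the focusing at either end. The total over a period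
  is zero, while every run between consecutive cap reflections has a nonnegative sum; so none of
  these runs can have a surplus.\<close>

definition D :: "nat \<Rightarrow> real" where "D k = (T k + T (Suc k)) / 2 - S k"

lemma D_period_sum: "(\<Sum>k=i..<i + n. D k) = 0"
proof -
  have shift: "(\<Sum>k=i..<i + n. f (Suc k)) = (\<Sum>k=i..<i + n. f k)" if "f (i + n) = f i" for f :: "nat \<Rightarrow> real"
  proof -
    have "(\<Sum>k=i..<i + n. f (Suc k)) - (\<Sum>k=i..<i + n. f k) = f (i + n) - f i"
      unfolding sum_subtractf[symmetric] by (rule sum_Suc_diff') simp
    then show ?thesis
      using that by simp
  qed
  have "D k = (T k - T (Suc k)) / 2 - out (Suc k) + out k" for k
    unfolding D_def using S_eq_diff[of k] inc_out[of k] by (simp add: field_simps)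
  then have "(\<Sum>k=i..<i + n. D k) = ((\<Sum>k=i..<i + n. T k) - (\<Sum>k=i..<i + n. T (Suc k))) / 2
      - (\<Sum>k=i..<i + n. out (Suc k)) + (\<Sum>k=i..<i + n. out k)"
    by (simp add: sum.distrib sum_subtractf sum_divide_distrib[symmetric])
  also have "\<dots> = 0"
    using shift[of T, OF T_periodic] shift[of out, OF out_periodic] by simp
  finally show ?thesis .
qed

lemma flat_run_u:
  assumes fl: "\<forall>j. i < j \<longrightarrow> j < k \<longrightarrow> A.flat j" and "i \<le> j" "j < k"
  shows "u j = u i"
  using assms(2,3)
proof (induction j rule: dec_induct)
  case (step j)
  then have f: "A.flat (Suc j)"
    using fl by simp
  then have "B.flat (Suc j)"
    using same_left same_right by simp
  then have "u (Suc j) = u j"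
    using A.flat_turn[OF f] B.flat_turn unfolding u_def inner_prod_def by simp
  then show ?case
    using step by simp
qed simp

lemma flat_run_S:
  assumes fl: "\<forall>j. i < j \<longrightarrow> j < k \<longrightarrow> A.flat j" and ik: "i < k"
  shows "(\<Sum>j=i..<k. S j) = inc (k - 1) - out i"
    and "(\<Sum>j=i..<k. S j) = ((\<Sum>j=i..<k. A.len j) + (\<Sum>j=i..<k. B.len j)) * (1 - u i)"
    and "(\<Sum>j=i..<k. D j) = (T i + T k) / 2 - (\<Sum>j=i..<k. S j)"
proof -
  have "(\<Sum>j=i..<Suc m. S j) = inc m - out i" if "i \<le> m" "m < k" for m
    using that
  proof (induction m rule: dec_induct)
    case base
    then show ?case
      by (simp add: S_eq_diff)
  next
    case (step m)
    then have "A.flat (Suc m)"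
      using fl by simp
    then have "out (Suc m) = inc m"
      using inc_out[of m] T_flat by simp
    then show ?case
      using step by (simp add: S_eq_diff)
  qed
  from this[of "k - 1"] show "(\<Sum>j=i..<k. S j) = inc (k - 1) - out i"
    using ik by simp
  have "(\<Sum>j=i..<k. S j) = (\<Sum>j=i..<k. (A.len j + B.len j) * (1 - u i))"
  proof (intro sum.cong refl)
    fix j assume "j \<in> {i..<k}"
    then have "u j = u i"
      using flat_run_u[OF fl, of j] by simp
    then show "S j = (A.len j + B.len j) * (1 - u i)"
      by (simp only: S_eq)
  qed
  then show "(\<Sum>j=i..<k. S j) = ((\<Sum>j=i..<k. A.len j) + (\<Sum>j=i..<k. B.len j)) * (1 - u i)"
    by (simp only: sum_distrib_right[symmetric] sum.distrib)
  have "(\<Sum>j=i..<k. (T j + T (Suc j)) / 2) = (T i + T k) / 2"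
  proof -
    have "(\<Sum>j=i..<k. T j) = T i + (\<Sum>j=Suc i..<k. T j)"
      using ik by (simp add: sum.atLeast_Suc_lessThan)
    also have "(\<Sum>j=Suc i..<k. T j) = 0"
      using fl by (intro sum.neutral) (auto intro: T_flat)
    finally have 1: "(\<Sum>j=i..<k. T j) = T i"
      by simp
    have "(\<Sum>j=i..<k. T (Suc j)) - (\<Sum>j=i..<k. T j) = T k - T i"
      unfolding sum_subtractf[symmetric] using ik by (intro sum_Suc_diff') simp
    then show ?thesis
      using 1 by (simp add: sum_divide_distrib[symmetric] sum.distrib)
  qed
  then show "(\<Sum>j=i..<k. D j) = (T i + T k) / 2 - (\<Sum>j=i..<k. S j)"
    by (simp add: D_def sum_subtractf)
qed

text \<open>Let \<open>X\<close> be the spreading over the run and \<open>w = 1 - u i\<close>. The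
  length of both runs gives \<open>X \<ge> 16 * w\<close>, as \<open>a \<ge> 8\<close>, and the
  incidence inequality at both ends gives \<open>X^2 \<le> 4 * w * (T i + T k)\<close>. Eliminating
  \<open>w\<close> leaves the factor 1/4, strictly below the credited 1/2; this surplus decides the
  argument.\<close>

lemma crossing_S_le:
  assumes fl: "\<forall>j. i < j \<longrightarrow> j < k \<longrightarrow> A.flat j" and ik: "i < k"
    and side: "A.left i \<and> A.right k \<or> A.right i \<and> A.left k"
  shows "(\<Sum>j=i..<k. S j) \<le> (T i + T k) / 4" and "16 * (1 - u i) \<le> (\<Sum>j=i..<k. S j)"
proof -
  define w where "w = 1 - u i"
  define X where "X = (\<Sum>j=i..<k. S j)"
  have w0: "w \<ge> 0"
    using u_le_1[of i] by (simp add: w_def)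
  have flB: "\<forall>j. i < j \<longrightarrow> j < k \<longrightarrow> B.flat j"
    using fl same_left same_right by simp
  have LA: "a \<le> (\<Sum>j=i..<k. A.len j)"
    by (rule A.crossing_length[OF fl ik side])
  have LB: "a \<le> (\<Sum>j=i..<k. B.len j)"
    using side same_left same_right by (intro B.crossing_length[OF flB ik]) auto
  have "16 * w \<le> ((\<Sum>j=i..<k. A.len j) + (\<Sum>j=i..<k. B.len j)) * w"
    using LA LB a8 w0 by (intro mult_right_mono) auto
  then have X16: "16 * w \<le> X"
    unfolding X_def flat_run_S(2)[OF fl ik] w_def .
  then show "16 * (1 - u i) \<le> (\<Sum>j=i..<k. S j)"
    by (simp add: X_def w_def)
  obtain k' where k': "k = Suc k'" "i \<le> k'"
    using ik by (cases k) auto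
  have ni: "\<not> A.flat i" and nk: "\<not> A.flat (Suc k')"
    using side k' by auto
  have uk: "u k' = u i"
    using flat_run_u[OF fl, of k'] k' by simp
  have Xd: "X = inc k' - out i"
    unfolding X_def flat_run_S(1)[OF fl ik] by (simp add: k')
  have 1: "(inc k')\<^sup>2 \<le> 2 * w * T k"
    using inc_square_le[OF nk] by (simp add: uk w_def k')
  have 2: "(out i)\<^sup>2 \<le> 2 * w * T i"
    using out_square_le[OF ni] by (simp add: w_def)
  have "0 \<le> (inc k' + out i)\<^sup>2"
    by simp
  then have "X\<^sup>2 \<le> 2 * (inc k')\<^sup>2 + 2 * (out i)\<^sup>2"
    unfolding Xd by (simp add: power2_eq_square algebra_simps)
  then have "X\<^sup>2 \<le> 4 * w * (T i + T k)"
    using 1 2 by (simp add: algebra_simps)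
  also have "\<dots> \<le> (X / 4) * (T i + T k)"
    using X16 T_nonneg[of i] T_nonneg[of k] by (intro mult_right_mono) auto
  finally have "X * X \<le> X * ((T i + T k) / 4)"
    by (simp add: power2_eq_square)
  then show "(\<Sum>j=i..<k. S j) \<le> (T i + T k) / 4"
    using T_nonneg[of i] T_nonneg[of k] X16 w0
    by (cases "X = 0") (auto simp: X_def[symmetric] mult_le_cancel_left)
qed

text \<open>On a chord of a cap \<open>len = 2 * c\<close>, and \<open>c\<close> is the same at both
  ends. So spreading and focusing share the factor \<open>C\<close>, and
  \<open>chord_inequality\<close> compares the rest. Two chords that differ by a rotation give
  equality, so a surplus cannot be expected here.\<close>

lemma chord_S_le:
  assumes side: "A.left i \<and> A.left (Suc i) \<or> A.right i \<and> A.right (Suc i)"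
  shows "S i \<le> (T i + T (Suc i)) / 2"
proof -
  have chord: "c (Suc k) = c k \<and> N (Suc k) = N k - (2 * c k) *\<^sub>R U k \<and> len k = 2 * c k"
    if st: "P (Suc k) = P k + len k *\<^sub>R U k" and diff: "P (Suc k) - P k = N k - N (Suc k)"
      and inc: "U k \<bullet> N (Suc k) = - c (Suc k)" and ck: "c k = U k \<bullet> N k"
      and nU: "norm (U k) = 1" and nN: "norm (N k) = 1" "norm (N (Suc k)) = 1" and l: "len k > 0"
    for P N U :: "nat \<Rightarrow> point" and c len :: "nat \<Rightarrow> real" and k
  proof -
    have N: "N (Suc k) = N k - len k *\<^sub>R U k"
      using st diff by (simp add: algebra_simps)
    have "N (Suc k) \<bullet> N (Suc k) = N k \<bullet> N k - 2 * len k * (U k \<bullet> N k) + len k * len k * (U k \<bullet> U k)"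
      unfolding N by (simp add: inner_diff_left inner_diff_right inner_commute algebra_simps)
    then have "len k * (len k - 2 * c k) = 0"
      using nU nN by (auto simp: dot_square_norm ck algebra_simps)
    then have l2: "len k = 2 * c k"
      using l by simp
    have "U k \<bullet> N (Suc k) = c k - len k"
      unfolding N using nU by (simp add: inner_diff_right ck dot_square_norm)
    then have "c (Suc k) = c k"
      using inc l2 by simp
    then show ?thesis
      using N l2 by simp
  qed
  have A: "A.c (Suc i) = A.c i \<and> A.N (Suc i) = A.N i - (2 * A.c i) *\<^sub>R A.U i \<and> A.len i = 2 * A.c i"
  proof (rule chord)
    show "P (Suc i) - P i = A.N i - A.N (Suc i)"
      using side A.N_left[of i] A.N_left[of "Suc i"] A.N_right[of i] A.N_right[of "Suc i"] by auto
  qed (rule A.step A.incoming A.c_def A.norm_U A.norm_N A.len_pos)+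
  have B: "B.c (Suc i) = B.c i \<and> B.N (Suc i) = B.N i - (2 * B.c i) *\<^sub>R B.U i \<and> B.len i = 2 * B.c i"
  proof (rule chord)
    show "P' (Suc i) - P' i = B.N i - B.N (Suc i)"
      using side same_left[of i] same_left[of "Suc i"] same_right[of i] same_right[of "Suc i"]
        B.N_left[of i] B.N_left[of "Suc i"] B.N_right[of i] B.N_right[of "Suc i"] by auto
  qed (rule B.step B.incoming B.c_def B.norm_U B.norm_N B.len_pos)+
  define C where "C = A.c i + B.c i"
  have "A.N i \<bullet> B.N i + A.N (Suc i) \<bullet> B.N (Suc i) \<le> 2 * u i"
    using chord_inequality[OF A.norm_U B.norm_U A.norm_N B.norm_N, of i i i i] u_nonneg[of i] A B
    by (simp add: u_def A.c_def B.c_def)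
  then have "C * (A.N i \<bullet> B.N i + A.N (Suc i) \<bullet> B.N (Suc i)) \<le> C * (2 * u i)"
    using A.c_pos[of i] B.c_pos[of i] by (intro mult_left_mono) (auto simp: C_def)
  moreover have "T i = 2 * C * (1 - A.N i \<bullet> B.N i)" "T (Suc i) = 2 * C * (1 - A.N (Suc i) \<bullet> B.N (Suc i))"
    using A B by (simp_all add: T_def C_def)
  moreover have "S i = 2 * C * (1 - u i)"
    using A B by (simp add: S_eq C_def)
  ultimately show ?thesis
    by (simp add: algebra_simps)
qed

lemma arc_run_D_nonneg:
  assumes fl: "\<forall>j. i < j \<longrightarrow> j < k \<longrightarrow> A.flat j" and ik: "i < k"
    and arcs: "\<not> A.flat i" "\<not> A.flat k"
  shows "(\<Sum>j=i..<k. D j) \<ge> 0"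
proof (cases "A.left i \<and> A.right k \<or> A.right i \<and> A.left k")
  case True
  then show ?thesis
    using crossing_S_le(1)[OF fl ik True] T_nonneg[of i] T_nonneg[of k]
    unfolding flat_run_S(3)[OF fl ik] by simp
next
  case False
  then have s: "A.left i \<and> A.left k \<or> A.right i \<and> A.right k"
    using arcs by blast
  then have k: "k = Suc i"
    by (rule A.same_side_adjacent[OF fl ik])
  then show ?thesis
    using chord_S_le[of i] s by (simp add: D_def)
qed

lemma D_sum_nonneg:
  assumes "i \<le> k" and arcs: "\<not> A.flat i" "\<not> A.flat k"
  shows "(\<Sum>j=i..<k. D j) \<ge> 0"
  using assms(1,3)
proof (induction k rule: less_induct)
  case (less k)
  show ?case
  proof (cases "i = k")
    case False
    define J where "J = {j. i \<le> j \<and> j < k \<and> \<not> A.flat j}"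
    have J: "finite J" "i \<in> J"
      using False less.prems(1) arcs(1) finite_subset[of J "{..<k}"] by (simp_all add: J_def subset_eq)
    \<comment> \<open>The last cap reflection before \<open>k\<close>: from there to
      \<open>k\<close> only edges are met.\<close>
    define m where "m = Max J"
    have "m \<in> J"
      unfolding m_def using J by (intro Max_in) auto
    then have m: "i \<le> m" "m < k" "\<not> A.flat m"
      by (auto simp: J_def)
    have fl: "\<forall>j. m < j \<longrightarrow> j < k \<longrightarrow> A.flat j"
    proof (intro allI impI, rule ccontr)
      fix j assume j: "m < j" "j < k" "\<not> A.flat j"
      then have "j \<in> J"
        using m by (auto simp: J_def)
      then show False
        using Max_ge[OF J(1)] j(1) by (fastforce simp: m_def)
    qed
    have "(\<Sum>j=i..<k. D j) = (\<Sum>j=i..<m. D j) + (\<Sum>j=m..<k. D j)"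
      using m by (simp add: sum.atLeastLessThan_concat)
    then show ?thesis
      using less.IH[of m] arc_run_D_nonneg[OF fl m(2,3) less.prems(2)] m by simp
  qed simp
qed

text \<open>The next vertex is the first boundary point on the ray: if the lengths differed, the end
  of the shorter flight would lie in the open side of the other trajectory, hence inside the open
  stadium.\<close>

lemma eq_step:
  assumes "P k = P' k" "A.U k = B.U k"
  shows "P (Suc k) = P' (Suc k)" "A.U (Suc k) = B.U (Suc k)"
proof -
  have between: "q + s *\<^sub>R v \<in> open_segment q (q + t *\<^sub>R v)" if "0 < s" "s < t" "v \<noteq> 0" for q v :: point and s t
  proof -
    have "q + s *\<^sub>R v = (1 - s / t) *\<^sub>R q + (s / t) *\<^sub>R (q + t *\<^sub>R v)"
      using that by (simp add: scaleR_right_distrib scaleR_left_diff_distrib)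
    moreover have "q \<noteq> q + t *\<^sub>R v" "0 < s / t" "s / t < 1"
      using that by auto
    ultimately show ?thesis
      unfolding in_segment by blast
  qed
  have nz: "B.U k \<noteq> 0"
    using B.norm_U[of k] by auto
  have "A.len k = B.len k"
  proof (rule ccontr)
    assume "A.len k \<noteq> B.len k"
    then consider "A.len k < B.len k" | "B.len k < A.len k"
      by linarith
    then show False
    proof cases
      case 1
      then have "P (Suc k) \<in> open_segment (P' k) (P' (Suc k))"
        unfolding A.step[of k] B.step[of k] assms using A.len_pos nz by (intro between) auto
      then show False
        using B.segment[of k] A.not_in_stadium by blast
    next
      case 2
      then have "P' (Suc k) \<in> open_segment (P k) (P (Suc k))"
        unfolding A.step[of k] B.step[of k] assms using B.len_pos nz by (intro between) auto
      then show False
        using A.segment[of k] B.not_in_stadium by blast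
    qed
  qed
  then show P: "P (Suc k) = P' (Suc k)"
    unfolding A.step[of k] B.step[of k] assms by simp
  then have N: "A.N (Suc k) = B.N (Suc k)"
    by (simp add: A.N_def B.N_def)
  then have "A.c (Suc k) = B.c (Suc k)"
    using A.incoming[of k] B.incoming[of k] assms by simp
  then show "A.U (Suc k) = B.U (Suc k)"
    using A.turn[of k] B.turn[of k] N assms by (simp add: algebra_simps)
qed

text \<open>A period that meets both caps contains a crossing from left to right. The rest of the
  period has a nonnegative sum of \<open>D\<close>, so the crossing has no surplus: focusing and
  spreading vanish there, which makes position and direction agree at \<open>i\<close>, and these
  determine everything afterwards.\<close>

theorem trajectories_equal:
  assumes L: "\<exists>k. A.left k" and R: "\<exists>k. A.right k"
  shows "P k = P' k"
proof -
  obtain l where l: "A.left l"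
    using L by blast
  obtain r where r: "A.right r"
    using R by blast
  have per: "P (r + m * n) = P r" for m
    by (induction m) (use A.periodic[of "r + _ * n"] in \<open>simp_all add: algebra_simps\<close>)
  have "l \<le> l * n"
    using A.n by simp
  then have "l < r + Suc l * n"
    using A.n unfolding mult_Suc by linarith
  then have "\<exists>k. k > l \<and> A.right k"
    using r per[of "Suc l"] by (intro exI[of _ "r + Suc l * n"]) simp
  \<comment> \<open>The first reflection on the right after \<open>l\<close>; below,
    \<open>i\<close> is the last one on the left before \<open>k0\<close>, so between them only
    edges are met.\<close>
  define k0 where "k0 = (LEAST k. k > l \<and> A.right k)"
  have k0: "k0 > l" "A.right k0"
    using LeastI_ex[OF \<open>\<exists>k. k > l \<and> A.right k\<close>] by (auto simp: k0_def)
  have k0_least: "\<not> A.right j" if "l < j" "j < k0" for j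
    using not_less_Least[of j "\<lambda>k. k > l \<and> A.right k"] that by (auto simp: k0_def)
  define J where "J = {j. l \<le> j \<and> j < k0 \<and> A.left j}"
  have J: "finite J" "l \<in> J"
    using k0(1) l finite_subset[of J "{..<k0}"] by (simp_all add: J_def subset_eq)
  define i where "i = Max J"
  have "i \<in> J"
    unfolding i_def using J by (intro Max_in) auto
  then have i: "l \<le> i" "i < k0" "A.left i"
    by (auto simp: J_def)
  have fl: "\<forall>j. i < j \<longrightarrow> j < k0 \<longrightarrow> A.flat j"
  proof (intro allI impI conjI)
    fix j assume j: "i < j" "j < k0"
    show "\<not> A.left j"
    proof
      assume "A.left j"
      then have "j \<in> J"
        using i j by (auto simp: J_def)
      then show False
        using Max_ge[OF J(1)] j(1) by (fastforce simp: i_def)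
    qed
    show "\<not> A.right j"
      using k0_least i j by simp
  qed
  have side: "A.left i \<and> A.right k0 \<or> A.right i \<and> A.left k0"
    using i k0 by simp
  have arc_i: "\<not> A.flat i" "\<not> A.flat (i + n)" and arc_k0: "\<not> A.flat k0"
    using i k0 A.periodic[of i] by auto
  have k0n: "k0 \<le> i + n"
  proof (rule ccontr)
    assume "\<not> k0 \<le> i + n"
    then have "A.flat (i + n)"
      using fl A.n by simp
    then show False
      using arc_i by simp
  qed
  have "0 = (\<Sum>j=i..<i + n. D j)"
    by (simp add: D_period_sum)
  also have "\<dots> = (\<Sum>j=i..<k0. D j) + (\<Sum>j=k0..<i + n. D j)"
    using i k0n by (simp add: sum.atLeastLessThan_concat)
  finally have "(\<Sum>j=i..<k0. D j) \<le> 0"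
    using D_sum_nonneg[OF k0n arc_k0 arc_i(2)] by simp
  then have T0: "T i + T k0 \<le> 0"
    using crossing_S_le(1)[OF fl i(2) side] unfolding flat_run_S(3)[OF fl i(2)] by simp
  have Ti: "T i = 0"
    using T0 T_nonneg[of i] T_nonneg[of k0] by linarith
  have eq1: "x = y" if "x \<bullet> y = 1" "norm x = 1" "norm y = 1" for x y :: point
  proof -
    have "(x - y) \<bullet> (x - y) = x \<bullet> x - 2 * (x \<bullet> y) + y \<bullet> y"
      unfolding inner_diff_left inner_diff_right using inner_commute[of y x] by simp
    also have "\<dots> = 0"
      using that by (simp add: dot_square_norm)
    finally show ?thesis
      by simp
  qed
  have "A.N i \<bullet> B.N i = 1"
    using Ti A.c_pos[of i] B.c_pos[of i] by (simp add: T_def)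
  then have "A.N i = B.N i"
    by (rule eq1) (simp_all add: A.norm_N B.norm_N)
  then have Pi: "P i = P' i"
    using displacement_arc[OF arc_i(1)] by simp
  have "16 * (1 - u i) \<le> 0"
    using crossing_S_le[OF fl i(2) side] T0 by simp
  then have "A.U i \<bullet> B.U i = 1"
    using u_le_1[of i] by (simp add: u_def)
  then have Ui: "A.U i = B.U i"
    by (rule eq1) (simp_all add: A.norm_U B.norm_U)
  have all: "P (i + m) = P' (i + m) \<and> A.U (i + m) = B.U (i + m)" for m
    by (induction m) (use Pi Ui eq_step in auto)
  have pA: "P (k + m * n) = P k" for m
    by (induction m) (use A.periodic[of "k + _ * n"] in \<open>simp_all add: algebra_simps\<close>)
  have pB: "P' (k + m * n) = P' k" for m
    by (induction m) (use B.periodic[of "k + _ * n"] in \<open>simp_all add: algebra_simps\<close>)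
  have "i \<le> k + i * n"
    using A.n by (simp add: trans_le_add2)
  then have "P (k + i * n) = P' (k + i * n)"
    using all[of "k + i * n - i"] by simp
  then show ?thesis
    using pA[of i] pB[of i] by simp
qed

end

text \<open>A word over a finite alphabet. The sign of \<open>cross\<close> is the side of incidence
  that \<open>incidence_inequality\<close> asks for; the signs of the components of \<open>U\<close>
  make corresponding directions enclose at most a right angle, as \<open>chord_inequality\<close>
  asks.\<close>

definition trajectory_code :: "real \<Rightarrow> point list \<Rightarrow> (bool \<times> bool \<times> bool \<times> bool \<times> bool \<times> bool) list" where
  "trajectory_code a ps = map (\<lambda>k.
     let P = (\<lambda>k. ps ! (k mod length ps)); U = sgn (P (Suc k) - P k) in
       (fst (P k) \<le> -a/2, a/2 \<le> fst (P k), snd (P k) > 0,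
        cross (inward_normal a (P k)) U \<ge> 0, fst U \<ge> 0, snd U \<ge> 0)) [0..<length ps]"

lemma closed_trajectory_interpret:
  assumes a: "a > 0" and ps: "closed_billiard_trajectory (stadium a) ps"
  shows "stadium_trajectory a (length ps) (\<lambda>k. ps ! (k mod length ps))"
proof -
  define n where "n = length ps"
  define P where "P k = ps ! (k mod n)" for k
  have n: "n \<ge> 2" and *: "\<And>k. k < n \<Longrightarrow> P k \<in> frontier (stadium a) \<and> P k \<noteq> P (k + 1) \<and>
       open_segment (P k) (P (k + 1)) \<subseteq> stadium a \<and> reflects (stadium a) (P k) (P (k + 1)) (P (k + 2))"
    using ps unfolding closed_billiard_trajectory_def Let_def n_def P_def by auto
  have mod: "P (k mod n + j) = P (k + j)" for k j
    by (simp add: P_def mod_add_left_eq)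
  have all: "P k \<in> frontier (stadium a) \<and> P k \<noteq> P (Suc k) \<and>
       open_segment (P k) (P (Suc k)) \<subseteq> stadium a \<and> reflects (stadium a) (P k) (P (Suc k)) (P (Suc (Suc k)))" for k
    using *[of "k mod n"] n mod[of k 0] mod[of k 1] mod[of k 2] by simp
  have "stadium_trajectory a n P"
  proof
    show "P (k + n) = P k" for k
      by (simp add: P_def)
  qed (use a n all in auto)
  then show ?thesis
    unfolding n_def P_def .
qed

lemma perimeter_eq_sum_len:
  assumes "stadium_trajectory a (length ps) (\<lambda>k. ps ! (k mod length ps))"
  shows "perimeter ps = (\<Sum>k<length ps. stadium_trajectory.len (\<lambda>k. ps ! (k mod length ps)) k)"
proof -
  interpret stadium_trajectory a "length ps" "\<lambda>k. ps ! (k mod length ps)"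
    by fact
  show ?thesis
    unfolding perimeter_def len_def by (intro sum.cong) auto
qed

lemma trajectory_code_inj:
  assumes a: "a \<ge> 8"
    and ps: "closed_billiard_trajectory (stadium a) ps" and qs: "closed_billiard_trajectory (stadium a) qs"
    and L: "\<exists>p\<in>set ps. fst p \<le> -a/2" and R: "\<exists>p\<in>set ps. a/2 \<le> fst p"
    and code: "trajectory_code a ps = trajectory_code a qs"
  shows "ps = qs"
proof -
  define n where "n = length ps"
  have n: "length qs = n"
    using arg_cong[OF code, of length] by (simp add: trajectory_code_def n_def)
  define P where "P k = ps ! (k mod n)" for k
  define P' where "P' k = qs ! (k mod n)" for k
  interpret A: stadium_trajectory a n P
    using closed_trajectory_interpret[OF _ ps] a unfolding n_def P_def by simp
  interpret B: stadium_trajectory a n P'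
    using closed_trajectory_interpret[OF _ qs] a n unfolding P'_def by simp
  have c: "(A.left k \<longleftrightarrow> B.left k) \<and> (A.right k \<longleftrightarrow> B.right k) \<and> (snd (P k) > 0 \<longleftrightarrow> snd (P' k) > 0)
      \<and> (cross (A.N k) (A.U k) \<ge> 0 \<longleftrightarrow> cross (B.N k) (B.U k) \<ge> 0)
      \<and> (fst (A.U k) \<ge> 0 \<longleftrightarrow> fst (B.U k) \<ge> 0) \<and> (snd (A.U k) \<ge> 0 \<longleftrightarrow> snd (B.U k) \<ge> 0)" if "k < n" for k
  proof -
    have "trajectory_code a ps ! k = trajectory_code a qs ! k"
      by (simp only: code)
    then show ?thesis
      using that n n_def
      by (simp add: trajectory_code_def Let_def A.N_def A.U_def B.N_def B.U_def P_def P'_def)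
  qed
  have md: "A.U (k mod n) = A.U k" "A.N (k mod n) = A.N k" "P (k mod n) = P k"
    "B.U (k mod n) = B.U k" "B.N (k mod n) = B.N k" "P' (k mod n) = P' k" for k
    by (simp_all add: A.U_def A.N_def B.U_def B.N_def P_def P'_def mod_Suc_eq)
  have c': "(A.left k \<longleftrightarrow> B.left k) \<and> (A.right k \<longleftrightarrow> B.right k) \<and> (snd (P k) > 0 \<longleftrightarrow> snd (P' k) > 0)
      \<and> (cross (A.N k) (A.U k) \<ge> 0 \<longleftrightarrow> cross (B.N k) (B.U k) \<ge> 0)
      \<and> (fst (A.U k) \<ge> 0 \<longleftrightarrow> fst (B.U k) \<ge> 0) \<and> (snd (A.U k) \<ge> 0 \<longleftrightarrow> snd (B.U k) \<ge> 0)" for k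
    using c[of "k mod n"] A.n unfolding md by simp
  interpret stadium_trajectory_pair a n P P'
    by unfold_locales (use a c' in blast)+
  have ex: "\<exists>k. Q (P k)" if ps: "\<exists>p\<in>set ps. Q p" for Q
  proof -
    obtain i where i: "i < n" "Q (ps ! i)"
      using ps by (auto simp: in_set_conv_nth n_def)
    then have "Q (P i)"
      by (simp add: P_def)
    then show ?thesis ..
  qed
  have "P k = P' k" for k
    using trajectories_equal ex[OF L] ex[OF R] by blast
  then show ?thesis
    using n by (intro nth_equalityI) (simp_all add: n_def P_def P'_def, metis mod_less)
qed

theorem countable_length_spectrum_stadium:
  assumes a: "a \<ge> 8"
  shows "countable (length_spectrum (stadium a))"
proof -
  define C where "C = {ps. closed_billiard_trajectory (stadium a) ps \<and>
      (\<exists>p\<in>set ps. fst p \<le> -a/2) \<and> (\<exists>p\<in>set ps. a/2 \<le> fst p)}"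
  have "inj_on (trajectory_code a) C"
    using trajectory_code_inj[OF a] by (auto simp: inj_on_def C_def)
  then have "countable C"
    using countable_image_inj_eq countableI_type by blast
  have "length_spectrum (stadium a) \<subseteq> perimeter ` C \<union> range (\<lambda>n::nat. 2 * real n)"
  proof
    fix l assume "l \<in> length_spectrum (stadium a)"
    then obtain ps where ps: "closed_billiard_trajectory (stadium a) ps" "l = perimeter ps"
      unfolding length_spectrum_def by blast
    have st: "stadium_trajectory a (length ps) (\<lambda>k. ps ! (k mod length ps))"
      using closed_trajectory_interpret[OF _ ps(1)] a by simp
    interpret stadium_trajectory a "length ps" "\<lambda>k. ps ! (k mod length ps)"
      by (rule st)
    show "l \<in> perimeter ` C \<union> range (\<lambda>n::nat. 2 * real n)"
    proof (cases "ps \<in> C")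
      case False
      have mem: "ps ! (k mod length ps) \<in> set ps" for k
        using n by (intro nth_mem mod_less_divisor) linarith
      from False consider "\<And>k. \<not> left k" | "\<And>k. \<not> right k"
        using ps(1) mem unfolding C_def by blast
      then have "len k = 2" for k
        by cases (blast intro: no_left_vertical no_right_vertical)+
      then have "l = 2 * real (length ps)"
        using perimeter_eq_sum_len[OF st] ps(2) by simp
      then show ?thesis
        by blast
    qed (use ps in auto)
  qed
  moreover have "countable (perimeter ` C \<union> range (\<lambda>n::nat. 2 * real n))"
    using \<open>countable C\<close> by (intro countable_Un countable_image) auto
  ultimately show ?thesis
    by (rule countable_subset)
qed

section \<open>The velocity of the family along the caps\<close>

lemma arc_dom_eq: "arc_dom = {-(pi/2)..pi/2}"
  by (simp add: arc_dom_def)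

lemma arc_dom_ends [simp]: "pi/2 \<in> arc_dom" "-(pi/2) \<in> arc_dom" "-pi/2 \<in> arc_dom" "0 \<in> arc_dom"
  by (simp_all add: arc_dom_eq)

lemma arc_dom_minus: "s \<in> arc_dom \<Longrightarrow> - s \<in> arc_dom"
  by (auto simp: arc_dom_eq)

lemma compact_arc_dom: "compact arc_dom"
  by (simp add: arc_dom_def)

lemma arc_vector_derivative_eq:
  fixes f :: "real \<Rightarrow> point"
  assumes "s \<in> arc_dom" "(f has_vector_derivative d) (at s within arc_dom)"
  shows "vector_derivative f (at s within arc_dom) = d"
  using assms unfolding arc_dom_def by (intro vector_derivative_within_closed_interval) auto

lemma arc_deriv_has_vector_derivative:
  assumes "Cr_on_arc r f" "k < r" "s \<in> arc_dom"
  shows "(arc_deriv k f has_vector_derivative arc_deriv (Suc k) f s) (at s within arc_dom)"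
  using assms by (simp add: Cr_on_arc_def vector_derivative_works[symmetric])

lemma continuous_on_arc_deriv:
  assumes "Cr_on_arc r f" "k \<le> r"
  shows "continuous_on arc_dom (arc_deriv k f)"
proof (cases "k = r")
  case False
  then show ?thesis
    using assms arc_deriv_has_vector_derivative[of r f k]
    by (auto simp: continuous_on_eq_continuous_within intro: has_vector_derivative_continuous)
qed (use assms in \<open>simp add: Cr_on_arc_def\<close>)

text \<open>\<open>vector_derivative\<close> has no meaning where no derivative exists, so linearity
  is available only on \<open>arc_dom\<close> and up to the order \<open>r\<close>, and is proved by
  induction on the order.\<close>

lemma arc_deriv_linear_combination:
  assumes f: "Cr_on_arc r f" and g: "Cr_on_arc r g"
  shows "k \<le> r \<Longrightarrow> s \<in> arc_dom \<Longrightarrow>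
    arc_deriv k (\<lambda>s. \<alpha> *\<^sub>R f s + \<beta> *\<^sub>R g s) s = \<alpha> *\<^sub>R arc_deriv k f s + \<beta> *\<^sub>R arc_deriv k g s"
    and "Cr_on_arc r (\<lambda>s. \<alpha> *\<^sub>R f s + \<beta> *\<^sub>R g s)"
proof -
  let ?h = "\<lambda>s. \<alpha> *\<^sub>R f s + \<beta> *\<^sub>R g s"
  have deriv: "(arc_deriv k ?h has_vector_derivative
        \<alpha> *\<^sub>R arc_deriv (Suc k) f s + \<beta> *\<^sub>R arc_deriv (Suc k) g s) (at s within arc_dom)"
    if eq: "\<And>s. s \<in> arc_dom \<Longrightarrow> arc_deriv k ?h s = \<alpha> *\<^sub>R arc_deriv k f s + \<beta> *\<^sub>R arc_deriv k g s"
      and k: "k < r" and s: "s \<in> arc_dom" for k s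
  proof (rule has_vector_derivative_transform[OF s eq])
    show "((\<lambda>s. \<alpha> *\<^sub>R arc_deriv k f s + \<beta> *\<^sub>R arc_deriv k g s) has_vector_derivative
        \<alpha> *\<^sub>R arc_deriv (Suc k) f s + \<beta> *\<^sub>R arc_deriv (Suc k) g s) (at s within arc_dom)"
      by (intro has_vector_derivative_add
          bounded_linear.has_vector_derivative[OF bounded_linear_scaleR_right]
          arc_deriv_has_vector_derivative[OF f k s] arc_deriv_has_vector_derivative[OF g k s])
  qed
  have eq: "arc_deriv k ?h s = \<alpha> *\<^sub>R arc_deriv k f s + \<beta> *\<^sub>R arc_deriv k g s" if "k \<le> r" "s \<in> arc_dom" for k s
    using that
  proof (induction k arbitrary: s)
    case (Suc k)
    then show ?case
      using arc_vector_derivative_eq[OF Suc.prems(2) deriv[OF Suc.IH _ Suc.prems(2)]] by simp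
  qed simp
  then show "k \<le> r \<Longrightarrow> s \<in> arc_dom \<Longrightarrow> arc_deriv k ?h s = \<alpha> *\<^sub>R arc_deriv k f s + \<beta> *\<^sub>R arc_deriv k g s"
    by blast
  show "Cr_on_arc r ?h"
    unfolding Cr_on_arc_def
  proof (intro conjI allI impI ballI)
    fix k s assume "k < r" "s \<in> arc_dom"
    then show "arc_deriv k ?h differentiable (at s within arc_dom)"
      using deriv[of k s] eq[of k] by (auto intro: differentiableI_vector)
  next
    have "continuous_on arc_dom (\<lambda>s. \<alpha> *\<^sub>R arc_deriv r f s + \<beta> *\<^sub>R arc_deriv r g s)"
      using f g by (intro continuous_intros continuous_on_arc_deriv) auto
    then show "continuous_on arc_dom (arc_deriv r ?h)"
      by (rule continuous_on_eq) (simp add: eq)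
  qed
qed

lemma norm_arc_deriv_le_Cr_norm:
  assumes f: "Cr_on_arc r f" and k: "k \<le> r" and s: "s \<in> arc_dom"
  shows "norm (arc_deriv k f s) \<le> Cr_norm r f"
proof -
  have bdd: "bdd_above ((\<lambda>s. norm (arc_deriv j f s)) ` arc_dom)" if "j \<le> r" for j
    using f that
    by (intro bounded_imp_bdd_above compact_imp_bounded compact_continuous_image compact_arc_dom
        continuous_on_norm continuous_on_arc_deriv)
  have le: "norm (arc_deriv j f s) \<le> (SUP s\<in>arc_dom. norm (arc_deriv j f s))" if "j \<le> r" for j
    by (rule cSUP_upper[OF s bdd[OF that]])
  have "norm (arc_deriv k f s) \<le> (SUP s\<in>arc_dom. norm (arc_deriv k f s))"
    by (rule le[OF k])
  also have "\<dots> \<le> Cr_norm r f"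
    unfolding Cr_norm_def
    using k order_trans[OF norm_ge_zero le] by (intro member_le_sum) auto
  finally show ?thesis .
qed

text \<open>By linearity of \<open>arc_deriv\<close>, the norm of the difference quotient error
  dominates the error of each of its derivatives. Later arguments use pointwise limits for the
  derivatives, and uniformity in the parameter only for the curves themselves.\<close>

lemma C1_into_CrE:
  assumes g: "C1_into_Cr r g"
  obtains D where "Cr_on_arc r (D 0)"
    "\<And>k s \<tau>. k \<le> r \<Longrightarrow> s \<in> arc_dom \<Longrightarrow> \<tau> \<in> {-1..1} \<Longrightarrow>
       ((\<lambda>t. (arc_deriv k (g t) s - arc_deriv k (g \<tau>) s) /\<^sub>R (t - \<tau>)) \<longlongrightarrow> arc_deriv k (D \<tau>) s) (at \<tau> within {-1..1})"
    "\<And>\<tau> e. \<tau> \<in> {-1..1} \<Longrightarrow> e > 0 \<Longrightarrow>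
       \<exists>d>0. \<forall>t\<in>{-1..1}. t \<noteq> \<tau> \<longrightarrow> \<bar>t - \<tau>\<bar> < d \<longrightarrow> (\<forall>s\<in>arc_dom. norm ((g t s - g \<tau> s) /\<^sub>R (t - \<tau>) - D \<tau> s) < e)"
    "\<And>\<tau> e. \<tau> \<in> {-1..1} \<Longrightarrow> e > 0 \<Longrightarrow>
       \<exists>d>0. \<forall>t\<in>{-1..1}. \<bar>t - \<tau>\<bar> < d \<longrightarrow> (\<forall>s\<in>arc_dom. norm (g t s - g \<tau> s) < e)"
proof -
  obtain D where Cg: "\<And>\<tau>. \<tau> \<in> {-1..1} \<Longrightarrow> Cr_on_arc r (g \<tau>)" and CD: "\<And>\<tau>. \<tau> \<in> {-1..1} \<Longrightarrow> Cr_on_arc r (D \<tau>)"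
    and lim: "\<And>\<tau>. \<tau> \<in> {-1..1} \<Longrightarrow>
      ((\<lambda>t. Cr_norm r (\<lambda>s. (g t s - g \<tau> s) /\<^sub>R (t - \<tau>) - D \<tau> s)) \<longlongrightarrow> 0) (at \<tau> within {-1..1})"
    using g unfolding C1_into_Cr_def by blast
  have quot: "norm ((arc_deriv k (g t) s - arc_deriv k (g \<tau>) s) /\<^sub>R (t - \<tau>) - arc_deriv k (D \<tau>) s)
       \<le> Cr_norm r (\<lambda>s. (g t s - g \<tau> s) /\<^sub>R (t - \<tau>) - D \<tau> s)"
    if k: "k \<le> r" and s: "s \<in> arc_dom" and \<tau>: "\<tau> \<in> {-1..1}" and t: "t \<in> {-1..1}" for k s \<tau> t
  proof -
    define c where "c = inverse (t - \<tau>)"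
    note l1 = arc_deriv_linear_combination[OF Cg[OF t] Cg[OF \<tau>], where \<alpha> = c and \<beta> = "-c"]
    note l2 = arc_deriv_linear_combination[OF l1(2) CD[OF \<tau>], where \<alpha> = 1 and \<beta> = "-1"]
    have fn: "(\<lambda>s. (g t s - g \<tau> s) /\<^sub>R (t - \<tau>) - D \<tau> s)
        = (\<lambda>s. 1 *\<^sub>R (c *\<^sub>R g t s + (-c) *\<^sub>R g \<tau> s) + (-1) *\<^sub>R D \<tau> s)"
      by (simp add: c_def algebra_simps)
    have "arc_deriv k (\<lambda>s. (g t s - g \<tau> s) /\<^sub>R (t - \<tau>) - D \<tau> s) s
        = (arc_deriv k (g t) s - arc_deriv k (g \<tau>) s) /\<^sub>R (t - \<tau>) - arc_deriv k (D \<tau>) s"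
      unfolding fn l2(1)[OF k s] l1(1)[OF k s] by (simp add: c_def algebra_simps)
    moreover have "Cr_on_arc r (\<lambda>s. (g t s - g \<tau> s) /\<^sub>R (t - \<tau>) - D \<tau> s)"
      unfolding fn by (rule l2(2))
    ultimately show ?thesis
      using norm_arc_deriv_le_Cr_norm[of r "\<lambda>s. (g t s - g \<tau> s) /\<^sub>R (t - \<tau>) - D \<tau> s", OF _ k s]
      by (simp only:)
  qed
  have uq: "\<exists>d>0. \<forall>t\<in>{-1..1}. t \<noteq> \<tau> \<longrightarrow> \<bar>t - \<tau>\<bar> < d \<longrightarrow> (\<forall>s\<in>arc_dom. norm ((g t s - g \<tau> s) /\<^sub>R (t - \<tau>) - D \<tau> s) < e)"
    if \<tau>: "\<tau> \<in> {-1..1}" and e: "e > 0" for \<tau> e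
  proof -
    have "\<forall>\<^sub>F t in at \<tau> within {-1..1}. dist (Cr_norm r (\<lambda>s. (g t s - g \<tau> s) /\<^sub>R (t - \<tau>) - D \<tau> s)) 0 < e"
      using lim[OF \<tau>] e by (rule tendstoD)
    then obtain d where d: "d > 0" "\<And>t. t \<in> {-1..1} \<Longrightarrow> t \<noteq> \<tau> \<Longrightarrow> dist t \<tau> < d \<Longrightarrow>
        dist (Cr_norm r (\<lambda>s. (g t s - g \<tau> s) /\<^sub>R (t - \<tau>) - D \<tau> s)) 0 < e"
      unfolding eventually_at by blast
    show ?thesis
    proof (intro exI[of _ d] conjI ballI impI)
      fix t s assume t: "t \<in> {-1..1}" "t \<noteq> \<tau>" "\<bar>t - \<tau>\<bar> < d" and s: "s \<in> arc_dom"
      have "norm ((g t s - g \<tau> s) /\<^sub>R (t - \<tau>) - D \<tau> s) \<le> Cr_norm r (\<lambda>s. (g t s - g \<tau> s) /\<^sub>R (t - \<tau>) - D \<tau> s)"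
        using quot[of 0 s \<tau> t] s \<tau> t by simp
      also have "\<dots> < e"
        using d(2)[of t] t by (simp add: dist_real_def)
      finally show "norm ((g t s - g \<tau> s) /\<^sub>R (t - \<tau>) - D \<tau> s) < e" .
    qed (rule d)
  qed
  show ?thesis
  proof (rule that[of D])
    show "Cr_on_arc r (D 0)"
      by (rule CD) simp
    show "((\<lambda>t. (arc_deriv k (g t) s - arc_deriv k (g \<tau>) s) /\<^sub>R (t - \<tau>)) \<longlongrightarrow> arc_deriv k (D \<tau>) s) (at \<tau> within {-1..1})"
      if "k \<le> r" "s \<in> arc_dom" "\<tau> \<in> {-1..1}" for k s \<tau>
    proof (rule Lim_transform_bound[OF _ lim[OF that(3)], THEN LIM_zero_cancel])
      show "\<forall>\<^sub>F t in at \<tau> within {-1..1}.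
          norm ((arc_deriv k (g t) s - arc_deriv k (g \<tau>) s) /\<^sub>R (t - \<tau>) - arc_deriv k (D \<tau>) s)
          \<le> norm (Cr_norm r (\<lambda>s. (g t s - g \<tau> s) /\<^sub>R (t - \<tau>) - D \<tau> s))"
        unfolding eventually_at using quot[OF that(1,2,3)]
        by (intro exI[of _ 1]) (auto intro: order_trans[OF _ abs_ge_self])
    qed
    show "\<exists>d>0. \<forall>t\<in>{-1..1}. \<bar>t - \<tau>\<bar> < d \<longrightarrow> (\<forall>s\<in>arc_dom. norm (g t s - g \<tau> s) < e)"
      if \<tau>: "\<tau> \<in> {-1..1}" and e: "e > 0" for \<tau> e
    proof -
      have "continuous_on arc_dom (arc_deriv 0 (D \<tau>))"
        by (rule continuous_on_arc_deriv[OF CD[OF \<tau>]]) simp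
      then have "bounded (D \<tau> ` arc_dom)"
        by (intro compact_imp_bounded compact_continuous_image compact_arc_dom) simp
      then obtain B where B: "\<And>s. s \<in> arc_dom \<Longrightarrow> norm (D \<tau> s) \<le> B"
        unfolding bounded_iff by blast
      have B0: "B \<ge> 0"
        using order_trans[OF norm_ge_zero B[of 0]] by simp
      obtain d where d: "d > 0" "\<forall>t\<in>{-1..1}. t \<noteq> \<tau> \<longrightarrow> \<bar>t - \<tau>\<bar> < d \<longrightarrow>
          (\<forall>s\<in>arc_dom. norm ((g t s - g \<tau> s) /\<^sub>R (t - \<tau>) - D \<tau> s) < 1)"
        using uq[OF \<tau>, of 1] by auto
      show ?thesis
      proof (intro exI[of _ "min d (e / (B + 1))"] conjI ballI impI)
        show "min d (e / (B + 1)) > 0"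
          using d(1) e B0 by simp
        fix t s assume t: "t \<in> {-1..1}" "\<bar>t - \<tau>\<bar> < min d (e / (B + 1))" and s: "s \<in> arc_dom"
        show "norm (g t s - g \<tau> s) < e"
        proof (cases "t = \<tau>")
          case False
          define q where "q = (g t s - g \<tau> s) /\<^sub>R (t - \<tau>)"
          have "norm (q - D \<tau> s) < 1"
            using d(2) t s False by (simp add: q_def)
          then have q: "norm q < B + 1"
            using norm_triangle_sub[of q "D \<tau> s"] B[OF s] by linarith
          have "g t s - g \<tau> s = (t - \<tau>) *\<^sub>R q"
            using False by (simp add: q_def)
          then have "norm (g t s - g \<tau> s) = \<bar>t - \<tau>\<bar> * norm q"
            by simp
          also have "\<dots> \<le> \<bar>t - \<tau>\<bar> * (B + 1)"
            using q by (intro mult_left_mono) auto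
          also have "\<dots> < (e / (B + 1)) * (B + 1)"
            using t B0 by (intro mult_strict_right_mono) auto
          also have "\<dots> = e"
            using B0 by simp
          finally show ?thesis .
        qed (use e in simp)
      qed
    qed
  qed (rule uq)
qed

section \<open>Parametrization of the undeformed caps\<close>

fun side_arc :: "real \<Rightarrow> side \<Rightarrow> real \<Rightarrow> point" where
  "side_arc a i s = (side_sign i * (a/2 + cos s), sin s)"

lemma side_sign_square [simp]: "side_sign i * side_sign i = 1"
  by (cases i) auto

lemma real_arc_derivative_unique:
  assumes "s \<in> arc_dom" "(f has_real_derivative d) (at s within arc_dom)"
    "(f has_real_derivative e) (at s within arc_dom)"
  shows "d = e"
proof -
  have "vector_derivative f (at s within arc_dom) = c" if "(f has_real_derivative c) (at s within arc_dom)" for c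
    using assms(1) that unfolding arc_dom_def has_real_derivative_iff_has_vector_derivative
    by (intro vector_derivative_within_closed_interval) auto
  then show ?thesis
    using assms(2,3) by blast
qed

text \<open>The angular velocity \<open>w\<close> is continuous with square
  \<open>c\<^sup>2\<close>, hence constant, and the arc is a uniform rotation with some
  \<open>\<omega>\<close>. The upper end point gives \<open>cos (\<omega> * pi) = -1\<close>, and
  staying in \<open>x \<ge> 0\<close> leaves only \<open>\<omega> = 1\<close>.\<close>

lemma unit_circle_constant_speed_arc:
  fixes x y x' y' :: "real \<Rightarrow> real"
  assumes circle: "\<And>s. s \<in> arc_dom \<Longrightarrow> (x s)\<^sup>2 + (y s)\<^sup>2 = 1"
    and dx: "\<And>s. s \<in> arc_dom \<Longrightarrow> (x has_real_derivative x' s) (at s within arc_dom)"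
    and dy: "\<And>s. s \<in> arc_dom \<Longrightarrow> (y has_real_derivative y' s) (at s within arc_dom)"
    and cont: "continuous_on arc_dom x'" "continuous_on arc_dom y'"
    and speed: "\<And>s. s \<in> arc_dom \<Longrightarrow> (x' s)\<^sup>2 + (y' s)\<^sup>2 = c\<^sup>2" and c: "c > 0"
    and ends: "x (-(pi/2)) = 0" "y (-(pi/2)) = -1" "x (pi/2) = 0" "y (pi/2) = 1"
    and pos: "\<And>s. s \<in> arc_dom \<Longrightarrow> x s \<ge> 0"
    and s: "s \<in> arc_dom"
  shows "x s = cos s \<and> y s = sin s"
proof -
  have orth: "x s * x' s + y s * y' s = 0" if s: "s \<in> arc_dom" for s
  proof -
    have "((\<lambda>s. x s * x s + y s * y s) has_real_derivative
        (x' s * x s + x' s * x s) + (y' s * y s + y' s * y s)) (at s within arc_dom)"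
      by (intro DERIV_add DERIV_mult dx dy s)
    moreover have "((\<lambda>s. x s * x s + y s * y s) has_real_derivative 0) (at s within arc_dom)"
      by (rule has_field_derivative_transform_within[OF DERIV_const[of 1] zero_less_one s])
         (use circle in \<open>simp add: power2_eq_square\<close>)
    ultimately have "(x' s * x s + x' s * x s) + (y' s * y s + y' s * y s) = 0"
      by (rule real_arc_derivative_unique[OF s])
    then show ?thesis
      by (simp add: algebra_simps)
  qed
  define w where "w s = y' s * x s - x' s * y s" for s
  have w2: "(w s)\<^sup>2 = c\<^sup>2" if s: "s \<in> arc_dom" for s
  proof -
    have "(w s)\<^sup>2 + (x s * x' s + y s * y' s)\<^sup>2 = ((x s)\<^sup>2 + (y s)\<^sup>2) * ((x' s)\<^sup>2 + (y' s)\<^sup>2)"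
      unfolding w_def by algebra
    then show ?thesis
      using orth[OF s] circle[OF s] speed[OF s] by simp
  qed
  have wc: "continuous_on arc_dom w"
    unfolding w_def
    by (intro continuous_intros cont) (use dx dy in \<open>auto simp: continuous_on_eq_continuous_within intro: DERIV_continuous\<close>)
  obtain \<omega> where \<omega>: "\<omega> = c \<or> \<omega> = -c" "\<And>s. s \<in> arc_dom \<Longrightarrow> w s = \<omega>"
  proof -
    have pm: "w s = c \<or> w s = -c" if "s \<in> arc_dom" for s
      using w2[OF that] by (simp add: power2_eq_iff)
    have "w constant_on arc_dom"
    proof (rule continuous_discrete_range_constant[OF _ wc])
      show "connected arc_dom"
        by (simp add: arc_dom_def)
      show "\<exists>e>0. \<forall>t. t \<in> arc_dom \<and> w t \<noteq> w s \<longrightarrow> e \<le> norm (w t - w s)" if "s \<in> arc_dom" for s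
        using c pm[OF that] pm by (intro exI[of _ c]) fastforce
    qed
    then obtain d where "\<And>s. s \<in> arc_dom \<Longrightarrow> w s = d"
      unfolding constant_on_def by blast
    moreover from this pm have "d = c \<or> d = -c"
      using arc_dom_ends(4) by metis
    ultimately show ?thesis
      using that by blast
  qed
  have x'y': "x' s = - \<omega> * y s \<and> y' s = \<omega> * x s" if s: "s \<in> arc_dom" for s
    using orth[OF s] circle[OF s] \<omega>(2)[OF s] unfolding w_def by algebra
  \<comment> \<open>\<open>A\<close> and \<open>B\<close> are the coordinates after rotating back by
    \<open>\<omega> * s\<close>, which freezes the point.\<close>
  define A where "A s = x s * cos (\<omega> * s) + y s * sin (\<omega> * s)" for s
  define B where "B s = y s * cos (\<omega> * s) - x s * sin (\<omega> * s)" for s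
  have "(A has_vector_derivative 0) (at s within arc_dom)" "(B has_vector_derivative 0) (at s within arc_dom)"
    if s: "s \<in> arc_dom" for s
    unfolding has_real_derivative_iff_has_vector_derivative[symmetric] A_def B_def
    using x'y'[OF s] by (auto intro!: derivative_eq_intros dx[OF s] dy[OF s] simp: algebra_simps)
  then have const: "\<exists>k. \<forall>s\<in>arc_dom. A s = k" "\<exists>k. \<forall>s\<in>arc_dom. B s = k"
    using has_vector_derivative_zero_constant[of arc_dom] by (metis arc_dom_def convex_real_interval(5))+
  define h where "h = pi/2"
  have AB: "A s = A (-h)" "B s = B (-h)" if "s \<in> arc_dom" for s
    using const that arc_dom_ends(2) unfolding h_def by metis+
  have xy: "x s = A s * cos (\<omega> * s) - B s * sin (\<omega> * s)" "y s = A s * sin (\<omega> * s) + B s * cos (\<omega> * s)" for s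
    using sin_cos_squared_add[of "\<omega> * s"] unfolding A_def B_def by algebra+
  have Ah: "A (-h) = sin (\<omega> * h)" "B (-h) = - cos (\<omega> * h)"
    using ends by (simp_all add: A_def B_def h_def)
  have X: "x s = sin (\<omega> * (s + h))" and Y: "y s = - cos (\<omega> * (s + h))" if "s \<in> arc_dom" for s
    unfolding xy AB[OF that] Ah by (simp_all add: distrib_left sin_add cos_add algebra_simps)
  have cpi: "cos (\<omega> * pi) = -1"
    using Y[of "pi/2"] ends by (simp add: h_def)
  have sin0: "sin (\<omega> * t) \<ge> 0" if "0 \<le> t" "t \<le> pi" for t
    using X[of "t - h"] pos[of "t - h"] that by (simp add: h_def arc_dom_eq)
  have "\<omega> > 0"
  proof (rule ccontr)
    assume "\<not> \<omega> > 0"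
    then have n: "\<omega> < 0"
      using \<omega>(1) c by auto
    \<comment> \<open>A time at which a rotation in the wrong sense has left the half-plane
      \<open>x \<ge> 0\<close>; the \<open>t\<close> in the next block serves a rotation that is too
      fast.\<close>
    define t where "t = min pi (pi / (2 * - \<omega>))"
    have t: "0 < t" "t \<le> pi" "t \<le> pi / (2 * - \<omega>)"
      using n by (auto simp: t_def divide_pos_neg)
    have "- \<omega> * t \<le> - \<omega> * (pi / (2 * - \<omega>))"
      using t n by (intro mult_left_mono) auto
    also have "\<dots> = pi / 2"
      using n by simp
    finally have "- \<omega> * t \<le> pi / 2" .
    then have "sin (- \<omega> * t) > 0"
      using t n by (intro sin_gt_zero) (auto simp: mult_neg_pos)
    then show False
      using sin0[of t] t by simp
  qed
  moreover have "\<omega> \<le> 1"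
  proof (rule ccontr)
    assume "\<not> \<omega> \<le> 1"
    then have n: "\<omega> > 1"
      by simp
    define t where "t = min pi (3 * pi / (2 * \<omega>))"
    have t: "0 < t" "t \<le> pi" "t \<le> 3 * pi / (2 * \<omega>)"
      using n by (auto simp: t_def)
    have "\<omega> * t > pi"
      using n by (auto simp: t_def min_def field_simps)
    moreover have "\<omega> * t \<le> \<omega> * (3 * pi / (2 * \<omega>))"
      using t n by (intro mult_left_mono) auto
    then have "\<omega> * t \<le> 3 * pi / 2"
      using n by simp
    ultimately have "sin (\<omega> * t) < 0"
      using pi_gt_zero by (intro sin_lt_zero) linarith+
    then show False
      using sin0[of t] t by simp
  qed
  ultimately have "\<omega> * pi = pi"
    using cos_inj_pi[of "\<omega> * pi" pi] cpi by (simp add: mult_left_le_one_le)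
  then have "\<omega> = 1"
    by simp
  then show ?thesis
    using X[OF s] Y[OF s] by (simp add: h_def sin_add cos_add)
qed

fun side_normal :: "side \<Rightarrow> real \<Rightarrow> point" where
  "side_normal i s = (- side_sign i * cos s, - sin s)"

lemma cos_nonneg_arc: "s \<in> arc_dom \<Longrightarrow> cos s \<ge> 0"
  by (intro cos_ge_zero) (auto simp: arc_dom_eq)

lemma clip_side:
  assumes "a > 0" "r \<ge> 0"
  shows "clip a (side_sign i * (a/2 + r)) = side_sign i * a/2"
  using assms by (cases i) (auto simp: clip_def)

lemma has_vector_derivative_at_0I:
  fixes f :: "real \<Rightarrow> 'a::real_normed_vector"
  assumes "((\<lambda>t. (f t - f 0) /\<^sub>R t) \<longlongrightarrow> v) (at 0)"
  shows "(f has_vector_derivative v) (at 0)"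
proof -
  have "((\<lambda>t. norm ((f t - f 0) /\<^sub>R t - v)) \<longlongrightarrow> 0) (at 0)"
    using assms by (intro tendsto_norm_zero LIM_zero)
  then have "((\<lambda>t. norm (f t - f 0 - t *\<^sub>R v) / norm t) \<longlongrightarrow> 0) (at 0)"
  proof (rule Lim_transform_eventually)
    show "\<forall>\<^sub>F t in at 0. norm ((f t - f 0) /\<^sub>R t - v) = norm (f t - f 0 - t *\<^sub>R v) / norm t"
    proof (rule eventually_at_topological[THEN iffD2], intro exI[of _ UNIV] conjI ballI impI)
      fix t :: real assume "t \<noteq> 0"
      then have "f t - f 0 - t *\<^sub>R v = t *\<^sub>R ((f t - f 0) /\<^sub>R t - v)"
        by (simp add: scaleR_right_diff_distrib)
      then have "norm (f t - f 0 - t *\<^sub>R v) = \<bar>t\<bar> * norm ((f t - f 0) /\<^sub>R t - v)"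
        by (simp only: norm_scaleR)
      then show "norm ((f t - f 0) /\<^sub>R t - v) = norm (f t - f 0 - t *\<^sub>R v) / norm t"
        using \<open>t \<noteq> 0\<close> by simp
    qed auto
  qed
  then show ?thesis
    unfolding has_vector_derivative_def has_derivative_at by (simp add: bounded_linear_scaleR_left)
qed

section \<open>Velocity and normal velocity of the family at the stadium\<close>

locale stadium_family =
  fixes a :: real and \<Omega> :: "real \<Rightarrow> point set" and \<gamma> :: "side \<Rightarrow> real \<Rightarrow> real \<Rightarrow> point"
  assumes a8: "a \<ge> 8" and family: "C1_family 4 a \<Omega> \<gamma>" and start: "\<Omega> 0 = stadium a"
begin

lemma a_pos: "a > 0"
  using a8 by simp

lemma member:
  assumes "\<tau> \<in> {-1..1}"
  shows "open (\<Omega> \<tau>)" "convex (\<Omega> \<tau>)"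
    "frontier (\<Omega> \<tau>) = flat_edges a \<union> (\<Union>i. \<gamma> i \<tau> ` arc_dom)"
    "stadium_arc_param 4 a i (\<gamma> i \<tau>)" "(x, y) \<in> \<Omega> \<tau> \<longleftrightarrow> (x, -y) \<in> \<Omega> \<tau>"
  using family assms unfolding C1_family_def generalised_stadium_def by blast+

text \<open>\<open>start\<close> fixes only the domain as a set. The parametrization follows from
  constant speed, the end points and the side condition of \<open>stadium_arc_param\<close>.\<close>

lemma start_arc:
  assumes s: "s \<in> arc_dom"
  shows "\<gamma> i 0 s = side_arc a i s"
proof -
  define \<sigma> where "\<sigma> = side_sign i"
  have \<sigma>: "\<sigma> * \<sigma> = 1"
    by (simp add: \<sigma>_def)
  have par: "stadium_arc_param 4 a i (\<gamma> i 0)"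
    by (rule member) simp
  obtain c where c: "\<And>s. s \<in> arc_dom \<Longrightarrow> norm (arc_deriv 1 (\<gamma> i 0) s) = c"
    using family unfolding C1_family_def constant_speed_def by (metis atLeastAtMost_iff zero_le_one neg_le_0_iff_le)
  have C: "Cr_on_arc 4 (\<gamma> i 0)" and nz: "\<And>s. s \<in> arc_dom \<Longrightarrow> arc_deriv 1 (\<gamma> i 0) s \<noteq> 0"
    and ends: "\<gamma> i 0 (-pi/2) = (\<sigma> * a/2, -1)" "\<gamma> i 0 (pi/2) = (\<sigma> * a/2, 1)"
    and side: "\<And>s. s \<in> arc_dom \<Longrightarrow> a/2 \<le> \<sigma> * fst (\<gamma> i 0 s)"
    using par unfolding stadium_arc_param_def \<sigma>_def by blast+
  have c0: "c > 0"
    using c[of 0] nz[of 0] by auto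
  define x where "x s = \<sigma> * fst (\<gamma> i 0 s) - a/2" for s
  define y where "y s = snd (\<gamma> i 0 s)" for s
  define x' where "x' s = \<sigma> * fst (arc_deriv 1 (\<gamma> i 0) s)" for s
  define y' where "y' s = snd (arc_deriv 1 (\<gamma> i 0) s)" for s
  have d: "(\<gamma> i 0 has_vector_derivative arc_deriv 1 (\<gamma> i 0) s) (at s within arc_dom)" if "s \<in> arc_dom" for s
    using arc_deriv_has_vector_derivative[OF C, of 0 s] that by simp
  have "x s = cos s \<and> y s = sin s"
  proof (rule unit_circle_constant_speed_arc[of x y x' y' c])
    fix s assume s: "s \<in> arc_dom"
    show "x s \<ge> 0"
      using side[OF s] by (simp add: x_def)
    have "\<gamma> i 0 s \<in> frontier (\<Omega> 0)"
      using member(3)[of 0] s by auto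
    then have o1: "offset a (\<gamma> i 0 s) = 1"
      by (simp add: start stadium_eq[OF a_pos] frontier_open_stadium[OF a_pos])
    have f: "fst (\<gamma> i 0 s) = \<sigma> * (a/2 + x s)"
      using \<sigma> by (simp add: x_def algebra_simps flip: mult.assoc)
    have cl: "clip a (fst (\<gamma> i 0 s)) = \<sigma> * a/2"
      unfolding f \<sigma>_def by (rule clip_side[OF a_pos \<open>x s \<ge> 0\<close>])
    have "fst (\<gamma> i 0 s) - clip a (fst (\<gamma> i 0 s)) = \<sigma> * x s"
      unfolding cl by (subst f) (simp add: algebra_simps)
    then have "(fst (\<gamma> i 0 s) - clip a (fst (\<gamma> i 0 s)))\<^sup>2 = (\<sigma> * x s)\<^sup>2"
      by (simp only:)
    also have "\<dots> = (x s)\<^sup>2"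
      using \<sigma> by (simp add: power_mult_distrib power2_eq_square)
    finally show "(x s)\<^sup>2 + (y s)\<^sup>2 = 1"
      using o1 by (simp add: offset_def y_def)
    show "(x has_real_derivative x' s) (at s within arc_dom)"
      unfolding x_def x'_def has_real_derivative_iff_has_vector_derivative
      using bounded_linear.has_vector_derivative[OF bounded_linear_compose[OF bounded_linear_mult_right bounded_linear_fst] d[OF s], of \<sigma>]
      by (simp add: has_vector_derivative_diff_const)
    show "(y has_real_derivative y' s) (at s within arc_dom)"
      unfolding y_def y'_def has_real_derivative_iff_has_vector_derivative
      by (rule bounded_linear.has_vector_derivative[OF bounded_linear_snd d[OF s]])
    have "(x' s)\<^sup>2 + (y' s)\<^sup>2 = (norm (arc_deriv 1 (\<gamma> i 0) s))\<^sup>2"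
      using \<sigma> by (simp add: x'_def y'_def norm_prod_def power_mult_distrib power2_eq_square)
    then show "(x' s)\<^sup>2 + (y' s)\<^sup>2 = c\<^sup>2"
      by (simp only: c[OF s])
  next
    have "continuous_on arc_dom (arc_deriv 1 (\<gamma> i 0))"
      by (rule continuous_on_arc_deriv[OF C]) simp
    then show "continuous_on arc_dom x'" "continuous_on arc_dom y'"
      unfolding x'_def y'_def by (intro continuous_intros, assumption)+
  qed (use c0 s ends \<sigma> in \<open>simp_all add: x_def y_def flip: mult.assoc\<close>)
  then have "\<sigma> * (\<sigma> * fst (\<gamma> i 0 s)) = \<sigma> * (a/2 + cos s)" "snd (\<gamma> i 0 s) = sin s"
    by (simp_all add: x_def y_def algebra_simps)
  then show ?thesis
    using \<sigma> by (simp add: prod_eq_iff \<sigma>_def[symmetric] flip: mult.assoc)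
qed

definition velocity :: "side \<Rightarrow> real \<Rightarrow> point" where
  "velocity i s = vector_derivative (\<lambda>\<tau>. \<gamma> i \<tau> s) (at 0)"

lemma C1_arc: "C1_into_Cr 4 (\<gamma> i)"
  using family by (simp add: C1_family_def)

lemma velocityE:
  obtains D where "Cr_on_arc 4 D" "\<And>s. s \<in> arc_dom \<Longrightarrow> velocity i s = D s"
    "\<And>k s. k \<le> 4 \<Longrightarrow> s \<in> arc_dom \<Longrightarrow>
       ((\<lambda>t. (arc_deriv k (\<gamma> i t) s - arc_deriv k (\<gamma> i 0) s) /\<^sub>R t) \<longlongrightarrow> arc_deriv k D s) (at 0)"
    "\<And>e. e > 0 \<Longrightarrow> \<exists>d>0. \<forall>t. t \<noteq> 0 \<longrightarrow> \<bar>t\<bar> < d \<longrightarrow>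
       (\<forall>s\<in>arc_dom. norm ((\<gamma> i t s - \<gamma> i 0 s) /\<^sub>R t - D s) < e)"
proof (rule C1_into_CrE[OF C1_arc[of i]])
  fix D :: "real \<Rightarrow> real \<Rightarrow> point"
  assume C: "Cr_on_arc 4 (D 0)"
    and L: "\<And>k s \<tau>. k \<le> 4 \<Longrightarrow> s \<in> arc_dom \<Longrightarrow> \<tau> \<in> {-1..1} \<Longrightarrow>
       ((\<lambda>t. (arc_deriv k (\<gamma> i t) s - arc_deriv k (\<gamma> i \<tau>) s) /\<^sub>R (t - \<tau>)) \<longlongrightarrow> arc_deriv k (D \<tau>) s) (at \<tau> within {-1..1})"
    and Q: "\<And>\<tau> e. \<tau> \<in> {-1..1} \<Longrightarrow> e > 0 \<Longrightarrow>
       \<exists>d>0. \<forall>t\<in>{-1..1}. t \<noteq> \<tau> \<longrightarrow> \<bar>t - \<tau>\<bar> < d \<longrightarrow> (\<forall>s\<in>arc_dom. norm ((\<gamma> i t s - \<gamma> i \<tau> s) /\<^sub>R (t - \<tau>) - D \<tau> s) < e)"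
  have at0: "at 0 within {-1..1} = at (0::real)"
    by (rule at_within_interior) auto
  have lim: "((\<lambda>t. (arc_deriv k (\<gamma> i t) s - arc_deriv k (\<gamma> i 0) s) /\<^sub>R t) \<longlongrightarrow> arc_deriv k (D 0) s) (at 0)"
    if "k \<le> 4" "s \<in> arc_dom" for k s
    using L[OF that, of 0] by (simp add: at0)
  have vel: "velocity i s = D 0 s" if "s \<in> arc_dom" for s
  proof -
    have "((\<lambda>t. (\<gamma> i t s - \<gamma> i 0 s) /\<^sub>R t) \<longlongrightarrow> D 0 s) (at 0)"
      using lim[of 0 s] that by simp
    then have "((\<lambda>\<tau>. \<gamma> i \<tau> s) has_vector_derivative D 0 s) (at 0)"
      by (rule has_vector_derivative_at_0I)
    then show ?thesis
      by (simp add: velocity_def vector_derivative_at)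
  qed
  have quot: "\<exists>d>0. \<forall>t. t \<noteq> 0 \<longrightarrow> \<bar>t\<bar> < d \<longrightarrow> (\<forall>s\<in>arc_dom. norm ((\<gamma> i t s - \<gamma> i 0 s) /\<^sub>R t - D 0 s) < e)"
    if e: "e > 0" for e
  proof -
    obtain d where d: "d > 0" "\<forall>t\<in>{-1..1}. t \<noteq> 0 \<longrightarrow> \<bar>t - 0\<bar> < d \<longrightarrow>
        (\<forall>s\<in>arc_dom. norm ((\<gamma> i t s - \<gamma> i 0 s) /\<^sub>R (t - 0) - D 0 s) < e)"
      using Q[of 0 e] e by auto
    show ?thesis
    proof (intro exI[of _ "min d 1"] conjI allI impI)
      fix t :: real assume t: "t \<noteq> 0" "\<bar>t\<bar> < min d 1"
      then have "t \<in> {-1..1}"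
        by (simp add: abs_less_iff)
      then show "\<forall>s\<in>arc_dom. norm ((\<gamma> i t s - \<gamma> i 0 s) /\<^sub>R t - D 0 s) < e"
        using d(2) t by simp
    qed (use d in simp)
  qed
  show thesis
    by (rule that[of "D 0"]) (use C vel lim quot in auto)
qed

lemma velocity_has_vector_derivative:
  assumes s: "s \<in> arc_dom"
  shows "((\<lambda>\<tau>. \<gamma> i \<tau> s) has_vector_derivative velocity i s) (at 0)"
proof (rule velocityE[of i])
  fix D assume D: "\<And>s. s \<in> arc_dom \<Longrightarrow> velocity i s = D s"
    and lim: "\<And>k s. k \<le> 4 \<Longrightarrow> s \<in> arc_dom \<Longrightarrow>
       ((\<lambda>t. (arc_deriv k (\<gamma> i t) s - arc_deriv k (\<gamma> i 0) s) /\<^sub>R t) \<longlongrightarrow> arc_deriv k D s) (at 0)"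
  have "((\<lambda>t. (\<gamma> i t s - \<gamma> i 0 s) /\<^sub>R t) \<longlongrightarrow> velocity i s) (at 0)"
    using lim[of 0 s] s D[OF s] by simp
  then show ?thesis
    by (rule has_vector_derivative_at_0I)
qed

lemma uniform_velocity:
  assumes "e > 0"
  shows "\<exists>d>0. \<forall>t. t \<noteq> 0 \<longrightarrow> \<bar>t\<bar> < d \<longrightarrow> (\<forall>s\<in>arc_dom. norm ((\<gamma> i t s - \<gamma> i 0 s) /\<^sub>R t - velocity i s) < e)"
proof (rule velocityE[of i])
  fix D assume D: "\<And>s. s \<in> arc_dom \<Longrightarrow> velocity i s = D s"
    and Q: "\<And>e. e > 0 \<Longrightarrow> \<exists>d>0. \<forall>t. t \<noteq> 0 \<longrightarrow> \<bar>t\<bar> < d \<longrightarrow>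
       (\<forall>s\<in>arc_dom. norm ((\<gamma> i t s - \<gamma> i 0 s) /\<^sub>R t - D s) < e)"
  show ?thesis
    using Q[OF assms] by (simp only: D cong: ball_cong)
qed

lemma uniformly_continuous_family:
  assumes "\<tau> \<in> {-1..1}" "e > 0"
  shows "\<exists>d>0. \<forall>t\<in>{-1..1}. \<bar>t - \<tau>\<bar> < d \<longrightarrow> (\<forall>s\<in>arc_dom. norm (\<gamma> i t s - \<gamma> i \<tau> s) < e)"
proof (rule C1_into_CrE[OF C1_arc[of i]])
  assume "\<And>\<tau> e. \<tau> \<in> {-1..1} \<Longrightarrow> e > 0 \<Longrightarrow>
       \<exists>d>0. \<forall>t\<in>{-1..1}. \<bar>t - \<tau>\<bar> < d \<longrightarrow> (\<forall>s\<in>arc_dom. norm (\<gamma> i t s - \<gamma> i \<tau> s) < e)"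
  then show ?thesis
    using assms .
qed

lemma member_ends:
  assumes "\<tau> \<in> {-1..1}"
  shows "\<gamma> i \<tau> (pi/2) = (side_sign i * a/2, 1)" "\<gamma> i \<tau> (-(pi/2)) = (side_sign i * a/2, -1)"
  using member(4)[OF assms, of i] unfolding stadium_arc_param_def minus_divide_left by blast+

lemma velocity_ends: "velocity i (pi/2) = 0" "velocity i (-(pi/2)) = 0"
proof -
  obtain D where D: "\<And>s. s \<in> arc_dom \<Longrightarrow> velocity i s = D s"
    "\<And>k s. k \<le> 4 \<Longrightarrow> s \<in> arc_dom \<Longrightarrow>
       ((\<lambda>t. (arc_deriv k (\<gamma> i t) s - arc_deriv k (\<gamma> i 0) s) /\<^sub>R t) \<longlongrightarrow> arc_deriv k D s) (at 0)"
    by (rule velocityE[of i]) (rule that)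
  have "D s = 0" if s: "s \<in> {pi/2, -(pi/2)}" for s
  proof -
    have eq: "\<gamma> i t s = \<gamma> i 0 s" if t: "t \<in> {-1..1}" for t
    proof -
      have z: "(0::real) \<in> {-1..1}"
        by simp
      have "s = pi/2 \<or> s = -(pi/2)"
        using s by blast
      then show ?thesis
        by (elim disjE) (simp_all only: member_ends[OF t] member_ends[OF z])
    qed
    have "\<forall>\<^sub>F t in at 0. (\<gamma> i t s - \<gamma> i 0 s) /\<^sub>R t = 0"
      unfolding eventually_at
    proof (intro exI[of _ 1] conjI ballI impI)
      fix t :: real assume "t \<noteq> 0 \<and> dist t 0 < 1"
      then have "\<gamma> i t s = \<gamma> i 0 s"
        by (intro eq) (auto simp: dist_real_def abs_less_iff)
      then show "(\<gamma> i t s - \<gamma> i 0 s) /\<^sub>R t = 0"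
        by simp
    qed simp
    then have "((\<lambda>t. (\<gamma> i t s - \<gamma> i 0 s) /\<^sub>R t) \<longlongrightarrow> 0) (at 0)"
      by (rule tendsto_eventually)
    moreover have "((\<lambda>t. (\<gamma> i t s - \<gamma> i 0 s) /\<^sub>R t) \<longlongrightarrow> D s) (at 0)"
    proof -
      have "s \<in> arc_dom"
        using s arc_dom_ends(1,2) by blast
      then show ?thesis
        using D(2)[of 0 s] by simp
    qed
    ultimately show ?thesis
      using LIM_unique by blast
  qed
  then show "velocity i (pi/2) = 0" "velocity i (-(pi/2)) = 0"
    using D(1) by simp_all
qed

definition normal_velocity :: "side \<Rightarrow> real \<Rightarrow> real" where
  "normal_velocity i s = velocity i s \<bullet> side_normal i s"

text \<open>The description in \<open>inward_unit_normal\<close> has to be shown unique. A unit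
  vector orthogonal to the arc is \<open>u\<close> times \<open>side_normal\<close> with
  \<open>u\<close> equal to 1 or -1, and a displacement by \<open>t\<close> along it changes the
  offset to \<open>(1 - t * u)^2\<close>, which is below 1 only for the inward sign.\<close>

lemma deformation_function_eq:
  assumes s: "s \<in> arc_dom"
  shows "deformation_function \<Omega> \<gamma> i s = normal_velocity i s"
proof -
  define \<sigma> where "\<sigma> = side_sign i"
  have \<sigma>: "\<sigma> * \<sigma> = 1"
    by (simp add: \<sigma>_def)
  have C: "Cr_on_arc 4 (\<gamma> i 0)"
    using member(4)[of 0 i] by (simp add: stadium_arc_param_def)
  have "(side_arc a i has_vector_derivative (- \<sigma> * sin s, cos s)) (at s within arc_dom)"
    unfolding side_arc.simps[abs_def] \<sigma>_def
    by (intro has_vector_derivative_Pair) (auto intro!: derivative_eq_intros simp flip: has_real_derivative_iff_has_vector_derivative)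
  moreover have "(\<gamma> i 0 has_vector_derivative arc_deriv 1 (\<gamma> i 0) s) (at s within arc_dom)"
    using arc_deriv_has_vector_derivative[OF C, of 0 s] s by simp
  then have "(side_arc a i has_vector_derivative arc_deriv 1 (\<gamma> i 0) s) (at s within arc_dom)"
    by (rule has_vector_derivative_transform[OF s start_arc[symmetric], rotated]) simp_all
  ultimately have T: "arc_deriv 1 (\<gamma> i 0) s = (- \<sigma> * sin s, cos s)"
    using arc_vector_derivative_eq[OF s] by metis
  have off: "offset a (\<gamma> i 0 s + t *\<^sub>R (u *\<^sub>R side_normal i s)) = (1 - t * u)\<^sup>2" if "t * u \<le> 1" for t u
  proof -
    have f: "fst (\<gamma> i 0 s + t *\<^sub>R (u *\<^sub>R side_normal i s)) = side_sign i * (a/2 + (1 - t * u) * cos s)"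
      by (simp add: start_arc[OF s] algebra_simps)
    have cl: "clip a (fst (\<gamma> i 0 s + t *\<^sub>R (u *\<^sub>R side_normal i s))) = side_sign i * a/2"
      unfolding f using that cos_nonneg_arc[OF s] by (intro clip_side a_pos mult_nonneg_nonneg) auto
    have "fst (\<gamma> i 0 s + t *\<^sub>R (u *\<^sub>R side_normal i s)) - side_sign i * a/2 = \<sigma> * ((1 - t * u) * cos s)"
      by (subst f) (simp add: \<sigma>_def algebra_simps)
    moreover have "snd (\<gamma> i 0 s + t *\<^sub>R (u *\<^sub>R side_normal i s)) = (1 - t * u) * sin s"
      by (simp add: start_arc[OF s] algebra_simps)
    ultimately have "offset a (\<gamma> i 0 s + t *\<^sub>R (u *\<^sub>R side_normal i s)) = (\<sigma> * ((1 - t * u) * cos s))\<^sup>2 + ((1 - t * u) * sin s)\<^sup>2"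
      unfolding offset_def cl by (simp only:)
    also have "\<dots> = (1 - t * u)\<^sup>2 * (\<sigma> * \<sigma> * (cos s)\<^sup>2 + (sin s)\<^sup>2)"
      by (simp add: power_mult_distrib power2_eq_square algebra_simps)
    finally show ?thesis
      by (simp add: \<sigma>)
  qed
  have "inward_unit_normal (\<Omega> 0) (\<gamma> i 0) s = side_normal i s"
    unfolding inward_unit_normal_def T
  proof (rule the_equality)
    have "\<gamma> i 0 s + t *\<^sub>R side_normal i s \<in> \<Omega> 0" if "t \<in> {0<..<1}" for t
      using off[of t 1] that unfolding start stadium_eq[OF a_pos] in_open_stadium_iff[OF a_pos]
      by (simp add: abs_square_less_1)
    moreover have "norm (side_normal i s) = 1" "side_normal i s \<bullet> (- \<sigma> * sin s, cos s) = 0"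
      by (cases i; simp add: norm_Pair \<sigma>_def inner_prod_def)+
    ultimately show "norm (side_normal i s) = 1 \<and> side_normal i s \<bullet> (- \<sigma> * sin s, cos s) = 0 \<and>
        (\<exists>\<epsilon>>0. \<forall>t\<in>{0<..<\<epsilon>}. \<gamma> i 0 s + t *\<^sub>R side_normal i s \<in> \<Omega> 0)"
      by (intro conjI exI[of _ 1]) auto
  next
    fix N :: point
    assume N: "norm N = 1 \<and> N \<bullet> (- \<sigma> * sin s, cos s) = 0 \<and> (\<exists>\<epsilon>>0. \<forall>t\<in>{0<..<\<epsilon>}. \<gamma> i 0 s + t *\<^sub>R N \<in> \<Omega> 0)"
    obtain n1 n2 where n: "N = (n1, n2)"
      by (cases N)
    define u where "u = - (\<sigma> * n1 * cos s) - n2 * sin s"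
    have sc: "sin s * sin s + cos s * cos s = 1"
      using sin_cos_squared_add3[of s] by linarith
    have 1: "n1 * n1 + n2 * n2 = 1" and 2: "n2 * cos s = \<sigma> * n1 * sin s"
      using N by (simp_all add: n norm_Pair inner_prod_def power2_eq_square algebra_simps)
    have nu: "n1 = - u * \<sigma> * cos s" "n2 = - u * sin s"
      unfolding u_def using 2 sc \<sigma> by algebra+
    have "u * u = 1"
      using 1 sc \<sigma> unfolding nu by algebra
    then have u1: "u = 1 \<or> u = -1"
      by (simp add: square_eq_1_iff)
    have Nu: "N = u *\<^sub>R side_normal i s"
      by (simp add: n nu \<sigma>_def)
    obtain \<epsilon> where \<epsilon>: "\<epsilon> > 0" "\<And>t. t \<in> {0<..<\<epsilon>} \<Longrightarrow> \<gamma> i 0 s + t *\<^sub>R N \<in> \<Omega> 0"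
      using N by blast
    have "u \<noteq> -1"
    proof
      assume u: "u = -1"
      have "offset a (\<gamma> i 0 s + (\<epsilon>/2) *\<^sub>R N) < 1"
        using \<epsilon>(2)[of "\<epsilon>/2"] \<epsilon>(1) by (simp add: start stadium_eq[OF a_pos] in_open_stadium_iff[OF a_pos])
      then have "(1 + \<epsilon>/2)\<^sup>2 < 1"
        using off[of "\<epsilon>/2" u] \<epsilon>(1) unfolding Nu u by simp
      then show False
        using \<epsilon>(1) by (simp add: abs_square_less_1)
    qed
    then show "N = side_normal i s"
      using u1 Nu by simp
  qed
  then show ?thesis
    by (simp add: deformation_function_def normal_velocity_def velocity_def)
qed

lemma normal_velocity_ends: "normal_velocity i (pi/2) = 0" "normal_velocity i (-(pi/2)) = 0"
  by (simp_all add: normal_velocity_def velocity_ends)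

lemma frontier_reflect:
  assumes \<tau>: "\<tau> \<in> {-1..1}" and p: "p \<in> frontier (\<Omega> \<tau>)"
  shows "(fst p, - snd p) \<in> frontier (\<Omega> \<tau>)"
proof -
  let ?R = "\<lambda>p::point. (fst p, - snd p)"
  have sym: "?R q \<in> \<Omega> \<tau> \<longleftrightarrow> q \<in> \<Omega> \<tau>" for q
    using member(5)[OF \<tau>, of "fst q" "snd q"] by simp
  have cont: "continuous_on UNIV ?R"
    by (intro continuous_intros)
  have RR: "?R (?R q) = q" for q
    by simp
  have cl: "?R q \<in> closure S" if q: "q \<in> closure S" and S: "\<And>q. q \<in> S \<Longrightarrow> ?R q \<in> S" for q S
  proof -
    have "?R ` closure S \<subseteq> closure S"
      using S closure_subset by (intro image_closure_subset continuous_on_subset[OF cont]) auto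
    then show ?thesis
      using q by blast
  qed
  have "p \<in> closure (\<Omega> \<tau>)" "p \<in> closure (- \<Omega> \<tau>)"
    using p by (auto simp: frontier_closures)
  then have "?R p \<in> closure (\<Omega> \<tau>)" "?R p \<in> closure (- \<Omega> \<tau>)"
    using sym by (auto intro!: cl)
  then show ?thesis
    by (simp add: frontier_closures)
qed

text \<open>The mirror image lies on the boundary by symmetry of the domain. On an edge it can only
  be a junction point, and the two arcs are separated by their side conditions. The parameter
  \<open>s'\<close> remains unidentified here.\<close>

lemma arc_reflect:
  assumes \<tau>: "\<tau> \<in> {-1..1}" and s: "s \<in> arc_dom"
  obtains s' where "s' \<in> arc_dom" "\<gamma> i \<tau> s' = (fst (\<gamma> i \<tau> s), - snd (\<gamma> i \<tau> s))"
proof -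
  let ?q = "(fst (\<gamma> i \<tau> s), - snd (\<gamma> i \<tau> s))"
  have side: "a/2 \<le> side_sign j * fst (\<gamma> j \<tau> s)" if "s \<in> arc_dom" for j s
    using member(4)[OF \<tau>, of j] that by (auto simp: stadium_arc_param_def)
  have "\<gamma> i \<tau> s \<in> frontier (\<Omega> \<tau>)"
    using member(3)[OF \<tau>] s by auto
  then have "?q \<in> frontier (\<Omega> \<tau>)"
    by (rule frontier_reflect[OF \<tau>])
  then consider "?q \<in> flat_edges a" | j t where "t \<in> arc_dom" "?q = \<gamma> j \<tau> t"
    unfolding member(3)[OF \<tau>] by blast
  then show ?thesis
  proof cases
    case 1
    then have "fst ?q \<in> {-a/2..a/2}" and y: "snd ?q = 1 \<or> snd ?q = -1"
      unfolding flat_edges_def by auto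
    then have x: "fst ?q = side_sign i * a/2"
      using side[OF s, of i] by (cases i) auto
    have "?q = \<gamma> i \<tau> (pi/2) \<or> ?q = \<gamma> i \<tau> (-(pi/2))"
      unfolding member_ends[OF \<tau>] using x y by (auto simp: prod_eq_iff)
    then show ?thesis
      using that[of "pi/2"] that[of "-(pi/2)"] by auto
  next
    case 2
    have "j = i"
    proof (rule ccontr)
      assume "j \<noteq> i"
      then have "side_sign j = - side_sign i"
        by (cases i; cases j) auto
      moreover have "fst (\<gamma> j \<tau> t) = fst (\<gamma> i \<tau> s)"
        using 2(2) by (metis fst_conv)
      ultimately show False
        using side[OF 2(1), of j] side[OF s, of i] a_pos by simp
    qed
    then show ?thesis
      using 2 that by metis
  qed
qed

lemma continuous_on_velocity: "continuous_on arc_dom (velocity i)"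
proof (rule velocityE[of i])
  fix D assume C: "Cr_on_arc 4 D" and D: "\<And>s. s \<in> arc_dom \<Longrightarrow> velocity i s = D s"
  have "continuous_on arc_dom (arc_deriv 0 D)"
    by (rule continuous_on_arc_deriv[OF C]) simp
  then show ?thesis
    by (rule continuous_on_eq) (simp add: D)
qed

text \<open>The mirror image of \<open>\<gamma> i t s\<close> is some \<open>\<gamma> i t s'\<close>
  with \<open>s'\<close> near \<open>-s\<close>. Projected to the normal at \<open>-s\<close>, the
  unknown shift from \<open>-s\<close> to \<open>s'\<close> along the circle contributes
  \<open>1 - cos (s' + s)\<close>, which is nonnegative. So one inequality holds without knowing
  \<open>s'\<close>, and exchanging \<open>s\<close> and \<open>-s\<close> gives the other.\<close>

lemma normal_velocity_le_reflect:
  assumes s: "s \<in> arc_dom"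
  shows "normal_velocity i (-s) \<le> normal_velocity i s"
proof (rule field_le_epsilon)
  fix e :: real assume e: "e > 0"
  define N where "N = side_normal i (-s)"
  have N1: "norm N = 1"
    unfolding N_def by (cases i) (simp_all add: norm_Pair)
  obtain \<delta> where \<delta>: "\<delta> > 0" "\<And>t. t \<in> arc_dom \<Longrightarrow> dist t (-s) < \<delta> \<Longrightarrow> dist (velocity i t) (velocity i (-s)) < e/3"
    using continuous_on_velocity[of i] arc_dom_minus[OF s] e unfolding continuous_on_iff
    by (metis divide_pos_pos zero_less_numeral)
  \<comment> \<open>Capped at \<open>pi\<close>, since the cosine decreases only up to
    there.\<close>
  define \<delta>' where "\<delta>' = min \<delta> pi"
  have \<delta>': "0 < \<delta>'" "\<delta>' \<le> pi" "\<delta>' \<le> \<delta>"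
    using \<delta>(1) by (auto simp: \<delta>'_def)
  have "cos \<delta>' < cos 0"
    using \<delta>' by (intro cos_monotone_0_pi) auto
  then have gap: "1 - cos \<delta>' > 0"
    by simp
  obtain d where d: "d > 0" "\<And>t r. t \<noteq> 0 \<Longrightarrow> \<bar>t\<bar> < d \<Longrightarrow> r \<in> arc_dom \<Longrightarrow>
      norm ((\<gamma> i t r - \<gamma> i 0 r) /\<^sub>R t - velocity i r) < e/3"
    using uniform_velocity[of "e/3" i] e by auto
  have "bounded (velocity i ` arc_dom)"
    by (intro compact_imp_bounded compact_continuous_image compact_arc_dom continuous_on_velocity)
  then obtain B where B: "\<And>r. r \<in> arc_dom \<Longrightarrow> norm (velocity i r) \<le> B"
    unfolding bounded_iff by blast
  have B0: "B \<ge> 0"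
    using order_trans[OF norm_ge_zero B[OF s]] .
  define M where "M = 2 * B + e"
  have M: "M > 0"
    using B0 e by (simp add: M_def)
  \<comment> \<open>So small that \<open>1 - cos (s' + s) \<le> t * M\<close> forces
    \<open>s'\<close> to be within \<open>\<delta>'\<close> of \<open>-s\<close>.\<close>
  define t where "t = min (min (d/2) 1) ((1 - cos \<delta>') / (2 * M))"
  have t: "t > 0" "t < d" "t \<le> 1" "t * M < 1 - cos \<delta>'"
  proof -
    show "t > 0" "t < d" "t \<le> 1"
      using d(1) gap M by (auto simp: t_def)
    have "t * M \<le> ((1 - cos \<delta>') / (2 * M)) * M"
      using M by (intro mult_right_mono) (auto simp: t_def)
    also have "\<dots> < 1 - cos \<delta>'"
      using M gap by simp
    finally show "t * M < 1 - cos \<delta>'" .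
  qed
  define q where "q r = (\<gamma> i t r - \<gamma> i 0 r) /\<^sub>R t" for r
  have q: "norm (q r - velocity i r) < e/3" if "r \<in> arc_dom" for r
    unfolding q_def using d(2)[of t r] t that by simp
  have \<gamma>t: "\<gamma> i t r = side_arc a i r + t *\<^sub>R q r" if "r \<in> arc_dom" for r
    using t(1) start_arc[OF that, of i] by (simp add: q_def)
  obtain s' where s': "s' \<in> arc_dom" "\<gamma> i t s' = (fst (\<gamma> i t s), - snd (\<gamma> i t s))"
    using arc_reflect[of t s i] t s by auto
  have ip: "\<bar>v \<bullet> N\<bar> \<le> norm v" for v :: point
    using Cauchy_Schwarz_ineq2[of v N] N1 by simp
  have ips: "\<bar>v \<bullet> side_normal i s\<bar> \<le> norm v" for v :: point
  proof -
    have "norm (side_normal i s) = 1"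
      by (cases i) (simp_all add: norm_Pair)
    then show ?thesis
      using Cauchy_Schwarz_ineq2[of v "side_normal i s"] by simp
  qed
  have eq: "t * (q s \<bullet> side_normal i s) = (1 - cos (s' + s)) + t * (q s' \<bullet> N)"
  proof -
    have "(\<gamma> i t s' - side_arc a i (-s)) \<bullet> N = t * (q s \<bullet> side_normal i s)"
      unfolding s'(2) \<gamma>t[OF s] N_def by (simp add: inner_prod_def algebra_simps)
    moreover have "(\<gamma> i t s' - side_arc a i (-s)) \<bullet> N = (1 - cos (s' + s)) + t * (q s' \<bullet> N)"
    proof -
      have "(side_arc a i s' - side_arc a i (-s)) \<bullet> N = (cos s * cos s + sin s * sin s) - (cos s' * cos s - sin s' * sin s)"
        unfolding N_def by (cases i) (simp_all add: inner_prod_def algebra_simps)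
      also have "\<dots> = 1 - cos (s' + s)"
        using sin_cos_squared_add3[of s] by (simp add: cos_add)
      finally have 1: "(side_arc a i s' - side_arc a i (-s)) \<bullet> N = 1 - cos (s' + s)" .
      have "\<gamma> i t s' - side_arc a i (-s) = (side_arc a i s' - side_arc a i (-s)) + t *\<^sub>R q s'"
        unfolding \<gamma>t[OF s'(1)] by (simp only: diff_conv_add_uminus add_ac)
      then show ?thesis
        by (simp only: inner_add_left inner_scaleR_left 1)
    qed
    ultimately show ?thesis
      by simp
  qed
  have qs: "norm (q r) \<le> B + e/3" if "r \<in> arc_dom" for r
    using q[OF that] B[OF that] norm_triangle_sub[of "q r" "velocity i r"] by linarith
  have "1 - cos (s' + s) = t * (q s \<bullet> side_normal i s - q s' \<bullet> N)"
    using eq by (simp add: algebra_simps)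
  also have "\<dots> \<le> t * M"
  proof (intro mult_left_mono)
    show "q s \<bullet> side_normal i s - q s' \<bullet> N \<le> M"
      using ips[of "q s"] ip[of "q s'"] qs[OF s] qs[OF s'(1)] e unfolding M_def by linarith
  qed (use t in simp)
  finally have "cos \<delta>' < cos (s' + s)"
    using t(4) by linarith
  then have cs: "cos \<delta>' < cos \<bar>s' + s\<bar>"
    by simp
  have "\<bar>s' + s\<bar> < \<delta>'"
  proof (rule ccontr)
    assume n: "\<not> \<bar>s' + s\<bar> < \<delta>'"
    have "\<bar>s' + s\<bar> \<le> pi"
      using s s'(1) by (auto simp: arc_dom_eq)
    then have "cos \<bar>s' + s\<bar> \<le> cos \<delta>'"
      using n \<delta>' by (intro cos_monotone_0_pi_le) auto
    then show False
      using cs by linarith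
  qed
  then have "dist s' (-s) < \<delta>"
    using \<delta>' by (simp add: dist_real_def)
  then have v: "norm (velocity i s' - velocity i (-s)) < e/3"
    using \<delta>(2)[OF s'(1)] by (simp add: dist_norm)
  have "t * (q s' \<bullet> N) \<le> t * (q s \<bullet> side_normal i s)"
    using eq cos_le_one[of "s' + s"] by linarith
  then have "q s' \<bullet> N \<le> q s \<bullet> side_normal i s"
    using t(1) by simp
  moreover have "q s \<bullet> side_normal i s \<le> normal_velocity i s + e/3"
    using ips[of "q s - velocity i s"] q[OF s] by (simp add: normal_velocity_def inner_diff_left)
  moreover have "velocity i s' \<bullet> N - e/3 \<le> q s' \<bullet> N"
    using ip[of "q s' - velocity i s'"] q[OF s'(1)] by (simp add: inner_diff_left)
  moreover have "normal_velocity i (-s) - e/3 \<le> velocity i s' \<bullet> N"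
    using ip[of "velocity i s' - velocity i (-s)"] v by (simp add: normal_velocity_def N_def inner_diff_left del: side_normal.simps)
  ultimately show "normal_velocity i (-s) \<le> normal_velocity i s + e"
    by linarith
qed

lemma normal_velocity_even: "s \<in> arc_dom \<Longrightarrow> normal_velocity i (-s) = normal_velocity i s"
  using normal_velocity_le_reflect[of s i] normal_velocity_le_reflect[of "-s" i] arc_dom_minus[of s] by simp

text \<open>At an end of the cap the derivative of the normal velocity reduces to two terms: the
  horizontal velocity, zero since the junction points are fixed, and the vertical component of the
  derivative of the velocity, zero since the arcs stay tangent to the horizontal edges. This
  provides the end conditions of \<open>even_cosine_series\<close>.\<close>

theorem normal_velocity_cosine_series:
  obtains b :: "nat \<Rightarrow> real" where "summable (\<lambda>m. real m ^ 2 * \<bar>b m\<bar>)" "summable (\<lambda>m. \<bar>b m\<bar>)"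
    "\<And>s. s \<in> arc_dom \<Longrightarrow> (\<lambda>m. b m * cos (2 * real m * s)) sums normal_velocity i s"
proof (rule velocityE[of i])
  fix D assume C: "Cr_on_arc 4 D" and D: "\<And>s. s \<in> arc_dom \<Longrightarrow> velocity i s = D s"
    and lim: "\<And>k s. k \<le> 4 \<Longrightarrow> s \<in> arc_dom \<Longrightarrow>
       ((\<lambda>t. (arc_deriv k (\<gamma> i t) s - arc_deriv k (\<gamma> i 0) s) /\<^sub>R t) \<longlongrightarrow> arc_deriv k D s) (at 0)"
  define \<sigma> where "\<sigma> = side_sign i"
  define x where "x k s = - \<sigma> * fst (arc_deriv k D s)" for k s
  define y where "y k s = - snd (arc_deriv k D s)" for k s
  have dx: "(x k has_real_derivative x l s) (at s within arc_dom)"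
    and dy: "(y k has_real_derivative y l s) (at s within arc_dom)"
    if k: "k < 4" "l = Suc k" and s: "s \<in> arc_dom" for k l s
  proof -
    note d = arc_deriv_has_vector_derivative[OF C k(1) s, folded k(2)]
    show "(x k has_real_derivative x l s) (at s within arc_dom)"
      unfolding x_def has_real_derivative_iff_has_vector_derivative
      by (rule bounded_linear.has_vector_derivative[OF bounded_linear_compose[OF bounded_linear_mult_right bounded_linear_fst] d])
    show "(y k has_real_derivative y l s) (at s within arc_dom)"
      unfolding y_def has_real_derivative_iff_has_vector_derivative
      by (rule bounded_linear.has_vector_derivative[OF bounded_linear_minus[OF bounded_linear_snd] d])
  qed
  have xc: "continuous_on arc_dom (x k)" and yc: "continuous_on arc_dom (y k)" if "k \<le> 4" for k
    unfolding x_def y_def using continuous_on_arc_deriv[OF C that] by (auto intro!: continuous_intros)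
  have D0: "D (pi/2) = 0" "D (-(pi/2)) = 0"
    using D velocity_ends by (metis arc_dom_ends(1,2))+
  have snd0: "snd (arc_deriv 1 (\<gamma> i t) s) = 0" if t: "t \<in> {-1..1}" and s: "s \<in> {pi/2, -(pi/2)}" for t s
  proof -
    have z: "snd v = 0" if "sgn v = (w, 0)" for v :: point and w
    proof (cases "v = 0")
      case False
      have "snd (sgn v) = 0"
        using that by simp
      then show ?thesis
        using False by (simp add: sgn_div_norm)
    qed simp
    have "sgn (arc_deriv 1 (\<gamma> i t) (-(pi/2))) = (side_sign i, 0)" "sgn (arc_deriv 1 (\<gamma> i t) (pi/2)) = (- side_sign i, 0)"
      using member(4)[OF t, of i] unfolding stadium_arc_param_def minus_divide_left by blast+
    then show ?thesis
      using s z by blast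
  qed
  have y1: "y 1 s = 0" if s: "s \<in> {pi/2, -(pi/2)}" for s
  proof -
    have "s \<in> arc_dom"
      using s arc_dom_ends(1,2) by blast
    then have "((\<lambda>t. snd ((arc_deriv 1 (\<gamma> i t) s - arc_deriv 1 (\<gamma> i 0) s) /\<^sub>R t)) \<longlongrightarrow> snd (arc_deriv 1 D s)) (at 0)"
      by (intro tendsto_snd lim) auto
    moreover have "\<forall>\<^sub>F t in at 0. snd ((arc_deriv 1 (\<gamma> i t) s - arc_deriv 1 (\<gamma> i 0) s) /\<^sub>R t) = 0"
      unfolding eventually_at using snd0[OF _ s] by (intro exI[of _ 1]) (auto simp: dist_real_def abs_less_iff)
    then have "((\<lambda>t. snd ((arc_deriv 1 (\<gamma> i t) s - arc_deriv 1 (\<gamma> i 0) s) /\<^sub>R t)) \<longlongrightarrow> 0) (at 0)"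
      by (rule tendsto_eventually)
    ultimately have "snd (arc_deriv 1 D s) = 0"
      by (rule LIM_unique)
    then show ?thesis
      by (simp add: y_def)
  qed
  define f where "f s = x 0 s * cos s + y 0 s * sin s" for s
  define f1 where "f1 s = x 1 s * cos s - x 0 s * sin s + y 1 s * sin s + y 0 s * cos s" for s
  define f2 where "f2 s = x 2 s * cos s - 2 * x 1 s * sin s - x 0 s * cos s
      + y 2 s * sin s + 2 * y 1 s * cos s - y 0 s * sin s" for s
  define f3 where "f3 s = x 3 s * cos s - 3 * x 2 s * sin s - 3 * x 1 s * cos s + x 0 s * sin s
      + y 3 s * sin s + 3 * y 2 s * cos s - 3 * y 1 s * sin s - y 0 s * cos s" for s
  define f4 where "f4 s = x 4 s * cos s - 4 * x 3 s * sin s - 6 * x 2 s * cos s + 4 * x 1 s * sin s + x 0 s * cos s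
      + y 4 s * sin s + 4 * y 3 s * cos s - 6 * y 2 s * sin s - 4 * y 1 s * cos s + y 0 s * sin s" for s
  have dd: "(x 0 has_real_derivative x 1 s) (at s within arc_dom)" "(x 1 has_real_derivative x 2 s) (at s within arc_dom)"
    "(x 2 has_real_derivative x 3 s) (at s within arc_dom)" "(x 3 has_real_derivative x 4 s) (at s within arc_dom)"
    "(y 0 has_real_derivative y 1 s) (at s within arc_dom)" "(y 1 has_real_derivative y 2 s) (at s within arc_dom)"
    "(y 2 has_real_derivative y 3 s) (at s within arc_dom)" "(y 3 has_real_derivative y 4 s) (at s within arc_dom)"
    if "s \<in> arc_dom" for s
    by (rule dx dy; simp add: that)+
  have F: "f s = normal_velocity i s" if "s \<in> arc_dom" for s
    using D[OF that] by (simp add: f_def x_def y_def normal_velocity_def inner_prod_def \<sigma>_def)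
  have d1: "(f has_real_derivative f1 s) (at s within arc_dom)" if "s \<in> arc_dom" for s
    unfolding f_def f1_def One_nat_def by (auto intro!: derivative_eq_intros dd[OF that, unfolded One_nat_def] simp: algebra_simps)
  have d2: "(f1 has_real_derivative f2 s) (at s within arc_dom)" if "s \<in> arc_dom" for s
    unfolding f1_def f2_def One_nat_def by (auto intro!: derivative_eq_intros dd[OF that, unfolded One_nat_def] simp: algebra_simps)
  have d3: "(f2 has_real_derivative f3 s) (at s within arc_dom)" if "s \<in> arc_dom" for s
    unfolding f2_def f3_def One_nat_def by (auto intro!: derivative_eq_intros dd[OF that, unfolded One_nat_def] simp: algebra_simps)
  have d4: "(f3 has_real_derivative f4 s) (at s within arc_dom)" if "s \<in> arc_dom" for s
    unfolding f3_def f4_def One_nat_def by (auto intro!: derivative_eq_intros dd[OF that, unfolded One_nat_def] simp: algebra_simps)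
  have c4: "continuous_on arc_dom f4"
    unfolding f4_def by (intro continuous_intros xc yc) auto
  have e1: "f1 (pi/2) = 0" "f1 (-(pi/2)) = 0"
    using y1 D0 by (simp_all add: f1_def x_def[of 0] y_def[of 0])
  have ev: "f (-s) = f s" if "s \<in> arc_dom" for s
    using normal_velocity_even[OF that] F[OF that] F[OF arc_dom_minus[OF that]] by simp
  show thesis
  proof (rule even_cosine_series[of f f1 f2 f3 f4, folded arc_dom_def, OF d1 d2 d3 d4 c4 _ e1(1) ev])
    show "f1 (-pi/2) = 0"
      using e1(2) by simp
    fix b :: "nat \<Rightarrow> real"
    assume "summable (\<lambda>m. real m ^ 2 * \<bar>b m\<bar>)" "summable (\<lambda>m. \<bar>b m\<bar>)"
      "\<And>s. s \<in> arc_dom \<Longrightarrow> (\<lambda>m. b m * cos (2 * real m * s)) sums f s"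
    then show thesis
      using F by (intro that[of b]) auto
  qed
qed

end

section \<open>First variation of the length of a strictly maximal polygon\<close>

text \<open>Tychonoff. Parameters of polygons are functions on all of \<open>nat\<close> that vanish
  beyond the last vertex, so the boxes used below are products of compact sets.\<close>

lemma compact_box_functions:
  fixes A :: "'i \<Rightarrow> 'a::topological_space set"
  assumes "\<And>i. compact (A i)"
  shows "compact {f. \<forall>i. f i \<in> A i}"
proof -
  have "compactin (product_topology (\<lambda>i. euclidean) UNIV) (PiE UNIV A)"
    using assms by (simp add: compactin_PiE)
  then show ?thesis
    by (simp add: euclidean_product_topology PiE_UNIV_domain Pi_def)
qed

lemma sum_cyclic_shift:
  fixes h :: "nat \<Rightarrow> 'a::comm_monoid_add"
  assumes "n \<ge> 1"
  shows "(\<Sum>k<n. h (Suc k mod n)) = (\<Sum>k<n. h k)"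
proof -
  obtain m where m: "n = Suc m"
    using assms by (cases n) auto
  have "(\<Sum>k<n. h (Suc k mod n)) = (\<Sum>k<m. h (Suc k mod n)) + h 0"
    by (simp add: m)
  also have "(\<Sum>k<m. h (Suc k mod n)) = (\<Sum>k<m. h (Suc k))"
    by (intro sum.cong) (auto simp: m)
  also have "\<dots> + h 0 = (\<Sum>k<n. h k)"
    unfolding m sum.lessThan_Suc_shift by (simp add: add.commute)
  finally show ?thesis .
qed

lemma has_real_derivative_dist:
  fixes f :: "real \<Rightarrow> point"
  assumes f: "(f has_vector_derivative f') (at x)" and ne: "f x \<noteq> p"
  shows "((\<lambda>x. dist p (f x)) has_real_derivative sgn (f x - p) \<bullet> f') (at x)"
proof -
  have "((\<lambda>x. f x - p) has_vector_derivative f') (at x)"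
    using f by (simp add: has_vector_derivative_diff_const)
  then have "((\<lambda>x. f x - p) has_derivative (\<lambda>h. h *\<^sub>R f')) (at x)"
    by (simp add: has_vector_derivative_def)
  moreover have "(norm has_derivative (\<lambda>h. h \<bullet> sgn (f x - p))) (at (f x - p))"
    using ne has_derivative_norm[of "f x - p"] by simp
  ultimately have "(norm \<circ> (\<lambda>x. f x - p) has_derivative (\<lambda>h. h \<bullet> sgn (f x - p)) \<circ> (\<lambda>h. h *\<^sub>R f')) (at x)"
    by (rule diff_chain_at)
  moreover have "norm \<circ> (\<lambda>x. f x - p) = (\<lambda>x. dist p (f x))"
    by (simp add: fun_eq_iff dist_norm norm_minus_commute)
  moreover have "(\<lambda>h. h \<bullet> sgn (f x - p)) \<circ> (\<lambda>h. h *\<^sub>R f') = (*) (sgn (f x - p) \<bullet> f')"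
    by (simp add: fun_eq_iff inner_commute)
  ultimately show ?thesis
    by (simp add: has_field_derivative_def)
qed

context stadium_family
begin

text \<open>A point \<open>z'\<close> outside the convex set \<open>\<Omega> \<tau>\<close> is
  separated from it in a unit direction \<open>W\<close>. But in direction \<open>W\<close> the
  stadium reaches at least \<open>3 * \<epsilon>\<close> beyond \<open>z\<close>, at a frontier
  point that the deformation moves by less than \<open>\<epsilon>\<close>, while \<open>z'\<close>
  is within \<open>\<epsilon>\<close> of \<open>z\<close>.\<close>

lemma interior_stable:
  assumes z: "z \<in> stadium a"
  obtains \<epsilon> d where "\<epsilon> > 0" "d > 0" "\<And>\<tau> z'. \<bar>\<tau>\<bar> < d \<Longrightarrow> dist z' z < \<epsilon> \<Longrightarrow> z' \<in> \<Omega> \<tau>"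
proof -
  have op: "open (stadium a)"
    by (simp add: stadium_eq[OF a_pos] open_open_stadium)
  obtain r where r: "r > 0" "ball z r \<subseteq> stadium a"
    using op z by (meson open_contains_ball)
  define \<epsilon> where "\<epsilon> = r / 4"
  have \<epsilon>: "\<epsilon> > 0"
    using r by (simp add: \<epsilon>_def)
  have "\<forall>i. \<exists>d>0. \<forall>t\<in>{-1..1}. \<bar>t - 0\<bar> < d \<longrightarrow> (\<forall>s\<in>arc_dom. norm (\<gamma> i t s - \<gamma> i 0 s) < \<epsilon>)"
    using uniformly_continuous_family[of 0 \<epsilon>] \<epsilon> by simp
  from choice[OF this] obtain d where
    "\<forall>i. d i > 0 \<and> (\<forall>t\<in>{-1..1}. \<bar>t - 0\<bar> < d i \<longrightarrow> (\<forall>s\<in>arc_dom. norm (\<gamma> i t s - \<gamma> i 0 s) < \<epsilon>))" ..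
  then have d: "\<And>i. d i > 0" "\<And>i t s. t \<in> {-1..1} \<Longrightarrow> \<bar>t\<bar> < d i \<Longrightarrow> s \<in> arc_dom \<Longrightarrow> norm (\<gamma> i t s - \<gamma> i 0 s) < \<epsilon>"
    by simp_all
  define d' where "d' = min 1 (min (d Left_Side) (d Right_Side))"
  have d': "d' > 0" "d' \<le> 1" "d' \<le> d i" for i
    using d(1) by (cases i; simp add: d'_def)+
  have "z' \<in> \<Omega> \<tau>" if \<tau>: "\<bar>\<tau>\<bar> < d'" and z': "dist z' z < \<epsilon>" for \<tau> z'
  proof (rule ccontr)
    assume out: "z' \<notin> \<Omega> \<tau>"
    have \<tau>1: "\<tau> \<in> {-1..1}"
      using \<tau> d'(2) by (auto simp: abs_less_iff)
    have "\<Omega> \<tau> \<noteq> {}"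
    proof
      assume "\<Omega> \<tau> = {}"
      then have "\<gamma> Left_Side \<tau> 0 \<in> {}"
        using member(3)[OF \<tau>1] arc_dom_ends(4) by auto
      then show False
        by simp
    qed
    then obtain w b where w: "w \<noteq> 0" "\<And>x. x \<in> \<Omega> \<tau> \<Longrightarrow> w \<bullet> x \<le> b" "w \<bullet> z' \<ge> b"
      using separating_hyperplane_sets[of "\<Omega> \<tau>" "{z'}"] member(2)[OF \<tau>1] out by auto
    define W where "W = sgn w"
    have W1: "norm W = 1"
      using w(1) by (simp add: W_def norm_sgn)
    have W: "W \<bullet> x \<le> W \<bullet> z'" if "x \<in> \<Omega> \<tau>" for x
    proof -
      have "w \<bullet> x \<le> w \<bullet> z'"
        using w(2)[OF that] w(3) by linarith
      then show ?thesis
        by (simp add: W_def sgn_div_norm mult_left_mono)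
    qed
    have "closure (\<Omega> \<tau>) \<subseteq> {x. W \<bullet> x \<le> W \<bullet> z'}"
      using W by (intro closure_minimal closed_Collect_le continuous_intros) auto
    then have Wf: "W \<bullet> x \<le> W \<bullet> z'" if "x \<in> frontier (\<Omega> \<tau>)" for x
      using that by (auto simp: frontier_def)
    have zz: "W \<bullet> z' < W \<bullet> z + \<epsilon>"
    proof -
      have "W \<bullet> (z' - z) \<le> norm W * norm (z' - z)"
        by (rule norm_cauchy_schwarz)
      then show ?thesis
        using z' W1 by (simp add: inner_diff_right dist_norm)
    qed
    have "compact (closure (stadium a))"
      by (simp add: stadium_eq[OF a_pos] bounded_open_stadium[OF a_pos])
    moreover have "closure (stadium a) \<noteq> {}"
      using z by auto
    moreover have "continuous_on (closure (stadium a)) (\<lambda>x. W \<bullet> x)"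
      by (intro continuous_intros)
    ultimately obtain \<xi> where "\<xi> \<in> closure (stadium a)" "\<forall>x\<in>closure (stadium a). W \<bullet> x \<le> W \<bullet> \<xi>"
      using continuous_attains_sup by blast
    then have \<xi>: "\<xi> \<in> closure (stadium a)" "\<And>x. x \<in> closure (stadium a) \<Longrightarrow> W \<bullet> x \<le> W \<bullet> \<xi>"
      by simp_all
    have "\<xi> \<notin> stadium a"
    proof
      assume "\<xi> \<in> stadium a"
      then obtain e where e: "e > 0" "ball \<xi> e \<subseteq> stadium a"
        using op by (meson open_contains_ball)
      have "\<xi> + (e/2) *\<^sub>R W \<in> ball \<xi> e"
        using e(1) W1 by (simp add: dist_norm)
      then have "W \<bullet> (\<xi> + (e/2) *\<^sub>R W) \<le> W \<bullet> \<xi>"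
        using e(2) closure_subset by (intro \<xi>(2)) blast
      then show False
        using e(1) W1 by (simp add: inner_add_right dot_square_norm)
    qed
    then have \<xi>f: "\<xi> \<in> frontier (\<Omega> 0)"
      using \<xi>(1) op by (simp add: start frontier_def interior_open)
    have "z + (3 * \<epsilon>) *\<^sub>R W \<in> ball z r"
      using \<epsilon> W1 by (simp add: dist_norm) (simp add: \<epsilon>_def)
    then have "W \<bullet> (z + (3 * \<epsilon>) *\<^sub>R W) \<le> W \<bullet> \<xi>"
      using r(2) closure_subset by (intro \<xi>(2)) blast
    then have \<xi>W: "W \<bullet> z + 3 * \<epsilon> \<le> W \<bullet> \<xi>"
      using W1 by (simp add: inner_add_right dot_square_norm)
    have z0: "(0::real) \<in> {-1..1}"
      by simp
    from \<xi>f consider "\<xi> \<in> flat_edges a" | i s where "s \<in> arc_dom" "\<xi> = \<gamma> i 0 s"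
      unfolding member(3)[OF z0] by blast
    then show False
    proof cases
      case 1
      then have "\<xi> \<in> frontier (\<Omega> \<tau>)"
        unfolding member(3)[OF \<tau>1] by blast
      then show False
        using Wf[of \<xi>] zz \<xi>W \<epsilon> by linarith
    next
      case 2
      then have "\<gamma> i \<tau> s \<in> frontier (\<Omega> \<tau>)"
        unfolding member(3)[OF \<tau>1] by blast
      then have "W \<bullet> \<gamma> i \<tau> s \<le> W \<bullet> z'"
        by (rule Wf)
      moreover have "W \<bullet> (\<gamma> i 0 s - \<gamma> i \<tau> s) \<le> norm W * norm (\<gamma> i 0 s - \<gamma> i \<tau> s)"
        by (rule norm_cauchy_schwarz)
      moreover have "norm (\<gamma> i 0 s - \<gamma> i \<tau> s) < \<epsilon>"
        using d(2)[OF \<tau>1 _ 2(1), of i] \<tau> d'(3)[of i] by (simp add: norm_minus_commute)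
      ultimately show False
        using W1 zz \<xi>W \<epsilon> 2(2) by (simp add: inner_diff_right)
    qed
  qed
  then show ?thesis
    using that[of \<epsilon> d'] \<epsilon> d'(1) by blast
qed

end

text \<open>\<open>distinct\<close> and \<open>midpoints\<close> are open conditions: they survive a
  small deformation and ensure that the maximal polygon nearby has its sides inside the domain and
  is traversed once.\<close>

locale stadium_polygon = stadium_family +
  fixes N :: nat and side :: "nat \<Rightarrow> side" and s :: "nat \<Rightarrow> real"
  assumes isospectral: "dynamically_isospectral \<Omega>"
    and N2: "N \<ge> 2" and s_interior: "\<And>k. k < N \<Longrightarrow> \<bar>s k\<bar> < pi/2" and s_zero: "\<And>k. k \<ge> N \<Longrightarrow> s k = 0"
    and distinct: "inj_on (\<lambda>k. side_arc a (side k) (s k)) {..<N}"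
    and midpoints: "\<And>k. k < N \<Longrightarrow>
      midpoint (side_arc a (side k) (s k)) (side_arc a (side (Suc k mod N)) (s (Suc k mod N))) \<in> stadium a"
    and strict_max: "\<exists>\<rho>>0. \<forall>\<sigma>. (\<forall>k<N. \<bar>\<sigma> k - s k\<bar> \<le> \<rho>) \<longrightarrow> (\<exists>k<N. \<sigma> k \<noteq> s k) \<longrightarrow>
      (\<Sum>k<N. dist (side_arc a (side k) (\<sigma> k)) (side_arc a (side (Suc k mod N)) (\<sigma> (Suc k mod N))))
      < (\<Sum>k<N. dist (side_arc a (side k) (s k)) (side_arc a (side (Suc k mod N)) (s (Suc k mod N))))"
begin

definition vertex :: "real \<Rightarrow> (nat \<Rightarrow> real) \<Rightarrow> nat \<Rightarrow> point" where
  "vertex \<tau> \<sigma> k = \<gamma> (side k) \<tau> (\<sigma> k)"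

definition length_at :: "real \<Rightarrow> (nat \<Rightarrow> real) \<Rightarrow> real" where
  "length_at \<tau> \<sigma> = (\<Sum>k<N. dist (vertex \<tau> \<sigma> k) (vertex \<tau> \<sigma> (Suc k mod N)))"

definition box :: "real \<Rightarrow> (nat \<Rightarrow> real) set" where
  "box \<rho> = {\<sigma>. \<forall>k. \<sigma> k \<in> (if k < N then {s k - \<rho>..s k + \<rho>} else {0})}"

definition Q :: "nat \<Rightarrow> point" where
  "Q k = side_arc a (side k) (s k)"

lemma nx: "Suc k mod N < N"
  using N2 by simp

lemma compact_box: "compact (box \<rho>)"
  unfolding box_def by (rule compact_box_functions) auto

lemma s_in_box: "\<rho> \<ge> 0 \<Longrightarrow> s \<in> box \<rho>"
  using s_zero by (auto simp: box_def)

lemma s_arc: "k < N \<Longrightarrow> s k \<in> arc_dom"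
  using s_interior[of k] by (auto simp: arc_dom_eq abs_less_iff)

lemma vertex_0: "k < N \<Longrightarrow> \<sigma> k \<in> arc_dom \<Longrightarrow> vertex 0 \<sigma> k = side_arc a (side k) (\<sigma> k)"
  unfolding vertex_def by (rule start_arc)

text \<open>Boxes of such a radius avoid the junction points, where a parameter could be varied to
  one side only.\<close>

definition admissible :: "real \<Rightarrow> bool" where
  "admissible \<rho> \<longleftrightarrow> \<rho> > 0 \<and> (\<forall>k<N. \<bar>s k\<bar> + \<rho> < pi/2)"

lemma box_interior: "admissible \<rho> \<Longrightarrow> \<sigma> \<in> box \<rho> \<Longrightarrow> k < N \<Longrightarrow> \<bar>\<sigma> k\<bar> < pi/2"
  unfolding admissible_def box_def by (drule conjunct2, drule spec[of _ k], drule CollectD, drule spec[of _ k]) auto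

lemma box_arc: "admissible \<rho> \<Longrightarrow> \<sigma> \<in> box \<rho> \<Longrightarrow> k < N \<Longrightarrow> \<sigma> k \<in> arc_dom"
  using box_interior[of \<rho> \<sigma> k] by (auto simp: arc_dom_eq abs_less_iff)

lemma continuous_on_member: "\<tau> \<in> {-1..1} \<Longrightarrow> continuous_on arc_dom (\<gamma> i \<tau>)"
  using member(4)[of \<tau> i] continuous_on_arc_deriv[of 4 "\<gamma> i \<tau>" 0] by (simp add: stadium_arc_param_def)

lemma continuous_on_length_at:
  assumes \<rho>: "admissible \<rho>" and \<tau>: "\<tau> \<in> {-1..1}"
  shows "continuous_on (box \<rho>) (length_at \<tau>)"
proof -
  have "continuous_on (box \<rho>) (\<lambda>\<sigma>. \<gamma> (side k) \<tau> (\<sigma> k))" if k: "k < N" for k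
  proof (rule continuous_on_compose2[OF continuous_on_member[OF \<tau>]])
    show "continuous_on (box \<rho>) (\<lambda>\<sigma>. \<sigma> k)"
      by (rule continuous_on_subset[OF continuous_on_product_coordinates]) simp
    show "(\<lambda>\<sigma>. \<sigma> k) ` box \<rho> \<subseteq> arc_dom"
      using box_arc[OF \<rho> _ k] by auto
  qed
  then show ?thesis
    unfolding length_at_def vertex_def using nx by (intro continuous_intros) auto
qed

lemma vertex_uniform:
  assumes \<rho>: "admissible \<rho>" and \<tau>: "\<tau> \<in> {-1..1}" and e: "e > 0"
  obtains d where "d > 0" "\<And>t \<sigma> k. t \<in> {-1..1} \<Longrightarrow> \<bar>t - \<tau>\<bar> < d \<Longrightarrow> \<sigma> \<in> box \<rho> \<Longrightarrow> k < N \<Longrightarrow>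
    dist (vertex t \<sigma> k) (vertex \<tau> \<sigma> k) < e"
proof -
  have "\<forall>i. \<exists>d>0. \<forall>t\<in>{-1..1}. \<bar>t - \<tau>\<bar> < d \<longrightarrow> (\<forall>s\<in>arc_dom. norm (\<gamma> i t s - \<gamma> i \<tau> s) < e)"
    using uniformly_continuous_family[OF \<tau> e] by simp
  from choice[OF this] obtain d where
    "\<forall>i. d i > 0 \<and> (\<forall>t\<in>{-1..1}. \<bar>t - \<tau>\<bar> < d i \<longrightarrow> (\<forall>s\<in>arc_dom. norm (\<gamma> i t s - \<gamma> i \<tau> s) < e))" ..
  then have d: "\<And>i. d i > 0" "\<And>i t s. t \<in> {-1..1} \<Longrightarrow> \<bar>t - \<tau>\<bar> < d i \<Longrightarrow> s \<in> arc_dom \<Longrightarrow> norm (\<gamma> i t s - \<gamma> i \<tau> s) < e"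
    by simp_all
  define d' where "d' = min (d Left_Side) (d Right_Side)"
  have d': "d' > 0" "d' \<le> d i" for i
    using d(1) by (cases i; simp add: d'_def)+
  have "dist (vertex t \<sigma> k) (vertex \<tau> \<sigma> k) < e"
    if "t \<in> {-1..1}" "\<bar>t - \<tau>\<bar> < d'" "\<sigma> \<in> box \<rho>" "k < N" for t \<sigma> k
    using d(2)[OF that(1) _ box_arc[OF \<rho> that(3,4)], of "side k"] that(2) d'(2)[of "side k"]
    by (simp add: vertex_def dist_norm)
  then show ?thesis
    using that[of d'] d'(1) by blast
qed

lemma length_at_uniform:
  assumes \<rho>: "admissible \<rho>" and \<tau>: "\<tau> \<in> {-1..1}" and e: "e > 0"
  obtains d where "d > 0" "\<And>t \<sigma>. t \<in> {-1..1} \<Longrightarrow> \<bar>t - \<tau>\<bar> < d \<Longrightarrow> \<sigma> \<in> box \<rho> \<Longrightarrow> \<bar>length_at t \<sigma> - length_at \<tau> \<sigma>\<bar> < e"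
proof -
  define \<epsilon> where "\<epsilon> = e / (2 * real N)"
  have \<epsilon>: "\<epsilon> > 0"
    using e N2 by (simp add: \<epsilon>_def)
  obtain d where d: "d > 0" "\<And>t \<sigma> k. t \<in> {-1..1} \<Longrightarrow> \<bar>t - \<tau>\<bar> < d \<Longrightarrow> \<sigma> \<in> box \<rho> \<Longrightarrow> k < N \<Longrightarrow>
    dist (vertex t \<sigma> k) (vertex \<tau> \<sigma> k) < \<epsilon>"
    by (rule vertex_uniform[OF \<rho> \<tau> \<epsilon>]) (rule that)
  have "\<bar>length_at t \<sigma> - length_at \<tau> \<sigma>\<bar> < e" if t: "t \<in> {-1..1}" "\<bar>t - \<tau>\<bar> < d" "\<sigma> \<in> box \<rho>" for t \<sigma>
  proof -
    have "\<bar>length_at t \<sigma> - length_at \<tau> \<sigma>\<bar>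
        \<le> (\<Sum>k<N. \<bar>dist (vertex t \<sigma> k) (vertex t \<sigma> (Suc k mod N)) - dist (vertex \<tau> \<sigma> k) (vertex \<tau> \<sigma> (Suc k mod N))\<bar>)"
      unfolding length_at_def sum_subtractf[symmetric] by (rule sum_abs)
    also have "\<dots> < (\<Sum>k<N. 2 * \<epsilon>)"
    proof (rule sum_strict_mono)
      fix k assume "k \<in> {..<N}"
      then have "dist (vertex t \<sigma> k) (vertex \<tau> \<sigma> k) < \<epsilon>" "dist (vertex t \<sigma> (Suc k mod N)) (vertex \<tau> \<sigma> (Suc k mod N)) < \<epsilon>"
        using d(2)[OF t] nx by auto
      then show "\<bar>dist (vertex t \<sigma> k) (vertex t \<sigma> (Suc k mod N)) - dist (vertex \<tau> \<sigma> k) (vertex \<tau> \<sigma> (Suc k mod N))\<bar> < 2 * \<epsilon>"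
        by metric
    qed (use N2 in \<open>auto simp: lessThan_empty_iff bot_nat_def\<close>)
    also have "\<dots> = e"
      using N2 by (simp add: \<epsilon>_def)
    finally show ?thesis .
  qed
  then show ?thesis
    using that d(1) by blast
qed

text \<open>Moving one vertex changes only its two sides; at a maximum the derivative of their total
  length along the arc vanishes, which is the law of reflection. A side is inside because its
  midpoint is an interior point of a convex set whose closure contains the ends, and distinct
  vertices exclude a repetition.\<close>

lemma critical_trajectory:
  assumes \<tau>: "\<tau> \<in> {-1..1}"
    and \<sigma>: "\<And>k. k < N \<Longrightarrow> \<bar>\<sigma> k\<bar> < pi/2"
    and inj: "inj_on (vertex \<tau> \<sigma>) {..<N}"
    and mid: "\<And>k. k < N \<Longrightarrow> midpoint (vertex \<tau> \<sigma> k) (vertex \<tau> \<sigma> (Suc k mod N)) \<in> \<Omega> \<tau>"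
    and e: "e > 0"
    and locmax: "\<And>j x. j < N \<Longrightarrow> \<bar>x - \<sigma> j\<bar> < e \<Longrightarrow> length_at \<tau> (\<sigma>(j := x)) \<le> length_at \<tau> \<sigma>"
  shows "length_at \<tau> \<sigma> \<in> length_spectrum (\<Omega> \<tau>)"
proof -
  define ps where "ps = map (vertex \<tau> \<sigma>) [0..<N]"
  have len: "length ps = N"
    by (simp add: ps_def)
  define P where "P k = ps ! (k mod N)" for k
  have P: "P k = vertex \<tau> \<sigma> (k mod N)" for k
    using N2 by (simp add: P_def ps_def)
  have \<sigma>a: "\<sigma> k \<in> arc_dom" if "k < N" for k
    using \<sigma>[OF that] by (auto simp: arc_dom_eq abs_less_iff)
  have vf: "vertex \<tau> \<sigma> k \<in> frontier (\<Omega> \<tau>)" if "k < N" for k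
    unfolding member(3)[OF \<tau>] vertex_def using \<sigma>a[OF that] by blast
  have nxne: "Suc k mod N \<noteq> k" if "k < N" for k
    using that N2 by (auto simp: mod_Suc)
  have vne: "vertex \<tau> \<sigma> k \<noteq> vertex \<tau> \<sigma> (Suc k mod N)" if "k < N" for k
    using inj_onD[OF inj, of k "Suc k mod N"] nxne[OF that] nx[of k] that by auto
  have seg: "open_segment (vertex \<tau> \<sigma> k) (vertex \<tau> \<sigma> (Suc k mod N)) \<subseteq> \<Omega> \<tau>" if k: "k < N" for k
  proof -
    define p where "p = vertex \<tau> \<sigma> k"
    define q where "q = vertex \<tau> \<sigma> (Suc k mod N)"
    define m where "m = midpoint p q"
    have i: "interior (\<Omega> \<tau>) = \<Omega> \<tau>"
      by (rule interior_open[OF member(1)[OF \<tau>]])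
    have m: "m \<in> interior (\<Omega> \<tau>)"
      using mid[OF k] by (simp add: i m_def p_def q_def)
    have "p \<in> closure (\<Omega> \<tau>)" "q \<in> closure (\<Omega> \<tau>)"
      using vf[OF k] vf[OF nx[of k]] by (auto simp: p_def q_def frontier_def)
    then have "open_segment m p \<subseteq> \<Omega> \<tau>" "open_segment m q \<subseteq> \<Omega> \<tau>"
      using in_interior_closure_convex_segment[OF member(2)[OF \<tau>] m] by (auto simp: i)
    moreover have "open_segment p q \<subseteq> open_segment m p \<union> {m} \<union> open_segment m q"
    proof -
      have "p \<noteq> q"
        using vne[OF k] by (simp add: p_def q_def)
      then have "m \<in> open_segment p q"
        by (simp add: m_def)
      then have "m \<in> closed_segment p q"
        by (simp add: open_segment_def)
      from Un_closed_segment[OF this]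
      have "closed_segment p q = closed_segment p m \<union> closed_segment m q"
        by simp
      then show ?thesis
        unfolding open_segment_def by (auto simp: closed_segment_commute)
    qed
    ultimately have "open_segment p q \<subseteq> \<Omega> \<tau>"
      using m by (auto simp: i)
    then show ?thesis
      by (simp add: p_def q_def)
  qed
  have refl: "reflects (\<Omega> \<tau>) (vertex \<tau> \<sigma> k) (vertex \<tau> \<sigma> j) (vertex \<tau> \<sigma> (Suc j mod N))"
    if k: "k < N" and j: "j = Suc k mod N" for k j
  proof -
    define c where "c x = \<gamma> (side j) \<tau> x" for x
    define T where "T = arc_deriv 1 (\<gamma> (side j) \<tau>) (\<sigma> j)"
    have jN: "j < N"
      using nx j by simp
    have int: "at (\<sigma> j) within arc_dom = at (\<sigma> j)"
      using \<sigma>[OF jN] by (intro at_within_interior) (auto simp: arc_dom_eq abs_less_iff)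
    have Cr: "Cr_on_arc 4 (\<gamma> (side j) \<tau>)" and T0: "T \<noteq> 0"
      using member(4)[OF \<tau>, of "side j"] \<sigma>a[OF jN] by (auto simp: stadium_arc_param_def T_def)
    have dc: "(c has_vector_derivative T) (at (\<sigma> j))"
      using arc_deriv_has_vector_derivative[OF Cr, of 0 "\<sigma> j"] \<sigma>a[OF jN]
      by (simp add: int T_def c_def[abs_def])
    have bt: "boundary_tangent (\<Omega> \<tau>) (vertex \<tau> \<sigma> j) T"
      unfolding boundary_tangent_def
    proof (intro exI[of _ "\<lambda>t. c (\<sigma> j + t)"] exI[of _ "pi/2 - \<bar>\<sigma> j\<bar>"] conjI ballI)
      show "0 < pi/2 - \<bar>\<sigma> j\<bar>"
        using \<sigma>[OF jN] by simp
      fix t assume "t \<in> {- (pi/2 - \<bar>\<sigma> j\<bar>)<..<pi/2 - \<bar>\<sigma> j\<bar>}"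
      then have "\<sigma> j + t \<in> arc_dom"
        by (auto simp: arc_dom_eq abs_if split: if_splits)
      then show "c (\<sigma> j + t) \<in> frontier (\<Omega> \<tau>)"
        unfolding member(3)[OF \<tau>] c_def by blast
    next
      have "((\<lambda>t. \<sigma> j + t) has_vector_derivative 1) (at 0)"
        by (auto intro!: derivative_eq_intros simp flip: has_real_derivative_iff_has_vector_derivative)
      from vector_diff_chain_at[OF this, of c T] dc
      show "((\<lambda>t. c (\<sigma> j + t)) has_vector_derivative T) (at 0)"
        by (simp add: o_def)
    qed (simp add: c_def vertex_def)
    define p where "p = vertex \<tau> \<sigma> k"
    define q where "q = vertex \<tau> \<sigma> (Suc j mod N)"
    have cj: "c (\<sigma> j) = vertex \<tau> \<sigma> j"
      by (simp add: c_def vertex_def)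
    have ne: "c (\<sigma> j) \<noteq> p" "c (\<sigma> j) \<noteq> q"
      using vne[OF k, folded j] vne[OF jN] by (auto simp: cj p_def q_def)
    have kj: "k \<noteq> j"
      using nxne[OF k] j by simp
    \<comment> \<open>Only the sides \<open>k\<close> and \<open>j\<close>, which end and start at
      vertex \<open>j\<close>, are affected. For \<open>N = 2\<close> they join the same two
      vertices, and then \<open>p = q\<close>.\<close>
    have split: "length_at \<tau> (\<sigma>(j := x)) - length_at \<tau> \<sigma>
        = (dist p (c x) - dist p (c (\<sigma> j))) + (dist q (c x) - dist q (c (\<sigma> j)))" for x
    proof -
      define g where "g l = dist (vertex \<tau> (\<sigma>(j := x)) l) (vertex \<tau> (\<sigma>(j := x)) (Suc l mod N))
          - dist (vertex \<tau> \<sigma> l) (vertex \<tau> \<sigma> (Suc l mod N))" for l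
      have v: "vertex \<tau> (\<sigma>(j := x)) l = (if l = j then c x else vertex \<tau> \<sigma> l)" for l
        by (simp add: vertex_def c_def)
      have "length_at \<tau> (\<sigma>(j := x)) - length_at \<tau> \<sigma> = (\<Sum>l<N. g l)"
        by (simp add: length_at_def g_def sum_subtractf)
      also have "\<dots> = (\<Sum>l\<in>{k, j}. g l)"
      proof (rule sum.mono_neutral_right)
        show "\<forall>l\<in>{..<N} - {k, j}. g l = 0"
        proof
          fix l assume l: "l \<in> {..<N} - {k, j}"
          have "Suc l mod N \<noteq> j"
          proof
            assume "Suc l mod N = j"
            then show False
              using l k unfolding j by (auto simp: mod_Suc split: if_splits)
          qed
          then show "g l = 0"
            using l by (simp add: g_def v)
        qed
      qed (use k jN in auto)
      also have "\<dots> = g k + g j"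
        using kj by simp
      also have "g k = dist p (c x) - dist p (c (\<sigma> j))"
        using kj by (simp add: g_def v p_def cj flip: j)
      also have "g j = dist q (c x) - dist q (c (\<sigma> j))"
        using nxne[OF jN] by (simp add: g_def v q_def cj dist_commute)
      finally show ?thesis .
    qed
    have "((\<lambda>x. dist p (c x) + dist q (c x)) has_real_derivative
        sgn (c (\<sigma> j) - p) \<bullet> T + sgn (c (\<sigma> j) - q) \<bullet> T) (at (\<sigma> j))"
      by (intro DERIV_add has_real_derivative_dist dc ne)
    then have "sgn (c (\<sigma> j) - p) \<bullet> T + sgn (c (\<sigma> j) - q) \<bullet> T = 0"
    proof (rule DERIV_local_max[OF _ e])
      show "\<forall>x. \<bar>\<sigma> j - x\<bar> < e \<longrightarrow> dist p (c x) + dist q (c x) \<le> dist p (c (\<sigma> j)) + dist q (c (\<sigma> j))"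
      proof (intro allI impI)
        fix x assume "\<bar>\<sigma> j - x\<bar> < e"
        then have "length_at \<tau> (\<sigma>(j := x)) \<le> length_at \<tau> \<sigma>"
          using jN by (intro locmax) (auto simp: abs_minus_commute)
        then show "dist p (c x) + dist q (c x) \<le> dist p (c (\<sigma> j)) + dist q (c (\<sigma> j))"
          using split[of x] by linarith
      qed
    qed
    moreover have "sgn (c (\<sigma> j) - q) = - sgn (q - c (\<sigma> j))"
      by (metis minus_diff_eq sgn_minus)
    ultimately have "sgn (vertex \<tau> \<sigma> j - p) \<bullet> T = sgn (q - vertex \<tau> \<sigma> j) \<bullet> T"
      by (simp add: cj)
    then show ?thesis
      unfolding reflects_def using T0 bt p_def q_def by blast
  qed
  have "closed_billiard_trajectory (\<Omega> \<tau>) ps"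
    unfolding closed_billiard_trajectory_def Let_def len P_def[symmetric]
  proof (intro conjI allI impI)
    fix k assume k: "k < N"
    have P0: "P k = vertex \<tau> \<sigma> k" and P1: "P (k + 1) = vertex \<tau> \<sigma> (Suc k mod N)"
      and P2: "P (k + 2) = vertex \<tau> \<sigma> (Suc (Suc k mod N) mod N)"
      using k by (simp_all add: P mod_Suc_eq)
    show "P k \<in> frontier (\<Omega> \<tau>)" "P k \<noteq> P (k + 1)" "open_segment (P k) (P (k + 1)) \<subseteq> \<Omega> \<tau>"
      unfolding P0 P1 using vf[OF k] vne[OF k] seg[OF k] by auto
    show "reflects (\<Omega> \<tau>) (P k) (P (k + 1)) (P (k + 2))"
      unfolding P0 P1 P2 by (rule refl[OF k]) simp
  next
    fix d assume d: "0 < d \<and> d < N"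
    show "rotate d ps \<noteq> ps"
    proof
      assume "rotate d ps = ps"
      then have "rotate d ps ! 0 = ps ! 0"
        by simp
      then have "ps ! d = ps ! 0"
        using d len by (simp add: nth_rotate)
      then have "vertex \<tau> \<sigma> d = vertex \<tau> \<sigma> 0"
        using d by (simp add: ps_def)
      then show False
        using inj_onD[OF inj, of d 0] d by auto
    qed
  qed (rule N2)
  moreover have "perimeter ps = length_at \<tau> \<sigma>"
    unfolding perimeter_def length_at_def len using N2 by (intro sum.cong) (auto simp: ps_def)
  ultimately show ?thesis
    unfolding length_spectrum_def by force
qed

lemma side_arc_lipschitz: "dist (side_arc a i x) (side_arc a i y) \<le> 2 * \<bar>x - y\<bar>"
proof -
  have "side_arc a i x - side_arc a i y = (side_sign i * (cos x - cos y), sin x - sin y)"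
    by (simp add: algebra_simps)
  then have "dist (side_arc a i x) (side_arc a i y) = norm (side_sign i * (cos x - cos y), sin x - sin y)"
    by (simp only: dist_norm)
  also have "\<dots> \<le> norm (side_sign i * (cos x - cos y)) + norm (sin x - sin y)"
    by (rule norm_Pair_le)
  also have "norm (side_sign i * (cos x - cos y)) = \<bar>cos x - cos y\<bar>"
    by (cases i) auto
  also have "norm (sin x - sin y) = \<bar>cos (pi/2 - x) - cos (pi/2 - y)\<bar>"
    by (simp add: cos_diff)
  also have "\<bar>cos x - cos y\<bar> + \<bar>cos (pi/2 - x) - cos (pi/2 - y)\<bar> \<le> \<bar>x - y\<bar> + \<bar>x - y\<bar>"
    using abs_cos_diff_le[of "pi/2 - x" "pi/2 - y"] by (intro add_mono abs_cos_diff_le) simp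
  finally show ?thesis
    by simp
qed

lemma separation:
  obtains r where "r > 0" "\<And>j k. j < N \<Longrightarrow> k < N \<Longrightarrow> j \<noteq> k \<Longrightarrow> dist (Q j) (Q k) \<ge> 2 * r"
proof -
  define S where "S = (\<lambda>(j, k). dist (Q j) (Q k)) ` {(j, k). j < N \<and> k < N \<and> j \<noteq> k}"
  have "finite S"
    unfolding S_def by (rule finite_imageI, rule finite_subset[of _ "{..<N} \<times> {..<N}"]) auto
  moreover have "(0, 1) \<in> {(j, k). j < N \<and> k < N \<and> j \<noteq> (k::nat)}"
    using N2 by simp
  then have ne: "S \<noteq> {}"
    unfolding S_def by blast
  ultimately have "Min S \<in> S"
    by simp
  moreover have "x > 0" if "x \<in> S" for x
    using that inj_onD[OF distinct] by (auto simp: S_def Q_def simp del: side_arc.simps)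
  ultimately have "Min S > 0"
    by blast
  moreover have "dist (Q j) (Q k) \<ge> Min S" if "j < N" "k < N" "j \<noteq> k" for j k
    using that \<open>finite S\<close> by (intro Min_le) (auto simp: S_def)
  ultimately show ?thesis
    using that[of "Min S / 2"] by simp
qed

lemma midpoints_stable:
  obtains \<epsilon> d where "\<epsilon> > 0" "d > 0"
    "\<And>\<tau> z k. k < N \<Longrightarrow> \<bar>\<tau>\<bar> < d \<Longrightarrow> dist z (midpoint (Q k) (Q (Suc k mod N))) < \<epsilon> \<Longrightarrow> z \<in> \<Omega> \<tau>"
proof -
  have "\<exists>e>0. \<forall>k<M. \<forall>\<tau> z. \<bar>\<tau>\<bar> < e \<longrightarrow> dist z (midpoint (Q k) (Q (Suc k mod N))) < e \<longrightarrow> z \<in> \<Omega> \<tau>" if "M \<le> N" for M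
    using that
  proof (induction M)
    case 0
    then show ?case
      by (intro exI[of _ 1]) simp
  next
    case (Suc M)
    then obtain e where e: "e > 0" "\<And>k \<tau> z. k < M \<Longrightarrow> \<bar>\<tau>\<bar> < e \<Longrightarrow> dist z (midpoint (Q k) (Q (Suc k mod N))) < e \<Longrightarrow> z \<in> \<Omega> \<tau>"
      by auto
    have "midpoint (Q M) (Q (Suc M mod N)) \<in> stadium a"
      unfolding Q_def using Suc.prems by (intro midpoints) simp
    then obtain \<epsilon> d where d: "\<epsilon> > 0" "d > 0" "\<And>\<tau> z. \<bar>\<tau>\<bar> < d \<Longrightarrow> dist z (midpoint (Q M) (Q (Suc M mod N))) < \<epsilon> \<Longrightarrow> z \<in> \<Omega> \<tau>"
      by (rule interior_stable) (rule that)
    show ?case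
    proof (intro exI[of _ "min e (min \<epsilon> d)"] conjI allI impI)
      show "0 < min e (min \<epsilon> d)"
        using e d by simp
      fix k \<tau> z assume "k < Suc M" "\<bar>\<tau>\<bar> < min e (min \<epsilon> d)" "dist z (midpoint (Q k) (Q (Suc k mod N))) < min e (min \<epsilon> d)"
      then show "z \<in> \<Omega> \<tau>"
        using e(2)[of k \<tau> z] d(3)[of \<tau> z] by (cases "k = M") auto
    qed
  qed
  from this[OF order_refl] obtain e where "e > 0"
    "\<forall>k<N. \<forall>\<tau> z. \<bar>\<tau>\<bar> < e \<longrightarrow> dist z (midpoint (Q k) (Q (Suc k mod N))) < e \<longrightarrow> z \<in> \<Omega> \<tau>"
    by blast
  then show ?thesis
    using that[of e e] by blast
qed

definition max_length :: "real \<Rightarrow> real \<Rightarrow> real" where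
  "max_length \<rho> \<tau> = Sup (length_at \<tau> ` box \<rho>)"

lemma max_length_attained:
  assumes \<rho>: "admissible \<rho>" and \<tau>: "\<tau> \<in> {-1..1}"
  obtains \<sigma> where "\<sigma> \<in> box \<rho>" "length_at \<tau> \<sigma> = max_length \<rho> \<tau>"
    "\<And>\<sigma>'. \<sigma>' \<in> box \<rho> \<Longrightarrow> length_at \<tau> \<sigma>' \<le> max_length \<rho> \<tau>"
proof -
  have "box \<rho> \<noteq> {}"
    using s_in_box[of \<rho>] \<rho> by (auto simp: admissible_def)
  then obtain \<sigma> where \<sigma>: "\<sigma> \<in> box \<rho>" "\<And>\<sigma>'. \<sigma>' \<in> box \<rho> \<Longrightarrow> length_at \<tau> \<sigma>' \<le> length_at \<tau> \<sigma>"
    using continuous_attains_sup[OF compact_box _ continuous_on_length_at[OF \<rho> \<tau>]] by blast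
  have "max_length \<rho> \<tau> = length_at \<tau> \<sigma>"
    unfolding max_length_def using \<sigma> by (intro cSup_eq_maximum) auto
  then show ?thesis
    using that \<sigma> by simp
qed

lemma max_length_continuous:
  assumes \<rho>: "admissible \<rho>"
  shows "continuous_on {-1..1} (max_length \<rho>)"
  unfolding continuous_on_iff
proof (intro ballI allI impI)
  fix \<tau> e :: real assume \<tau>: "\<tau> \<in> {-1..1}" and e: "0 < e"
  obtain d where d: "d > 0" "\<And>t \<sigma>. t \<in> {-1..1} \<Longrightarrow> \<bar>t - \<tau>\<bar> < d \<Longrightarrow> \<sigma> \<in> box \<rho> \<Longrightarrow> \<bar>length_at t \<sigma> - length_at \<tau> \<sigma>\<bar> < e"
    by (rule length_at_uniform[OF \<rho> \<tau> e]) (rule that)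
  show "\<exists>d>0. \<forall>t\<in>{-1..1}. dist t \<tau> < d \<longrightarrow> dist (max_length \<rho> t) (max_length \<rho> \<tau>) < e"
  proof (intro exI[of _ d] conjI ballI impI)
    fix t assume t: "t \<in> {-1..1}" "dist t \<tau> < d"
    obtain \<sigma> where \<sigma>: "\<sigma> \<in> box \<rho>" "length_at \<tau> \<sigma> = max_length \<rho> \<tau>"
      "\<And>\<sigma>'. \<sigma>' \<in> box \<rho> \<Longrightarrow> length_at \<tau> \<sigma>' \<le> max_length \<rho> \<tau>"
      by (rule max_length_attained[OF \<rho> \<tau>]) (rule that)
    obtain \<sigma>' where \<sigma>': "\<sigma>' \<in> box \<rho>" "length_at t \<sigma>' = max_length \<rho> t"
      "\<And>\<sigma>. \<sigma> \<in> box \<rho> \<Longrightarrow> length_at t \<sigma> \<le> max_length \<rho> t"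
      by (rule max_length_attained[OF \<rho> t(1)]) (rule that)
    have td: "\<bar>t - \<tau>\<bar> < d"
      using t(2) by (simp add: dist_real_def)
    show "dist (max_length \<rho> t) (max_length \<rho> \<tau>) < e"
      using d(2)[OF t(1) td \<sigma>(1)] d(2)[OF t(1) td \<sigma>'(1)] \<sigma>(2) \<sigma>(3)[OF \<sigma>'(1)] \<sigma>'(2) \<sigma>'(3)[OF \<sigma>(1)]
      unfolding dist_real_def by linarith
  qed (rule d)
qed

lemma length_at_0_strict_max:
  obtains \<rho>0 where "\<rho>0 > 0" "\<And>\<rho> \<sigma>. admissible \<rho> \<Longrightarrow> \<rho> \<le> \<rho>0 \<Longrightarrow> \<sigma> \<in> box \<rho> \<Longrightarrow> \<sigma> \<noteq> s \<Longrightarrow> length_at 0 \<sigma> < length_at 0 s"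
proof -
  obtain \<rho>0 where \<rho>0: "\<rho>0 > 0" "\<And>\<sigma>. (\<forall>k<N. \<bar>\<sigma> k - s k\<bar> \<le> \<rho>0) \<Longrightarrow> (\<exists>k<N. \<sigma> k \<noteq> s k) \<Longrightarrow>
      (\<Sum>k<N. dist (side_arc a (side k) (\<sigma> k)) (side_arc a (side (Suc k mod N)) (\<sigma> (Suc k mod N))))
      < (\<Sum>k<N. dist (side_arc a (side k) (s k)) (side_arc a (side (Suc k mod N)) (s (Suc k mod N))))"
    using strict_max by blast
  have "length_at 0 \<sigma> < length_at 0 s" if \<rho>: "admissible \<rho>" "\<rho> \<le> \<rho>0" and \<sigma>: "\<sigma> \<in> box \<rho>" "\<sigma> \<noteq> s" for \<rho> \<sigma>
  proof -
    have eq: "length_at 0 \<sigma>' = (\<Sum>k<N. dist (side_arc a (side k) (\<sigma>' k)) (side_arc a (side (Suc k mod N)) (\<sigma>' (Suc k mod N))))"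
      if "\<And>k. k < N \<Longrightarrow> \<sigma>' k \<in> arc_dom" for \<sigma>'
      unfolding length_at_def using that nx by (intro sum.cong refl) (simp add: vertex_0 del: side_arc.simps)
    obtain k where k: "\<sigma> k \<noteq> s k"
      using \<sigma>(2) by (auto simp: fun_eq_iff)
    have kN: "k < N"
    proof (rule ccontr)
      assume n: "\<not> k < N"
      then have "\<sigma> k = 0"
        using \<sigma>(1) by (auto simp: box_def dest: spec[of _ k])
      then show False
        using k n s_zero by simp
    qed
    have "\<forall>k<N. \<bar>\<sigma> k - s k\<bar> \<le> \<rho>0"
    proof (intro allI impI)
      fix k assume "k < N"
      then have "\<sigma> k \<in> {s k - \<rho>..s k + \<rho>}"
        using \<sigma>(1) unfolding box_def by (metis (mono_tags, lifting) mem_Collect_eq)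
      then show "\<bar>\<sigma> k - s k\<bar> \<le> \<rho>0"
        using \<rho>(2) by (auto simp: abs_le_iff)
    qed
    moreover have "length_at 0 \<sigma> = (\<Sum>k<N. dist (side_arc a (side k) (\<sigma> k)) (side_arc a (side (Suc k mod N)) (\<sigma> (Suc k mod N))))"
      by (rule eq) (rule box_arc[OF \<rho>(1) \<sigma>(1)])
    moreover have "length_at 0 s = (\<Sum>k<N. dist (side_arc a (side k) (s k)) (side_arc a (side (Suc k mod N)) (s (Suc k mod N))))"
      by (rule eq) (rule s_arc)
    moreover have "\<exists>k<N. \<sigma> k \<noteq> s k"
      using k kN by blast
    ultimately show ?thesis
      using \<rho>0(2)[of \<sigma>] by (simp only:)
  qed
  then show ?thesis
    using that[of \<rho>0] \<rho>0(1) by blast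
qed

text \<open>At time 0 the length on the faces \<open>K\<close> of the box stays
  \<open>2 * \<eta>\<close> below its value at \<open>s\<close>. A deformation that changes lengths
  by less than \<open>\<eta>\<close> cannot push a maximizer to a face, so the maximizer is an
  interior critical polygon. Only the maximal value, not the maximizer, has to vary
  continuously.\<close>

lemma persistent_trajectories:
  obtains \<rho> d where "admissible \<rho>" "d > 0" "d \<le> 1" "max_length \<rho> 0 = length_at 0 s"
    "\<And>\<tau>. \<bar>\<tau>\<bar> < d \<Longrightarrow> max_length \<rho> \<tau> \<in> length_spectrum (\<Omega> \<tau>)"
proof -
  obtain r where r: "r > 0" "\<And>j k. j < N \<Longrightarrow> k < N \<Longrightarrow> j \<noteq> k \<Longrightarrow> dist (Q j) (Q k) \<ge> 2 * r"
    by (rule separation) (rule that)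
  obtain \<epsilon> d1 where \<epsilon>: "\<epsilon> > 0" "d1 > 0"
    "\<And>\<tau> z k. k < N \<Longrightarrow> \<bar>\<tau>\<bar> < d1 \<Longrightarrow> dist z (midpoint (Q k) (Q (Suc k mod N))) < \<epsilon> \<Longrightarrow> z \<in> \<Omega> \<tau>"
    by (rule midpoints_stable) (rule that)
  obtain \<rho>0 where \<rho>0: "\<rho>0 > 0" "\<And>\<rho> \<sigma>. admissible \<rho> \<Longrightarrow> \<rho> \<le> \<rho>0 \<Longrightarrow> \<sigma> \<in> box \<rho> \<Longrightarrow> \<sigma> \<noteq> s \<Longrightarrow> length_at 0 \<sigma> < length_at 0 s"
    by (rule length_at_0_strict_max) (rule that)
  define e where "e = min r \<epsilon> / 2"
  have e: "e > 0" "2 * e \<le> r" "2 * e \<le> \<epsilon>"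
    using r(1) \<epsilon>(1) by (auto simp: e_def)
  define g where "g = Min ((\<lambda>k. pi/2 - \<bar>s k\<bar>) ` {..<N})"
  have gS: "finite ((\<lambda>k. pi/2 - \<bar>s k\<bar>) ` {..<N})" "(\<lambda>k. pi/2 - \<bar>s k\<bar>) ` {..<N} \<noteq> {}"
    using N2 by (auto simp: lessThan_empty_iff bot_nat_def)
  have g0: "g > 0"
    using Min_in[OF gS] s_interior by (auto simp: g_def)
  have gle: "g \<le> pi/2 - \<bar>s k\<bar>" if "k < N" for k
    unfolding g_def using that gS(1) by (intro Min_le) auto
  \<comment> \<open>\<open>e/4\<close> moves vertices by at most \<open>e/2\<close>, because
    \<open>side_arc\<close> has Lipschitz constant 2; \<open>\<rho>0\<close> keeps the maximum
    strict; \<open>g/2\<close> keeps the parameters off the ends of the arcs.\<close>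
  define \<rho> where "\<rho> = min (min (e/4) \<rho>0) (g/2)"
  have \<rho>pos: "\<rho> > 0" "\<rho> \<le> e/4" "\<rho> \<le> \<rho>0" "\<rho> \<le> g/2"
    using e \<rho>0(1) g0 by (auto simp: \<rho>_def)
  have adm: "admissible \<rho>"
    unfolding admissible_def
  proof (intro conjI allI impI)
    fix k assume "k < N"
    then show "\<bar>s k\<bar> + \<rho> < pi/2"
      using gle[of k] \<rho>pos(4) g0 by linarith
  qed (rule \<rho>pos)
  have z: "(0::real) \<in> {-1..1}"
    by simp
  define K where "K = box \<rho> \<inter> (\<Union>k<N. {\<sigma>. \<bar>\<sigma> k - s k\<bar> = \<rho>})"
  have "closed {\<sigma> :: nat \<Rightarrow> real. \<bar>\<sigma> k - s k\<bar> = \<rho>}" for k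
    by (intro closed_Collect_eq continuous_intros continuous_on_product_coordinates)
  then have K: "compact K"
    unfolding K_def by (intro compact_Int_closed compact_box closed_UN) auto
  have sK: "s \<notin> K"
    using \<rho>pos(1) by (auto simp: K_def)
  obtain \<eta> where \<eta>: "\<eta> > 0" "\<And>\<sigma>. \<sigma> \<in> K \<Longrightarrow> length_at 0 \<sigma> \<le> length_at 0 s - 2 * \<eta>"
  proof (cases "K = {}")
    case True
    then show ?thesis
      using that[of 1] by auto
  next
    case False
    have "continuous_on K (length_at 0)"
      by (rule continuous_on_subset[OF continuous_on_length_at[OF adm z]]) (auto simp: K_def)
    then obtain \<sigma>1 where \<sigma>1: "\<sigma>1 \<in> K" "\<And>\<sigma>. \<sigma> \<in> K \<Longrightarrow> length_at 0 \<sigma> \<le> length_at 0 \<sigma>1"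
      using continuous_attains_sup[OF K False] by blast
    have "length_at 0 \<sigma>1 < length_at 0 s"
      using \<sigma>1(1) sK by (intro \<rho>0(2)[OF adm \<rho>pos(3)]) (auto simp: K_def)
    moreover define \<eta>0 where "\<eta>0 = (length_at 0 s - length_at 0 \<sigma>1) / 2"
    moreover have "length_at 0 s - 2 * \<eta>0 = length_at 0 \<sigma>1"
      by (simp add: \<eta>0_def field_simps)
    ultimately show ?thesis
      using that[of \<eta>0] \<sigma>1(2) by simp
  qed
  obtain d2 where d2: "d2 > 0" "\<And>t \<sigma>. t \<in> {-1..1} \<Longrightarrow> \<bar>t - 0\<bar> < d2 \<Longrightarrow> \<sigma> \<in> box \<rho> \<Longrightarrow> \<bar>length_at t \<sigma> - length_at 0 \<sigma>\<bar> < \<eta>"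
    by (rule length_at_uniform[OF adm z \<eta>(1)]) (rule that)
  obtain d3 where d3: "d3 > 0" "\<And>t \<sigma> k. t \<in> {-1..1} \<Longrightarrow> \<bar>t - 0\<bar> < d3 \<Longrightarrow> \<sigma> \<in> box \<rho> \<Longrightarrow> k < N \<Longrightarrow>
    dist (vertex t \<sigma> k) (vertex 0 \<sigma> k) < e/2"
    by (rule vertex_uniform[OF adm z half_gt_zero[OF e(1)]]) (rule that)
  define d where "d = min (min d1 d2) (min d3 1)"
  have d: "d > 0" "d \<le> 1" "d \<le> d1" "d \<le> d2" "d \<le> d3"
    using \<epsilon>(2) d2(1) d3(1) by (auto simp: d_def)
  have sb: "s \<in> box \<rho>"
    using \<rho>pos(1) by (intro s_in_box) simp
  show ?thesis
  proof (rule that[OF adm d(1,2)])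
    have "length_at 0 \<sigma> \<le> length_at 0 s" if "\<sigma> \<in> box \<rho>" for \<sigma>
      using \<rho>0(2)[OF adm \<rho>pos(3) that] by (cases "\<sigma> = s") auto
    then show "max_length \<rho> 0 = length_at 0 s"
      unfolding max_length_def using sb by (intro cSup_eq_maximum) auto
  next
    fix \<tau> assume \<tau>d: "\<bar>\<tau>\<bar> < d"
    then have \<tau>: "\<tau> \<in> {-1..1}"
      using d(2) by (auto simp: abs_less_iff)
    obtain \<sigma> where \<sigma>: "\<sigma> \<in> box \<rho>" "length_at \<tau> \<sigma> = max_length \<rho> \<tau>"
      "\<And>\<sigma>'. \<sigma>' \<in> box \<rho> \<Longrightarrow> length_at \<tau> \<sigma>' \<le> max_length \<rho> \<tau>"
      by (rule max_length_attained[OF adm \<tau>]) (rule that)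
    have close: "dist (vertex \<tau> \<sigma> k) (Q k) < e" if k: "k < N" for k
    proof -
      have "\<sigma> k \<in> {s k - \<rho>..s k + \<rho>}"
        using \<sigma>(1) k unfolding box_def by (metis (mono_tags, lifting) mem_Collect_eq)
      then have "\<bar>\<sigma> k - s k\<bar> \<le> \<rho>"
        by (auto simp: abs_le_iff)
      then have "4 * \<bar>\<sigma> k - s k\<bar> \<le> 4 * \<rho>"
        by simp
      also have "\<dots> \<le> e"
        using \<rho>pos(2) by simp
      finally have "2 * \<bar>\<sigma> k - s k\<bar> \<le> e/2"
        by simp
      then have "dist (vertex 0 \<sigma> k) (Q k) \<le> e/2"
        using side_arc_lipschitz[of "side k" "\<sigma> k" "s k"] vertex_0[where \<sigma>=\<sigma>, OF k box_arc[OF adm \<sigma>(1) k]]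
        by (simp add: Q_def del: side_arc.simps)
      moreover have "dist (vertex \<tau> \<sigma> k) (vertex 0 \<sigma> k) < e/2"
        using d3(2)[OF \<tau> _ \<sigma>(1) k] \<tau>d d(5) by simp
      ultimately show ?thesis
        using dist_triangle[of "vertex \<tau> \<sigma> k" "Q k" "vertex 0 \<sigma> k"] by linarith
    qed
    have "\<sigma> \<notin> K"
    proof
      assume K: "\<sigma> \<in> K"
      have "length_at \<tau> \<sigma> < length_at 0 \<sigma> + \<eta>" "length_at 0 s < length_at \<tau> s + \<eta>"
        using d2(2)[OF \<tau> _ \<sigma>(1)] d2(2)[OF \<tau> _ sb] \<tau>d d(4) by (simp_all add: abs_less_iff)
      then have "length_at \<tau> \<sigma> < length_at \<tau> s"
        using \<eta>(2)[OF K] by linarith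
      then show False
        using \<sigma>(2) \<sigma>(3)[OF sb] by linarith
    qed
    then have inner: "\<bar>\<sigma> k - s k\<bar> < \<rho>" if k: "k < N" for k
    proof -
      have "\<sigma> k \<in> {s k - \<rho>..s k + \<rho>}"
        using \<sigma>(1) k unfolding box_def by (metis (mono_tags, lifting) mem_Collect_eq)
      then have "\<bar>\<sigma> k - s k\<bar> \<le> \<rho>"
        by (auto simp: abs_le_iff)
      moreover have "\<bar>\<sigma> k - s k\<bar> \<noteq> \<rho>"
        using \<open>\<sigma> \<notin> K\<close> \<sigma>(1) k by (auto simp: K_def)
      ultimately show ?thesis
        by simp
    qed
    define m where "m = Min ((\<lambda>k. \<rho> - \<bar>\<sigma> k - s k\<bar>) ` {..<N})"
    have mS: "finite ((\<lambda>k. \<rho> - \<bar>\<sigma> k - s k\<bar>) ` {..<N})" "(\<lambda>k. \<rho> - \<bar>\<sigma> k - s k\<bar>) ` {..<N} \<noteq> {}"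
      using N2 by (auto simp: lessThan_empty_iff bot_nat_def)
    have m0: "m > 0"
      using Min_in[OF mS] inner by (auto simp: m_def)
    have mle: "m \<le> \<rho> - \<bar>\<sigma> k - s k\<bar>" if "k < N" for k
      unfolding m_def using that mS(1) by (intro Min_le) auto
    have "length_at \<tau> \<sigma> \<in> length_spectrum (\<Omega> \<tau>)"
    proof (rule critical_trajectory[OF \<tau> _ _ _ m0])
      show "\<bar>\<sigma> k\<bar> < pi/2" if "k < N" for k
        by (rule box_interior[OF adm \<sigma>(1) that])
      show "inj_on (vertex \<tau> \<sigma>) {..<N}"
      proof (rule inj_onI, rule ccontr)
        fix j k assume jk: "j \<in> {..<N}" "k \<in> {..<N}" "vertex \<tau> \<sigma> j = vertex \<tau> \<sigma> k" "j \<noteq> k"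
        have "dist (Q j) (Q k) < 2 * e"
          using close[of j] close[of k] jk dist_triangle[of "Q j" "Q k" "vertex \<tau> \<sigma> j"] by (simp add: dist_commute)
        then show False
          using r(2)[of j k] jk e by simp
      qed
      show "midpoint (vertex \<tau> \<sigma> k) (vertex \<tau> \<sigma> (Suc k mod N)) \<in> \<Omega> \<tau>" if k: "k < N" for k
      proof (rule \<epsilon>(3)[OF k])
        show "\<bar>\<tau>\<bar> < d1"
          using \<tau>d d(3) by simp
        have "dist (midpoint p q) (midpoint p' q') \<le> (dist p p' + dist q q') / 2" for p q p' q' :: point
        proof -
          have "midpoint p q - midpoint p' q' = (1/2) *\<^sub>R ((p - p') + (q - q'))"
            by (simp add: midpoint_def algebra_simps)
          then have "dist (midpoint p q) (midpoint p' q') = (1/2) * norm ((p - p') + (q - q'))"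
            by (simp add: dist_norm)
          also have "\<dots> \<le> (1/2) * (norm (p - p') + norm (q - q'))"
            by (intro mult_left_mono norm_triangle_ineq) auto
          finally show ?thesis
            by (simp add: dist_norm)
        qed
        from this[of "vertex \<tau> \<sigma> k" "vertex \<tau> \<sigma> (Suc k mod N)" "Q k" "Q (Suc k mod N)"]
        show "dist (midpoint (vertex \<tau> \<sigma> k) (vertex \<tau> \<sigma> (Suc k mod N))) (midpoint (Q k) (Q (Suc k mod N))) < \<epsilon>"
          using close[OF k] close[OF nx[of k]] e by simp
      qed
      show "length_at \<tau> (\<sigma>(j := x)) \<le> length_at \<tau> \<sigma>" if j: "j < N" and x: "\<bar>x - \<sigma> j\<bar> < m" for j x
      proof -
        have "x \<in> {s j - \<rho>..s j + \<rho>}"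
          using mle[OF j] x by (auto simp: abs_less_iff abs_if split: if_splits)
        then have "(\<sigma>(j := x)) k \<in> (if k < N then {s k - \<rho>..s k + \<rho>} else {0})" for k
        proof (cases "k = j")
          case False
          moreover have "\<sigma> k \<in> (if k < N then {s k - \<rho>..s k + \<rho>} else {0})"
            using \<sigma>(1) unfolding box_def by blast
          ultimately show ?thesis
            by (simp only: fun_upd_other not_False_eq_True)
        qed (use j in simp)
        then have "\<sigma>(j := x) \<in> box \<rho>"
          unfolding box_def by blast
        then show ?thesis
          using \<sigma>(2,3) by simp
      qed
    qed
    then show "max_length \<rho> \<tau> \<in> length_spectrum (\<Omega> \<tau>)"
      using \<sigma>(2) by simp
  qed
qed

lemma length_at_derivative:
  "((\<lambda>\<tau>. length_at \<tau> s) has_real_derivative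
     (\<Sum>k<N. sgn (Q (Suc k mod N) - Q k) \<bullet> (velocity (side (Suc k mod N)) (s (Suc k mod N)) - velocity (side k) (s k)))) (at 0)"
proof -
  have dv: "((\<lambda>\<tau>. vertex \<tau> s k) has_vector_derivative velocity (side k) (s k)) (at 0)" if k: "k < N" for k
  proof -
    have "((\<lambda>\<tau>. \<gamma> (side k) \<tau> (s k)) has_vector_derivative velocity (side k) (s k)) (at 0)"
      by (rule velocity_has_vector_derivative[OF s_arc[OF k]])
    then show ?thesis
      by (simp add: vertex_def)
  qed
  have v0: "vertex 0 s k = Q k" if "k < N" for k
    using vertex_0[of k s, OF that s_arc[OF that]] by (simp add: Q_def)
  have "((\<lambda>\<tau>. dist (vertex \<tau> s k) (vertex \<tau> s (Suc k mod N))) has_real_derivative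
      sgn (Q (Suc k mod N) - Q k) \<bullet> (velocity (side (Suc k mod N)) (s (Suc k mod N)) - velocity (side k) (s k))) (at 0)"
    if k: "k < N" for k
  proof -
    have ne: "Q k \<noteq> Q (Suc k mod N)"
    proof
      assume "Q k = Q (Suc k mod N)"
      then have "k = Suc k mod N"
        using k nx by (intro inj_onD[OF distinct]) (simp_all add: Q_def del: side_arc.simps)
      then show False
        using k N2 by (auto simp: mod_Suc split: if_splits)
    qed
    have "((\<lambda>\<tau>. dist 0 (vertex \<tau> s (Suc k mod N) - vertex \<tau> s k)) has_real_derivative
      sgn ((vertex 0 s (Suc k mod N) - vertex 0 s k) - 0) \<bullet> (velocity (side (Suc k mod N)) (s (Suc k mod N)) - velocity (side k) (s k))) (at 0)"
      using ne v0[OF k] v0[OF nx[of k]]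
      by (intro has_real_derivative_dist has_vector_derivative_diff dv nx k) auto
    then show ?thesis
      unfolding v0[OF k] v0[OF nx[of k]] by (simp add: dist_norm norm_minus_commute)
  qed
  then show ?thesis
    unfolding length_at_def by (intro DERIV_sum) auto
qed

text \<open>The maximum is compared rather than differentiated: if the derivative at the fixed
  parameters \<open>s\<close> were nonzero, moving \<open>\<tau>\<close> to the appropriate side
  would increase \<open>length_at \<tau> s\<close> and hence the maximum. Being continuous, the
  maximum would then sweep an interval of positive length inside a countable spectrum.\<close>

theorem first_variation_zero:
  "(\<Sum>k<N. sgn (Q (Suc k mod N) - Q k) \<bullet> (velocity (side (Suc k mod N)) (s (Suc k mod N)) - velocity (side k) (s k))) = 0"
  (is "?V = 0")
proof (rule ccontr)
  assume V: "?V \<noteq> 0"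
  obtain \<rho> d where \<rho>: "admissible \<rho>" "d > 0" "d \<le> 1" "max_length \<rho> 0 = length_at 0 s"
    "\<And>\<tau>. \<bar>\<tau>\<bar> < d \<Longrightarrow> max_length \<rho> \<tau> \<in> length_spectrum (\<Omega> \<tau>)"
    by (rule persistent_trajectories) (rule that)
  have spec: "max_length \<rho> \<tau> \<in> length_spectrum (stadium a)" if "\<bar>\<tau>\<bar> < d" for \<tau>
  proof -
    have "\<tau> \<in> {-1..1}"
      using that \<rho>(3) by (auto simp: abs_less_iff)
    then show ?thesis
      using \<rho>(5)[OF that] isospectral by (simp add: dynamically_isospectral_def start)
  qed
  obtain \<tau>1 where \<tau>1: "\<bar>\<tau>1\<bar> < d" "length_at \<tau>1 s > length_at 0 s"
  proof (cases "?V > 0")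
    case True
    obtain e where e: "e > 0" "\<And>h. h > 0 \<Longrightarrow> h < e \<Longrightarrow> length_at 0 s < length_at (0 + h) s"
      using DERIV_pos_inc_right[OF length_at_derivative True] by blast
    then show ?thesis
      using that[of "min e d / 2"] \<rho>(2) by auto
  next
    case False
    then have "?V < 0"
      using V by simp
    then obtain e where e: "e > 0" "\<And>h. h > 0 \<Longrightarrow> h < e \<Longrightarrow> length_at 0 s < length_at (0 - h) s"
      using DERIV_neg_dec_left[OF length_at_derivative] by blast
    then show ?thesis
      using that[of "- (min e d / 2)"] \<rho>(2) e(2)[of "min e d / 2"] by auto
  qed
  have \<tau>1m: "\<tau>1 \<in> {-1..1}"
    using \<tau>1(1) \<rho>(3) by (auto simp: abs_less_iff)
  have sb: "s \<in> box \<rho>"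
    using \<rho>(1) by (intro s_in_box) (simp add: admissible_def)
  have "length_at \<tau>1 s \<le> max_length \<rho> \<tau>1"
    by (rule max_length_attained[OF \<rho>(1) \<tau>1m]) (use sb in blast)
  then have lt: "max_length \<rho> 0 < max_length \<rho> \<tau>1"
    using \<tau>1(2) \<rho>(4) by simp
  define I where "I = closed_segment 0 \<tau>1"
  have Id: "\<bar>t\<bar> < d" if "t \<in> I" for t
    using that \<tau>1(1) unfolding I_def closed_segment_eq_real_ivl by (auto split: if_splits)
  have "I \<subseteq> {-1..1}"
    using Id \<rho>(3) by (force simp: abs_less_iff)
  then have "continuous_on I (max_length \<rho>)"
    using max_length_continuous[OF \<rho>(1)] continuous_on_subset by blast
  then have "connected (max_length \<rho> ` I)"
    by (intro connected_continuous_image) (simp_all add: I_def)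
  moreover have "max_length \<rho> 0 \<in> max_length \<rho> ` I" "max_length \<rho> \<tau>1 \<in> max_length \<rho> ` I"
    by (auto simp: I_def)
  ultimately have "{max_length \<rho> 0..max_length \<rho> \<tau>1} \<subseteq> max_length \<rho> ` I"
    by (rule connected_contains_Icc)
  also have "\<dots> \<subseteq> length_spectrum (stadium a)"
    using Id spec by auto
  finally have "countable {max_length \<rho> 0..max_length \<rho> \<tau>1}"
    using countable_length_spectrum_stadium[OF a8] countable_subset by blast
  then show False
    using lt uncountable_closed_interval by blast
qed

end

section \<open>Segments between the caps\<close>

text \<open>Strict concavity on \<open>{0..pi}\<close> from the mean value theorem. The equality
  case is recorded because strictness of the maximal orbit is deduced from it.\<close>

lemma sin_le_tangent:
  fixes u v :: real
  assumes "u \<in> {0..pi}" "v \<in> {0..pi}"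
  shows "sin v \<le> sin u + cos u * (v - u)" "sin v = sin u + cos u * (v - u) \<Longrightarrow> v = u"
proof -
  have *: "sin v < sin u + cos u * (v - u)" if "v \<noteq> u"
  proof (cases "u < v")
    case True
    have "\<exists>z. u < z \<and> z < v \<and> sin v - sin u = (v - u) * cos z"
      using True by (intro MVT2) (auto intro!: derivative_eq_intros)
    then obtain z where z: "u < z" "z < v" "sin v - sin u = (v - u) * cos z"
      by blast
    have "cos z < cos u"
      using z assms by (intro cos_monotone_0_pi) auto
    then have "(v - u) * cos z < (v - u) * cos u"
      using True by (intro mult_strict_left_mono) auto
    then show ?thesis
      using z(3) by (simp add: algebra_simps)
  next
    case False
    then have lt: "v < u"
      using that by simp
    then have "\<exists>z. v < z \<and> z < u \<and> sin u - sin v = (u - v) * cos z"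
      by (intro MVT2) (auto intro!: derivative_eq_intros)
    then obtain z where z: "v < z" "z < u" "sin u - sin v = (u - v) * cos z"
      by blast
    have "cos u < cos z"
      using z assms by (intro cos_monotone_0_pi) auto
    then have "(u - v) * cos u < (u - v) * cos z"
      using lt by (intro mult_strict_left_mono) auto
    then show ?thesis
      using z(3) by (simp add: algebra_simps)
  qed
  show "sin v \<le> sin u + cos u * (v - u)"
    using * by (cases "v = u") auto
  show "v = u" if "sin v = sin u + cos u * (v - u)"
    using that * by force
qed

lemma cos_le_tangent:
  fixes u v :: real
  assumes "\<bar>u\<bar> \<le> pi/2" "\<bar>v\<bar> \<le> pi/2"
  shows "cos v \<le> cos u - sin u * (v - u)" "cos v = cos u - sin u * (v - u) \<Longrightarrow> v = u"
proof -
  have "u + pi/2 \<in> {0..pi}" "v + pi/2 \<in> {0..pi}"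
    using assms by (auto simp: abs_le_iff)
  note sin_le_tangent[OF this]
  moreover have "sin (x + pi/2) = cos x" "cos (x + pi/2) = - sin x" for x :: real
    by (simp_all add: sin_add cos_add)
  ultimately show "cos v \<le> cos u - sin u * (v - u)" "cos v = cos u - sin u * (v - u) \<Longrightarrow> v = u"
    by simp_all
qed

lemma side_arc_Right: "side_arc a Right_Side s = - side_arc a Left_Side (- s)"
  by simp

lemma arc_chord:
  "side_arc a Left_Side (b + c) - side_arc a Left_Side (b - c) = (2 * sin c) *\<^sub>R (sin b, cos b)"
  by (simp add: sin_add cos_add sin_diff cos_diff)

lemma dist_arc_chord:
  "dist (side_arc a Left_Side x) (side_arc a Left_Side y) = 2 * \<bar>sin ((y - x) / 2)\<bar>"
proof -
  have "side_arc a Left_Side y - side_arc a Left_Side x = (2 * sin ((y - x)/2)) *\<^sub>R (sin ((x + y)/2), cos ((x + y)/2))"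
    using arc_chord[of a "(x + y)/2" "(y - x)/2"] by (simp add: field_simps del: side_arc.simps)
  then have "dist (side_arc a Left_Side y) (side_arc a Left_Side x) = \<bar>2 * sin ((y - x)/2)\<bar> * norm (sin ((x + y)/2), cos ((x + y)/2))"
    by (simp only: dist_norm norm_scaleR real_norm_def)
  then show ?thesis
    by (simp add: norm_prod_def dist_commute abs_mult del: side_arc.simps)
qed

text \<open>A point of the right cap is written as the antipode of a point of the left cap; both
  caps then share one parametrization, and the length becomes symmetric in \<open>x\<close> and
  \<open>y\<close>.\<close>

definition crossing :: "real \<Rightarrow> real \<Rightarrow> real \<Rightarrow> real" where
  "crossing a x y = dist (side_arc a Left_Side x) (- side_arc a Left_Side y)"

lemma crossing_eq:
  "crossing a x y = sqrt ((a + cos x + cos y)\<^sup>2 + (sin x + sin y)\<^sup>2)"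
proof -
  have "(- (a/2 + cos x) - (a/2 + cos y))\<^sup>2 = (a + cos x + cos y)\<^sup>2"
    by (simp add: power2_eq_square algebra_simps)
  then show ?thesis
    by (simp add: crossing_def dist_Pair_Pair dist_real_def)
qed

lemma crossing_minus: "crossing a (-x) (-y) = crossing a x y"
proof -
  have "(- sin x - sin y)\<^sup>2 = (sin x + sin y)\<^sup>2"
    by (simp add: power2_eq_square algebra_simps)
  then show ?thesis
    by (simp add: crossing_eq)
qed

lemma rotated_crossing:
  fixes a x y \<phi> :: real
  shows "(a + cos x + cos y) * cos \<phi> + (sin x + sin y) * sin \<phi> = a * cos \<phi> + cos (x - \<phi>) + cos (y - \<phi>)"
    and "(sin x + sin y) * cos \<phi> - (a + cos x + cos y) * sin \<phi> = sin (x - \<phi>) + sin (y - \<phi>) - a * sin \<phi>"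
  by (simp_all add: cos_diff sin_diff algebra_simps)

lemma rotate_components:
  fixes X Y c s :: real
  assumes "X * c + Y * s = H" "Y * c - X * s = 0" "s\<^sup>2 + c\<^sup>2 = 1"
  shows "X = H * c" "Y = H * s" "X\<^sup>2 + Y\<^sup>2 = H\<^sup>2"
proof -
  have 1: "H * c = X * c\<^sup>2 + (Y * c) * s" "H * s = (X * s) * c + Y * s\<^sup>2"
    by (simp_all add: assms(1)[symmetric] power2_eq_square algebra_simps)
  have 2: "Y * c = X * s"
    using assms(2) by simp
  show X: "X = H * c"
    using assms(3) unfolding 1(1) 2 by (simp add: power2_eq_square algebra_simps flip: distrib_left)
  show Y: "Y = H * s"
    using assms(3) unfolding 1(2) 2[symmetric] by (simp add: power2_eq_square algebra_simps flip: distrib_left)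
  have "X\<^sup>2 + Y\<^sup>2 = H\<^sup>2 * (s\<^sup>2 + c\<^sup>2)"
    unfolding X Y by (simp add: power_mult_distrib algebra_simps)
  then show "X\<^sup>2 + Y\<^sup>2 = H\<^sup>2"
    using assms(3) by simp
qed

text \<open>\<open>crit\<close> states that the segment has no component orthogonal to the direction
  \<open>\<phi>\<close>, so its length equals its projection to that direction.\<close>

lemma crossing_critical:
  assumes a: "a > 0" and \<phi>: "\<bar>\<phi>\<bar> < pi/2" and x: "\<bar>x - \<phi>\<bar> \<le> pi/2" and y: "\<bar>y - \<phi>\<bar> \<le> pi/2"
    and crit: "a * sin \<phi> = sin (x - \<phi>) + sin (y - \<phi>)"
  defines "H \<equiv> a * cos \<phi> + cos (x - \<phi>) + cos (y - \<phi>)"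
  shows "H > 0" "crossing a x y = H" "a + cos x + cos y = H * cos \<phi>" "sin x + sin y = H * sin \<phi>"
proof -
  have "cos (x - \<phi>) \<ge> 0" "cos (y - \<phi>) \<ge> 0"
    by (rule cos_ge_zero; use x y in linarith)+
  moreover have "cos \<phi> > 0"
    by (rule cos_gt_zero_pi; use \<phi> in linarith)
  ultimately have "a * cos \<phi> > 0" "cos (x - \<phi>) \<ge> 0" "cos (y - \<phi>) \<ge> 0"
    using a by simp_all
  then show H: "H > 0"
    by (simp add: H_def)
  have 1: "(a + cos x + cos y) * cos \<phi> + (sin x + sin y) * sin \<phi> = H"
    unfolding H_def by (rule rotated_crossing)
  have 2: "(sin x + sin y) * cos \<phi> - (a + cos x + cos y) * sin \<phi> = 0"
    using rotated_crossing(2)[where a=a and x=x and y=y and \<phi>=\<phi>] crit by simp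
  note r = rotate_components[OF 1 2 sin_cos_squared_add]
  show "crossing a x y = H" "a + cos x + cos y = H * cos \<phi>" "sin x + sin y = H * sin \<phi>"
    using r H by (simp_all add: crossing_eq)
qed

text \<open>The length of a segment between the two caps is the maximum over \<open>\<phi>\<close> of its projection
  \<open>a * cos \<phi> + cos (x - \<phi>) + cos (y - \<phi>)\<close> to the direction \<open>\<phi>\<close>, which is concave in
  \<open>(x, y, \<phi>)\<close>.\<close>

lemma crossing_le_tangent:
  assumes a: "a > 0" and \<phi>: "\<bar>\<phi>\<bar> < pi/2" and x: "\<bar>x - \<phi>\<bar> \<le> pi/2" and y: "\<bar>y - \<phi>\<bar> \<le> pi/2"
    and crit: "a * sin \<phi> = sin (x - \<phi>) + sin (y - \<phi>)"
    and x': "\<bar>x'\<bar> < pi/2" and y': "\<bar>y'\<bar> < pi/2"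
  defines "T \<equiv> crossing a x y - sin (x - \<phi>) * (x' - x) - sin (y - \<phi>) * (y' - y)"
  shows "crossing a x' y' \<le> T" "crossing a x' y' = T \<Longrightarrow> x' = x \<and> y' = y"
proof -
  define X where "X = a + cos x' + cos y'"
  define Y where "Y = sin x' + sin y'"
  have cx: "cos x' > 0" and cy: "cos y' > 0"
    by (rule cos_gt_zero_pi; use x' y' in linarith)+
  have X: "X > 0"
    using a cx cy by (simp add: X_def)
  \<comment> \<open>The direction of the second segment: both lengths become values of the same
    function, at \<open>(x', y', \<theta>)\<close> and at \<open>(x, y, \<phi>)\<close>.\<close>
  define \<theta> where "\<theta> = arctan (Y / X)"
  define C where "C = crossing a x' y'"
  have C: "C = sqrt (X\<^sup>2 + Y\<^sup>2)"
    by (simp add: C_def crossing_eq X_def Y_def)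
  have C0: "C > 0"
    unfolding C using X by (simp add: add_pos_nonneg)
  have \<theta>: "\<bar>\<theta>\<bar> < pi/2"
    unfolding \<theta>_def using arctan_lbound[of "Y/X"] arctan_ubound[of "Y/X"] by linarith
  have s1: "sqrt (1 + (Y/X)\<^sup>2) = C / X"
  proof -
    have "1 + (Y/X)\<^sup>2 = (X\<^sup>2 + Y\<^sup>2) / X\<^sup>2"
      using X by (simp add: power_divide field_simps)
    then show ?thesis
      using X by (simp add: C real_sqrt_divide)
  qed
  have cs: "cos \<theta> = X / C" "sin \<theta> = Y / C"
    unfolding \<theta>_def cos_arctan sin_arctan s1 using X by simp_all
  have sq: "X\<^sup>2 + Y\<^sup>2 = C\<^sup>2"
    by (simp add: C)
  have "X * cos \<theta> + Y * sin \<theta> = (X\<^sup>2 + Y\<^sup>2) / C"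
    by (simp add: cs power2_eq_square add_divide_distrib)
  then have CH: "C = a * cos \<theta> + cos (x' - \<theta>) + cos (y' - \<theta>)"
    using rotated_crossing(1)[of a x' y' \<theta>] C0
    unfolding sq X_def[symmetric] Y_def[symmetric] by (simp add: power2_eq_square)
  \<comment> \<open>The cosine is concave only within a quarter turn of 0, so the second segment
    must make an acute angle with both normals.\<close>
  have pos: "cos (t - \<theta>) > 0" if t: "t = x' \<or> t = y'" "\<bar>t\<bar> < pi/2" for t
  proof -
    have ct: "cos t > 0"
      by (rule cos_gt_zero_pi; use t(2) in linarith)
    have "cos t * cos x' + sin t * sin x' + (cos t * cos y' + sin t * sin y') = 1 + cos (x' - y')"
      using t(1) sin_cos_squared_add3[of x'] sin_cos_squared_add3[of y']
      by (auto simp: cos_diff mult.commute)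
    moreover have "C * cos (t - \<theta>) = cos t * X + sin t * Y"
      using C0 by (simp add: cos_diff cs distrib_left)
    ultimately have "C * cos (t - \<theta>) = a * cos t + (1 + cos (x' - y'))"
      by (simp add: X_def Y_def algebra_simps)
    moreover have "1 + cos (x' - y') \<ge> 0"
      using cos_ge_minus_one[of "x' - y'"] by linarith
    moreover have "a * cos t > 0"
      using a ct by simp
    ultimately have "C * cos (t - \<theta>) > 0"
      by linarith
    then show ?thesis
      using C0 by (simp add: zero_less_mult_iff)
  qed
  have small: "\<bar>t - \<theta>\<bar> \<le> pi/2" if "cos (t - \<theta>) > 0" "\<bar>t\<bar> < pi/2" for t
  proof (rule ccontr)
    assume "\<not> ?thesis"
    moreover have "\<bar>t - \<theta>\<bar> < pi"
      using that(2) \<theta> by linarith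
    ultimately have "cos \<bar>t - \<theta>\<bar> \<le> cos (pi/2)"
      by (intro cos_monotone_0_pi_le) auto
    then show False
      using that(1) by simp
  qed
  note xt = small[OF pos[of x']] and yt = small[OF pos[of y']]
  have t1: "cos \<theta> \<le> cos \<phi> - sin \<phi> * (\<theta> - \<phi>)" "cos \<theta> = cos \<phi> - sin \<phi> * (\<theta> - \<phi>) \<Longrightarrow> \<theta> = \<phi>"
    using \<phi> \<theta> by (auto intro: cos_le_tangent)
  have t2: "cos (x' - \<theta>) \<le> cos (x - \<phi>) - sin (x - \<phi>) * (x' - \<theta> - (x - \<phi>))"
    "cos (x' - \<theta>) = cos (x - \<phi>) - sin (x - \<phi>) * (x' - \<theta> - (x - \<phi>)) \<Longrightarrow> x' - \<theta> = x - \<phi>"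
    using x xt x' by (auto intro: cos_le_tangent)
  have t3: "cos (y' - \<theta>) \<le> cos (y - \<phi>) - sin (y - \<phi>) * (y' - \<theta> - (y - \<phi>))"
    "cos (y' - \<theta>) = cos (y - \<phi>) - sin (y - \<phi>) * (y' - \<theta> - (y - \<phi>)) \<Longrightarrow> y' - \<theta> = y - \<phi>"
    using y yt y' by (auto intro: cos_le_tangent)
  have t1': "a * cos \<theta> \<le> a * (cos \<phi> - sin \<phi> * (\<theta> - \<phi>))"
    using t1(1) a by simp
  \<comment> \<open>By \<open>crit\<close> the derivative in the direction variable vanishes, so
    \<open>\<theta>\<close> drops out of the tangent plane.\<close>
  have "sin (x - \<phi>) * (\<theta> - \<phi>) + sin (y - \<phi>) * (\<theta> - \<phi>) = a * sin \<phi> * (\<theta> - \<phi>)"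
    by (simp add: crit algebra_simps)
  then have T: "T = a * (cos \<phi> - sin \<phi> * (\<theta> - \<phi>)) + (cos (x - \<phi>) - sin (x - \<phi>) * (x' - \<theta> - (x - \<phi>)))
      + (cos (y - \<phi>) - sin (y - \<phi>) * (y' - \<theta> - (y - \<phi>)))"
    unfolding T_def crossing_critical(2)[OF a \<phi> x y crit] by (simp add: algebra_simps)
  show "crossing a x' y' \<le> T"
    unfolding C_def[symmetric] CH T using t1' t2(1) t3(1) by linarith
  assume "crossing a x' y' = T"
  then have "a * cos \<theta> = a * (cos \<phi> - sin \<phi> * (\<theta> - \<phi>))"
    "cos (x' - \<theta>) = cos (x - \<phi>) - sin (x - \<phi>) * (x' - \<theta> - (x - \<phi>))"
    "cos (y' - \<theta>) = cos (y - \<phi>) - sin (y - \<phi>) * (y' - \<theta> - (y - \<phi>))"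
    unfolding C_def[symmetric] CH T using t1' t2(1) t3(1) by linarith+
  then show "x' = x \<and> y' = y"
    using t1(2) t2(2) t3(2) a by simp
qed

section \<open>Orbits winding around both caps\<close>

lemma uminus_open_stadium:
  assumes "x \<in> open_stadium a"
  shows "- x \<in> open_stadium a"
proof -
  obtain c where c: "c \<in> {-a/2..a/2}" "x \<in> ball (c, 0) 1"
    using assms by (auto simp: open_stadium_def)
  have "dist (- c, 0) (- x) = dist (c, 0) x"
    using dist_minus[of "(c, 0)" x] by simp
  then have "- x \<in> ball (- c, 0) 1"
    using c(2) by simp
  moreover have "- c \<in> {-a/2..a/2}"
    using c(1) by simp
  ultimately show ?thesis
    unfolding open_stadium_def by blast
qed

lemma midpoint_uminus: "midpoint (- x) (- y) = - midpoint x (y :: point)"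
  unfolding midpoint_def scaleR_minus_right[symmetric] by simp

lemma midpoint_chord_in_stadium:
  assumes a: "a > 0" and c: "0 < c" "c < pi"
  shows "midpoint (side_arc a Left_Side b) (side_arc a Left_Side (b + 2 * c)) \<in> open_stadium a"
proof -
  define m where "m = midpoint (side_arc a Left_Side b) (side_arc a Left_Side (b + 2 * c))"
  have "side_arc a Left_Side b = side_arc a Left_Side ((b + c) - c)"
    "side_arc a Left_Side (b + 2 * c) = side_arc a Left_Side ((b + c) + c)"
    by (simp_all add: algebra_simps)
  then have "m = (- (a/2) - cos (b + c) * cos c, sin (b + c) * cos c)"
    unfolding m_def midpoint_def by (simp only: side_arc.simps sin_add[of "b + c"] sin_diff[of "b + c"]
        cos_add[of "b + c"] cos_diff[of "b + c"]) (simp add: algebra_simps)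
  then have "dist (-a/2, 0) m = norm (cos c *\<^sub>R (cos (b + c), - sin (b + c)))"
    by (simp add: dist_norm mult.commute)
  also have "\<dots> = \<bar>cos c\<bar>"
    unfolding norm_scaleR by (simp add: norm_prod_def)
  also have "\<dots> < 1"
  proof -
    have "cos c < 1"
      using cos_monotone_0_pi[of 0 c] c by simp
    moreover have "- 1 < cos c"
      using cos_monotone_0_pi[of c pi] c by simp
    ultimately show ?thesis
      by linarith
  qed
  finally have "m \<in> ball (-a/2, 0) 1"
    by simp
  moreover have "-a/2 \<in> {-a/2..a/2}"
    using a by simp
  ultimately show ?thesis
    unfolding open_stadium_def m_def by blast
qed

lemma midpoint_crossing_in_stadium:
  assumes a: "a \<ge> 8" and x: "\<bar>x\<bar> < pi/2" and y: "\<bar>y\<bar> < pi/2"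
  shows "midpoint (side_arc a Left_Side x) (- side_arc a Left_Side y) \<in> open_stadium a"
proof -
  define c where "c = (cos y - cos x) / 2"
  have m: "midpoint (side_arc a Left_Side x) (- side_arc a Left_Side y) = (c, (sin x - sin y) / 2)"
    by (simp add: midpoint_def c_def)
  have s: "\<bar>sin z\<bar> < 1" if "\<bar>z\<bar> < pi/2" for z :: real
  proof -
    have "cos z > 0"
      by (rule cos_gt_zero_pi; use that in linarith)
    then have "(sin z)\<^sup>2 < 1"
      using sin_cos_squared_add[of z] by (smt (verit) zero_less_power)
    then show ?thesis
      by (simp add: abs_square_less_1)
  qed
  have "\<bar>(sin x - sin y) / 2\<bar> < 1"
    using s[OF x] s[OF y] by (simp add: abs_less_iff)
  then have "(c, (sin x - sin y) / 2) \<in> ball (c, 0) 1"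
    by (simp add: dist_Pair_Pair dist_real_def)
  moreover have "\<bar>cos y - cos x\<bar> \<le> a"
    using a abs_cos_le_one[of x] abs_cos_le_one[of y] by linarith
  then have "c \<in> {-a/2..a/2}"
    unfolding c_def by (simp add: abs_le_iff field_simps)
  ultimately show ?thesis
    unfolding m open_stadium_def by blast
qed

lemma abs_grid_le: "j < n \<Longrightarrow> c \<ge> 0 \<Longrightarrow> \<bar>grid n c j\<bar> \<le> (real n - 1) * c"
  unfolding grid_def abs_mult by (intro mult_mono) (auto simp: abs_le_iff)

text \<open>\<open>\<alpha>\<close> and \<open>\<beta>\<close> are half the angular steps on the
  caps, \<open>\<psi>\<close> is the slope angle of the flight from left to right. The last vertex
  on the left has the angle \<open>(q - 1) * \<alpha>\<close> and is left in the direction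
  \<open>q * \<alpha>\<close>, measured from the vertical, which must be the complement of
  \<open>\<psi>\<close>; the arrival on the right gives the equation for \<open>\<beta>\<close>.
  \<open>closing\<close> says that the segment between the two vertices indeed has this
  slope.\<close>

locale stadium_orbit = stadium_family +
  fixes q p :: nat and \<alpha> \<beta> \<psi> :: real
  assumes iso: "dynamically_isospectral \<Omega>"
    and q1: "q \<ge> 1" and p1: "p \<ge> 1" and \<alpha>0: "0 < \<alpha>" and \<beta>0: "0 < \<beta>" and \<psi>: "\<bar>\<psi>\<bar> < pi/2"
    and q\<alpha>: "real q * \<alpha> = pi/2 - \<psi>" and p\<beta>: "real p * \<beta> = pi/2 + \<psi>"
    and left_top: "(real q - 1) * \<alpha> < pi/2" and right_top: "(real p - 1) * \<beta> < pi/2"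
    and closing: "a * sin \<psi> = cos \<beta> - cos \<alpha>"
begin

text \<open>The orbit climbs the left cap with \<open>q\<close> reflections and descends the right cap with \<open>p\<close>
  reflections. The vertex of angle \<open>b\<close> on the right cap is the antipode of the vertex of angle
  \<open>b\<close> on the left cap, so that angles increase along both caps.\<close>

definition orient :: "nat \<Rightarrow> real" where
  "orient k = (if k < q then 1 else -1)"

definition orbit_side :: "nat \<Rightarrow> side" where
  "orbit_side k = (if k < q then Left_Side else Right_Side)"

definition turn :: "nat \<Rightarrow> real" where
  "turn k = (if k < q then \<alpha> else \<beta>)"

definition angle :: "nat \<Rightarrow> real" where
  "angle k = (if k < q then grid q \<alpha> k else grid p \<beta> (k - q))"

definition orbit_param :: "nat \<Rightarrow> real" where
  "orbit_param k = (if k < q + p then orient k * angle k else 0)"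

abbreviation nxt :: "nat \<Rightarrow> nat" where
  "nxt k \<equiv> Suc k mod (q + p)"

definition cap :: "nat \<Rightarrow> real \<Rightarrow> point" where
  "cap k b = orient k *\<^sub>R side_arc a Left_Side b"

text \<open>A chord of the left cap between the angles \<open>b - c\<close> and \<open>b + c\<close>
  has the direction \<open>(sin b, cos b)\<close>; this is the outgoing direction at the
  vertex.\<close>

definition heading :: "nat \<Rightarrow> point" where
  "heading k = orient k *\<^sub>R (sin (angle k + turn k), cos (angle k + turn k))"

lemma orient_cases: "orient k = 1 \<or> orient k = -1"
  by (simp add: orient_def)

lemma orient_square: "orient k * (orient k * x) = x"
  by (simp add: orient_def)

lemma side_arc_orbit_side: "side_arc a (orbit_side k) (orient k * b) = cap k b"
  by (simp add: orbit_side_def cap_def orient_def side_arc_Right del: side_arc.simps)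

lemma \<alpha>_pi: "\<alpha> < pi" and \<beta>_pi: "\<beta> < pi"
proof -
  have "\<alpha> \<le> real q * \<alpha>" "\<beta> \<le> real p * \<beta>"
    using q1 p1 \<alpha>0 \<beta>0 by simp_all
  then show "\<alpha> < pi" "\<beta> < pi"
    using q\<alpha> p\<beta> \<psi> by linarith+
qed

lemma turn: "0 < turn k" "turn k < pi"
  using \<alpha>0 \<beta>0 \<alpha>_pi \<beta>_pi by (simp_all add: turn_def)

lemma sin_turn_pos: "sin (turn k) > 0"
  using turn by (intro sin_gt_zero)

lemma edge_cases [consumes 1, case_names same top bottom]:
  assumes k: "k < q + p"
  obtains (same) "nxt k = Suc k" "orient (Suc k) = orient k" "turn (Suc k) = turn k"
      "angle (Suc k) = angle k + 2 * turn k" "Suc k < q + p"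
  | (top) "k < q" "nxt k = q" "orient k = 1" "orient q = -1" "turn k = \<alpha>" "turn q = \<beta>"
      "angle k = (real q - 1) * \<alpha>" "angle q = - ((real p - 1) * \<beta>)"
  | (bottom) "Suc k = q + p" "nxt k = 0" "orient k = -1" "orient 0 = 1" "turn k = \<beta>" "turn 0 = \<alpha>"
      "angle k = (real p - 1) * \<beta>" "angle 0 = - ((real q - 1) * \<alpha>)"
proof -
  consider "Suc k < q" | "Suc k = q" | "Suc k > q" "Suc k < q + p" | "Suc k = q + p"
    using k by linarith
  then show ?thesis
  proof cases
    case 1
    then show ?thesis
      by (intro same) (simp_all add: orient_def turn_def angle_def grid_def algebra_simps)
  next
    case 2
    then have "real k = real q - 1"
      by linarith
    then show ?thesis
      using 2 p1 by (intro top) (auto simp: orient_def turn_def angle_def grid_def algebra_simps)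
  next
    case 3
    then have "real (Suc k - q) = real (k - q) + 1"
      by linarith
    then show ?thesis
      using 3 by (intro same) (auto simp: orient_def turn_def angle_def grid_def algebra_simps)
  next
    case 4
    then have "k - q = p - 1" "\<not> k < q"
      using p1 by linarith+
    then show ?thesis
      using 4 q1 p1 by (intro bottom) (simp_all add: orient_def turn_def angle_def grid_def of_nat_diff algebra_simps)
  qed
qed

lemma crossing_at_orbit:
  assumes x: "x = (real q - 1) * \<alpha>" and y: "y = - ((real p - 1) * \<beta>)"
  shows "crossing a x y > 0" "a + cos x + cos y = crossing a x y * cos \<psi>"
    "sin x + sin y = - (crossing a x y * sin \<psi>)"
    "\<bar>x'\<bar> < pi/2 \<Longrightarrow> \<bar>y'\<bar> < pi/2 \<Longrightarrow>
       crossing a x' y' \<le> crossing a x y - cos \<alpha> * (x' - x) + cos \<beta> * (y' - y)"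
    "\<bar>x'\<bar> < pi/2 \<Longrightarrow> \<bar>y'\<bar> < pi/2 \<Longrightarrow>
       crossing a x' y' = crossing a x y - cos \<alpha> * (x' - x) + cos \<beta> * (y' - y) \<Longrightarrow> x' = x \<and> y' = y"
proof -
  have x: "x - - \<psi> = pi/2 - \<alpha>" and y: "y - - \<psi> = \<beta> - pi/2"
    using q\<alpha> p\<beta> by (simp_all add: x y algebra_simps)
  have sx: "sin (x - - \<psi>) = cos \<alpha>" and sy: "sin (y - - \<psi>) = - cos \<beta>"
    unfolding x y by (simp_all add: sin_diff)
  have \<psi>': "\<bar>- \<psi>\<bar> < pi/2"
    using \<psi> by simp
  have bx: "\<bar>x - - \<psi>\<bar> \<le> pi/2" and by': "\<bar>y - - \<psi>\<bar> \<le> pi/2"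
    unfolding x y using \<alpha>0 \<beta>0 \<alpha>_pi \<beta>_pi by linarith+
  have crit: "a * sin (- \<psi>) = sin (x - - \<psi>) + sin (y - - \<psi>)"
    unfolding sx sy using closing by simp
  note c = crossing_critical[OF a_pos \<psi>' bx by' crit]
  note t = crossing_le_tangent[OF a_pos \<psi>' bx by' crit, unfolded sx sy]
  show "crossing a x y > 0" "a + cos x + cos y = crossing a x y * cos \<psi>"
    "sin x + sin y = - (crossing a x y * sin \<psi>)"
    using c by simp_all
  show "\<bar>x'\<bar> < pi/2 \<Longrightarrow> \<bar>y'\<bar> < pi/2 \<Longrightarrow>
       crossing a x' y' \<le> crossing a x y - cos \<alpha> * (x' - x) + cos \<beta> * (y' - y)"
    using t(1)[of x' y'] by simp
  show "\<bar>x'\<bar> < pi/2 \<Longrightarrow> \<bar>y'\<bar> < pi/2 \<Longrightarrow>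
       crossing a x' y' = crossing a x y - cos \<alpha> * (x' - x) + cos \<beta> * (y' - y) \<Longrightarrow> x' = x \<and> y' = y"
    using t(2)[of x' y'] by simp
qed

text \<open>Each side lies below its tangent plane at the orbit, and the linear terms contributed by
  the two sides at a vertex are opposite, so they cancel around the orbit. Rotating a chord along
  its cap keeps its length, so equality forces only equal displacements there; on a crossing it
  forces the displacements to vanish.\<close>

lemma edge_length:
  fixes b :: "nat \<Rightarrow> real"
  assumes k: "k < q + p" and b: "\<And>j. j < q + p \<Longrightarrow> \<bar>b j\<bar> < pi/2"
    and close: "\<And>j. j < q + p \<Longrightarrow> \<bar>b j - angle j\<bar> \<le> min \<alpha> \<beta>"
  defines "T \<equiv> dist (cap k (angle k)) (cap (nxt k) (angle (nxt k)))
      + (cos (turn (nxt k)) * (b (nxt k) - angle (nxt k)) - cos (turn k) * (b k - angle k))"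
  shows "dist (cap k (b k)) (cap (nxt k) (b (nxt k))) \<le> T" (is "?l \<le> T")
    and "dist (cap k (b k)) (cap (nxt k) (b (nxt k))) = T \<Longrightarrow>
      b (nxt k) - angle (nxt k) = b k - angle k \<and> (Suc k = q + p \<longrightarrow> b k = angle k)"
proof -
  have "?l \<le> T \<and> (?l = T \<longrightarrow> b (nxt k) - angle (nxt k) = b k - angle k \<and> (Suc k = q + p \<longrightarrow> b k = angle k))"
    using k
  proof (cases rule: edge_cases)
    case same
    define v where "v = (b (Suc k) - b k) / 2"
    have len: "dist (cap k u) (cap (Suc k) w) = 2 * \<bar>sin ((w - u) / 2)\<bar>" for u w
      using orient_cases[of k] dist_arc_chord[of a u w] by (auto simp: cap_def same dist_minus simp del: side_arc.simps)
    have mn: "min \<alpha> \<beta> \<le> turn k"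
      by (simp add: turn_def)
    have v: "v \<in> {0..pi}"
      using b[OF k] b[OF same(5)] close[OF k] close[OF same(5)] mn unfolding same(4) v_def by auto
    have tk: "turn k \<in> {0..pi}"
      using turn[of k] by auto
    have "?l = 2 * sin v"
      using sin_ge_zero[of v] v by (simp add: same(1) len v_def)
    moreover have "dist (cap k (angle k)) (cap (nxt k) (angle (nxt k))) = 2 * sin (turn k)"
      using sin_turn_pos[of k] by (simp add: same len)
    then have "T = 2 * (sin (turn k) + cos (turn k) * (v - turn k))"
      unfolding T_def by (simp add: same v_def) (simp add: algebra_simps)
    ultimately show ?thesis
      using sin_le_tangent[OF tk v] same(5) by (auto simp: same(1,4) v_def)
  next
    case top
    note H = crossing_at_orbit[OF top(7,8)]
    have len: "dist (cap k u) (cap q w) = crossing a u w" for u w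
      by (simp add: cap_def top crossing_def del: side_arc.simps)
    have q: "q < q + p"
      using p1 by simp
    have T: "T = crossing a (angle k) (angle q) - cos \<alpha> * (b k - angle k) + cos \<beta> * (b q - angle q)"
      unfolding T_def top(2) len by (simp add: top(5,6))
    show ?thesis
      unfolding T top(2) len using H(4,5)[OF b[OF k] b[OF q]] by auto
  next
    case bottom
    have "- angle 0 = (real q - 1) * \<alpha>" "- angle k = - ((real p - 1) * \<beta>)"
      by (simp_all add: bottom)
    note H = crossing_at_orbit[OF this]
    have len: "dist (cap k u) (cap 0 w) = crossing a (- w) (- u)" for u w
      unfolding crossing_minus by (simp add: cap_def bottom crossing_def dist_commute del: side_arc.simps)
    have q: "0 < q + p"
      using p1 by simp
    have bm: "\<bar>- b 0\<bar> < pi/2" "\<bar>- b k\<bar> < pi/2"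
      using b[OF k] b[OF q] by simp_all
    have T: "T = crossing a (- angle 0) (- angle k) - cos \<alpha> * (- b 0 - - angle 0) + cos \<beta> * (- b k - - angle k)"
      unfolding T_def bottom(2) len by (simp add: bottom(5,6) algebra_simps)
    show ?thesis
      unfolding T bottom(2) len using H(4,5)[OF bm] by auto
  qed
  then show "?l \<le> T" "?l = T \<Longrightarrow> b (nxt k) - angle (nxt k) = b k - angle k \<and> (Suc k = q + p \<longrightarrow> b k = angle k)"
    by blast+
qed

text \<open>The direction of a side is expressed through its initial vertex and through its final
  vertex. With both forms the first variation can be regrouped by vertices.\<close>

lemma edge_direction:
  assumes k: "k < q + p"
  shows "sgn (cap (nxt k) (angle (nxt k)) - cap k (angle k)) = heading k"
    and "heading k = orient (nxt k) *\<^sub>R (sin (angle (nxt k) - turn (nxt k)), cos (angle (nxt k) - turn (nxt k)))"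
proof -
  have unit: "norm (sin t, cos t) = 1" for t :: real
    by (simp add: norm_prod_def)
  have nh: "norm (heading k) = 1"
    using orient_cases[of k] by (auto simp: heading_def norm_prod_def)
  have sg: "sgn (c *\<^sub>R heading k) = heading k" if "c > 0" for c
    using that nh by (simp add: sgn_div_norm)
  have "(\<exists>c>0. cap (nxt k) (angle (nxt k)) - cap k (angle k) = c *\<^sub>R heading k) \<and>
    heading k = orient (nxt k) *\<^sub>R (sin (angle (nxt k) - turn (nxt k)), cos (angle (nxt k) - turn (nxt k)))"
    using k
  proof (cases rule: edge_cases)
    case same
    have "cap (nxt k) (angle (nxt k)) - cap k (angle k)
        = orient k *\<^sub>R (side_arc a Left_Side ((angle k + turn k) + turn k) - side_arc a Left_Side ((angle k + turn k) - turn k))"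
      by (simp add: cap_def same scaleR_right_diff_distrib add.assoc del: side_arc.simps)
    also have "\<dots> = (2 * sin (turn k)) *\<^sub>R heading k"
      unfolding arc_chord heading_def by (simp add: mult_ac)
    finally have "cap (nxt k) (angle (nxt k)) - cap k (angle k) = (2 * sin (turn k)) *\<^sub>R heading k" .
    moreover have "2 * sin (turn k) > 0"
      using sin_turn_pos[of k] by simp
    moreover have "angle (Suc k) - turn (Suc k) = angle k + turn k"
      by (simp add: same)
    ultimately show ?thesis
      by (metis heading_def same(1,2))
  next
    case top
    note H = crossing_at_orbit(1-3)[OF top(7,8)]
    have ang: "angle k + turn k = pi/2 - \<psi>" "angle q - turn q = - (pi/2 + \<psi>)"
      using q\<alpha> p\<beta> by (simp_all add: top algebra_simps)
    have h: "heading k = (cos \<psi>, sin \<psi>)"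
      unfolding heading_def ang by (simp add: top sin_diff cos_diff)
    have "cap q (angle q) - cap k (angle k) = (a + cos (angle k) + cos (angle q), - (sin (angle k) + sin (angle q)))"
      by (simp add: cap_def top(3,4))
    also have "\<dots> = crossing a (angle k) (angle q) *\<^sub>R heading k"
      unfolding H(2,3) h by simp
    finally show ?thesis
      unfolding top(2) using H(1) by (auto simp: h ang(2) top(4) sin_add cos_add simp del: minus_add_distrib)
  next
    case bottom
    have "- angle 0 = (real q - 1) * \<alpha>" "- angle k = - ((real p - 1) * \<beta>)"
      by (simp_all add: bottom)
    note H = crossing_at_orbit(1-3)[OF this]
    have ang: "angle k + turn k = pi/2 + \<psi>" "angle 0 - turn 0 = - (pi/2 - \<psi>)"
      using q\<alpha> p\<beta> by (simp_all add: bottom algebra_simps)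
    have h: "heading k = (- cos \<psi>, sin \<psi>)"
      unfolding heading_def ang by (simp add: bottom sin_add cos_add)
    have "cap 0 (angle 0) - cap k (angle k)
        = (- (a + cos (- angle 0) + cos (- angle k)), - (sin (- angle 0) + sin (- angle k)))"
      by (simp add: cap_def bottom(3,4))
    also have "\<dots> = crossing a (- angle 0) (- angle k) *\<^sub>R heading k"
      unfolding H(2,3) h by simp
    finally show ?thesis
      unfolding bottom(2) using H(1) by (auto simp: h ang(2) bottom(4) sin_diff cos_diff)
  qed
  then show "sgn (cap (nxt k) (angle (nxt k)) - cap k (angle k)) = heading k"
    and "heading k = orient (nxt k) *\<^sub>R (sin (angle (nxt k) - turn (nxt k)), cos (angle (nxt k) - turn (nxt k)))"
    using sg by auto
qed

lemma angle_interior: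
  assumes "k < q + p"
  shows "\<bar>angle k\<bar> < pi/2"
  using assms abs_grid_le[of k q \<alpha>] abs_grid_le[of "k - q" p \<beta>] \<alpha>0 \<beta>0 left_top right_top
  by (simp add: angle_def) linarith

lemma inj_on_orbit: "inj_on (\<lambda>k. cap k (angle k)) {..<q + p}"
proof (rule inj_onI)
  fix j k assume "j \<in> {..<q + p}" "k \<in> {..<q + p}"
    and eq: "cap j (angle j) = cap k (angle k)"
  then have jk: "j < q + p" "k < q + p"
    by auto
  have *: "a/2 + cos (angle i) > 0" if "i < q + p" for i
  proof -
    have "cos (angle i) > 0"
      by (rule cos_gt_zero_pi; use angle_interior[OF that] in linarith)
    then show ?thesis
      using a_pos by simp
  qed
  have f: "orient j * (a/2 + cos (angle j)) = orient k * (a/2 + cos (angle k))"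
    and s: "orient j * sin (angle j) = orient k * sin (angle k)"
    using eq by (simp_all add: cap_def algebra_simps)
  have o: "orient j = orient k"
    using f *[OF jk(1)] *[OF jk(2)] orient_cases[of j] orient_cases[of k] by auto
  then have "sin (angle j) = sin (angle k)"
    using s orient_cases[of k] by auto
  then have "angle j = angle k"
    using angle_interior[OF jk(1)] angle_interior[OF jk(2)] sin_inj_pi[of "angle j" "angle k"] by linarith
  moreover have "j < q \<longleftrightarrow> k < q"
    using o by (auto simp: orient_def split: if_splits)
  ultimately show "j = k"
    using jk \<alpha>0 \<beta>0 by (auto simp: angle_def grid_def split: if_splits)
qed

lemma orbit_midpoints:
  assumes k: "k < q + p"
  shows "midpoint (cap k (angle k)) (cap (nxt k) (angle (nxt k))) \<in> open_stadium a"
  using k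
proof (cases rule: edge_cases)
  case same
  have m: "midpoint (side_arc a Left_Side (angle k)) (side_arc a Left_Side (angle k + 2 * turn k)) \<in> open_stadium a"
    by (intro midpoint_chord_in_stadium a_pos turn)
  show ?thesis
    using orient_cases[of k] m uminus_open_stadium[OF m]
    by (auto simp: cap_def same midpoint_uminus simp del: side_arc.simps)
next
  case top
  have "q < q + p"
    using p1 by simp
  from midpoint_crossing_in_stadium[OF a8 angle_interior[OF k] angle_interior[OF this]]
  show ?thesis
    by (simp add: cap_def top(2-4) del: side_arc.simps)
next
  case bottom
  have "0 < q + p"
    using p1 by simp
  from midpoint_crossing_in_stadium[OF a8 angle_interior[OF this] angle_interior[OF k]]
  show ?thesis
    by (simp add: cap_def bottom(2-4) midpoint_sym del: side_arc.simps)
qed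

text \<open>In the sum of the edge inequalities the linear terms cancel. Equality would make the
  displacement the same at all vertices, and the crossing that starts at vertex
  \<open>q + p - 1\<close> makes it zero.\<close>

lemma orbit_strict_max:
  fixes b :: "nat \<Rightarrow> real"
  assumes b: "\<And>j. j < q + p \<Longrightarrow> \<bar>b j\<bar> < pi/2" "\<And>j. j < q + p \<Longrightarrow> \<bar>b j - angle j\<bar> \<le> min \<alpha> \<beta>"
    and ne: "\<exists>k<q + p. b k \<noteq> angle k"
  shows "(\<Sum>k<q + p. dist (cap k (b k)) (cap (nxt k) (b (nxt k))))
    < (\<Sum>k<q + p. dist (cap k (angle k)) (cap (nxt k) (angle (nxt k))))" (is "sum ?l _ < sum ?m _")
proof -
  define T where "T k = ?m k + (cos (turn (nxt k)) * (b (nxt k) - angle (nxt k)) - cos (turn k) * (b k - angle k))" for k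
  have edge: "?l k \<le> T k" "?l k = T k \<Longrightarrow> b (nxt k) - angle (nxt k) = b k - angle k \<and> (Suc k = q + p \<longrightarrow> b k = angle k)"
    if "k < q + p" for k
    using edge_length[OF that b] by (simp_all add: T_def)
  have "(\<Sum>k<q + p. T k) = (\<Sum>k<q + p. ?m k)"
    using sum_cyclic_shift[of "q + p" "\<lambda>k. cos (turn k) * (b k - angle k)"] q1
    unfolding T_def sum.distrib sum_subtractf by simp
  moreover have "sum ?l {..<q + p} < sum T {..<q + p}"
  proof (rule ccontr)
    assume "\<not> ?thesis"
    moreover have le: "sum ?l {..<q + p} \<le> sum T {..<q + p}"
      using edge(1) by (intro sum_mono) auto
    ultimately have eq: "sum ?l {..<q + p} = sum T {..<q + p}"
      by simp
    have all: "?l k = T k" if "k < q + p" for k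
      using sum_mono_inv[OF eq] edge(1) that by simp
    have const: "b (nxt k) - angle (nxt k) = b k - angle k" if "k < q + p" for k
      using edge(2)[OF that all[OF that]] by blast
    have "b (q + p - 1) = angle (q + p - 1)"
      using edge(2)[of "q + p - 1", OF _ all] q1 by simp
    then have zero: "b 0 - angle 0 = 0"
      using const[of "q + p - 1"] q1 by simp
    have "b k - angle k = 0" if "k < q + p" for k
      using that
    proof (induction k)
      case (Suc k)
      then show ?case
        using const[of k] by simp
    qed (rule zero)
    then show False
      using ne by force
  qed
  ultimately show ?thesis
    by simp
qed

sublocale polygon: stadium_polygon a \<Omega> \<gamma> "q + p" orbit_side orbit_param
proof
  show "dynamically_isospectral \<Omega>"
    by (rule iso)
  show "2 \<le> q + p"
    using q1 p1 by simp
  have op: "orbit_param k = orient k * angle k" if "k < q + p" for k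
    using that by (simp add: orbit_param_def)
  have nx: "nxt k < q + p" for k
    using q1 by simp
  show "\<bar>orbit_param k\<bar> < pi/2" if "k < q + p" for k
    using angle_interior[OF that] orient_cases[of k] by (auto simp: op that)
  show "orbit_param k = 0" if "k \<ge> q + p" for k
    using that by (simp add: orbit_param_def)
  have pt: "side_arc a (orbit_side k) (orbit_param k) = cap k (angle k)" if "k < q + p" for k
    unfolding op[OF that] by (rule side_arc_orbit_side)
  show "inj_on (\<lambda>k. side_arc a (orbit_side k) (orbit_param k)) {..<q + p}"
    using inj_on_orbit pt by (subst inj_on_cong[of _ _ "\<lambda>k. cap k (angle k)"]) auto
  show "midpoint (side_arc a (orbit_side k) (orbit_param k)) (side_arc a (orbit_side (nxt k)) (orbit_param (nxt k))) \<in> stadium a"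
    if "k < q + p" for k
    unfolding pt[OF that] pt[OF nx] stadium_eq[OF a_pos] by (rule orbit_midpoints[OF that])
  \<comment> \<open>Small enough for \<open>edge_length\<close> to apply and for all vertices to
    stay inside their caps.\<close>
  define \<rho> where "\<rho> = min (min \<alpha> \<beta>) (min (pi/2 - (real q - 1) * \<alpha>) (pi/2 - (real p - 1) * \<beta>)) / 2"
  have \<rho>: "\<rho> > 0" "\<rho> \<le> min \<alpha> \<beta>" "(real q - 1) * \<alpha> + \<rho> < pi/2" "(real p - 1) * \<beta> + \<rho> < pi/2"
  proof -
    define m1 m2 where "m1 = min \<alpha> \<beta>" and "m2 = min (pi/2 - (real q - 1) * \<alpha>) (pi/2 - (real p - 1) * \<beta>)"
    have "m1 > 0" "m2 > 0" "m2 \<le> pi/2 - (real q - 1) * \<alpha>" "m2 \<le> pi/2 - (real p - 1) * \<beta>"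
      using \<alpha>0 \<beta>0 left_top right_top by (simp_all add: m1_def m2_def)
    moreover have "\<rho> = min m1 m2 / 2"
      by (simp add: \<rho>_def m1_def m2_def)
    ultimately show "\<rho> > 0" "\<rho> \<le> min \<alpha> \<beta>" "(real q - 1) * \<alpha> + \<rho> < pi/2" "(real p - 1) * \<beta> + \<rho> < pi/2"
      unfolding m1_def[symmetric] by auto
  qed
  show "\<exists>\<rho>>0. \<forall>\<sigma>. (\<forall>k<q + p. \<bar>\<sigma> k - orbit_param k\<bar> \<le> \<rho>) \<longrightarrow> (\<exists>k<q + p. \<sigma> k \<noteq> orbit_param k) \<longrightarrow>
      (\<Sum>k<q + p. dist (side_arc a (orbit_side k) (\<sigma> k)) (side_arc a (orbit_side (nxt k)) (\<sigma> (nxt k))))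
      < (\<Sum>k<q + p. dist (side_arc a (orbit_side k) (orbit_param k)) (side_arc a (orbit_side (nxt k)) (orbit_param (nxt k))))"
  proof (intro exI conjI allI impI)
    fix \<sigma> assume \<sigma>: "\<forall>k<q + p. \<bar>\<sigma> k - orbit_param k\<bar> \<le> \<rho>" "\<exists>k<q + p. \<sigma> k \<noteq> orbit_param k"
    define b where "b k = orient k * \<sigma> k" for k
    have \<sigma>b: "\<sigma> k = orient k * b k" for k
      by (simp add: b_def orient_square)
    have close: "\<bar>b k - angle k\<bar> \<le> \<rho>" if "k < q + p" for k
    proof -
      have "\<bar>orient k * (b k - angle k)\<bar> \<le> \<rho>"
        using \<sigma>(1) that by (simp add: right_diff_distrib \<sigma>b op)
      then show ?thesis
        by (simp add: abs_mult orient_def split: if_splits)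
    qed
    have room: "\<bar>angle k\<bar> + \<rho> < pi/2" if "k < q + p" for k
      using that abs_grid_le[of k q \<alpha>] abs_grid_le[of "k - q" p \<beta>] \<alpha>0 \<beta>0 \<rho>(3,4)
      by (simp add: angle_def) linarith
    have b1: "\<bar>b k\<bar> < pi/2" if "k < q + p" for k
      using close[OF that] room[OF that] by linarith
    have b2: "\<bar>b k - angle k\<bar> \<le> min \<alpha> \<beta>" if "k < q + p" for k
      using close[OF that] \<rho>(2) by linarith
    have b3: "\<exists>k<q + p. b k \<noteq> angle k"
      using \<sigma>(2) \<sigma>b op by metis
    have "(\<Sum>k<q + p. dist (cap k (b k)) (cap (nxt k) (b (nxt k))))
      < (\<Sum>k<q + p. dist (cap k (angle k)) (cap (nxt k) (angle (nxt k))))"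
      by (rule orbit_strict_max[OF b1 b2 b3])
    moreover have "side_arc a (orbit_side k) (\<sigma> k) = cap k (b k)" for k
      unfolding \<sigma>b by (rule side_arc_orbit_side)
    ultimately show "(\<Sum>k<q + p. dist (side_arc a (orbit_side k) (\<sigma> k)) (side_arc a (orbit_side (nxt k)) (\<sigma> (nxt k))))
      < (\<Sum>k<q + p. dist (side_arc a (orbit_side k) (orbit_param k)) (side_arc a (orbit_side (nxt k)) (orbit_param (nxt k))))"
      using pt nx by simp
  qed (rule \<rho>)
qed

text \<open>At a vertex, outgoing minus incoming direction is \<open>2 * sin (turn k)\<close> times
  the inward normal, so a cyclic summation by parts leaves only normal velocities. On the right cap
  the parameter is minus the angle, which evenness absorbs.\<close>

lemma orbit_normal_velocity:
  "sin \<alpha> * (\<Sum>j<q. normal_velocity Left_Side (grid q \<alpha> j)) + sin \<beta> * (\<Sum>j<p. normal_velocity Right_Side (grid p \<beta> j)) = 0"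
proof -
  define v where "v k = velocity (orbit_side k) (orbit_param k)" for k
  define nv where "nv k = normal_velocity (orbit_side k) (orbit_param k)" for k
  define inc where "inc k = orient k *\<^sub>R (sin (angle k - turn k), cos (angle k - turn k))" for k
  have nx: "nxt k < q + p" for k
    using q1 by simp
  have Q: "polygon.Q k = cap k (angle k)" if "k < q + p" for k
    using that side_arc_orbit_side[of k "angle k"] by (simp add: polygon.Q_def orbit_param_def del: side_arc.simps)
  have inc: "heading k = inc (nxt k)" if "k < q + p" for k
    unfolding inc_def by (rule edge_direction(2)[OF that])
  have "(\<Sum>k<q + p. heading k \<bullet> (v (nxt k) - v k)) = 0"
    using polygon.first_variation_zero edge_direction(1) Q nx by (simp add: v_def)
  also have "(\<Sum>k<q + p. heading k \<bullet> (v (nxt k) - v k)) = (\<Sum>k<q + p. inc (nxt k) \<bullet> v (nxt k)) - (\<Sum>k<q + p. heading k \<bullet> v k)"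
    by (simp add: inner_diff_right sum_subtractf inc)
  also have "(\<Sum>k<q + p. inc (nxt k) \<bullet> v (nxt k)) = (\<Sum>k<q + p. inc k \<bullet> v k)"
    using sum_cyclic_shift[of "q + p" "\<lambda>k. inc k \<bullet> v k"] q1 by simp
  also have "(\<Sum>k<q + p. inc k \<bullet> v k) - (\<Sum>k<q + p. heading k \<bullet> v k) = (\<Sum>k<q + p. - (2 * (sin (turn k) * nv k)))"
    unfolding sum_subtractf[symmetric]
  proof (intro sum.cong refl)
    fix k assume "k \<in> {..<q + p}"
    then have "heading k - inc k = (2 * sin (turn k)) *\<^sub>R side_normal (orbit_side k) (orbit_param k)"
      by (auto simp: heading_def inc_def orbit_side_def orbit_param_def orient_def sin_add sin_diff cos_add cos_diff)
    then have "(heading k - inc k) \<bullet> v k = 2 * sin (turn k) * nv k"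
      by (simp add: nv_def v_def normal_velocity_def inner_commute del: side_normal.simps)
    then show "inc k \<bullet> v k - heading k \<bullet> v k = - (2 * (sin (turn k) * nv k))"
      by (simp add: inner_diff_left algebra_simps)
  qed
  finally have "(\<Sum>k<q + p. sin (turn k) * nv k) = 0"
    by (simp add: sum_negf sum_distrib_left[symmetric])
  also have "{..<q + p} = {..<q} \<union> {q..<q + p}"
    by auto
  also have "(\<Sum>k\<in>{..<q} \<union> {q..<q + p}. sin (turn k) * nv k)
      = (\<Sum>k<q. sin (turn k) * nv k) + (\<Sum>k=q..<q + p. sin (turn k) * nv k)"
    by (intro sum.union_disjoint) auto
  also have "(\<Sum>k=q..<q + p. sin (turn k) * nv k) = (\<Sum>j<p. sin (turn (j + q)) * nv (j + q))"
    using sum.shift_bounds_nat_ivl[of "\<lambda>k. sin (turn k) * nv k" 0 q p] by (simp add: lessThan_atLeast0 add.commute)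
  also have "\<dots> = (\<Sum>j<p. sin \<beta> * normal_velocity Right_Side (grid p \<beta> j))"
  proof (intro sum.cong refl)
    fix j assume "j \<in> {..<p}"
    then have "grid p \<beta> j \<in> arc_dom"
      using abs_grid_le[of j p \<beta>] right_top \<beta>0 by (simp add: arc_dom_eq abs_le_iff)
    then show "sin (turn (j + q)) * nv (j + q) = sin \<beta> * normal_velocity Right_Side (grid p \<beta> j)"
      using \<open>j \<in> {..<p}\<close> normal_velocity_even by (simp add: turn_def nv_def orbit_side_def orbit_param_def orient_def angle_def)
  qed
  also have "(\<Sum>k<q. sin (turn k) * nv k) = (\<Sum>j<q. sin \<alpha> * normal_velocity Left_Side (grid q \<alpha> j))"
    by (intro sum.cong refl) (simp add: turn_def nv_def orbit_side_def orbit_param_def orient_def angle_def)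
  finally show ?thesis
    by (simp add: sum_distrib_left)
qed

end

section \<open>Rigidity\<close>

text \<open>The case of exact grids, without error terms: vanishing means bound the constant
  \<open>b 0\<close> by tails with bounded weighted sums, so it is zero, and then bound
  \<open>b p\<close> by the multiples from \<open>2 * p\<close> on, with total factor
  \<open>2/3 < 1\<close>.\<close>

lemma cosine_series_zero_of_grid_sums:
  fixes b :: "nat \<Rightarrow> real"
  assumes s2: "summable (\<lambda>m. real m ^ 2 * \<bar>b m\<bar>)" and s0: "summable (\<lambda>m. \<bar>b m\<bar>)"
    and zero: "\<And>p. p \<ge> 1 \<Longrightarrow> (\<Sum>j<p. \<Sum>m. b m * cos (2 * real m * grid p (pi / (2 * real p)) j)) = 0"
  shows "b m = 0"
proof -
  define B where "B = (\<Sum>m. real m ^ 2 * \<bar>b m\<bar>)"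
  have mean: "(\<Sum>m. b m * grid_kernel p (pi / (2 * real p)) m) = 0" if "p \<ge> 1" for p
    using grid_sum_cosine_series(2)[OF s0 that] zero[OF that] that by simp
  have b0: "\<bar>b 0\<bar> \<le> (\<Sum>k. \<bar>b ((k + 1) * p)\<bar>)" "\<bar>b p\<bar> \<le> \<bar>b 0\<bar> + (\<Sum>k. \<bar>b ((k + 2) * p)\<bar>)" if "p \<ge> 1" for p
    using aliasing_bounds[OF s0 that] unfolding mean[OF that] by simp_all
  have "real N * \<bar>b 0\<bar> \<le> B * (5/3)" for N
  proof -
    have "real N * \<bar>b 0\<bar> = (\<Sum>p=1..N. \<bar>b 0\<bar>)"
      by simp
    also have "\<dots> \<le> (\<Sum>p=1..N. real p ^ 2 * (\<Sum>k. \<bar>b ((k + 1) * (1 * p))\<bar>))"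
    proof (rule sum_mono)
      fix p assume "p \<in> {1..N}"
      then have p: "p \<ge> 1"
        by simp
      then have "1 * \<bar>b 0\<bar> \<le> real p ^ 2 * \<bar>b 0\<bar>"
        by (intro mult_right_mono) simp_all
      also have "\<dots> \<le> real p ^ 2 * (\<Sum>k. \<bar>b ((k + 1) * p)\<bar>)"
        by (intro mult_left_mono b0 p) simp
      finally show "\<bar>b 0\<bar> \<le> real p ^ 2 * (\<Sum>k. \<bar>b ((k + 1) * (1 * p))\<bar>)"
        by simp
    qed
    also have "\<dots> \<le> B / real 1 ^ 2 * (5/3)"
      unfolding B_def using sum_inverse_squares_le(1) by (intro weighted_multiples_sum_le s2 s0) auto
    finally show ?thesis
      by simp
  qed
  then have z: "b 0 = 0"
    using reals_Archimedean3[of "\<bar>b 0\<bar>"] by (metis linorder_not_le zero_less_abs_iff)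
  have "(\<Sum>m<n. real (Suc m) ^ 2 * \<bar>b (Suc m)\<bar>) \<le> B * (2/3)" for n
  proof -
    have "(\<Sum>m<n. real (Suc m) ^ 2 * \<bar>b (Suc m)\<bar>) = (\<Sum>p=1..n. real p ^ 2 * \<bar>b p\<bar>)"
      by (simp add: sum.atLeast1_atMost_eq)
    also have "\<dots> \<le> (\<Sum>p=1..n. real p ^ 2 * (\<Sum>k. \<bar>b ((k + 2) * (1 * p))\<bar>))"
      using b0(2) by (intro sum_mono mult_left_mono) (auto simp: z)
    also have "\<dots> \<le> B / real 1 ^ 2 * (2/3)"
      unfolding B_def using sum_inverse_squares_le(2) by (intro weighted_multiples_sum_le s2 s0) auto
    finally show ?thesis
      by simp
  qed
  moreover have sS: "summable (\<lambda>m. real (Suc m) ^ 2 * \<bar>b (Suc m)\<bar>)"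
    using s2 by (subst summable_Suc_iff)
  ultimately have "(\<Sum>m. real (Suc m) ^ 2 * \<bar>b (Suc m)\<bar>) \<le> B * (2/3)"
    by (intro suminf_le_const)
  moreover have BS: "B = (\<Sum>m. real (Suc m) ^ 2 * \<bar>b (Suc m)\<bar>)"
    using suminf_split_head[OF s2] by (simp add: B_def)
  moreover have "(\<Sum>m. real (Suc m) ^ 2 * \<bar>b (Suc m)\<bar>) \<ge> 0"
    by (intro suminf_nonneg sS) simp
  ultimately have "(\<Sum>m. real (Suc m) ^ 2 * \<bar>b (Suc m)\<bar>) = 0"
    by simp
  then have "\<forall>m. real (Suc m) ^ 2 * \<bar>b (Suc m)\<bar> = 0"
    by (subst (asm) suminf_eq_zero_iff[OF sS]) simp_all
  then have "b (Suc m) = 0" for m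
    by (metis abs_eq_0 mult_eq_0_iff of_nat_eq_0_iff old.nat.distinct(2) power_eq_0_iff)
  then show ?thesis
    using z by (cases m) auto
qed

lemma grid_in_arc_dom:
  assumes "j < n" "c \<ge> 0" "(real n - 1) * c \<le> pi/2"
  shows "grid n c j \<in> arc_dom"
  using abs_grid_le[OF assms(1,2)] assms(3) unfolding arc_dom_eq atLeastAtMost_iff by linarith

text \<open>The equation for \<open>\<delta>\<close> is the closing condition of the orbit with \<open>4 * p\<close> reflections on the left
  and \<open>p\<close> reflections on the right.\<close>

lemma closing_angle:
  fixes a :: real and p :: nat
  assumes a: "a \<ge> 8" and p: "p \<ge> 1"
  obtains \<delta> where "0 \<le> \<delta>" "\<delta> \<le> 4 / (a * real p ^ 2)"
    "a * sin \<delta> = cos ((pi/2 + \<delta>) / real (4 * p)) - cos ((pi/2 - \<delta>) / real p)"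
proof -
  \<comment> \<open>Chosen so that \<open>a * sin D \<ge> a * D / 2 = 2 / p^2\<close> balances
    \<open>1 - cos \<beta> \<le> \<beta>^2 / 2 \<le> 2 / p^2\<close>; this gives the upper sign for
    the intermediate value theorem.\<close>
  define D where "D = 4 / (a * real p ^ 2)"
  have p2: "real p ^ 2 \<ge> 1"
    using p by simp
  have "a * real p ^ 2 \<ge> 8 * 1"
    using a p2 by (intro mult_mono) auto
  then have D: "0 < D" "D \<le> 1/2"
    by (simp_all add: D_def field_simps)
  define f where "f x = a * sin x + cos ((pi/2 - x) / real p) - cos ((pi/2 + x) / real (4 * p))" for x
  have "f 0 \<le> 0"
  proof -
    have "pi / 2 / real (4 * p) \<le> pi / 2 / real p" "pi / 2 / real p \<le> pi"
      using p by (simp_all add: field_simps)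
    then have "cos (pi / 2 / real p) \<le> cos (pi / 2 / real (4 * p))"
      by (intro cos_monotone_0_pi_le) auto
    then show ?thesis
      by (simp add: f_def)
  qed
  moreover have "f D \<ge> 0"
  proof -
    define \<beta> where "\<beta> = (pi/2 - D) / real p"
    have "0 \<le> pi/2 - D" "pi/2 - D \<le> 2"
      using D pi_less_4 pi_gt3 by linarith+
    then have "0 \<le> \<beta>" "\<beta> \<le> 2 / real p"
      by (simp_all add: \<beta>_def divide_right_mono)
    then have \<beta>2: "\<beta>\<^sup>2 \<le> (2 / real p)\<^sup>2"
      by (intro power_mono)
    have "1 - cos \<beta> = 2 * (sin (\<beta>/2))\<^sup>2"
      using cos_double_sin[of "\<beta>/2"] by simp
    also have "(sin (\<beta>/2))\<^sup>2 \<le> (\<beta>/2)\<^sup>2"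
      using abs_sin_x_le_abs_x[of "\<beta>/2"] by (simp only: abs_le_square_iff)
    finally have "1 - cos \<beta> \<le> \<beta>\<^sup>2 / 2"
      by (simp add: power_divide)
    then have "1 - cos \<beta> \<le> 2 / real p ^ 2"
      using \<beta>2 by (simp add: power_divide)
    moreover have "sin D \<ge> D / 2"
    proof -
      have "\<exists>z. 0 < z \<and> z < D \<and> sin D - sin 0 = (D - 0) * cos z"
        using D by (intro MVT2) (auto intro!: derivative_eq_intros)
      then obtain z where z: "0 < z" "z < D" "sin D = D * cos z"
        by auto
      have "cos (pi/3) \<le> cos z"
        using z D pi_gt3 by (intro cos_monotone_0_pi_le) auto
      then have "D * (1/2) \<le> D * cos z"
        using D by (intro mult_left_mono) (auto simp: cos_60)
      then show ?thesis
        using z by simp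
    qed
    then have "a * (D / 2) \<le> a * sin D"
      using a by simp
    then have "2 / real p ^ 2 \<le> a * sin D"
      using a p by (simp add: D_def)
    moreover have "cos ((pi/2 + D) / real (4 * p)) \<le> 1"
      by simp
    ultimately show ?thesis
      unfolding f_def \<beta>_def by linarith
  qed
  moreover have "isCont f x" for x
    unfolding f_def using p by (intro continuous_intros) auto
  ultimately have "\<exists>x. 0 \<le> x \<and> x \<le> D \<and> f x = 0"
    using D by (intro IVT) auto
  then obtain \<delta> where "0 \<le> \<delta>" "\<delta> \<le> D" "f \<delta> = 0"
    by blast
  then show ?thesis
    by (intro that[of \<delta>]) (simp_all add: D_def f_def)
qed

locale isospectral_family = stadium_family +
  assumes iso: "dynamically_isospectral \<Omega>"
begin

text \<open>With equally many reflections on both caps, \<open>\<psi> = 0\<close> and equal steps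
  satisfy the closing condition trivially, so both grids are exact.\<close>

lemma diagonal_orbits:
  assumes p: "p \<ge> 1"
  shows "(\<Sum>j<p. normal_velocity Left_Side (grid p (pi / (2 * real p)) j) + normal_velocity Right_Side (grid p (pi / (2 * real p)) j)) = 0"
proof -
  define c where "c = pi / (2 * real p)"
  have c: "c > 0" "real p * c = pi/2" "(real p - 1) * c < pi/2"
    using p by (simp_all add: c_def field_simps)
  have "c \<le> real p * c"
    using p c(1) by simp
  then have "c < pi"
    using c(2) pi_gt_zero by linarith
  then have s: "sin c > 0"
    using c by (intro sin_gt_zero)
  interpret stadium_orbit a \<Omega> \<gamma> p p c c 0
    using p c iso by unfold_locales auto
  have "sin c * ((\<Sum>j<p. normal_velocity Left_Side (grid p c j)) + (\<Sum>j<p. normal_velocity Right_Side (grid p c j))) = 0"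
    using orbit_normal_velocity by (simp add: distrib_left)
  then show ?thesis
    using s by (simp add: sum.distrib c_def)
qed

text \<open>The extreme vertices stay on the left cap only if the excess \<open>\<delta>\<close> of
  \<open>4 * p * \<alpha>\<close> over \<open>pi/2\<close> is smaller than \<open>\<alpha>\<close>,
  that is, small against \<open>1 / p\<close>. The bound \<open>4 / (a * p^2)\<close> with
  \<open>a \<ge> 100\<close> ensures this.\<close>

lemma lopsided_orbits:
  assumes a: "a \<ge> 100" and p: "p \<ge> 1"
  obtains \<delta> where "0 \<le> \<delta>" "\<delta> \<le> 4 / (a * real p ^ 2)"
    "(real p - 1) * ((pi/2 - \<delta>) / real p) \<le> pi/2" "(real (4 * p) - 1) * ((pi/2 + \<delta>) / real (4 * p)) \<le> pi/2"
    "sin ((pi/2 + \<delta>) / real (4 * p)) * (\<Sum>j<4 * p. normal_velocity Left_Side (grid (4 * p) ((pi/2 + \<delta>) / real (4 * p)) j))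
      + sin ((pi/2 - \<delta>) / real p) * (\<Sum>j<p. normal_velocity Right_Side (grid p ((pi/2 - \<delta>) / real p) j)) = 0"
proof -
  obtain \<delta> where \<delta>: "0 \<le> \<delta>" "\<delta> \<le> 4 / (a * real p ^ 2)"
    "a * sin \<delta> = cos ((pi/2 + \<delta>) / real (4 * p)) - cos ((pi/2 - \<delta>) / real p)"
    by (rule closing_angle[OF a8 p]) (rule that)
  define \<alpha> \<beta> where "\<alpha> = (pi/2 + \<delta>) / real (4 * p)" and "\<beta> = (pi/2 - \<delta>) / real p"
  have "100 * real p \<le> a * real p ^ 2"
    using a p by (intro mult_mono) (simp_all add: power2_eq_square)
  then have "\<delta> \<le> 4 / (100 * real p)"
    using \<delta>(2) p by (elim order_trans) (intro divide_left_mono, auto)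
  then have small: "25 * real p * \<delta> \<le> 1"
    using p by (simp add: field_simps)
  have "25 * \<delta> \<le> 25 * real p * \<delta>"
    using \<delta>(1) p by (simp add: mult_right_mono)
  then have \<delta>1: "\<delta> < 1"
    using small by linarith
  have eq: "real (4 * p) * \<alpha> = pi/2 - - \<delta>" "real p * \<beta> = pi/2 + - \<delta>"
    using p by (simp_all add: \<alpha>_def \<beta>_def)
  have \<beta>: "\<beta> > 0"
    using \<delta>1 pi_gt3 p by (simp add: \<beta>_def)
  have "pi/2 + \<delta> > 1"
    using \<delta>(1) pi_gt3 by linarith
  then have "real (4 * p) * \<delta> < pi/2 + \<delta>"
    using small \<delta>(1) p by (simp add: algebra_simps) 
  then have \<alpha>: "\<alpha> > \<delta>"
    using p by (simp add: \<alpha>_def field_simps)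
  have le: "(real (4 * p) - 1) * \<alpha> < pi/2" "(real p - 1) * \<beta> < pi/2"
    unfolding left_diff_distrib eq using \<alpha> \<beta> \<delta>(1) by simp_all
  interpret stadium_orbit a \<Omega> \<gamma> "4 * p" p \<alpha> \<beta> "- \<delta>"
  proof
    show "\<bar>- \<delta>\<bar> < pi/2"
      using \<delta>1 \<delta>(1) pi_gt3 by simp
    show "a * sin (- \<delta>) = cos \<beta> - cos \<alpha>"
      using \<delta>(3) by (simp add: \<alpha>_def \<beta>_def)
  qed (use p iso eq le \<alpha> \<beta> \<delta>(1) in simp_all)
  show ?thesis
    using that[OF \<delta>(1,2)] le orbit_normal_velocity by (simp add: \<alpha>_def \<beta>_def)
qed

lemma normal_velocity_antisymmetric:
  assumes "s \<in> arc_dom"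
  shows "normal_velocity Left_Side s = - normal_velocity Right_Side s"
proof -
  obtain b where b: "summable (\<lambda>m. real m ^ 2 * \<bar>b m\<bar>)" "summable (\<lambda>m. \<bar>b m\<bar>)"
    "\<And>s. s \<in> arc_dom \<Longrightarrow> (\<lambda>m. b m * cos (2 * real m * s)) sums normal_velocity Left_Side s"
    by (rule normal_velocity_cosine_series) (rule that)
  obtain c where c: "summable (\<lambda>m. real m ^ 2 * \<bar>c m\<bar>)" "summable (\<lambda>m. \<bar>c m\<bar>)"
    "\<And>s. s \<in> arc_dom \<Longrightarrow> (\<lambda>m. c m * cos (2 * real m * s)) sums normal_velocity Right_Side s"
    by (rule normal_velocity_cosine_series) (rule that)
  have h: "(\<lambda>m. (b m + c m) * cos (2 * real m * s)) sums (normal_velocity Left_Side s + normal_velocity Right_Side s)"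
    if "s \<in> arc_dom" for s
    using sums_add[OF b(3)[OF that] c(3)[OF that]] by (simp add: distrib_right)
  have "b m + c m = 0" for m
  proof (rule cosine_series_zero_of_grid_sums)
    show "summable (\<lambda>m. real m ^ 2 * \<bar>b m + c m\<bar>)"
      by (rule summable_comparison_test'[OF summable_add[OF b(1) c(1)], of 0])
        (simp add: mult_left_mono flip: distrib_left)
    show "summable (\<lambda>m. \<bar>b m + c m\<bar>)"
      by (rule summable_comparison_test'[OF summable_add[OF b(2) c(2)], of 0]) simp
    fix p :: nat assume p: "p \<ge> 1"
    have "(real p - 1) * (pi / (2 * real p)) \<le> pi/2"
      using p by (simp add: field_simps)
    then have "grid p (pi / (2 * real p)) j \<in> arc_dom" if "j < p" for j
      using that by (intro grid_in_arc_dom) auto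
    then have "(\<Sum>j<p. \<Sum>m. (b m + c m) * cos (2 * real m * grid p (pi / (2 * real p)) j))
      = (\<Sum>j<p. normal_velocity Left_Side (grid p (pi / (2 * real p)) j) + normal_velocity Right_Side (grid p (pi / (2 * real p)) j))"
      by (intro sum.cong refl sums_unique[symmetric] h) simp
    then show "(\<Sum>j<p. \<Sum>m. (b m + c m) * cos (2 * real m * grid p (pi / (2 * real p)) j)) = 0"
      using diagonal_orbits[OF p] by simp
  qed
  then have "(\<lambda>m. 0) sums (normal_velocity Left_Side s + normal_velocity Right_Side s)"
    using h[OF assms] by simp
  then have "normal_velocity Left_Side s + normal_velocity Right_Side s = 0"
    by (rule sums_unique2[OF _ sums_zero])
  then show ?thesis
    by simp
qed

text \<open>The steps of the lopsided orbits are those of the exact grids times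
  \<open>\<mu> p\<close> and \<open>\<nu> p\<close>, which differ from 1 by
  \<open>2 * \<delta> p / pi\<close>. Antisymmetry eliminates the left cap, so the orbit equation
  becomes the hypothesis of \<open>cosine_series_rigidity\<close>.\<close>

lemma normal_velocity_Right_zero:
  assumes a: "a \<ge> 100000" and s: "s \<in> arc_dom"
  shows "normal_velocity Right_Side s = 0"
proof -
  obtain b where b: "summable (\<lambda>m. real m ^ 2 * \<bar>b m\<bar>)" "summable (\<lambda>m. \<bar>b m\<bar>)"
    "\<And>s. s \<in> arc_dom \<Longrightarrow> (\<lambda>m. b m * cos (2 * real m * s)) sums normal_velocity Right_Side s"
    by (rule normal_velocity_cosine_series) (rule that)
  have a100: "a \<ge> 100"
    using a by simp
  define good where "good p \<delta> \<longleftrightarrow> 0 \<le> \<delta> \<and> \<delta> \<le> 4 / (a * real p ^ 2) \<and>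
    (real p - 1) * ((pi/2 - \<delta>) / real p) \<le> pi/2 \<and> (real (4 * p) - 1) * ((pi/2 + \<delta>) / real (4 * p)) \<le> pi/2 \<and>
    sin ((pi/2 + \<delta>) / real (4 * p)) * (\<Sum>j<4 * p. normal_velocity Left_Side (grid (4 * p) ((pi/2 + \<delta>) / real (4 * p)) j))
      + sin ((pi/2 - \<delta>) / real p) * (\<Sum>j<p. normal_velocity Right_Side (grid p ((pi/2 - \<delta>) / real p) j)) = 0" for p \<delta>
  have "\<exists>\<delta>. p \<ge> 1 \<longrightarrow> good p \<delta>" for p
    unfolding good_def using lopsided_orbits[OF a100, of p] by metis
  then obtain \<delta> where \<delta>: "\<And>p. p \<ge> 1 \<Longrightarrow> good p (\<delta> p)"
    by metis
  define \<mu> \<nu> where "\<mu> p = 1 - 2 * \<delta> p / pi" and "\<nu> p = 1 + 2 * \<delta> p / pi" for p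
  have dev: "\<bar>2 * \<delta> p / pi\<bar> \<le> (1/20000) / real p ^ 2" if p: "p \<ge> 1" for p
  proof -
    have d: "0 \<le> \<delta> p" "\<delta> p \<le> 4 / (a * real p ^ 2)"
      using \<delta>[OF p] by (simp_all add: good_def)
    have "\<bar>2 * \<delta> p / pi\<bar> = 2 * \<delta> p / pi"
      using d(1) by simp
    also have "\<dots> \<le> 2 * \<delta> p / 2"
      using d(1) pi_ge_two by (intro divide_left_mono) auto
    also have "\<dots> \<le> 4 / (a * real p ^ 2)"
      using d(2) by simp
    \<comment> \<open>Origin of the threshold for \<open>a\<close>: \<open>4 / 100000\<close> lies
      below the tolerance \<open>1/20000\<close> allowed by
      \<open>cosine_series_rigidity\<close>.\<close>
    also have "\<dots> \<le> 4 / (100000 * real p ^ 2)"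
      using a p by (intro divide_left_mono mult_right_mono mult_pos_pos) auto
    also have "\<dots> \<le> (1/20000) / real p ^ 2"
      using p by (simp add: field_simps)
    finally show ?thesis .
  qed
  have \<mu>: "\<mu> p * (pi / (2 * real p)) = (pi/2 - \<delta> p) / real p"
    and \<nu>: "\<nu> p * (pi / (2 * real (4 * p))) = (pi/2 + \<delta> p) / real (4 * p)" if "p \<ge> 1" for p
    using that by (simp_all add: \<mu>_def \<nu>_def field_simps)
  have "b m = 0" for m
  proof (rule cosine_series_rigidity[OF b(1,2)])
    \<comment> \<open>At \<open>pi/2\<close> the cosines are \<open>(-1)^m\<close>, and the normal
      velocity vanishes at the junction point.\<close>
    show "(\<lambda>m. b m * (-1) ^ m) sums 0"
      using b(3)[of "pi/2"] normal_velocity_ends(1)[of Right_Side] by (simp add: mult.commute)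
    show "(0::real) \<le> 1/20000" "1/20000 \<le> (1/20000 :: real)"
      by simp_all
    show "\<bar>\<mu> p - 1\<bar> \<le> (1/20000) / real p ^ 2" "\<bar>\<nu> p - 1\<bar> \<le> (1/20000) / real p ^ 2" if "p \<ge> 1" for p
      using dev[OF that] by (simp_all add: \<mu>_def \<nu>_def)
    fix p :: nat assume p: "p \<ge> 1"
    have g: "0 \<le> \<delta> p" "\<delta> p \<le> 4 / (a * real p ^ 2)" "(real p - 1) * ((pi/2 - \<delta> p) / real p) \<le> pi/2"
      "(real (4 * p) - 1) * ((pi/2 + \<delta> p) / real (4 * p)) \<le> pi/2"
      "sin ((pi/2 + \<delta> p) / real (4 * p)) * (\<Sum>j<4 * p. normal_velocity Left_Side (grid (4 * p) ((pi/2 + \<delta> p) / real (4 * p)) j))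
      + sin ((pi/2 - \<delta> p) / real p) * (\<Sum>j<p. normal_velocity Right_Side (grid p ((pi/2 - \<delta> p) / real p) j)) = 0"
      using \<delta>[OF p] unfolding good_def by blast+
    have "2 * \<delta> p / pi \<le> 1"
    proof -
      have "real p ^ 2 \<ge> 1"
        using p by simp
      then have "(1/20000) / real p ^ 2 \<le> 1"
        by (simp add: divide_le_eq)
      then show ?thesis
        using dev[OF p] by linarith
    qed
    then have nonneg: "0 \<le> (pi/2 - \<delta> p) / real p" "0 \<le> (pi/2 + \<delta> p) / real (4 * p)"
      using g(1) p by (simp_all add: field_simps)
    have r: "(\<Sum>j<p. \<Sum>m. b m * cos (2 * real m * grid p ((pi/2 - \<delta> p) / real p) j))
        = (\<Sum>j<p. normal_velocity Right_Side (grid p ((pi/2 - \<delta> p) / real p) j))"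
      using nonneg g(3) by (intro sum.cong refl sums_unique[symmetric] b(3) grid_in_arc_dom) auto
    have l: "(\<Sum>j<4 * p. \<Sum>m. b m * cos (2 * real m * grid (4 * p) ((pi/2 + \<delta> p) / real (4 * p)) j))
        = - (\<Sum>j<4 * p. normal_velocity Left_Side (grid (4 * p) ((pi/2 + \<delta> p) / real (4 * p)) j))"
      unfolding sum_negf[symmetric]
    proof (intro sum.cong refl)
      fix j assume "j \<in> {..<4 * p}"
      then have "grid (4 * p) ((pi/2 + \<delta> p) / real (4 * p)) j \<in> arc_dom"
        using nonneg g(4) by (intro grid_in_arc_dom) auto
      then show "(\<Sum>m. b m * cos (2 * real m * grid (4 * p) ((pi/2 + \<delta> p) / real (4 * p)) j))
          = - normal_velocity Left_Side (grid (4 * p) ((pi/2 + \<delta> p) / real (4 * p)) j)"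
        using sums_unique[OF b(3)] normal_velocity_antisymmetric by simp
    qed
    show "sin (\<mu> p * (pi / (2 * real p))) * (\<Sum>j<p. \<Sum>m. b m * cos (2 * real m * grid p (\<mu> p * (pi / (2 * real p))) j))
      = sin (\<nu> p * (pi / (2 * real (4 * p))))
        * (\<Sum>j<4 * p. \<Sum>m. b m * cos (2 * real m * grid (4 * p) (\<nu> p * (pi / (2 * real (4 * p)))) j))"
      unfolding \<mu>[OF p] \<nu>[OF p] r l using g(5) by simp
  qed
  then have "(\<lambda>m. 0) sums normal_velocity Right_Side s"
    using b(3)[OF s] by simp
  then show ?thesis
    by (rule sums_unique2[OF _ sums_zero])
qed

end

theorem theorem1p1:
  shows "\<exists>a\<^sub>0>0. \<forall>a\<ge>a\<^sub>0.
    \<forall>(\<Omega> :: real \<Rightarrow> point set) (\<gamma> :: side \<Rightarrow> real \<Rightarrow> real \<Rightarrow> point).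
      C1_family 4 a \<Omega> \<gamma> \<longrightarrow> dynamically_isospectral \<Omega> \<longrightarrow> \<Omega> 0 = stadium a \<longrightarrow>
      (\<forall>i. \<forall>s\<in>arc_dom. deformation_function \<Omega> \<gamma> i s = 0)"
proof (intro exI[of _ 100000] conjI allI impI ballI)
  fix a :: real and \<Omega> :: "real \<Rightarrow> point set" and \<gamma> :: "side \<Rightarrow> real \<Rightarrow> real \<Rightarrow> point" and i s
  assume a: "100000 \<le> a" and fam: "C1_family 4 a \<Omega> \<gamma>" "dynamically_isospectral \<Omega>" "\<Omega> 0 = stadium a"
    and s: "s \<in> arc_dom"
  interpret isospectral_family a \<Omega> \<gamma>
    using a fam by unfold_locales auto
  show "deformation_function \<Omega> \<gamma> i s = 0"
    using deformation_function_eq[OF s] normal_velocity_Right_zero[OF a s] normal_velocity_antisymmetric[OF s]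
    by (cases i) simp_all
qed simp

end
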